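(* Let $d\ge 3$ be an integer, $d=2k+\epsilon$ with $\epsilon\in\{0,1\}$, let $S_d\subset\mathbb{P}^{k+2}$ be the image of $\varphi_{I_d}:\mathbb{P}^2\to\mathbb{P}^{k+2}$, and let $I(S_d)\subset R=K[x_0,\ldots,x_{k+2}]$ be its homogeneous ideal. Then: (1) If $d=2k+1$ is odd, then $I(S_d)$ is a determinantal ideal (and, hence, Cohen-Macaulay) with minimal free resolution $$0\to R(-k-2)^k\to\cdots\to R(-4)^{3\binom k4}\oplus R(-5)^{3\binom k3}\to R(-3)^{2\binom k3}\oplus R(-4)^{2\binom k2}\to R(-2)^{\binom k2}\oplus R(-3)^k\to R\to R/I(S_d)\to 0,$$ where the $j$-th free module is $R(-j-1)^{j\binom{k}{j+1}}\oplus R(-j-2)^{j\binom kj}$ for $1\le j\le k$. (2) If $d=2k$ is even, then $I(S_d)$ is a Cohen-Macaulay ideal with minimal free resolution $$0\to R(-k-2)^{k-1}\to R(-k-1)^{(k-2)\binom{k}{k-1}}\oplus R(-k)^{k-1}\to\cdots\to R(-5)^{2\binom k3}\oplus R(-4)^{3\binom k4}\to R(-4)^{\binom k2}\oplus R(-3)^{2\binom k3}\to R(-2)^{1+\binom k2}\to R\to R/I(S_d)\to 0,$$ where the first free module after $R$ is $R(-2)^{1+\binom k2}$ and the $j$-th is $R(-j-1)^{j\binom{k}{j+1}}\oplus R(-j-2)^{(j-1)\binom kj}$ for $2\le j\le k$.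
   Context: $K$ is an algebraically closed field of characteristic zero. $I_d=(x^d,y^d,z^d,x^ky^kz^{\epsilon},x^{k-1}y^{k-1}z^{\epsilon+2},\ldots,x^2y^2z^{d-4},xyz^{d-2})\subset K[x,y,z]$ and $\varphi_{I_d}$ is the morphism sending $(x,y,z)$ to $(x^d,y^d,z^d,x^ky^kz^{\epsilon},\ldots,xyz^{d-2})$. A homogeneous ideal of $R$ is called determinantal if it is generated by the maximal minors of a homogeneous $m\times n$ matrix ($m\ge n$, up to transposition) and has depth (grade) $m-n+1$. An ideal $I$ is called Cohen-Macaulay if $R/I$ is Cohen-Macaulay. Binomial coefficients $\binom{k}{i}$ with $i>k$ are zero. *)

theory Defs
  imports
    "HOL-Library.Poly_Mapping"
    "HOL-Library.Extended_Nat"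
    "HOL-Computational_Algebra.Polynomial"
    "HOL-Algebra.QuotRing"
    "HOL-Algebra.Ring_Divisibility"
    "Jordan_Normal_Form.Determinant"
    "Jordan_Normal_Form.DL_Submatrix"
begin

section \<open>Polynomial rings in finitely many variables\<close>

text \<open>A monomial is its finitely supported exponent function; multiplication of
  \<^typ>\<open>(nat \<Rightarrow>\<^sub>0 nat) \<Rightarrow>\<^sub>0 'a\<close> is convolution, i.e. multiplication of polynomials.\<close>

type_synonym 'a mpoly = "(nat \<Rightarrow>\<^sub>0 nat) \<Rightarrow>\<^sub>0 'a"

text \<open>The ring \<open>K[x\<^sub>0, ..., x\<^sub>n\<^sub>-\<^sub>1]\<close>.\<close>

definition mpoly_ring :: "nat \<Rightarrow> ('a::comm_ring_1) mpoly ring" where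
  "mpoly_ring n =
     \<lparr>carrier = {p. \<forall>m\<in>Poly_Mapping.keys p. Poly_Mapping.keys m \<subseteq> {..<n}},
      mult = (*), one = 1, zero = 0, add = (+)\<rparr>"

definition mvar :: "nat \<Rightarrow> ('a::comm_ring_1) mpoly" where
  "mvar i = Poly_Mapping.single (Poly_Mapping.single i 1) 1"

definition monom_deg :: "(nat \<Rightarrow>\<^sub>0 nat) \<Rightarrow> nat" where
  "monom_deg m = (\<Sum>i\<in>Poly_Mapping.keys m. Poly_Mapping.lookup m i)"

definition eval_mpoly :: "('a::comm_ring_1) mpoly \<Rightarrow> 'a vec \<Rightarrow> 'a" where
  "eval_mpoly p v = (\<Sum>m\<in>Poly_Mapping.keys p.
     Poly_Mapping.lookup p m * (\<Prod>i\<in>Poly_Mapping.keys m. v $ i ^ Poly_Mapping.lookup m i))"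

text \<open>The graded piece of \<open>K[x\<^sub>0, ..., x\<^sub>n\<^sub>-\<^sub>1]\<close> in degree \<open>e\<close>; it contains \<open>0\<close>, and it is
  \<open>{0}\<close> if \<open>e\<close> is negative.\<close>

definition graded_piece :: "nat \<Rightarrow> int \<Rightarrow> ('a::comm_ring_1) mpoly set" where
  "graded_piece n e =
     {p \<in> carrier (mpoly_ring n). \<forall>m\<in>Poly_Mapping.keys p. int (monom_deg m) = e}"

definition homogeneous_ideal :: "nat \<Rightarrow> ('a::comm_ring_1) mpoly set \<Rightarrow> bool" where
  "homogeneous_ideal n I \<longleftrightarrow>
     (\<exists>G \<subseteq> (\<Union>e. graded_piece n e). I = genideal (mpoly_ring n) G)"

definition irrelevant_ideal :: "nat \<Rightarrow> ('a::comm_ring_1) mpoly set" where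
  "irrelevant_ideal n = genideal (mpoly_ring n) (mvar ` {..<n})"

lemma cring_mpoly_ring: "cring (mpoly_ring n :: ('a::comm_ring_1) mpoly ring)"
proof (rule cringI)
  show "abelian_group (mpoly_ring n :: 'a mpoly ring)"
  proof (rule abelian_groupI)
    fix p q :: "'a mpoly"
    assume "p \<in> carrier (mpoly_ring n)" "q \<in> carrier (mpoly_ring n)"
    then show "p \<oplus>\<^bsub>mpoly_ring n\<^esub> q \<in> carrier (mpoly_ring n)"
      using Poly_Mapping.keys_add[of p q] by (fastforce simp: mpoly_ring_def)
  next
    fix p :: "'a mpoly"
    assume "p \<in> carrier (mpoly_ring n)"
    then show "\<exists>q\<in>carrier (mpoly_ring n). q \<oplus>\<^bsub>mpoly_ring n\<^esub> p = \<zero>\<^bsub>mpoly_ring n\<^esub>"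
      by (intro bexI[of _ "- p"]) (auto simp: mpoly_ring_def)
  qed (auto simp: mpoly_ring_def algebra_simps)
  show "Group.comm_monoid (mpoly_ring n :: 'a mpoly ring)"
  proof (rule comm_monoidI)
    fix p q :: "'a mpoly"
    assume pq: "p \<in> carrier (mpoly_ring n)" "q \<in> carrier (mpoly_ring n)"
    have "Poly_Mapping.keys m \<subseteq> {..<n}" if m: "m \<in> Poly_Mapping.keys (p * q)" for m
    proof -
      obtain a b where ab: "m = a + b" "a \<in> Poly_Mapping.keys p" "b \<in> Poly_Mapping.keys q"
        using m Poly_Mapping.keys_mult[of p q] by blast
      then show ?thesis
        using pq Poly_Mapping.keys_add[of a b] by (fastforce simp: mpoly_ring_def)
    qed
    then show "p \<otimes>\<^bsub>mpoly_ring n\<^esub> q \<in> carrier (mpoly_ring n)"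
      by (simp add: mpoly_ring_def)
  qed (auto simp: mpoly_ring_def algebra_simps)
qed (auto simp: mpoly_ring_def algebra_simps)


section \<open>Grade, height, and the Cohen-Macaulay property\<close>

definition regular_sequence :: "('r, 'm) ring_scheme \<Rightarrow> 'r list \<Rightarrow> bool" where
  "regular_sequence A xs \<longleftrightarrow>
     set xs \<subseteq> carrier A \<and>
     (\<forall>i<length xs. \<forall>r\<in>carrier A.
        r \<otimes>\<^bsub>A\<^esub> xs ! i \<in> genideal A (set (take i xs)) \<longrightarrow> r \<in> genideal A (set (take i xs))) \<and>
     genideal A (set xs) \<noteq> carrier A"

text \<open>The grade, or depth, of an ideal \<open>J\<close> on the ring \<open>A\<close> itself.\<close>

definition grade :: "('r, 'm) ring_scheme \<Rightarrow> 'r set \<Rightarrow> enat" where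
  "grade A J = Sup {enat (length xs) | xs. set xs \<subseteq> J \<and> regular_sequence A xs}"

definition prime_height :: "('r, 'm) ring_scheme \<Rightarrow> 'r set \<Rightarrow> enat" where
  "prime_height A P = Sup {enat l | l. \<exists>Q :: nat \<Rightarrow> 'r set.
     (\<forall>i\<le>l. primeideal (Q i) A) \<and> (\<forall>i<l. Q i \<subset> Q (Suc i)) \<and> Q l = P}"

text \<open>Equality of depth and codimension at every maximal ideal, as in Eisenbud,
  Commutative Algebra, Section 18.2. For a maximal ideal \<open>P\<close> of a Noetherian ring these
  numbers are the depth and the dimension of the local ring at \<open>P\<close>.\<close>

definition cohen_macaulay_ring :: "('r, 'm) ring_scheme \<Rightarrow> bool" where
  "cohen_macaulay_ring A \<longleftrightarrow>
     cring A \<and> noetherian_ring A \<and> (\<forall>P. maximalideal P A \<longrightarrow> grade A P = prime_height A P)"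

definition cohen_macaulay_ideal :: "('r, 'm) ring_scheme \<Rightarrow> 'r set \<Rightarrow> bool" where
  "cohen_macaulay_ideal A I \<longleftrightarrow> ideal I A \<and> cohen_macaulay_ring (A Quot I)"


section \<open>Homogeneous matrices, determinantal ideals, minimal free resolutions\<close>

text \<open>A list \<open>as\<close> of integers stands for the graded free module
  \<open>F = R(-as\<^sub>0) \<oplus> R(-as\<^sub>1) \<oplus> \<dots>\<close> over \<open>R = K[x\<^sub>0, ..., x\<^sub>n\<^sub>-\<^sub>1]\<close>, whose \<open>i\<close>-th basis element has
  degree \<open>as\<^sub>i\<close>. A homogeneous matrix is the matrix of a degree-preserving homomorphism from
  the module of \<open>bs\<close> (columns) to that of \<open>as\<close> (rows).\<close>

definition homogeneous_mat ::
    "nat \<Rightarrow> int list \<Rightarrow> int list \<Rightarrow> ('a::comm_ring_1) mpoly mat \<Rightarrow> bool" where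
  "homogeneous_mat n as bs M \<longleftrightarrow>
     M \<in> carrier_mat (length as) (length bs) \<and>
     (\<forall>i<length as. \<forall>j<length bs. M $$ (i, j) \<in> graded_piece n (bs ! j - as ! i))"

definition determinantal_ideal :: "nat \<Rightarrow> ('a::comm_ring_1) mpoly set \<Rightarrow> bool" where
  "determinantal_ideal n I \<longleftrightarrow>
     homogeneous_ideal n I \<and>
     (\<exists>p q as bs M. 1 \<le> q \<and> q \<le> p \<and> length as = p \<and> length bs = q \<and>
        homogeneous_mat n as bs M \<and>
        I = genideal (mpoly_ring n)
              {det (submatrix M T UNIV) | T. T \<subseteq> {..<p} \<and> card T = q} \<and>
        grade (mpoly_ring n) I = enat (p - q + 1))"

definition free_module :: "nat \<Rightarrow> int list \<Rightarrow> ('a::comm_ring_1) mpoly vec set" where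
  "free_module n as =
     {v \<in> carrier_vec (length as). \<forall>i<length as. v $ i \<in> carrier (mpoly_ring n)}"

text \<open>The complex \<open>0 \<rightarrow> F L \<rightarrow> \<dots> \<rightarrow> F 1 \<rightarrow> F 0 = R \<rightarrow> R/I \<rightarrow> 0\<close>, where \<open>D j\<close> is the matrix of
  \<open>F j \<rightarrow> F (j - 1)\<close>. Cycles in \<open>F 0\<close> are the elements of the kernel of \<open>R \<rightarrow> R/I\<close>.\<close>

definition res_cycles :: "nat \<Rightarrow> ('a::comm_ring_1) mpoly set \<Rightarrow>
    (nat \<Rightarrow> int list) \<Rightarrow> (nat \<Rightarrow> 'a mpoly mat) \<Rightarrow> nat \<Rightarrow> 'a mpoly vec set" where
  "res_cycles n I F D j =
     (if j = 0 then {v \<in> free_module n (F 0). v $ 0 \<in> I}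
      else {v \<in> free_module n (F j). D j *\<^sub>v v = 0\<^sub>v (length (F (j - 1)))})"

definition res_boundaries :: "nat \<Rightarrow> nat \<Rightarrow>
    (nat \<Rightarrow> int list) \<Rightarrow> (nat \<Rightarrow> ('a::comm_ring_1) mpoly mat) \<Rightarrow> nat \<Rightarrow> 'a mpoly vec set" where
  "res_boundaries n L F D j =
     (if j < L then (\<lambda>v. D (Suc j) *\<^sub>v v) ` free_module n (F (Suc j))
      else {0\<^sub>v (length (F j))})"

text \<open>Minimality: the image of each \<open>F j \<rightarrow> F (j - 1)\<close> lies in \<open>\<mm> F (j - 1)\<close>, where \<open>\<mm>\<close> is the
  irrelevant ideal.\<close>

definition minimal_free_resolution :: "nat \<Rightarrow> ('a::comm_ring_1) mpoly set \<Rightarrow> nat \<Rightarrow>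
    (nat \<Rightarrow> int list) \<Rightarrow> (nat \<Rightarrow> 'a mpoly mat) \<Rightarrow> bool" where
  "minimal_free_resolution n I L F D \<longleftrightarrow>
     F 0 = [0] \<and>
     (\<forall>j\<in>{1..L}. homogeneous_mat n (F (j - 1)) (F j) (D j)) \<and>
     (\<forall>j\<le>L. res_cycles n I F D j = res_boundaries n L F D j) \<and>
     (\<forall>j\<in>{1..L}. \<forall>v\<in>free_module n (F j). \<forall>i<length (F (j - 1)).
        (D j *\<^sub>v v) $ i \<in> irrelevant_ideal n)"

text \<open>\<open>I\<close> has a minimal graded free resolution of length \<open>L\<close> with the prescribed modules.\<close>

definition has_minimal_free_resolution ::
    "nat \<Rightarrow> ('a::comm_ring_1) mpoly set \<Rightarrow> nat \<Rightarrow> (nat \<Rightarrow> int list) \<Rightarrow> bool" where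
  "has_minimal_free_resolution n I L F \<longleftrightarrow> (\<exists>D. minimal_free_resolution n I L F D)"


section \<open>Projective space and homogeneous ideals of its subsets\<close>

definition proj_point :: "('a::field) vec \<Rightarrow> 'a vec set" where
  "proj_point v = {c \<cdot>\<^sub>v v | c. c \<noteq> 0}"

definition proj_space :: "nat \<Rightarrow> ('a::field) vec set set" where
  "proj_space n = proj_point ` (carrier_vec (n + 1) - {0\<^sub>v (n + 1)})"

definition homogeneous_ideal_of :: "nat \<Rightarrow> ('a::field) vec set set \<Rightarrow> 'a mpoly set" where
  "homogeneous_ideal_of n X = genideal (mpoly_ring (n + 1))
     {f. (\<exists>e. f \<in> graded_piece (n + 1) e) \<and> (\<forall>P\<in>X. \<forall>v\<in>P. eval_mpoly f v = 0)}"


section \<open>The surface \<open>S\<^sub>d\<close>\<close>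

text \<open>With \<open>k = d div 2\<close> and \<open>\<epsilon> = d mod 2\<close>: the coordinates are \<open>x\<^sup>d\<close>, \<open>y\<^sup>d\<close>, \<open>z\<^sup>d\<close>, followed
  by the \<open>k\<close> monomials \<open>x\<^sup>k\<^sup>-\<^sup>i y\<^sup>k\<^sup>-\<^sup>i z\<^sup>\<epsilon>\<^sup>+\<^sup>2\<^sup>i\<close> for \<open>i = 0, ..., k - 1\<close>.\<close>

definition phi_vec :: "nat \<Rightarrow> ('a::field) vec \<Rightarrow> 'a vec" where
  "phi_vec d v =
     (let x = v $ 0; y = v $ 1; z = v $ 2; k = d div 2; \<epsilon> = d mod 2 in
      vec_of_list ([x ^ d, y ^ d, z ^ d] @
        map (\<lambda>i. x ^ (k - i) * y ^ (k - i) * z ^ (\<epsilon> + 2 * i)) [0..<k]))"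

text \<open>The induced map on projective points; independence of the representative is
  \<open>phi_proj_point\<close> below.\<close>

definition phi :: "nat \<Rightarrow> ('a::field) vec set \<Rightarrow> 'a vec set" where
  "phi d P = (\<Union>v\<in>P. proj_point (phi_vec d v))"

definition S_surface :: "nat \<Rightarrow> ('a::field) vec set set" where
  "S_surface d = phi d ` proj_space 2"

lemma dim_phi_vec: "dim_vec (phi_vec d v) = d div 2 + 3"
  by (simp add: phi_vec_def Let_def del: vec_of_list_map vec_of_list_Cons)

lemma phi_vec_smult:
  fixes v :: "'a::field vec"
  assumes "v \<in> carrier_vec 3"
  shows "phi_vec d (c \<cdot>\<^sub>v v) = c ^ d \<cdot>\<^sub>v phi_vec d v"
proof (rule eq_vecI)
  show "dim_vec (phi_vec d (c \<cdot>\<^sub>v v)) = dim_vec (c ^ d \<cdot>\<^sub>v phi_vec d v)"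
    by (simp add: dim_phi_vec)
next
  fix i assume "i < dim_vec (c ^ d \<cdot>\<^sub>v phi_vec d v)"
  then have i: "i < d div 2 + 3" by (simp add: dim_phi_vec)
  have "phi_vec d (c \<cdot>\<^sub>v v) $ i = c ^ d * phi_vec d v $ i"
  proof (cases "i < 3")
    case True
    then consider "i = 0" | "i = 1" | "i = 2" by linarith
    then show ?thesis
      using assms by cases (simp_all add: phi_vec_def Let_def vec_of_list_index power_mult_distrib
        del: vec_of_list_map vec_of_list_Cons)
  next
    case False
    define j where "j = i - 3"
    have j: "i = Suc (Suc (Suc j))" "j < d div 2" using False i by (auto simp: j_def)
    have "c ^ d = c ^ (d div 2 - j) * c ^ (d div 2 - j) * c ^ (d mod 2 + 2 * j)"
      unfolding power_add[symmetric]
      by (rule arg_cong[where f = "\<lambda>n. c ^ n"]) (use j(2) in presburger)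
    then show ?thesis
      using assms j by (simp add: phi_vec_def Let_def vec_of_list_index power_mult_distrib
        del: vec_of_list_map vec_of_list_Cons)
  qed
  then show "phi_vec d (c \<cdot>\<^sub>v v) $ i = (c ^ d \<cdot>\<^sub>v phi_vec d v) $ i"
    using i by (simp add: dim_phi_vec)
qed

lemma phi_proj_point:
  fixes v :: "'a::field vec"
  assumes "v \<in> carrier_vec 3"
  shows "phi d (proj_point v) = proj_point (phi_vec d v)"
proof
  show "phi d (proj_point v) \<subseteq> proj_point (phi_vec d v)"
  proof
    fix w assume "w \<in> phi d (proj_point v)"
    then obtain a b where "a \<noteq> 0" "b \<noteq> 0" "w = b \<cdot>\<^sub>v phi_vec d (a \<cdot>\<^sub>v v)"
      by (auto simp: phi_def proj_point_def)
    then have "w = (b * a ^ d) \<cdot>\<^sub>v phi_vec d v" "b * a ^ d \<noteq> 0"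
      using assms by (simp_all add: phi_vec_smult smult_smult_assoc)
    then show "w \<in> proj_point (phi_vec d v)" by (auto simp: proj_point_def)
  qed
next
  have "v \<in> proj_point v"
    unfolding proj_point_def by (rule CollectI, rule exI[of _ 1]) simp
  then show "proj_point (phi_vec d v) \<subseteq> phi d (proj_point v)" by (auto simp: phi_def)
qed

lemma S_surface_subset:
  assumes "d > 0"
  shows "(S_surface d :: ('a::field) vec set set) \<subseteq> proj_space (d div 2 + 2)"
proof
  fix P :: "'a vec set" assume "P \<in> S_surface d"
  then obtain v :: "'a vec" where v: "v \<in> carrier_vec 3" "v \<noteq> 0\<^sub>v 3"
      and P: "P = phi d (proj_point v)"
    by (auto simp: S_surface_def proj_space_def)
  have P': "P = proj_point (phi_vec d v)" using P v(1) by (simp add: phi_proj_point)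
  have co: "phi_vec d v $ 0 = v $ 0 ^ d" "phi_vec d v $ 1 = v $ 1 ^ d" "phi_vec d v $ 2 = v $ 2 ^ d"
    by (simp_all add: phi_vec_def Let_def vec_of_list_index del: vec_of_list_map vec_of_list_Cons)
  have "phi_vec d v \<noteq> 0\<^sub>v (d div 2 + 3)"
  proof
    assume *: "phi_vec d v = 0\<^sub>v (d div 2 + 3)"
    have z: "v $ 0 = 0" "v $ 1 = 0" "v $ 2 = 0"
      using co assms unfolding * by simp_all
    have "v = 0\<^sub>v 3"
    proof (rule eq_vecI)
      fix i assume "i < dim_vec (0\<^sub>v 3 :: 'a vec)"
      then consider "i = 0" | "i = 1" | "i = 2" by fastforce
      then show "v $ i = 0\<^sub>v 3 $ i" using z by cases auto
    qed (use v in auto)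
    then show False using v by simp
  qed
  moreover have "phi_vec d v \<in> carrier_vec (d div 2 + 3)"
    by (rule carrier_vecI) (simp add: dim_phi_vec)
  ultimately show "P \<in> proj_space (d div 2 + 2)"
    unfolding P' proj_space_def by (auto simp: numeral_3_eq_3)
qed

end

theory Submission
  imports Defs
begin

text \<open>Because \<open>S\<^sub>d\<close> is parametrized by monomials, its ideal is the kernel of a homomorphism into
  \<open>K[x, y, z]\<close>. Let \<open>w\<^sub>i\<close> be the variable that stands for \<open>(x y)\<^sup>k\<^sup>-\<^sup>i z\<^sup>\<epsilon>\<^sup>+\<^sup>2\<^sup>i\<close>, so that
  \<open>w\<^sub>k = x\<^sub>2\<close>. The kernel is generated by the 2-minors of the matrix with the columns
  \<open>(w\<^sub>i, w\<^sub>i\<^sub>+\<^sub>1)\<close> for \<open>i < k\<close>, to which one adds the column \<open>(x\<^sub>0 x\<^sub>1, w\<^sub>0\<^sup>2)\<close> for odd \<open>d\<close> and the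
  quadric \<open>x\<^sub>0 x\<^sub>1 - w\<^sub>0\<^sup>2\<close> for even \<open>d\<close>: these relations rewrite every monomial into some
  \<open>x\<^sub>0\<^sup>i x\<^sub>1\<^sup>j x\<^sub>2\<^sup>l e\<^sub>u\<close> with \<open>u < d\<close>, and the images of these monomials are pairwise different.
  Hence \<open>R / I\<close> is a free \<open>K[x\<^sub>0, x\<^sub>1, x\<^sub>2]\<close>-module on the \<open>e\<^sub>u\<close>, and therefore Cohen-Macaulay.

  The entries of either row of the matrix are pairwise coprime monomials, so each row is a
  regular sequence. This and a grading in which the first row is lighter than the second one
  make the Eagon-Northcott complex exact. It is the resolution for odd \<open>d\<close>; for even \<open>d\<close> the
  resolution is the mapping cone of the multiplication by the quadric, which is regular modulo
  the minors.\<close>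

section \<open>Koszul complexes\<close>

text \<open>For general matrices the exactness of the Eagon-Northcott complex rests on a depth
  estimate for the ideal of minors. Here only the regularity of each single row enters, and the
  missing fact is that a form killed by the contractions with both rows is a double contraction. It
  is obtained by descent: solving along the second row and contracting with the first gives another
  common cycle, of weight lower by one because the first row is lighter, and weights are bounded
  below.

  Cohen-Macaulayness is a condition on all maximal ideals of \<open>R / I\<close>, not only on the
  homogeneous one. Over an algebraically closed field such an ideal contains some
  \<open>x_i - \<alpha>_i\<close> for each \<open>i\<close>; freeness makes the first three of these
  a regular sequence. Dimension theory is replaced by a count of monomials, which shows that any
  four elements of \<open>K[x, y, z]\<close> are algebraically dependent and thereby bounds chains
  of primes.

  The type of polynomials has infinitely many variables; a retraction onto finitely many of them
  brings solutions of linear equations back into \<open>R\<close>.\<close>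

definition koszul_sign :: "nat \<Rightarrow> nat set \<Rightarrow> 'r::comm_ring_1" where
  "koszul_sign i S = (- 1) ^ card {s \<in> S. s < i}"

text \<open>Contraction of a form with the vector \<open>x\<close>. A form is a coefficient function
  on all sets of indices, so the boundary at \<open>S\<close> collects the coefficients at the
  one-element enlargements of \<open>S\<close>.\<close>

definition koszul :: "nat \<Rightarrow> (nat \<Rightarrow> 'r::comm_ring_1) \<Rightarrow> (nat set \<Rightarrow> 'r) \<Rightarrow> nat set \<Rightarrow> 'r" where
  "koszul n x w S = (\<Sum>i\<in>{..<n} - S. koszul_sign i S * x i * w (insert i S))"

definition forms :: "nat \<Rightarrow> nat \<Rightarrow> (nat set \<Rightarrow> 'r::comm_ring_1) set" where
  "forms n j = {w. \<forall>S. w S \<noteq> 0 \<longrightarrow> S \<subseteq> {..<n} \<and> card S = j}"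

text \<open>Only the colon conditions, which are what drives the exactness of the Koszul complex in
  positive degrees; coefficients range over the whole ring type.\<close>

definition regular_seq :: "nat \<Rightarrow> (nat \<Rightarrow> 'r::comm_ring_1) \<Rightarrow> bool" where
  "regular_seq n x \<longleftrightarrow> (\<forall>i<n. \<forall>r c. r * x i = (\<Sum>l<i. c l * x l) \<longrightarrow> (\<exists>c'. r = (\<Sum>l<i. c' l * x l)))"

lemma koszul_sign_insert:
  assumes "i \<notin> S"
  shows "koszul_sign l (insert i S) = (if i < l then - koszul_sign l S else koszul_sign l S)"
proof (cases "i < l")
  case True
  then have "{s \<in> insert i S. s < l} = insert i {s \<in> S. s < l}" by auto
  moreover have "finite {s \<in> S. s < l}" by (rule finite_subset[of _ "{..<l}"]) auto
  ultimately show ?thesis using True assms by (simp add: koszul_sign_def)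
next
  case False
  then have "{s \<in> insert i S. s < l} = {s \<in> S. s < l}" by auto
  then show ?thesis using False by (simp add: koszul_sign_def)
qed

lemma koszul_sign_top: "S \<subseteq> {..<n} \<Longrightarrow> koszul_sign n S = (- 1) ^ card S"
  unfolding koszul_sign_def by (rule arg_cong[where f = "\<lambda>A. (- 1) ^ card A"]) auto

lemma koszul_add: "koszul n x (\<lambda>S. u S + v S) = (\<lambda>S. koszul n x u S + koszul n x v S)"
  by (rule ext) (simp add: koszul_def distrib_left sum.distrib)

lemma koszul_smult: "koszul n x (\<lambda>S. c * u S) = (\<lambda>S. c * koszul n x u S)"
  by (rule ext) (simp add: koszul_def sum_distrib_left mult.left_commute)

lemma koszul_minus: "koszul n x (\<lambda>S. - u S) = (\<lambda>S. - koszul n x u S)"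
  using koszul_smult[of n x "-1" u] by simp

lemma koszul_diff: "koszul n x (\<lambda>S. u S - v S) = (\<lambda>S. koszul n x u S - koszul n x v S)"
  using koszul_add[of n x u "\<lambda>S. - v S"] by (simp add: koszul_minus)

lemma koszul_zero: "koszul n x (\<lambda>S. 0) = (\<lambda>S. 0)"
  by (rule ext) (simp add: koszul_def)

lemma forms_add: "u \<in> forms n j \<Longrightarrow> v \<in> forms n j \<Longrightarrow> (\<lambda>S. u S + v S) \<in> forms n j"
  unfolding forms_def mem_Collect_eq by (metis add_0)

lemma forms_diff: "u \<in> forms n j \<Longrightarrow> v \<in> forms n j \<Longrightarrow> (\<lambda>S. u S - v S) \<in> forms n j"
  unfolding forms_def mem_Collect_eq by (metis diff_self)

lemma forms_smult: "u \<in> forms n j \<Longrightarrow> (\<lambda>S. c * u S) \<in> forms n j"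
  unfolding forms_def mem_Collect_eq by (metis mult_zero_right)

lemma forms_zero: "(\<lambda>S. 0) \<in> forms n j"
  by (simp add: forms_def)

lemma formsD: "u \<in> forms n j \<Longrightarrow> u S \<noteq> 0 \<Longrightarrow> S \<subseteq> {..<n} \<and> card S = j"
  by (simp add: forms_def)

lemma koszul_forms:
  assumes "u \<in> forms n (Suc j)"
  shows "koszul n x u \<in> forms n j"
  unfolding forms_def
proof (clarify, rule ccontr)
  fix S assume nz: "koszul n x u S \<noteq> 0" and S: "\<not> (S \<subseteq> {..<n} \<and> card S = j)"
  have "u (insert i S) = 0" if i: "i \<in> {..<n} - S" for i
  proof (rule ccontr)
    assume "u (insert i S) \<noteq> 0"
    then have *: "insert i S \<subseteq> {..<n}" "card (insert i S) = Suc j" using formsD[OF assms] by blast+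
    have "finite (insert i S)" using finite_subset[OF *(1)] by simp
    then have "card S = j" using *(2) i by simp
    then show False using S *(1) by simp
  qed
  then have "koszul n x u S = 0" by (simp add: koszul_def)
  with nz show False by simp
qed

text \<open>In the double sum over ordered pairs, the sign of the term of \<open>(i, l)\<close>
  depends on which index is added first; exchanging the two vectors exchanges the roles of
  \<open>i\<close> and \<open>l\<close> and flips this sign.\<close>

lemma koszul_anticommute:
  "koszul n a (koszul n b w) S = - koszul n b (koszul n a w) S"
proof -
  let ?A = "{..<n} - S"
  define f where "f a b i l = (if i = l then 0 else
      (if i < l then - 1 else 1) * koszul_sign i S * koszul_sign l S * a i * b l *
        w (insert l (insert i S)))"
    for a b :: "nat \<Rightarrow> 'a" and i l
  have exp: "koszul n a (koszul n b w) S = (\<Sum>i\<in>?A. \<Sum>l\<in>?A. f a b i l)" for a b :: "nat \<Rightarrow> 'a"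
  proof -
    have "koszul n a (koszul n b w) S = (\<Sum>i\<in>?A. koszul_sign i S * a i *
        (\<Sum>l\<in>?A - {i}. koszul_sign l (insert i S) * b l * w (insert l (insert i S))))"
      unfolding koszul_def by (intro sum.cong refl arg_cong2[where f = "(*)"] sum.cong) auto
    also have "\<dots> = (\<Sum>i\<in>?A. \<Sum>l\<in>?A - {i}. f a b i l)"
      unfolding sum_distrib_left
      by (intro sum.cong refl) (auto simp: f_def koszul_sign_insert algebra_simps)
    also have "\<dots> = (\<Sum>i\<in>?A. \<Sum>l\<in>?A. f a b i l)"
    proof (rule sum.cong[OF refl])
      fix i assume "i \<in> ?A"
      then show "(\<Sum>l\<in>?A - {i}. f a b i l) = (\<Sum>l\<in>?A. f a b i l)"
        by (intro sum.mono_neutral_left) (auto simp: f_def)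
    qed
    finally show ?thesis .
  qed
  have anti: "f b a l i = - f a b i l" for i l
  proof (cases "i = l")
    case False
    then have *: "(i < l) = (\<not> l < i)" by auto
    have "insert i (insert l S) = insert l (insert i S)" by (rule insert_commute)
    then show ?thesis using False by (simp add: f_def * mult_ac)
  qed (simp add: f_def)
  have "(\<Sum>i\<in>?A. \<Sum>l\<in>?A. f b a i l) = (\<Sum>l\<in>?A. \<Sum>i\<in>?A. f b a i l)"
    by (rule sum.swap)
  also have "\<dots> = - (\<Sum>i\<in>?A. \<Sum>l\<in>?A. f a b i l)"
    by (simp only: anti sum_negf)
  finally have "(\<Sum>i\<in>?A. \<Sum>l\<in>?A. f b a i l) = - (\<Sum>i\<in>?A. \<Sum>l\<in>?A. f a b i l)" .
  then show ?thesis unfolding exp by simp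
qed

text \<open>Anticommutation of \<open>a\<close> with itself gives \<open>x = - x\<close>, and 2 is
  cancellable in a domain of characteristic zero.\<close>

lemma koszul_koszul:
  fixes a :: "nat \<Rightarrow> 'r::{idom,ring_char_0}"
  shows "koszul n a (koszul n a w) S = 0"
proof -
  have key: "x = 0" if "x = - x" for x :: 'r
  proof -
    have "2 * x = 0" using that by (metis add.right_inverse mult_2)
    then show ?thesis by simp
  qed
  show ?thesis by (rule key, rule koszul_anticommute)
qed

text \<open>Splitting forms by whether they involve the index \<open>n\<close> exhibits the complex
  on \<open>n + 1\<close> elements as the cone of multiplication by \<open>x n\<close>; the sign
  comes from moving \<open>n\<close>, the largest index, past \<open>S\<close>.\<close>

lemma koszul_Suc:
  assumes S: "S \<subseteq> {..<n}"
  shows "koszul (Suc n) x w S = koszul n x w S + (- 1) ^ card S * x n * w (insert n S)"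
    and "koszul (Suc n) x w (insert n S) = koszul n x (\<lambda>T. w (insert n T)) S"
proof -
  have nS: "n \<notin> S" using S by auto
  have "{..<Suc n} - S = insert n ({..<n} - S)" using S nS by auto
  then show "koszul (Suc n) x w S = koszul n x w S + (- 1) ^ card S * x n * w (insert n S)"
    by (simp add: koszul_def add.commute koszul_sign_top[OF S])
  have "{..<Suc n} - insert n S = {..<n} - S" using S by auto
  then have "koszul (Suc n) x w (insert n S) =
      (\<Sum>i\<in>{..<n} - S. koszul_sign i (insert n S) * x i * w (insert i (insert n S)))"
    by (simp add: koszul_def)
  also have "\<dots> = (\<Sum>i\<in>{..<n} - S. koszul_sign i S * x i * w (insert n (insert i S)))"
    by (intro sum.cong refl) (auto simp: koszul_sign_insert[OF nS] insert_commute)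
  finally show "koszul (Suc n) x w (insert n S) = koszul n x (\<lambda>T. w (insert n T)) S"
    by (simp add: koszul_def)
qed

lemma koszul_empty: "koszul n x w {} = (\<Sum>i<n. x i * w {i})"
  by (simp add: koszul_def koszul_sign_def)

lemma card_0_forms: "u \<in> forms n 0 \<Longrightarrow> S \<noteq> {} \<Longrightarrow> u S = 0"
  using finite_subset[of S "{..<n}"] by (fastforce dest: formsD)

text \<open>The classical induction along the cone of multiplication by the last element.\<close>

lemma koszul_exact:
  assumes "regular_seq n x" "w \<in> forms n (Suc j)" "koszul n x w = (\<lambda>S. 0)"
  shows "\<exists>v\<in>forms n (Suc (Suc j)). koszul n x v = w"
  using assms
proof (induction n arbitrary: w j)
  case 0
  have "w S = 0" for S using formsD[OF 0(2), of S] by (cases "w S = 0") auto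
  then show ?case by (intro bexI[of _ "\<lambda>S. 0"]) (auto simp: koszul_zero forms_zero)
next
  case (Suc n)
  have reg: "regular_seq n x" using Suc.prems(1) by (simp add: regular_seq_def)
  define w0 where "w0 S = (if n \<in> S then 0 else w S)" for S
  define w1 where "w1 S = (if n \<in> S then 0 else w (insert n S))" for S
  have w0: "w0 \<in> forms n (Suc j)"
    unfolding forms_def
  proof (clarify)
    fix S assume "w0 S \<noteq> 0"
    then have "n \<notin> S" "w S \<noteq> 0" by (auto simp: w0_def split: if_splits)
    then show "S \<subseteq> {..<n} \<and> card S = Suc j"
      using formsD[OF Suc.prems(2), of S] by (auto simp: less_Suc_eq)
  qed
  have w1: "w1 \<in> forms n j"
    unfolding forms_def
  proof (clarify)
    fix S assume "w1 S \<noteq> 0"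
    then have n: "n \<notin> S" "w (insert n S) \<noteq> 0" by (auto simp: w1_def split: if_splits)
    then have *: "insert n S \<subseteq> {..<Suc n}" "card (insert n S) = Suc j"
      using formsD[OF Suc.prems(2)] by blast+
    have "finite (insert n S)" using finite_subset[OF *(1)] by simp
    then have "card S = j" using *(2) n by simp
    moreover have "S \<subseteq> {..<n}" using *(1) n(1) by (auto simp: less_Suc_eq)
    ultimately show "S \<subseteq> {..<n} \<and> card S = j" by simp
  qed
  have z1: "koszul n x w1 = (\<lambda>S. 0)"
  proof
    fix S show "koszul n x w1 S = 0"
    proof (cases "S \<subseteq> {..<n}")
      case True
      have "koszul n x w1 S = koszul n x (\<lambda>T. w (insert n T)) S"
        unfolding koszul_def using True by (intro sum.cong) (auto simp: w1_def)
      also have "\<dots> = 0" using koszul_Suc(2)[OF True, of x w] Suc.prems(3) by simp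
      finally show ?thesis .
    next
      case False
      then have "w1 (insert i S) = 0" for i using formsD[OF w1, of "insert i S"] by blast
      then show ?thesis by (simp add: koszul_def)
    qed
  qed
  have z0: "koszul n x w0 S + (- 1) ^ card S * x n * w1 S = 0" if "S \<subseteq> {..<n}" for S
  proof -
    have "koszul n x w0 S = koszul n x w S"
      unfolding koszul_def using that by (intro sum.cong) (auto simp: w0_def)
    moreover have "n \<notin> S" using that by auto
    ultimately show ?thesis using koszul_Suc(1)[OF that, of x w] Suc.prems(3) by (simp add: w1_def)
  qed
  \<comment> \<open>Only the bottom degree uses that \<open>x n\<close> is a nonzerodivisor modulo
    the earlier elements: there \<open>w1\<close> is a single scalar, and its multiple by
    \<open>x n\<close> is a combination of the earlier \<open>x l\<close>. In higher degrees
    \<open>w1\<close> is a cycle of the shorter complex.\<close>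
  obtain v1 where v1: "v1 \<in> forms n (Suc j)" "koszul n x v1 = w1"
  proof (cases j)
    case 0
    have "w1 {} * x n = (\<Sum>l<n. (- w0 {l}) * x l)"
      using z0[of "{}"] by (simp add: koszul_empty sum_negf algebra_simps eq_neg_iff_add_eq_0)
    then obtain c where c: "w1 {} = (\<Sum>l<n. c l * x l)"
      using Suc.prems(1)[unfolded regular_seq_def, rule_format, OF lessI] by metis
    define v where "v S = (if \<exists>l<n. S = {l} then c (the_elem S) else 0)" for S
    have v: "v \<in> forms n (Suc 0)" by (auto simp: forms_def v_def)
    have "koszul n x v S = w1 S" for S
    proof (cases "S = {}")
      case True
      then show ?thesis using c by (simp add: koszul_empty v_def mult.commute)
    next
      case False
      then show ?thesis using card_0_forms[OF koszul_forms[OF v]] card_0_forms[of w1] w1 0 by auto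
    qed
    then show ?thesis using that v 0 by blast
  next
    case (Suc i)
    then have "w1 \<in> forms n (Suc i)" using w1 by simp
    from Suc.IH[OF reg this z1] show ?thesis using that Suc by blast
  qed
  \<comment> \<open>With this sign, \<open>z0\<close> says that \<open>w0\<close>, corrected by the
    lift \<open>v1\<close> of \<open>w1\<close>, is a cycle.\<close>
  let ?s = "(- 1) ^ j * x n"
  have "koszul n x (\<lambda>S. w0 S + ?s * v1 S) S = 0" for S
  proof (cases "S \<subseteq> {..<n} \<and> card S = j")
    case True
    then show ?thesis using z0[of S] v1(2) by (simp add: koszul_add koszul_smult)
  next
    case False
    have "(\<lambda>S. w0 S + ?s * v1 S) \<in> forms n (Suc j)" by (intro forms_add forms_smult w0 v1)
    then show ?thesis using False formsD[OF koszul_forms] by blast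
  qed
  then obtain v0 where v0: "v0 \<in> forms n (Suc (Suc j))" "koszul n x v0 = (\<lambda>S. w0 S + ?s * v1 S)"
    using Suc.IH[OF reg, of "\<lambda>S. w0 S + ?s * v1 S" j] forms_add[OF w0 forms_smult[OF v1(1)]] by auto
  define v where "v S = (if n \<in> S then v1 (S - {n}) else v0 S)" for S
  have v: "v \<in> forms (Suc n) (Suc (Suc j))"
    unfolding forms_def
  proof (clarify)
    fix S assume nz: "v S \<noteq> 0"
    show "S \<subseteq> {..<Suc n} \<and> card S = Suc (Suc j)"
    proof (cases "n \<in> S")
      case True
      then have "S - {n} \<subseteq> {..<n}" "card (S - {n}) = Suc j"
        using nz formsD[OF v1(1), of "S - {n}"] by (auto simp: v_def)
      then show ?thesis using True by (auto simp: card_Diff_singleton_if)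
    next
      case False
      then show ?thesis using nz formsD[OF v0(1), of S] by (auto simp: v_def)
    qed
  qed
  have "koszul (Suc n) x v S = w S" for S
  proof (cases "S \<subseteq> {..<Suc n}")
    case True
    show ?thesis
    proof (cases "n \<in> S")
      case True
      define T where "T = S - {n}"
      have T: "S = insert n T" "T \<subseteq> {..<n}" "n \<notin> T"
        using True \<open>S \<subseteq> {..<Suc n}\<close> by (auto simp: T_def less_Suc_eq)
      have "koszul (Suc n) x v S = koszul n x (\<lambda>U. v (insert n U)) T"
        using koszul_Suc(2)[OF T(2)] T(1) by simp
      also have "\<dots> = koszul n x v1 T"
        unfolding koszul_def using T by (intro sum.cong refl) (auto simp: v_def insert_Diff_if)
      finally show ?thesis using v1(2) T by (simp add: w1_def)
    next
      case False
      then have S: "S \<subseteq> {..<n}" using True by (auto simp: less_Suc_eq)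
      have "koszul n x v S = koszul n x v0 S"
        unfolding koszul_def using False by (intro sum.cong refl) (auto simp: v_def)
      then have "koszul (Suc n) x v S = koszul n x v0 S + (- 1) ^ card S * x n * v1 S"
        using koszul_Suc(1)[OF S, of x v] False by (simp add: v_def)
      also have "\<dots> = w0 S + ((- 1) ^ j + (- 1) ^ card S) * x n * v1 S"
        using v0(2) by (simp add: algebra_simps)
      \<comment> \<open>\<open>v1\<close> lives on sets of size \<open>j + 1\<close>, where the two
        signs cancel.\<close>
      also have "\<dots> = w0 S"
        using formsD[OF v1(1), of S] by (cases "v1 S = 0") auto
      finally show ?thesis using False by (simp add: w0_def)
    qed
  next
    case False
    then show ?thesis using formsD[OF koszul_forms[OF v], where S =
      S] formsD[OF Suc.prems(2), of S] by metis
  qed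
  then show ?case using v by blast
qed

section \<open>The Eagon-Northcott complex of a matrix with two rows\<close>

text \<open>The \<open>j\<close>-th module \<open>\<Lambda>\<^sup>j\<^sup>+\<^sup>1 F \<otimes> D\<^sub>j\<^sub>-\<^sub>1 G\<close> has the basis of pairs \<open>(S, p)\<close>, where \<open>S\<close> has
  \<open>j + 1\<close> elements and \<open>p\<close> is the exponent of the divided power of the first row.\<close>

definition en_basis :: "nat \<Rightarrow> nat \<Rightarrow> (nat set \<times> nat) set" where
  "en_basis n j = (if j = 0 then {({}, 0)} else {S. S \<subseteq> {..<n} \<and> card S = j + 1} \<times> {..<j})"

text \<open>On the divided power with exponents \<open>p\<close> and \<open>j - 1 - p\<close> the
  differential lowers either exponent by one and contracts with the corresponding row; divided
  powers keep all coefficients equal to 1. In degree 1 the map is the double contraction, which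
  produces the 2-minors.\<close>

definition end_map :: "nat \<Rightarrow> (nat \<Rightarrow> 'r::comm_ring_1) \<Rightarrow> (nat \<Rightarrow> 'r) \<Rightarrow> nat \<Rightarrow>
    (nat set \<times> nat \<Rightarrow> 'r) \<Rightarrow> nat set \<times> nat \<Rightarrow> 'r" where
  "end_map n a b j u = (\<lambda>(S, p).
     if j = 1 then (if S = {} \<and> p = 0 then koszul n a (koszul n b (\<lambda>T. u (T, 0))) {} else 0)
     else if p < j - 1 then koszul n a (\<lambda>T. u (T, p + 1)) S + koszul n b (\<lambda>T. u (T, p)) S else 0)"

definition supported_on :: "'b set \<Rightarrow> ('b \<Rightarrow> 'r::zero) set" where
  "supported_on X = {u. \<forall>e. e \<notin> X \<longrightarrow> u e = 0}"

lemma end_map_add: "end_map n a b j (\<lambda>e. u e + v e) = (\<lambda>e. end_map n a b j u e + end_map n a b j v e)"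
  by (rule ext) (auto simp: end_map_def koszul_add algebra_simps)

lemma end_map_smult: "end_map n a b j (\<lambda>e. c * u e) = (\<lambda>e. c * end_map n a b j u e)"
  by (rule ext) (auto simp: end_map_def koszul_smult algebra_simps)

lemma supp_forms:
  assumes "u \<in> supported_on (en_basis n (Suc j))"
  shows "(\<lambda>T. u (T, p)) \<in> forms n (Suc (Suc j))"
  unfolding forms_def
proof (clarify)
  fix T assume "u (T, p) \<noteq> 0"
  then have "(T, p) \<in> en_basis n (Suc j)" using assms unfolding supported_on_def by blast
  then show "T \<subseteq> {..<n} \<and> card T = Suc (Suc j)" by (simp add: en_basis_def)
qed

lemma forms_supp:
  assumes "\<And>p. (\<lambda>T. u (T, p)) \<in> forms n (Suc (Suc j))" "\<And>T p. p \<ge> Suc j \<Longrightarrow> u (T, p) = 0"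
  shows "u \<in> supported_on (en_basis n (Suc j))"
  unfolding supported_on_def
proof (clarify, rule ccontr)
  fix T p assume *: "(T, p) \<notin> en_basis n (Suc j)" "u (T, p) \<noteq> 0"
  then have "p < Suc j" using assms(2)[of p T] by (meson not_less)
  moreover have "T \<subseteq> {..<n} \<and> card T = Suc (Suc j)" using formsD[OF assms(1)] *(2) by blast
  ultimately show False using * by (auto simp: en_basis_def)
qed

lemma end_map_supp:
  assumes "u \<in> supported_on (en_basis n (Suc j))"
  shows "end_map n a b (Suc j) u \<in> supported_on (en_basis n j)"
proof (cases j)
  case 0
  then show ?thesis by (auto simp: supported_on_def en_basis_def end_map_def)
next
  case (Suc i)
  show ?thesis unfolding Suc
  proof (rule forms_supp)
    fix p
    show "(\<lambda>T. end_map n a b (Suc (Suc i)) u (T, p)) \<in> forms n (Suc (Suc i))"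
      using supp_forms[OF assms] Suc
      by (cases "p < Suc i") (auto simp: end_map_def forms_zero intro!: forms_add koszul_forms)
  qed (auto simp: end_map_def)
qed

lemma end_map_end_map:
  fixes a :: "nat \<Rightarrow> 'r::{idom,ring_char_0}"
  shows "end_map n a b (Suc j) (end_map n a b (Suc (Suc j)) u) e = 0"
proof -
  obtain S p where e: "e = (S, p)" by force
  show ?thesis
  proof (cases "j = 0")
    case True
    have "koszul n a (koszul n b (\<lambda>T. koszul n a (\<lambda>T. u (T, 1)) T +
      koszul n b (\<lambda>T. u (T, 0)) T)) {} = 0"
    proof -
      have "koszul n b (\<lambda>T. koszul n a (\<lambda>T. u (T, 1)) T + koszul n b (\<lambda>T. u (T, 0)) T) =
          (\<lambda>S. - koszul n a (koszul n b (\<lambda>T. u (T, 1))) S)"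
        by (rule ext) (simp add: koszul_add koszul_koszul koszul_anticommute[of n b a])
      then show ?thesis by (simp add: koszul_minus koszul_koszul)
    qed
    then show ?thesis using True e by (auto simp: end_map_def)
  next
    case False
    show ?thesis
    proof (cases "p < j")
      case True
      let ?v = "\<lambda>p T. u (T, p)"
      have 1: "(\<lambda>T. end_map n a b (Suc (Suc j)) u (T, q)) =
          (\<lambda>S. koszul n a (?v (q + 1)) S + koszul n b (?v q) S)" if "q < Suc j" for q
        using that by (auto simp: end_map_def)
      have "end_map n a b (Suc j) (end_map n a b (Suc (Suc j)) u) e =
          koszul n a (\<lambda>T. end_map n a b (Suc (Suc j)) u (T, p + 1)) S +
          koszul n b (\<lambda>T. end_map n a b (Suc (Suc j)) u (T, p)) S"
        using True e False by (simp add: end_map_def[of _ _ _ "Suc j"])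
      also have "\<dots> = 0"
        using True by (simp add: 1 koszul_add koszul_koszul koszul_anticommute[of n b a])
      finally show ?thesis .
    next
      case False
      then show ?thesis using e \<open>j \<noteq> 0\<close> by (simp add: end_map_def)
    qed
  qed
qed

text \<open>\<open>trunc W\<close> keeps the terms of weight at most \<open>W\<close>, for a grading in which the first row of the
  matrix is lighter than the second one.\<close>

locale eagon_northcott =
  fixes n :: nat and a b :: "nat \<Rightarrow> 'r::{idom,ring_char_0}" and \<beta> :: "nat \<Rightarrow> int"
    and trunc :: "int \<Rightarrow> 'r \<Rightarrow> 'r"
  assumes rega: "regular_seq n a" and regb: "regular_seq n b"
    and beta: "\<And>i. \<beta> i \<ge> 0"
    and trunc_add: "\<And>W x y. trunc W (x + y) = trunc W x + trunc W y"
    and trunc_minus: "\<And>W x. trunc W (- x) = - trunc W x"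
    and trunc_b: "\<And>W i x. i < n \<Longrightarrow> trunc W (b i * x) = b i * trunc (W - \<beta> i) x"
    and trunc_a: "\<And>W i x. i < n \<Longrightarrow> trunc W (a i * x) = a i * trunc (W - \<beta> i + 1) x"
    and trunc_neg: "\<And>W x. W < 0 \<Longrightarrow> trunc W x = 0"
    and trunc_idem: "\<And>W x. trunc W (trunc W x) = trunc W x"
    and trunc_ex: "\<And>x. \<exists>V. \<forall>W\<ge>V. trunc W x = x"
begin

lemma trunc_0: "trunc W 0 = 0"
  using trunc_add[of W 0 0] by simp

lemma trunc_sum: "trunc W (sum f A) = (\<Sum>i\<in>A. trunc W (f i))"
  by (induction A rule: infinite_finite_induct) (simp_all add: trunc_0 trunc_add)

lemma trunc_koszul_sign: "trunc W (koszul_sign i S * x) = koszul_sign i S * trunc W x"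
proof -
  have "koszul_sign i S = (1::'r) \<or> koszul_sign i S = (-1::'r)"
    unfolding koszul_sign_def by (metis neg_one_even_power neg_one_odd_power)
  then show ?thesis by (auto simp: trunc_minus)
qed

text \<open>The basis element of \<open>S\<close> gets the weight \<open>sum \<beta> S\<close>, so
  that contraction with the second row preserves weights while contraction with the first row lowers
  them by one.\<close>

definition weight_trunc :: "int \<Rightarrow> (nat set \<Rightarrow> 'r) \<Rightarrow> nat set \<Rightarrow> 'r" where
  "weight_trunc W u S = trunc (W - sum \<beta> S) (u S)"

lemma weight_trunc_forms: "u \<in> forms n j \<Longrightarrow> weight_trunc W u \<in> forms n j"
  unfolding forms_def weight_trunc_def mem_Collect_eq by (metis trunc_0)

lemma weight_trunc_koszul_b:
  assumes "S \<subseteq> {..<n}"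
  shows "koszul n b (weight_trunc W u) S = weight_trunc W (koszul n b u) S"
proof -
  have fin: "finite S" using assms finite_subset by blast
  have "trunc (W - sum \<beta> S) (koszul_sign i S * b i * u (insert i S)) =
      koszul_sign i S * b i * trunc (W - sum \<beta> (insert i S)) (u (insert i S))" if "i \<in> {..<n} - S" for i
    using that fin by (simp add: mult.assoc trunc_koszul_sign trunc_b algebra_simps)
  then show ?thesis by (simp add: koszul_def weight_trunc_def trunc_sum)
qed

lemma weight_trunc_koszul_a:
  assumes "S \<subseteq> {..<n}"
  shows "koszul n a (weight_trunc W u) S = weight_trunc (W - 1) (koszul n a u) S"
proof -
  have fin: "finite S" using assms finite_subset by blast
  have "trunc (W - 1 - sum \<beta> S) (koszul_sign i S * a i * u (insert i S)) =
      koszul_sign i S * a i * trunc (W - sum \<beta> (insert i S)) (u (insert i S))" if "i \<in> {..<n} - S" for i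
    using that fin by (simp add: mult.assoc trunc_koszul_sign trunc_a algebra_simps)
  then show ?thesis by (simp add: koszul_def weight_trunc_def trunc_sum)
qed

lemma weight_trunc_ex:
  assumes "u \<in> forms n j"
  shows "\<exists>V. weight_trunc V u = u"
proof -
  have "\<forall>S. \<exists>V. \<forall>W\<ge>V. trunc W (u S) = u S" using trunc_ex by blast
  then obtain V where V: "\<And>S W. W \<ge> V S \<Longrightarrow> trunc W (u S) = u S" by metis
  let ?M = "Max ((\<lambda>S. V S + sum \<beta> S) ` Pow {..<n})"
  have "weight_trunc ?M u S = u S" for S
  proof (cases "S \<subseteq> {..<n}")
    case True
    then have "V S + sum \<beta> S \<le> ?M" by (intro Max_ge) auto
    then show ?thesis unfolding weight_trunc_def by (intro V) simp
  next
    case False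
    then have "u S = 0" using formsD[OF assms] by blast
    then show ?thesis by (simp add: weight_trunc_def trunc_0)
  qed
  then show ?thesis by blast
qed

text \<open>Writing \<open>z = \<partial>\<^sub>b u\<close>, the form \<open>\<partial>\<^sub>a u\<close> is again a common cycle, of smaller weight.\<close>

lemma common_cycle:
  assumes "z \<in> forms n (Suc i)" "koszul n a z = (\<lambda>S. 0)" "koszul n b z = (\<lambda>S. 0)"
  shows "\<exists>v\<in>forms n (Suc (Suc (Suc i))). z = koszul n b (koszul n a v)"
proof -
  \<comment> \<open>Induction on a strict upper bound of the weight, which drops with each passage
    from \<open>z\<close> to \<open>y\<close>.\<close>
  have main: "\<exists>v\<in>forms n (Suc (Suc (Suc i))). z = koszul n b (koszul n a v)"
    if "z \<in> forms n (Suc i)" "koszul n a z = (\<lambda>S. 0)" "koszul n b z = (\<lambda>S. 0)" "weight_trunc W z =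
      z" "W < int m"
    for m z W
    using that
  proof (induction m arbitrary: z W)
    case 0
    have "z S = 0" for S
    proof -
      have "z S = trunc (W - sum \<beta> S) (z S)" using fun_cong[OF 0(4), of S] by (simp add:
        weight_trunc_def)
      also have "\<dots> = 0" using 0(5) sum_nonneg[of S \<beta>] beta by (intro trunc_neg) (simp add:
        less_le_trans)
      finally show ?thesis .
    qed
    then have "z = (\<lambda>S. 0)" by auto
    then show ?case by (intro bexI[of _ "\<lambda>S. 0"]) (auto simp: koszul_zero forms_zero)
  next
    case (Suc m)
    obtain u0 where u0: "u0 \<in> forms n (Suc (Suc i))" "koszul n b u0 = z"
      using koszul_exact[OF regb Suc.prems(1,3)] by blast
    \<comment> \<open>Truncation keeps this a preimage of \<open>z\<close> and bounds its weight by
      \<open>W\<close>.\<close>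
    define u where "u = weight_trunc W u0"
    have u: "u \<in> forms n (Suc (Suc i))" using u0 weight_trunc_forms by (simp add: u_def)
    have bu: "koszul n b u = z"
    proof
      fix S show "koszul n b u S = z S"
      proof (cases "S \<subseteq> {..<n}")
        case True
        then show ?thesis unfolding u_def using weight_trunc_koszul_b[OF True, of W u0] u0(2)
          Suc.prems(4) by simp
      next
        case False
        then show ?thesis using formsD[OF koszul_forms[OF u]] formsD[OF Suc.prems(1)] by metis
      qed
    qed
    have tru: "weight_trunc W u = u" by (rule ext) (simp add: u_def weight_trunc_def trunc_idem)
    define y where "y = koszul n a u"
    have y: "y \<in> forms n (Suc i)" using koszul_forms[OF u] by (simp add: y_def)
    have "koszul n a y = (\<lambda>S. 0)" by (rule ext) (simp add: y_def koszul_koszul)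
    moreover have "koszul n b y = (\<lambda>S. 0)"
      using Suc.prems(2) by (intro ext) (simp add: y_def koszul_anticommute[of n b a] bu)
    moreover have "weight_trunc (W - 1) y = y"
    proof
      fix S show "weight_trunc (W - 1) y S = y S"
      proof (cases "S \<subseteq> {..<n}")
        case True
        then show ?thesis using weight_trunc_koszul_a[OF True, of W u] tru by (simp add: y_def)
      next
        case False
        then show ?thesis using formsD[OF y] formsD[OF weight_trunc_forms[OF y]] by metis
      qed
    qed
    ultimately obtain v where v: "v \<in> forms n (Suc (Suc (Suc i)))" "y = koszul n b (koszul n a v)"
      using Suc.IH[OF y, of "W - 1"] Suc.prems(5) by auto
    \<comment> \<open>Adding a \<open>b\<close>-boundary leaves the image \<open>z\<close>
      unchanged, and by anticommutation this one cancels \<open>koszul n a u\<close>; hence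
      \<open>t\<close> is an \<open>a\<close>-boundary.\<close>
    define t where "t S = u S + koszul n b v S" for S
    have t: "t \<in> forms n (Suc (Suc i))" unfolding t_def by (intro forms_add u koszul_forms v)
    have "koszul n a t S = 0" for S
    proof -
      have "koszul n a t S = y S + koszul n a (koszul n b v) S" unfolding t_def by (simp add:
        koszul_add y_def)
      also have "\<dots> = 0" using v(2) koszul_anticommute[of n a b v S] by simp
      finally show ?thesis .
    qed
    then obtain s where s: "s \<in> forms n (Suc (Suc (Suc i)))" "koszul n a s = t"
      using koszul_exact[OF rega t] by blast
    have "z = koszul n b t" unfolding t_def by (simp add: koszul_add bu koszul_koszul)
    then show ?case using s by blast
  qed
  obtain W where "weight_trunc W z = z" using weight_trunc_ex[OF assms(1)] by blast
  then show ?thesis using main[OF assms, of W "nat (W + 1)"] by simp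
qed

text \<open>A cycle is a family \<open>w p\<close> in which \<open>koszul n a (w (p + 1))\<close>
  cancels \<open>koszul n b (w p)\<close>. Its top member yields the common cycle
  \<open>koszul n b (w j)\<close>. By \<open>common_cycle\<close> this is a double contraction of
  some \<open>h\<close>, which becomes the top component of the preimage; the components below are
  solved one at a time along the row \<open>b\<close>.\<close>

theorem end_map_exact:
  assumes u: "u \<in> supported_on (en_basis n (Suc j))" and z: "end_map n a b (Suc j) u = (\<lambda>e. 0)"
  shows "\<exists>v\<in>supported_on (en_basis n (Suc (Suc j))). end_map n a b (Suc (Suc j)) v = u"
proof -
  define w where "w p = (\<lambda>T. u (T, p))" for p
  have w: "w p \<in> forms n (Suc (Suc j))" for p using supp_forms[OF u] by (simp add: w_def)
  have rel: "koszul n a (w (Suc p)) S + koszul n b (w p) S = 0" if "p < j" for p S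
    using fun_cong[OF z, of "(S, p)"] that by (auto simp: end_map_def w_def)
  define y where "y = koszul n b (w j)"
  have y: "y \<in> forms n (Suc j)" using koszul_forms[OF w] by (simp add: y_def)
  have "koszul n a y S = 0" for S
  proof (cases j)
    case 0
    show ?thesis
    proof (cases "S = {}")
      case True
      then show ?thesis using fun_cong[OF z, of "({}, 0)"] 0 by (simp add: end_map_def y_def w_def)
    next
      case False
      then show ?thesis using card_0_forms[OF koszul_forms] y 0 by blast
    qed
  next
    case (Suc i)
    have "koszul n a (w j) = (\<lambda>S. - koszul n b (w i) S)"
      using rel[of i] Suc by (auto simp: eq_neg_iff_add_eq_0)
    then show ?thesis unfolding y_def by (simp add: koszul_anticommute[of n a b] koszul_minus
      koszul_koszul)
  qed
  moreover have "koszul n b y = (\<lambda>S. 0)" by (rule ext) (simp add: y_def koszul_koszul)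
  ultimately obtain h where h: "h \<in> forms n (Suc (Suc (Suc j)))" "y = koszul n b (koszul n a h)"
    using common_cycle[OF y] by blast
  \<comment> \<open>\<open>m\<close> counts the equations already solved, from \<open>p = j\<close>
    downwards. The next one is solvable by the choice of \<open>h\<close> if \<open>p = j\<close>,
    and by the cycle relation \<open>rel\<close> below.\<close>
  have "\<exists>v. (\<forall>p. v p \<in> forms n (Suc (Suc (Suc j)))) \<and> v (Suc j) = h \<and>
      (\<forall>p\<le>j. Suc j - m \<le> p \<longrightarrow> (\<forall>S. koszul n a (v (Suc p)) S + koszul n b (v p) S =
        w p S))" if "m \<le> Suc j" for m
    using that
  proof (induction m)
    case 0
    show ?case using h(1) by (intro exI[of _ "\<lambda>p. h"]) auto
  next
    case (Suc m)
    then obtain v where v: "\<And>p. v p \<in> forms n (Suc (Suc (Suc j)))" "v (Suc j) = h"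
      "\<And>p S. p \<le> j \<Longrightarrow> Suc j - m \<le> p \<Longrightarrow> koszul n a (v (Suc p)) S + koszul n b (v p) S = w p S"
      by auto
    define p where "p = j - m"
    have p: "p \<le> j" "Suc j - Suc m = p" "Suc j - m = Suc p" using Suc.prems by (auto simp: p_def)
    let ?t = "\<lambda>S. w p S - koszul n a (v (Suc p)) S"
    have t: "?t \<in> forms n (Suc (Suc j))" by (intro forms_diff w koszul_forms v)
    have "koszul n b ?t S = 0" for S
    proof (cases "p = j")
      case True
      then show ?thesis using h(2) v(2) by (simp add: koszul_diff y_def)
    next
      case False
      then have pj: "p < j" using p by simp
      have "koszul n b (v (Suc p)) = (\<lambda>S. w (Suc p) S - koszul n a (v (Suc (Suc p))) S)"
        using v(3)[of "Suc p"] pj p(3) by (intro ext) (metis Suc_leI add_diff_cancel_left' le_refl)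
      then show ?thesis
        using rel[OF pj, of S] by (simp add: koszul_diff koszul_anticommute[of n b a] koszul_koszul
          add.commute)
    qed
    then obtain s where s: "s \<in> forms n (Suc (Suc (Suc j)))" "koszul n b s = ?t"
      using koszul_exact[OF regb t] by blast
    show ?case
    proof (intro exI[of _ "v(p := s)"] conjI allI impI)
      show "(v(p := s)) q \<in> forms n (Suc (Suc (Suc j)))" for q using v(1) s(1) by simp
      show "(v(p := s)) (Suc j) = h" using v(2) p(1) by simp
      fix q S assume q: "q \<le> j" "Suc j - Suc m \<le> q"
      show "koszul n a ((v(p := s)) (Suc q)) S + koszul n b ((v(p := s)) q) S = w q S"
      proof (cases "q = p")
        case True
        then show ?thesis using s(2) by simp
      next
        case False
        then show ?thesis using v(3)[of q S] q p by simp
      qed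
    qed
  qed
  from this[of "Suc j"] obtain v where v: "\<And>p. v p \<in> forms n (Suc (Suc (Suc j)))"
    "\<And>p S. p \<le> j \<Longrightarrow> koszul n a (v (Suc p)) S + koszul n b (v p) S = w p S" by auto
  define V where "V = (\<lambda>(T, p). if p < Suc (Suc j) then v p T else 0)"
  have "V \<in> supported_on (en_basis n (Suc (Suc j)))"
  proof (rule forms_supp)
    show "(\<lambda>T. V (T, p)) \<in> forms n (Suc (Suc (Suc j)))" for p
      by (cases "p < Suc (Suc j)") (simp_all add: V_def v forms_zero)
  qed (simp add: V_def)
  moreover have "end_map n a b (Suc (Suc j)) V = u"
  proof
    fix e :: "nat set \<times> nat"
    obtain S p where e: "e = (S, p)" by force
    show "end_map n a b (Suc (Suc j)) V e = u e"
    proof (cases "p \<le> j")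
      case True
      then show ?thesis using v(2)[OF True, of S] by (simp add: e end_map_def V_def w_def)
    next
      case False
      then have "u e = 0" using u by (auto simp: supported_on_def en_basis_def e)
      then show ?thesis using False by (simp add: e end_map_def)
    qed
  qed
  ultimately show ?thesis by blast
qed

end

section \<open>Adjoining an element to a subring\<close>

text \<open>Rings are subsets of one ambient type, so that variables can be adjoined one at a time
  and ideals of different stages compared by intersection.\<close>

definition subring_set :: "'r::comm_ring_1 set \<Rightarrow> bool" where
  "subring_set D \<longleftrightarrow> 1 \<in> D \<and> (\<forall>x\<in>D. \<forall>y\<in>D. x - y \<in> D \<and> x * y \<in> D)"

definition ideal_in :: "'r::comm_ring_1 set \<Rightarrow> 'r set \<Rightarrow> bool" where
  "ideal_in D P \<longleftrightarrow> P \<subseteq> D \<and> 0 \<in> P \<and> (\<forall>x\<in>P. \<forall>y\<in>P. x + y \<in> P) \<and> (\<forall>x\<in>D. \<forall>y\<in>P. x * y \<in> P)"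

definition polys_over :: "'r::comm_ring_1 set \<Rightarrow> 'r poly set" where
  "polys_over D = {p. \<forall>i. coeff p i \<in> D}"

definition adjoin :: "'r::comm_ring_1 set \<Rightarrow> 'r \<Rightarrow> 'r set" where
  "adjoin D x = (\<lambda>p. poly p x) ` polys_over D"

lemma subring_setD:
  assumes "subring_set D"
  shows "1 \<in> D" "0 \<in> D" "x \<in> D \<Longrightarrow> y \<in> D \<Longrightarrow> x - y \<in> D" "x \<in> D \<Longrightarrow> y \<in> D \<Longrightarrow> x * y \<in> D"
    "x \<in> D \<Longrightarrow> - x \<in> D" "x \<in> D \<Longrightarrow> y \<in> D \<Longrightarrow> x + y \<in> D"
proof -
  show 1: "1 \<in> D" and d: "x \<in> D \<Longrightarrow> y \<in> D \<Longrightarrow> x - y \<in> D" "x \<in> D \<Longrightarrow> y \<in> D \<Longrightarrow> x * y \<in> D" for x y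
    using assms by (auto simp: subring_set_def)
  show 0: "0 \<in> D" using d(1)[OF 1 1] by simp
  show m: "x \<in> D \<Longrightarrow> - x \<in> D" for x using d(1)[OF 0, of x] by simp
  show "x \<in> D \<Longrightarrow> y \<in> D \<Longrightarrow> x + y \<in> D" using d(1)[OF _ m, of x y] by simp
qed

lemma subring_set_sum: "subring_set D \<Longrightarrow> (\<And>i. i \<in> A \<Longrightarrow> f i \<in> D) \<Longrightarrow> sum f A \<in> D"
  by (induction A rule: infinite_finite_induct) (auto simp: subring_setD)

lemma subring_set_power: "subring_set D \<Longrightarrow> x \<in> D \<Longrightarrow> x ^ n \<in> D"
  by (induction n) (auto simp: subring_setD)

lemma ideal_inD:
  assumes "ideal_in D P"
  shows "P \<subseteq> D" "0 \<in> P" "x \<in> P \<Longrightarrow> y \<in> P \<Longrightarrow> x + y \<in> P" "x \<in> D \<Longrightarrow> y \<in> P \<Longrightarrow> x * y \<in> P"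
    "x \<in> D \<Longrightarrow> y \<in> P \<Longrightarrow> y * x \<in> P"
  using assms by (auto simp: ideal_in_def mult.commute)

lemma ideal_in_diff: "subring_set D \<Longrightarrow> ideal_in D P \<Longrightarrow> x \<in> P \<Longrightarrow> y \<in> P \<Longrightarrow> x - y \<in> P"
  using ideal_inD(3)[of D P x "- 1 * y"] ideal_inD(4)[of D P "- 1" y] subring_setD(1,5)[of D] by simp

lemma ideal_in_sum: "ideal_in D P \<Longrightarrow> (\<And>i. i \<in> A \<Longrightarrow> f i \<in> P) \<Longrightarrow> sum f A \<in> P"
  by (induction A rule: infinite_finite_induct) (auto simp: ideal_inD)

lemma polys_over_poly:
  assumes "subring_set D"
  shows "0 \<in> polys_over D" "c \<in> D \<Longrightarrow> monom c n \<in> polys_over D" "p \<in> polys_over D \<Longrightarrow> q \<in> polys_over D \<Longrightarrow>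
    p + q \<in> polys_over D"
    "p \<in> polys_over D \<Longrightarrow> q \<in> polys_over D \<Longrightarrow> p - q \<in> polys_over D" "p \<in> polys_over D \<Longrightarrow>
      q \<in> polys_over D \<Longrightarrow> p * q \<in> polys_over D"
    "c \<in> D \<Longrightarrow> p \<in> polys_over D \<Longrightarrow> smult c p \<in> polys_over D" "1 \<in> polys_over D"
    "c \<in> D \<Longrightarrow> p \<in> polys_over D \<Longrightarrow> pCons c p \<in> polys_over D" "p \<in> polys_over D \<Longrightarrow> lead_coeff p \<in> D"
  using subring_setD[OF assms]
  by (auto simp: polys_over_def coeff_mult coeff_pCons split: nat.split intro!: subring_set_sum[OF
    assms])

lemma polys_over_power: "subring_set D \<Longrightarrow> p \<in> polys_over D \<Longrightarrow> p ^ n \<in> polys_over D"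
  by (induction n) (auto simp: polys_over_poly)

lemma polys_over_sum: "subring_set D \<Longrightarrow> (\<And>i. i \<in> A \<Longrightarrow> f i \<in> polys_over D) \<Longrightarrow> sum f A \<in> polys_over D"
  by (induction A rule: infinite_finite_induct) (auto simp: polys_over_poly)

lemma adjoinI: "p \<in> polys_over D \<Longrightarrow> poly p x \<in> adjoin D x"
  by (auto simp: adjoin_def)

lemma adjoinE: assumes "y \<in> adjoin D x" obtains p where "p \<in> polys_over D" "y = poly p x"
  using assms by (auto simp: adjoin_def)

lemma subring_set_adjoin:
  assumes "subring_set D"
  shows "subring_set (adjoin D x)"
  unfolding subring_set_def
proof (intro conjI ballI)
  show "1 \<in> adjoin D x" using adjoinI[OF polys_over_poly(7)[OF assms], of x] by simp
  fix y z assume "y \<in> adjoin D x" "z \<in> adjoin D x"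
  then obtain p q where *: "p \<in> polys_over D" "q \<in> polys_over D" "y = poly p x" "z = poly q x"
    by (metis adjoinE)
  show "y - z \<in> adjoin D x" using adjoinI[OF polys_over_poly(4)[OF assms *(1,2)], of x] * by simp
  show "y * z \<in> adjoin D x" using adjoinI[OF polys_over_poly(5)[OF assms *(1,2)], of x] * by simp
qed

lemma adjoin_base: "subring_set D \<Longrightarrow> c \<in> D \<Longrightarrow> c \<in> adjoin D x"
  using adjoinI[OF polys_over_poly(2)[of D c 0], of x] by (simp add: monom_0)

lemma adjoin_gen: "subring_set D \<Longrightarrow> x \<in> adjoin D x"
  using adjoinI[OF polys_over_poly(2)[OF _ subring_setD(1), of D 1], of x] by (simp add: poly_monom)

text \<open>Leading coefficients are not invertible in \<open>D\<close>, so each division step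
  multiplies by the one of \<open>t\<close>; the coefficients never leave \<open>D\<close>.\<close>

lemma pseudo_division:
  assumes D: "subring_set D" and t: "t \<in> polys_over D" "degree t \<ge> 1" and p: "p \<in> polys_over D"
  shows "\<exists>M Q r. Q \<in> polys_over D \<and> r \<in> polys_over D \<and> smult (lead_coeff t ^ M) p = t * Q + r \<and>
    degree r < degree t \<and> degree Q \<le> degree p - degree t"
  using p
proof (induction "degree p" arbitrary: p rule: less_induct)
  case less
  show ?case
  proof (cases "degree p < degree t")
    case True
    then show ?thesis using less.prems polys_over_poly(1)[OF D]
      by (intro exI[of _ 0] exI[of _ "0 :: 'a poly"] exI[of _ p]) simp
  next
    case False
    define m where "m = monom (lead_coeff p) (degree p - degree t)"
    define p' where "p' = smult (lead_coeff t) p - m * t"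
    have m: "m \<in> polys_over D"
      unfolding m_def by (intro polys_over_poly(2)[OF D] polys_over_poly(9)[OF D] less.prems)
    have p': "p' \<in> polys_over D"
      unfolding p'_def by (intro polys_over_poly(4-6)[OF D] polys_over_poly(9)[OF D] less.prems m t(1))
    have "coeff p' i = 0" if "i > degree p - 1" for i
    proof -
      have i: "i \<ge> degree p" "degree p \<ge> degree t" using that t False by auto
      show ?thesis
      proof (cases "i = degree p")
        case True
        then show ?thesis using i by (simp add: p'_def m_def coeff_monom_mult)
      next
        case False
        then have "i - (degree p - degree t) > degree t" using i by linarith
        then show ?thesis using i False by (simp add: p'_def m_def coeff_monom_mult coeff_eq_0)
      qed
    qed
    then have "degree p' \<le> degree p - 1" by (intro degree_le) auto
    then have dp: "degree p' < degree p" using t False by linarith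
    obtain M Q r where IH: "Q \<in> polys_over D" "r \<in> polys_over D" "smult (lead_coeff t ^ M) p' =
      t * Q + r"
      "degree r < degree t" "degree Q \<le> degree p' - degree t"
      using less.hyps[OF dp p'] by blast
    let ?Q = "Q + smult (lead_coeff t ^ M) m"
    have "smult (lead_coeff t ^ Suc M) p = smult (lead_coeff t ^ M) (p' + m * t)"
      by (simp add: p'_def mult.commute)
    also have "\<dots> = t * ?Q + r" using IH(3) by (simp add: smult_add_right algebra_simps)
    finally have "smult (lead_coeff t ^ Suc M) p = t * ?Q + r" .
    moreover have "degree ?Q \<le> degree p - degree t"
      using IH(5) dp degree_monom_le[of "lead_coeff p" "degree p - degree t"]
        degree_smult_le[of "lead_coeff t ^ M" m]
      by (intro degree_add_le) (auto simp: m_def)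
    moreover have "?Q \<in> polys_over D"
      using IH(1) m t by (intro polys_over_poly(3,6)[OF D] subring_set_power[OF D]
        polys_over_poly(9)[OF D])
    ultimately show ?thesis using IH(2,4)
      by (intro exI[of _ "Suc M"] exI[of _ ?Q] exI[of _ r] conjI)
  qed
qed

section \<open>Contraction of G-ideals\<close>

text \<open>The condition on \<open>g\<close> says that inverting \<open>g\<close> turns \<open>D / P\<close> into a field.\<close>

definition G_ideal :: "'r::comm_ring_1 set \<Rightarrow> 'r set \<Rightarrow> bool" where
  "G_ideal D P \<longleftrightarrow> ideal_in D P \<and> 1 \<notin> P \<and> (\<forall>x\<in>D. \<forall>y\<in>D. x * y \<in> P \<longrightarrow> x \<in> P \<or> y \<in> P) \<and>
     (\<exists>g\<in>D - P. \<forall>u\<in>D - P. \<exists>v\<in>D. \<exists>N. u * v - g ^ N \<in> P)"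

text \<open>The polynomials of minimal degree that vanish modulo \<open>P\<close> replace the usual argument with
  integral extensions.\<close>

theorem G_ideal_contract:
  fixes D :: "'r::comm_ring_1 set"
  assumes D: "subring_set D" and G: "G_ideal (adjoin D x) P"
  shows "G_ideal D (P \<inter> D)"
proof -
  define E where "E = adjoin D x"
  have E: "subring_set E" using subring_set_adjoin[OF D] by (simp add: E_def)
  have P: "ideal_in E P" and P1: "1 \<notin> P" and prime: "\<And>y z. y \<in> E \<Longrightarrow> z \<in> E \<Longrightarrow> y * z \<in> P \<Longrightarrow> y \<in> P \<or> z \<in> P"
    using G by (auto simp: G_ideal_def E_def)
  obtain g where g: "g \<in> E" "g \<notin> P" "\<And>u. u \<in> E \<Longrightarrow> u \<notin> P \<Longrightarrow> \<exists>v\<in>E. \<exists>N. u * v - g ^ N \<in> P"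
    using G unfolding G_ideal_def E_def by blast
  have DE: "c \<in> D \<Longrightarrow> c \<in> E" for c using adjoin_base[OF D] by (simp add: E_def)
  have xE: "x \<in> E" using adjoin_gen[OF D] by (simp add: E_def)
  have evE: "p \<in> polys_over D \<Longrightarrow> poly p x \<in> E" for p by (simp add: E_def adjoinI)
  have cD: "p \<in> polys_over D \<Longrightarrow> coeff p i \<in> D" for p i by (simp add: polys_over_def)
  note Es = subring_setD[OF E] subring_set_power[OF E]
  note Ds = subring_setD[OF D] subring_set_power[OF D]
  note Ps = ideal_inD(2-)[OF P] ideal_in_diff[OF E P]
  note pc = polys_over_poly[OF D] polys_over_power[OF D]
  have primepow: "y \<in> P" if "y ^ m \<in> P" "y \<in> E" for y m
    using that(1)
  proof (induction m)
    case (Suc m)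
    then show ?case using prime[of y "y ^ m"] Es(7)[OF that(2)] that(2) by auto
  qed (use P1 in simp)
  have idD: "ideal_in D (P \<inter> D)"
    unfolding ideal_in_def using Ds Ps DE by auto
  have evP: "poly p x \<in> P" if "p \<in> polys_over D" "\<forall>i. coeff p i \<in> P" for p
    unfolding poly_altdef using that by (intro ideal_in_sum[OF P]) (auto intro!: Ps Es xE)
  have "\<exists>f\<in>D - P. \<forall>u\<in>D - P. \<exists>v\<in>D. \<exists>N. u * v - f ^ N \<in> P"
  proof (cases "\<forall>p\<in>polys_over D. poly p x \<in> P \<longrightarrow> (\<forall>i. coeff p i \<in> P)")
    case True
    obtain g' where g': "g' \<in> polys_over D" "g = poly g' x" using g(1) unfolding E_def by (rule adjoinE)
    \<comment> \<open>In this case \<open>x\<close> is transcendental modulo \<open>P\<close>, which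
      is impossible: \<open>Y\<close> would become a unit modulo \<open>P\<close> although it has
      positive degree there.\<close>
    define Y where "Y = 1 + pCons 0 g'"
    have Y: "Y \<in> polys_over D" using pc Ds g' by (simp add: Y_def)
    have Yx: "poly Y x = 1 + x * g" by (simp add: Y_def g')
    have "coeff Y 0 = 1" by (simp add: Y_def)
    then have "poly Y x \<notin> P" using True Y P1 by metis
    then obtain v N where v: "v \<in> E" "poly Y x * v - g ^ N \<in> P" using g(3)[OF evE[OF Y]] by blast
    obtain v' where v': "v' \<in> polys_over D" "v = poly v' x" using v(1) unfolding E_def by (rule adjoinE)
    have "\<exists>Z\<in>polys_over D. (Y - 1) ^ N = (- 1) ^ N + Y * Z"
    proof (induction N)
      case 0
      show ?case using pc(1) by (intro bexI[of _ 0]) auto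
    next
      case (Suc N)
      then obtain Z where Z: "Z \<in> polys_over D" "(Y - 1) ^ N = (- 1) ^ N + Y * Z" by blast
      have "(- 1) ^ N \<in> polys_over D" using pc(4)[OF pc(1) pc(7)] polys_over_power[OF D] by auto
      then have "(- 1) ^ N + (Y - 1) * Z \<in> polys_over D" using Z Y pc by auto
      moreover have "(Y - 1) ^ Suc N = (- 1) ^ Suc N + Y * ((- 1) ^ N + (Y - 1) * Z)"
        by (simp add: Z(2) algebra_simps)
      ultimately show ?case by blast
    qed
    then obtain Z where Z: "Z \<in> polys_over D" "(Y - 1) ^ N = (- 1) ^ N + Y * Z" by blast
    \<comment> \<open>Multiplying the relation for \<open>v\<close> by \<open>x ^ N\<close> produces
      \<open>(x * g) ^ N\<close>, the value of \<open>(Y - 1) ^ N\<close>, which is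
      \<open>(- 1) ^ N\<close> up to the multiple \<open>Y * Z\<close>. So \<open>Y * W\<close> is
      congruent to \<open>(- 1) ^ N\<close>.\<close>
    define W where "W = monom 1 N * v' - Z"
    have W: "W \<in> polys_over D" using Z v' pc Ds by (auto simp: W_def)
    define T where "T = Y * W - (- 1) ^ N"
    have m1: "(- 1) ^ N \<in> polys_over D" using pc(4)[OF pc(1) pc(7)] polys_over_power[OF D] by auto
    have T: "T \<in> polys_over D" using pc Y W m1 by (auto simp: T_def)
    have "poly ((Y - 1) ^ N) x = poly ((- 1) ^ N + Y * Z) x" using Z(2) by simp
    then have "(x * g) ^ N = poly ((-1) ^ N) x + poly Y x * poly Z x" by (simp add: Yx)
    then have "poly T x = x ^ N * (poly Y x * v - g ^ N)"
      by (simp add: T_def W_def v' poly_monom power_mult_distrib algebra_simps)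
    then have "poly T x \<in> P" using Ps(3)[OF Es(7)[OF xE] v(2)] by simp
    then have TP: "coeff T i \<in> P" for i using True T by blast
    have one: "coeff ((- 1) ^ N :: 'r poly) i = (if i = 0 then (- 1) ^ N else 0)" for i
    proof -
      have "(- 1 :: 'r poly) = [:- 1:]" by (simp add: one_pCons)
      then have "(- 1 :: 'r poly) ^ N = [:(- 1) ^ N:]" by (simp only: poly_const_pow)
      then show ?thesis by (simp add: coeff_pCons split: nat.split)
    qed
    have Wn: "\<exists>i. coeff W i \<notin> P"
    proof (rule ccontr)
      assume "\<not> ?thesis"
      then have "coeff Y 0 * coeff W 0 \<in> P" using Ps(3) cD[OF Y] DE by blast
      then have "coeff Y 0 * coeff W 0 - coeff T 0 \<in> P" using TP Ps(5) by blast
      then have "(- 1) ^ N \<in> P" by (simp add: T_def one coeff_mult)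
      then show False using P1 Ps(3)[OF _ \<open>(- 1) ^ N \<in> P\<close>, of "(- 1) ^ N"] Es
        by (simp add: power_mult_distrib[symmetric])
    qed
    have fin: "finite {i. coeff p i \<notin> P}" for p :: "'r poly"
      by (rule finite_subset[of _ "{..degree p}"]) (use Ps(1) in \<open>auto intro: le_degree\<close>)
    \<comment> \<open>Degrees modulo \<open>P\<close>: the product of the two leading coefficients
      sits in degree \<open>s + r > 0\<close>, where \<open>(- 1) ^ N\<close> has no
      coefficient.\<close>
    define r where "r = Max {i. coeff W i \<notin> P}"
    define s where "s = Max {i. coeff Y i \<notin> P}"
    have r: "coeff W r \<notin> P" "\<And>i. i > r \<Longrightarrow> coeff W i \<in> P"
      using Max_in[OF fin, of W] Wn Max_ge[OF fin, of _ W] by (force simp: r_def)+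
    have "\<exists>i. coeff g' i \<notin> P" using evP[OF g'(1)] g g' by auto
    then obtain i where "coeff Y (Suc i) \<notin> P" by (auto simp: Y_def)
    then have Yn: "{i. coeff Y i \<notin> P} \<noteq> {}" "Suc i \<le> s" using Max_ge[OF fin, of "Suc i" Y] by (auto
      simp: s_def)
    have s: "coeff Y s \<notin> P" "\<And>i. i > s \<Longrightarrow> coeff Y i \<in> P"
      using Max_in[OF fin Yn(1)] Max_ge[OF fin, of _ Y] by (force simp: s_def)+
    have "coeff (Y * W) (s + r) - coeff Y s * coeff W r \<in> P"
    proof -
      have "coeff (Y * W) (s + r) = coeff Y s * coeff W r +
          (\<Sum>i\<in>{..s + r} - {s}. coeff Y i * coeff W (s + r - i))"
        unfolding coeff_mult by (subst sum.remove[of _ s]) auto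
      moreover have "(\<Sum>i\<in>{..s + r} - {s}. coeff Y i * coeff W (s + r - i)) \<in> P"
      proof (rule ideal_in_sum[OF P])
        fix i assume i: "i \<in> {..s + r} - {s}"
        show "coeff Y i * coeff W (s + r - i) \<in> P"
        proof (cases "i > s")
          case True
          then show ?thesis using s(2) Ps(4) cD[OF W] DE by blast
        next
          case False
          then have "s + r - i > r" using i by auto
          then show ?thesis using r(2) Ps(3) cD[OF Y] DE by blast
        qed
      qed
      ultimately show ?thesis by simp
    qed
    moreover have "coeff (Y * W) (s + r) \<in> P"
      using TP[of "s + r"] Yn(2) by (simp add: T_def one)
    ultimately have "coeff Y s * coeff W r \<in> P" using Ps(5) by fastforce
    then show ?thesis using prime r(1) s(1) cD[OF Y] cD[OF W] DE by blast
  next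
    case False
    \<comment> \<open>A minimal \<open>h\<close> plays the minimal polynomial of \<open>x\<close>
      modulo \<open>P\<close>: a polynomial of smaller degree vanishes at \<open>x\<close> modulo
      \<open>P\<close> only if all its coefficients lie in \<open>P\<close>.\<close>
    define H where "H p \<longleftrightarrow> p \<in> polys_over D \<and> poly p x \<in> P \<and> (\<exists>i. coeff p i \<notin> P)" for p
    define h where "h = arg_min degree H"
    have "\<exists>p. H p" using False by (auto simp: H_def)
    then have h: "H h" "\<And>p. H p \<Longrightarrow> degree h \<le> degree p"
      unfolding h_def by (metis arg_min_natI, metis arg_min_nat_le)
    have hD: "h \<in> polys_over D" "poly h x \<in> P" using h by (auto simp: H_def)
    have small: "coeff p i \<in> P" if "p \<in> polys_over D" "poly p x \<in> P" "degree p < degree h" for p i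
      using h(2)[of p] that by (auto simp: H_def)
    define drp where "drp p = p - monom (lead_coeff p) (degree p)" for p :: "'r poly"
    have drp: "drp p \<in> polys_over D" "poly (drp p) x = poly p x - lead_coeff p * x ^ degree p"
      "coeff (drp p) i = (if i = degree p then 0 else coeff p i)" if "p \<in> polys_over D" for p i
      using that pc by (auto simp: drp_def poly_monom)
    have drpdeg: "degree (drp p) < degree p" if "degree p \<ge> 1" for p
    proof -
      have "degree (drp p) \<le> degree p - 1"
        using that by (intro degree_le) (auto simp: drp_def coeff_eq_0)
      then show ?thesis using that by simp
    qed
    have dh: "degree h \<ge> 1"
    proof (rule ccontr)
      assume "\<not> ?thesis"
      then obtain c where "h = [:c:]" by (metis degree_eq_zeroE less_one not_le)
      moreover from this have "coeff h i \<in> P" for i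
        using hD(2) Ps(1) by (cases i) auto
      ultimately show False using h(1) by (auto simp: H_def)
    qed
    have lh: "lead_coeff h \<notin> P"
    proof
      assume l: "lead_coeff h \<in> P"
      have "poly (drp h) x \<in> P"
        using drp(2)[OF hD(1)] hD l Ps(4,5) Es(7)[OF xE] by simp
      moreover have "\<exists>i. coeff (drp h) i \<notin> P"
        using h(1) l drp(3)[OF hD(1)] unfolding H_def by metis
      ultimately have "H (drp h)" using drp(1)[OF hD(1)] by (simp add: H_def)
      then show False using h(2) drpdeg[OF dh] by (meson not_less)
    qed
    have lhD: "lead_coeff h \<in> D" using hD cD by blast
    have reduce: "\<exists>M r. r \<in> polys_over D \<and> degree r < degree h \<and>
      lead_coeff h ^ M * poly p x - poly r x \<in> P"
      if p: "p \<in> polys_over D" for p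
    proof -
      obtain M Q r where *: "Q \<in> polys_over D" "r \<in> polys_over D" "smult (lead_coeff h ^ M) p =
        h * Q + r"
        "degree r < degree h" using pseudo_division[OF D hD(1) dh p] by blast
      have "lead_coeff h ^ M * poly p x = poly h x * poly Q x + poly r x"
        using arg_cong[OF *(3), of "\<lambda>q. poly q x"] by simp
      then have "lead_coeff h ^ M * poly p x - poly r x \<in> P"
        using Ps(4)[OF evE[OF *(1)] hD(2)] by simp
      then show ?thesis using * by blast
    qed
    \<comment> \<open>The multiples of \<open>g\<close> that do not vanish modulo \<open>P\<close>,
      as polynomials in \<open>x\<close>. One of least degree turns out to be a constant
      \<open>e\<close> of \<open>D\<close>, so that inverting \<open>e\<close> inverts
      \<open>g\<close>.\<close>
    define Wt where "Wt t \<longleftrightarrow> t \<in> polys_over D \<and> poly t x \<notin> P \<and> (\<exists>w\<in>E. g * w - poly t x \<in> P)" for t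
    define t where "t = arg_min degree Wt"
    obtain g' where g': "g' \<in> polys_over D" "g = poly g' x" using g(1) unfolding E_def by (rule adjoinE)
    have "Wt g'" using g g' Es(1) Ps(1) by (auto simp: Wt_def intro!: bexI[of _ 1])
    then have t: "Wt t" "\<And>p. Wt p \<Longrightarrow> degree t \<le> degree p"
      unfolding t_def by (metis arg_min_natI, metis arg_min_nat_le)
    obtain w where w: "w \<in> E" "g * w - poly t x \<in> P" using t(1) by (auto simp: Wt_def)
    have tD: "t \<in> polys_over D" "poly t x \<notin> P" using t by (auto simp: Wt_def)
    have "degree t = 0"
    proof (rule ccontr)
      assume "degree t \<noteq> 0"
      then have dt: "degree t \<ge> 1" by simp
      have lt: "lead_coeff t \<notin> P"
      proof
        assume l: "lead_coeff t \<in> P"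
        then have lx: "lead_coeff t * x ^ degree t \<in> P" using Ps(4)[OF Es(7)[OF xE]] by simp
        have "poly (drp t) x \<notin> P"
        proof
          assume "poly (drp t) x \<in> P"
          from Ps(2)[OF this lx] show False using tD drp(2)[OF tD(1)] by simp
        qed
        moreover have "g * w - poly (drp t) x \<in> P"
          using Ps(2)[OF w(2) lx] unfolding drp(2)[OF tD(1)] by (simp add: diff_diff_eq2 diff_add_eq)
        ultimately have "Wt (drp t)" using drp(1)[OF tD(1)] w by (auto simp: Wt_def)
        then show False using t(2) drpdeg[OF dt] by (meson not_less)
      qed
      \<comment> \<open>The remainder of \<open>t\<close> modulo \<open>h\<close> is again a
        nonvanishing multiple of \<open>g\<close>, so minimality of \<open>t\<close> bounds its
        degree.\<close>
      have th: "degree t < degree h"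
      proof -
        obtain M r where r: "r \<in> polys_over D" "degree r < degree h" "lead_coeff h ^ M * poly t x -
          poly r x \<in> P"
          using reduce[OF tD(1)] by blast
        have lM: "lead_coeff h ^ M \<in> E" using Es(7) DE[OF lhD] by blast
        have "poly r x \<notin> P"
        proof
          assume "poly r x \<in> P"
          from Ps(2)[OF r(3) this] have "lead_coeff h ^ M * poly t x \<in> P" by simp
          then show False using prime[OF lM evE[OF tD(1)]] tD(2) primepow lh DE[OF lhD] by blast
        qed
        moreover have "lead_coeff h ^ M * (g * w - poly t x) +
          (lead_coeff h ^ M * poly t x - poly r x) \<in> P"
          using Ps(2)[OF Ps(3)[OF lM w(2)] r(3)] .
        then have "g * (lead_coeff h ^ M * w) - poly r x \<in> P" by (simp add: algebra_simps)
        ultimately have "Wt r" using r(1) Es(4)[OF lM w(1)] by (auto simp: Wt_def)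
        then show ?thesis using t(2) r(2) by (meson le_less_trans)
      qed
      \<comment> \<open>By minimality of \<open>t\<close> the remainder vanishes modulo
        \<open>P\<close>, hence so does the quotient. As its degree is below that of
        \<open>h\<close>, its coefficients lie in \<open>P\<close>, and comparing leading
        coefficients contradicts \<open>lt\<close> and \<open>lh\<close>.\<close>
      obtain M Q r where q: "Q \<in> polys_over D" "r \<in> polys_over D" "smult (lead_coeff t ^ M) h =
        t * Q + r"
        "degree r < degree t" "degree Q \<le> degree h - degree t"
        using pseudo_division[OF D tD(1) dt hD(1)] by blast
      have qx: "lead_coeff t ^ M * poly h x = poly t x * poly Q x + poly r x"
        using arg_cong[OF q(3), of "\<lambda>q. poly q x"] by simp
      have ltE: "lead_coeff t ^ M \<in> E" using Es(7) DE cD[OF tD(1)] by blast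
      have lth: "lead_coeff t ^ M * poly h x \<in> P" using Ps(3)[OF ltE hD(2)] .
      have "poly r x \<in> P"
      proof (rule ccontr)
        assume rn: "poly r x \<notin> P"
        let ?w = "- (w * poly Q x)"
        have "poly Q x * (g * w - poly t x) + lead_coeff t ^ M * poly h x \<in> P"
          using Ps(2)[OF Ps(3)[OF evE[OF q(1)] w(2)] lth] .
        then have "0 - (poly Q x * (g * w - poly t x) + lead_coeff t ^ M * poly h x) \<in> P"
          using Ps(1,5) by blast
        moreover have "0 - (poly Q x * (g * w - poly t x) + lead_coeff t ^ M * poly h x) =
          g * ?w - poly r x"
          unfolding qx by (simp add: algebra_simps)
        ultimately have "g * ?w - poly r x \<in> P" by simp
        moreover have "?w \<in> E" using Es w evE[OF q(1)] by blast
        ultimately have "Wt r" using rn q(2) unfolding Wt_def by blast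
        then show False using t(2) q(4) by (meson not_less)
      qed
      from Ps(5)[OF lth this] have "poly t x * poly Q x \<in> P" unfolding qx by simp
      then have "poly Q x \<in> P" using prime[OF evE[OF tD(1)] evE[OF q(1)]] tD(2) by blast
      moreover have "degree Q < degree h" using q(5) dt th by linarith
      ultimately have QP: "coeff Q i \<in> P" for i using small[OF q(1)] by blast
      have "coeff (smult (lead_coeff t ^ M) h) (degree h) = coeff (t * Q) (degree h)"
        using q(3,4) th by (simp add: coeff_eq_0)
      then have "lead_coeff t ^ M * lead_coeff h = (\<Sum>i\<le>degree h. coeff t i * coeff Q (degree h - i))"
        by (simp add: coeff_mult)
      moreover have "\<dots> \<in> P"
        using QP cD[OF tD(1)] DE by (intro ideal_in_sum[OF P] Ps(3)) auto
      ultimately have "lead_coeff t ^ M * lead_coeff h \<in> P" by simp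
      then show False using prime[OF ltE DE[OF lhD]] lh primepow lt DE cD[OF tD(1)] by blast
    qed
    then obtain e where te: "t = [:e:]" by (metis degree_eq_zeroE)
    have e: "e \<in> D" "e \<notin> P" "g * w - e \<in> P" using te tD w cD[of t 0] by auto
    \<comment> \<open>Inverting \<open>e\<close> inverts \<open>g\<close> and hence every
      \<open>u\<close> outside \<open>P\<close>; inverting the leading coefficient of
      \<open>h\<close> brings the inverse down to degree below \<open>degree h\<close>, where its
      constant term is already an inverse in \<open>D\<close>.\<close>
    define f where "f = lead_coeff h * e"
    have f: "f \<in> D" "f \<notin> P" using e lhD lh prime DE Ds by (auto simp: f_def)
    have "\<exists>v\<in>D. \<exists>N. u * v - f ^ N \<in> P" if u: "u \<in> D" "u \<notin> P" for u
    proof -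
      obtain v N where v: "v \<in> E" "u * v - g ^ N \<in> P" using g(3)[OF DE[OF u(1)] u(2)] by blast
      have "(g * w) ^ N - e ^ N \<in> P"
      proof (induction N)
        case 0
        then show ?case using Ps(1) by simp
      next
        case (Suc N)
        have "(g * w) * ((g * w) ^ N - e ^ N) + (g * w - e) * e ^ N \<in> P"
          using Suc e(3) g(1) w(1) DE[OF e(1)] by (intro Ps(2) Ps(3) Ps(4) Es) auto
        then show ?case by (simp add: algebra_simps)
      qed
      moreover have "w ^ N * (u * v - g ^ N) \<in> P" using Ps(3)[OF Es(7)[OF w(1)] v(2)] .
      ultimately have "w ^ N * (u * v - g ^ N) + ((g * w) ^ N - e ^ N) \<in> P" using Ps(2) by blast
      then have 1: "u * (v * w ^ N) - e ^ N \<in> P" by (simp add: algebra_simps power_mult_distrib)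
      have "v * w ^ N \<in> E" by (intro Es(4,7) v(1) w(1))
      then obtain p where p: "p \<in> polys_over D" "v * w ^ N = poly p x" unfolding E_def by (rule adjoinE)
      obtain M r where r: "r \<in> polys_over D" "degree r < degree h" "lead_coeff h ^ M * poly p x -
        poly r x \<in> P"
        using reduce[OF p(1)] by blast
      have lM: "lead_coeff h ^ M \<in> D" using Ds(7) lhD by blast
      have "lead_coeff h ^ M * (u * (v * w ^ N) - e ^ N) - u * (lead_coeff h ^ M * poly p x -
        poly r x) \<in> P"
        by (rule Ps(5)[OF Ps(3)[OF DE[OF lM] 1] Ps(3)[OF DE[OF u(1)] r(3)]])
      then have 2: "u * poly r x - lead_coeff h ^ M * e ^ N \<in> P" by (simp add: p(2) algebra_simps)
      define q where "q = smult u r - [:lead_coeff h ^ M * e ^ N:]"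
      have "q \<in> polys_over D" unfolding q_def using u(1) r(1) lM e(1) Ds by (intro pc) (auto simp: pc)
      moreover have "poly q x \<in> P" using 2 by (simp add: q_def)
      moreover have "degree q < degree h"
        unfolding q_def using r(2) dh degree_smult_le[of u r] by (intro degree_diff_less) auto
      ultimately have "coeff q 0 \<in> P" using small by blast
      then have "u * coeff r 0 - lead_coeff h ^ M * e ^ N \<in> P" by (simp add: q_def)
      moreover have "lead_coeff h ^ N * e ^ M \<in> E" by (intro Es(4,7) DE lhD e(1))
      ultimately have "(lead_coeff h ^ N * e ^ M) * (u * coeff r 0 - lead_coeff h ^ M * e ^ N) \<in> P"
        using Ps(3) by blast
      then have "u * (coeff r 0 * (lead_coeff h ^ N * e ^ M)) - f ^ (M + N) \<in> P"
        by (simp add: f_def algebra_simps power_add power_mult_distrib)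
      moreover have "coeff r 0 * (lead_coeff h ^ N * e ^ M) \<in> D"
        by (intro Ds(4,7) cD[OF r(1)] lhD e(1))
      ultimately show ?thesis by blast
    qed
    then show ?thesis using f by blast
  qed
  then obtain f where f: "f \<in> D - P" "\<And>u. u \<in> D - P \<Longrightarrow> \<exists>v\<in>D. \<exists>N. u * v - f ^ N \<in> P" by blast
  have fD: "u * v - f ^ N \<in> D" if "u \<in> D" "v \<in> D" for u v N
    using that f(1) Ds by auto
  have "\<exists>v\<in>D. \<exists>N. u * v - f ^ N \<in> P \<inter> D" if "u \<in> D - P \<inter> D" for u
    using f(2)[of u] that fD by blast
  then show ?thesis
    unfolding G_ideal_def using idD P1 prime DE f(1) by blast
qed

section \<open>Hilbert's basis theorem\<close>

definition span_in :: "'r::comm_ring_1 set \<Rightarrow> (nat \<Rightarrow> 'r) \<Rightarrow> nat \<Rightarrow> 'r set" where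
  "span_in D f n = {\<Sum>i<n. d i * f i | d. \<forall>i<n. d i \<in> D}"

definition noetherian_in :: "'r::comm_ring_1 set \<Rightarrow> bool" where
  "noetherian_in D \<longleftrightarrow> (\<forall>J. ideal_in D J \<longrightarrow> (\<exists>n f. (\<forall>i<n. f i \<in> J) \<and> J \<subseteq> span_in D f n))"

lemma span_inI: "(\<And>i. i < n \<Longrightarrow> d i \<in> D) \<Longrightarrow> (\<Sum>i<n. d i * f i) \<in> span_in D f n"
  by (auto simp: span_in_def)

lemma span_in_cong: "(\<And>i. i < n \<Longrightarrow> f i = g i) \<Longrightarrow> span_in D f n = span_in D g n"
  unfolding span_in_def by (metis (no_types, lifting) lessThan_iff sum.cong)

lemma span_inE:
  assumes "x \<in> span_in D f n"
  obtains d where "x = (\<Sum>i<n. d i * f i)" "\<forall>i<n. d i \<in> D"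
proof -
  have "\<exists>d. x = (\<Sum>i<n. d i * f i) \<and> (\<forall>i<n. d i \<in> D)" using assms by (simp add: span_in_def)
  then show ?thesis using that by (elim exE conjE)
qed

lemma ideal_in_span_in:
  assumes D: "subring_set D" and f: "\<And>i. i < n \<Longrightarrow> f i \<in> D"
  shows "ideal_in D (span_in D f n)"
  unfolding ideal_in_def
proof (intro conjI ballI)
  show "span_in D f n \<subseteq> D" using subring_setD[OF D] f by (auto simp: span_in_def intro!:
    subring_set_sum[OF D])
  show "0 \<in> span_in D f n" using span_inI[of n "\<lambda>_. 0" D f] subring_setD[OF D] by simp
  fix x y assume y: "y \<in> span_in D f n"
  then obtain e where e: "y = (\<Sum>i<n. e i * f i)" "\<forall>i<n. e i \<in> D" by (rule span_inE)
  show "x + y \<in> span_in D f n" if x: "x \<in> span_in D f n"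
  proof -
    obtain d where d: "x = (\<Sum>i<n. d i * f i)" "\<forall>i<n. d i \<in> D" using x by (rule span_inE)
    have "x + y = (\<Sum>i<n. (d i + e i) * f i)" by (simp add: d e distrib_right sum.distrib)
    then show ?thesis using span_inI[of n "\<lambda>i. d i + e i" D f] d e subring_setD[OF D] by simp
  qed
  show "x * y \<in> span_in D f n" if "x \<in> D"
  proof -
    have "x * y = (\<Sum>i<n. (x * e i) * f i)" by (simp add: e sum_distrib_left mult.assoc)
    then show ?thesis using span_inI[of n "\<lambda>i. x * e i" D f] e subring_setD[OF D] that by simp
  qed
qed

lemma span_in_gen:
  assumes "subring_set D" "i < n"
  shows "f i \<in> span_in D f n"
proof -
  have "(\<Sum>l<n. (if l = i then 1 else 0) * f l) = (\<Sum>l<n. if l = i then f l else 0)"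
    by (intro sum.cong) auto
  also have "\<dots> = f i" using assms by simp
  finally show ?thesis using span_inI[of n "\<lambda>l. if l = i then 1 else 0" D f] subring_setD[OF
    assms(1)] by simp
qed

lemma span_in_least: "ideal_in D J \<Longrightarrow> (\<And>i. i < n \<Longrightarrow> f i \<in> J) \<Longrightarrow> span_in D f n \<subseteq> J"
  by (auto simp: span_in_def intro!: ideal_in_sum ideal_inD(4))

lemma span_in_mono:
  assumes "subring_set D" "\<And>i. i < m \<Longrightarrow> f i \<in> D" "n \<le> m"
  shows "span_in D f n \<subseteq> span_in D f m"
proof (rule span_in_least)
  show "ideal_in D (span_in D f m)" by (rule ideal_in_span_in[OF assms(1,2)])
  show "f i \<in> span_in D f m" if "i < n" for i using span_in_gen[OF assms(1)] that assms(3) by simp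
qed

text \<open>Hilbert's argument, with degrees taken over the polynomials that represent an element,
  since \<open>x\<close> may satisfy relations over \<open>D\<close>. An ideal without finite
  generation yields a sequence of representatives of least degree outside the span of the earlier
  ones; their leading coefficients lie in a finitely generated ideal of \<open>D\<close>, and this
  allows a degree to be lowered.\<close>

theorem noetherian_in_adjoin:
  fixes D :: "'r::comm_ring_1 set"
  assumes D: "subring_set D" and N: "noetherian_in D"
  shows "noetherian_in (adjoin D x)"
proof (rule ccontr)
  define E where "E = adjoin D x"
  have E: "subring_set E" using subring_set_adjoin[OF D] by (simp add: E_def)
  assume "\<not> noetherian_in (adjoin D x)"
  then obtain J where J: "ideal_in E J" and nfg: "\<And>n f. (\<And>i. i < n \<Longrightarrow> f i \<in> J) \<Longrightarrow> \<not> J \<subseteq> span_in E f n"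
    unfolding noetherian_in_def E_def by blast
  have JE: "J \<subseteq> E" using ideal_inD(1)[OF J] .
  define Q where "Q f n r \<longleftrightarrow> r \<in> polys_over D \<and> poly r x \<in> J \<and> poly r x \<notin> span_in E (\<lambda>i. poly (f i) x) n"
    for f :: "nat \<Rightarrow> 'r poly" and n r
  define P where "P f n r \<longleftrightarrow> Q f n r \<and> (\<forall>s. Q f n s \<longrightarrow> degree r \<le> degree s)" for f n r
  have Qcong: "Q f n = Q g n" if "\<And>z. z < n \<Longrightarrow> f z = g z" for f g n
  proof
    fix r show "Q f n r = Q g n r"
      using span_in_cong[of n "\<lambda>i. poly (f i) x" "\<lambda>i. poly (g i) x" E] that by (simp add: Q_def)
  qed
  \<comment> \<open>The choice of \<open>p n\<close> depends on all earlier choices, hence the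
    well-founded recursion.\<close>
  have "\<exists>p. \<forall>n. P p n (p n)"
  proof (rule dependent_wf_choice[OF wf_less_than])
    show "P f n r = P g n r" if "\<And>z. (z, n) \<in> less_than \<Longrightarrow> f z = g z" for f g n r
      using Qcong[of n f g] that by (simp add: P_def)
    show "\<exists>r. P f n r" if "\<And>y. (y, n) \<in> less_than \<Longrightarrow> P f y (f y)" for n f
    proof -
      have "\<not> J \<subseteq> span_in E (\<lambda>i. poly (f i) x) n" using that by (intro nfg) (auto simp: P_def Q_def)
      then obtain y where y: "y \<in> J" "y \<notin> span_in E (\<lambda>i. poly (f i) x) n" by blast
      then obtain r where "r \<in> polys_over D" "y = poly r x" using JE by (auto simp: E_def elim: adjoinE)
      then have "Q f n r" using y by (simp add: Q_def)
      then have "P f n (arg_min degree (Q f n))"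
        unfolding P_def by (metis arg_min_natI arg_min_nat_le)
      then show ?thesis by blast
    qed
  qed
  then obtain p where p: "\<And>n. P p n (p n)" by blast
  have pD: "p n \<in> polys_over D" "poly (p n) x \<in> J" "poly (p n) x \<notin> span_in E (\<lambda>i. poly (p i) x) n" for n
    using p by (auto simp: P_def Q_def)
  have pE: "poly (p n) x \<in> E" for n using pD JE by blast
  have mono: "degree (p i) \<le> degree (p n)" if "i \<le> n" for i n
  proof -
    have "Q p i (p n)"
      using pD[of n] span_in_mono[OF E, of n "\<lambda>i. poly (p i) x" i] pE that by (auto simp: Q_def)
    then show ?thesis using p[of i] by (simp add: P_def)
  qed
  define c where "c n = lead_coeff (p n)" for n
  have cD: "c n \<in> D" for n using pD(1) by (simp add: c_def polys_over_def)
  define L where "L = (\<Union>n. span_in D c n)"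
  have "ideal_in D L"
    unfolding ideal_in_def
  proof (intro conjI ballI)
    show "L \<subseteq> D" using ideal_inD(1)[OF ideal_in_span_in[OF D]] cD by (auto simp: L_def)
    show "0 \<in> L" using ideal_inD(2)[OF ideal_in_span_in[OF D, of 0 c]] by (auto simp: L_def)
    fix y z assume z: "z \<in> L"
    show "y * z \<in> L" if "y \<in> D"
    proof -
      obtain n where "z \<in> span_in D c n" using z by (auto simp: L_def)
      then have "y * z \<in> span_in D c n" using ideal_inD(4)[OF ideal_in_span_in[OF D] that] cD by blast
      then show ?thesis by (auto simp: L_def)
    qed
    show "y + z \<in> L" if y: "y \<in> L"
    proof -
      obtain m n where "y \<in> span_in D c m" "z \<in> span_in D c n" using y z by (auto simp: L_def)
      then have "y \<in> span_in D c (max m n)" "z \<in> span_in D c (max m n)"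
        using span_in_mono[OF D, of "max m n" c m] span_in_mono[OF D, of "max m n" c n] cD by auto
      then have "y + z \<in> span_in D c (max m n)" using ideal_inD(3)[OF ideal_in_span_in[OF D]] cD by
        blast
      then show ?thesis by (auto simp: L_def)
    qed
  qed
  then obtain m f where f: "\<forall>i<m. f i \<in> L" "L \<subseteq> span_in D f m" using N unfolding noetherian_in_def
    by blast
  then have "\<forall>i<m. \<exists>k. f i \<in> span_in D c k" by (auto simp: L_def)
  then obtain k where k: "\<And>i. i < m \<Longrightarrow> f i \<in> span_in D c (k i)" by metis
  define n where "n = Max (insert 0 (k ` {..<m}))"
  have "f i \<in> span_in D c n" if "i < m" for i
  proof -
    have "k i \<le> n" using that by (auto simp: n_def)
    then show ?thesis using k[OF that] span_in_mono[OF D, of n c "k i"] cD by blast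
  qed
  then have "span_in D f m \<subseteq> span_in D c n" using span_in_least[OF ideal_in_span_in[OF D]] cD by blast
  moreover have "c n \<in> L" using span_in_gen[OF D, of n "Suc n" c] by (auto simp: L_def)
  ultimately have "c n \<in> span_in D c n" using f(2) by blast
  then obtain d where d: "c n = (\<Sum>i<n. d i * c i)" "\<forall>i<n. d i \<in> D" by (rule span_inE)
  \<comment> \<open>It has the same leading term as \<open>p n\<close>, by the relation between the
    leading coefficients; the shifts make sense because the degrees do not decrease.\<close>
  define q where "q = (\<Sum>i<n. monom (d i) (degree (p n) - degree (p i)) * p i)"
  define r where "r = p n - q"
  have q: "q \<in> polys_over D" unfolding q_def using d polys_over_poly[OF D] pD(1) by (intro
    polys_over_sum[OF D]) auto
  have qx: "poly q x = (\<Sum>i<n. (d i * x ^ (degree (p n) - degree (p i))) * poly (p i) x)"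
    by (simp add: q_def poly_sum poly_monom)
  have qsp: "poly q x \<in> span_in E (\<lambda>i. poly (p i) x) n"
    unfolding qx using d subring_setD[OF E] adjoin_base[OF D] adjoin_gen[OF D] subring_set_power[OF E]
    by (intro span_inI) (auto simp: E_def)
  have spI': "ideal_in E (span_in E (\<lambda>i. poly (p i) x) n)" by (rule ideal_in_span_in[OF E pE])
  have r0: "coeff r i = 0" if i: "i \<ge> degree (p n)" for i
  proof -
    have "coeff (monom (d l) (degree (p n) - degree (p l)) * p l) i = (if i =
      degree (p n) then d l * c l else 0)"
      if l: "l < n" for l
    proof -
      have col_degree: "degree (p l) \<le> degree (p n)" using mono l by simp
      show ?thesis
      proof (cases "i = degree (p n)")
        case True
        then show ?thesis using col_degree by (simp add: coeff_monom_mult c_def)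
      next
        case False
        then have "i - (degree (p n) - degree (p l)) > degree (p l)" using i col_degree by linarith
        then show ?thesis using False by (simp add: coeff_monom_mult coeff_eq_0)
      qed
    qed
    then have "coeff q i = (\<Sum>l<n. if i = degree (p n) then d l * c l else 0)"
      by (simp add: q_def coeff_sum)
    then show ?thesis using d(1) i by (cases "i = degree (p n)") (auto simp: r_def c_def coeff_eq_0)
  qed
  have rn: "poly r x \<notin> span_in E (\<lambda>i. poly (p i) x) n"
  proof
    assume "poly r x \<in> span_in E (\<lambda>i. poly (p i) x) n"
    from ideal_inD(3)[OF spI' this qsp] show False using pD(3) by (simp add: r_def)
  qed
  have "poly q x \<in> J" using qsp span_in_least[OF J, of n "\<lambda>i. poly (p i) x"] pD(2) by blast
  then have "poly r x \<in> J" using ideal_in_diff[OF E J] pD(2) by (simp add: r_def)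
  moreover have "r \<in> polys_over D" using q pD(1) polys_over_poly[OF D] by (simp add: r_def)
  ultimately have "Q p n r" using rn by (simp add: Q_def)
  then have le: "degree (p n) \<le> degree r" using p[of n] by (simp add: P_def)
  have "r \<noteq> 0" using rn ideal_inD(2)[OF spI'] by auto
  then show False using r0[OF le] by simp
qed

section \<open>Polynomials in several variables\<close>

abbreviation mon :: "(nat \<Rightarrow>\<^sub>0 nat) \<Rightarrow> 'a::comm_ring_1 mpoly" where
  "mon m \<equiv> Poly_Mapping.single m 1"

abbreviation Cst :: "'a::comm_ring_1 \<Rightarrow> 'a mpoly" where
  "Cst c \<equiv> Poly_Mapping.single 0 c"

lemma mpoly_induct [case_names single add]:
  assumes "\<And>m c. P (Poly_Mapping.single m c)" and "\<And>p q. P p \<Longrightarrow> P q \<Longrightarrow> P (p + q)"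
  shows "P (p :: 'a::comm_ring_1 mpoly)"
proof (induction p rule: Poly_Mapping.update_induct)
  case const
  show ?case using assms(1)[of 0 0] by simp
next
  case (update f a b)
  have "Poly_Mapping.update a b f = f + Poly_Mapping.single a b"
    using update(1) by (intro poly_mapping_eqI) (auto simp: lookup_update lookup_add lookup_single
      when_def in_keys_iff)
  then show ?case using assms update by simp
qed

definition is_ring_hom :: "('a::comm_ring_1 \<Rightarrow> 'b::comm_ring_1) \<Rightarrow> bool" where
  "is_ring_hom h \<longleftrightarrow> h 1 = 1 \<and> (\<forall>x y. h (x + y) = h x + h y \<and> h (x * y) = h x * h y)"

lemma is_ring_homD:
  assumes "is_ring_hom h"
  shows "h 1 = 1" "h (x + y) = h x + h y" "h (x * y) = h x * h y" "h 0 = 0" "h (- x) = - h x"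
    "h (x - y) = h x - h y" "h (x ^ n) = h x ^ n" "h (sum f A) = (\<Sum>a\<in>A. h (f a))"
    "h (prod f A) = (\<Prod>a\<in>A. h (f a))"
proof -
  show 1: "h 1 = 1" and a: "h (x + y) = h x + h y" and m: "h (x * y) = h x * h y" for x y
    using assms by (auto simp: is_ring_hom_def)
  show 0: "h 0 = 0" using a[of 0 0] by simp
  show n: "h (- x) = - h x" for x using a[of x "- x"] 0 by (simp add: eq_neg_iff_add_eq_0 add.commute)
  show "h (x - y) = h x - h y" using a[of x "- y"] n by simp
  show "h (x ^ n) = h x ^ n" by (induction n) (simp_all add: 1 m)
  show "h (sum f A) = (\<Sum>a\<in>A. h (f a))"
    by (induction A rule: infinite_finite_induct) (simp_all add: 0 a)
  show "h (prod f A) = (\<Prod>a\<in>A. h (f a))"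
    by (induction A rule: infinite_finite_induct) (simp_all add: 1 m)
qed

lemma is_ring_hom_Cst: "is_ring_hom Cst"
  by (auto simp: is_ring_hom_def single_add mult_single)

lemma is_ring_hom_id: "is_ring_hom (\<lambda>x. x)"
  by (auto simp: is_ring_hom_def)

text \<open>For multiplicative \<open>F\<close> this is an evaluation homomorphism; other choices of
  \<open>F\<close> give truncation by weight, remainders and the extraction of coefficients.\<close>

definition lin_ext :: "('a::comm_ring_1 \<Rightarrow> 'b::comm_ring_1) \<Rightarrow> ((nat \<Rightarrow>\<^sub>0 nat) \<Rightarrow> 'b) \<Rightarrow> 'a mpoly \<Rightarrow> 'b" where
  "lin_ext h F p = (\<Sum>m\<in>Poly_Mapping.keys p. h (Poly_Mapping.lookup p m) * F m)"

lemma lin_ext_superset: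
  assumes "is_ring_hom h" "finite A" "Poly_Mapping.keys p \<subseteq> A"
  shows "lin_ext h F p = (\<Sum>m\<in>A. h (Poly_Mapping.lookup p m) * F m)"
  unfolding lin_ext_def using assms is_ring_homD(4)[OF assms(1)]
  by (intro sum.mono_neutral_left) (auto simp: in_keys_iff)

lemma lin_ext_add: "is_ring_hom h \<Longrightarrow> lin_ext h F (p + q) = lin_ext h F p + lin_ext h F q"
  using keys_add[of p q]
  by (simp add: lin_ext_superset[of h "Poly_Mapping.keys p \<union> Poly_Mapping.keys q"] lookup_add
    is_ring_homD
      distrib_right sum.distrib)

lemma lin_ext_single: "is_ring_hom h \<Longrightarrow> lin_ext h F (Poly_Mapping.single m c) = h c * F m"
  by (simp add: lin_ext_superset[of h "{m}"])

lemma lin_ext_0: "lin_ext h F 0 = 0"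
  by (simp add: lin_ext_def)

lemma lin_ext_minus: "is_ring_hom h \<Longrightarrow> lin_ext h F (- p) = - lin_ext h F p"
  using lin_ext_add[of h F p "- p"] by (simp add: lin_ext_0 eq_neg_iff_add_eq_0 add.commute)

lemma lin_ext_diff: "is_ring_hom h \<Longrightarrow> lin_ext h F (p - q) = lin_ext h F p - lin_ext h F q"
  using lin_ext_add[of h F p "- q"] by (simp add: lin_ext_minus)

lemma lin_ext_mult:
  assumes h: "is_ring_hom h" and F: "\<And>m m'. F (m + m') = F m * F m'"
  shows "lin_ext h F (p * q) = lin_ext h F p * lin_ext h F q"
proof (induction p rule: mpoly_induct)
  case (single m c)
  show ?case
  proof (induction q rule: mpoly_induct)
    case (single k d)
    then show ?case by (simp add: mult_single lin_ext_single[OF h] F is_ring_homD[OF h] mult_ac)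
  qed (simp add: distrib_left lin_ext_add[OF h])
qed (simp add: distrib_right lin_ext_add[OF h])

definition monom_value :: "(nat \<Rightarrow> 'b::comm_semiring_1) \<Rightarrow> (nat \<Rightarrow>\<^sub>0 nat) \<Rightarrow> 'b" where
  "monom_value \<sigma> m = (\<Prod>i\<in>Poly_Mapping.keys m. \<sigma> i ^ Poly_Mapping.lookup m i)"

lemma monom_value_superset:
  assumes "finite A" "Poly_Mapping.keys m \<subseteq> A"
  shows "monom_value \<sigma> m = (\<Prod>i\<in>A. \<sigma> i ^ Poly_Mapping.lookup m i)"
  unfolding monom_value_def using assms by (intro prod.mono_neutral_left) (auto simp: in_keys_iff)

lemma monom_value_add: "monom_value \<sigma> (m + m') = monom_value \<sigma> m * monom_value \<sigma> m'"
  using keys_add[of m m']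
  by (simp add: monom_value_superset[of "Poly_Mapping.keys m \<union> Poly_Mapping.keys m'"] lookup_add
    power_add
      prod.distrib)

lemma monom_value_0: "monom_value \<sigma> 0 = 1"
  by (simp add: monom_value_def)

lemma monom_value_single: "monom_value \<sigma> (Poly_Mapping.single i e) = \<sigma> i ^ e"
  by (simp add: monom_value_superset[of "{i}"])

lemma monom_value_cong: "(\<And>i. i \<in> Poly_Mapping.keys m \<Longrightarrow> \<sigma> i = \<tau> i) \<Longrightarrow> monom_value \<sigma> m = monom_value \<tau> m"
  by (simp add: monom_value_def)

lemma monomial_induct [case_names zero add]:
  assumes "P 0" "\<And>m i. P m \<Longrightarrow> P (m + Poly_Mapping.single i 1)"
  shows "P (m :: nat \<Rightarrow>\<^sub>0 nat)"
proof (induction m rule: Poly_Mapping.update_induct)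
  case (update f a b)
  have *: "P (f + Poly_Mapping.single a c)" for c
  proof (induction c)
    case (Suc c)
    have "f + Poly_Mapping.single a (Suc c) = (f + Poly_Mapping.single a c) + Poly_Mapping.single a 1"
      by (simp add: add.assoc single_add[symmetric])
    then show ?case using assms(2)[OF Suc] by simp
  qed (use update in simp)
  have "Poly_Mapping.update a b f = f + Poly_Mapping.single a b"
    using update(1) by (intro poly_mapping_eqI) (auto simp: lookup_update lookup_add lookup_single
      when_def in_keys_iff)
  then show ?case using * by simp
qed (use assms in simp)

definition eval_hom :: "('a::comm_ring_1 \<Rightarrow> 'b::comm_ring_1) \<Rightarrow> (nat \<Rightarrow> 'b) \<Rightarrow> 'a mpoly \<Rightarrow> 'b" where
  "eval_hom h \<sigma> = lin_ext h (monom_value \<sigma>)"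

lemma is_ring_hom_eval_hom: "is_ring_hom h \<Longrightarrow> is_ring_hom (eval_hom h \<sigma>)"
  unfolding eval_hom_def is_ring_hom_def[of "lin_ext h (monom_value \<sigma>)"]
  using lin_ext_single[of h "monom_value \<sigma>" 0 1] by (simp add: lin_ext_add lin_ext_mult
    monom_value_add monom_value_0 is_ring_homD)

lemma eval_hom_single: "is_ring_hom h \<Longrightarrow> eval_hom h \<sigma> (Poly_Mapping.single m c) = h c * monom_value \<sigma> m"
  by (simp add: eval_hom_def lin_ext_single)

lemma eval_hom_mvar: "is_ring_hom h \<Longrightarrow> eval_hom h \<sigma> (mvar i) = \<sigma> i"
  by (simp add: mvar_def eval_hom_single is_ring_homD monom_value_single)

lemma eval_hom_Cst: "is_ring_hom h \<Longrightarrow> eval_hom h \<sigma> (Cst c) = h c"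
  by (simp add: eval_hom_single monom_value_0)

lemma eval_hom_comp:
  assumes "is_ring_hom f" "is_ring_hom h"
  shows "f (eval_hom h \<sigma> p) = eval_hom (\<lambda>c. f (h c)) (\<lambda>i. f (\<sigma> i)) p"
  using assms by (simp add: eval_hom_def lin_ext_def is_ring_homD monom_value_def)

lemma monom_value_mvar: "monom_value mvar m = mon m"
proof (induction m rule: monomial_induct)
  case (add m i)
  then show ?case by (simp add: monom_value_add monom_value_single mvar_def mult_single)
qed (simp add: monom_value_0)

lemma eval_hom_mvar_id: "eval_hom Cst mvar p = p"
proof (induction p rule: mpoly_induct)
  case (single m c)
  then show ?case by (simp add: eval_hom_single is_ring_hom_Cst monom_value_mvar mult_single)
qed (simp add: is_ring_homD[OF is_ring_hom_eval_hom[OF is_ring_hom_Cst]])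

subsection \<open>Restriction of the variables\<close>

definition vars_in :: "nat set \<Rightarrow> 'a::comm_ring_1 mpoly set" where
  "vars_in V = {p. \<forall>m\<in>Poly_Mapping.keys p. Poly_Mapping.keys m \<subseteq> V}"

lemma carrier_mpoly_ring: "carrier (mpoly_ring n) = vars_in {..<n}"
  by (simp add: mpoly_ring_def vars_in_def)

lemma mpoly_ring_ops:
  "x \<otimes>\<^bsub>mpoly_ring n\<^esub> y = x * y" "x \<oplus>\<^bsub>mpoly_ring n\<^esub> y = x + y" "\<one>\<^bsub>mpoly_ring n\<^esub> =
    1" "\<zero>\<^bsub>mpoly_ring n\<^esub> = 0"
  by (simp_all add: mpoly_ring_def)

lemma vars_in_single: "Poly_Mapping.keys m \<subseteq> V \<Longrightarrow> Poly_Mapping.single m c \<in> vars_in V"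
  by (simp add: vars_in_def)

lemma subring_set_vars_in: "subring_set (vars_in V)"
  unfolding subring_set_def
proof (intro conjI ballI)
  show "1 \<in> vars_in V" by (simp add: vars_in_def)
  fix x y :: "'a mpoly" assume xy: "x \<in> vars_in V" "y \<in> vars_in V"
  show "x - y \<in> vars_in V" using xy keys_diff[of x y] by (auto simp: vars_in_def)
  show "x * y \<in> vars_in V"
    unfolding vars_in_def
  proof (clarify)
    fix m v assume "m \<in> Poly_Mapping.keys (x * y)" "v \<in> Poly_Mapping.keys m"
    then obtain a b where "m = a + b" "a \<in> Poly_Mapping.keys x" "b \<in> Poly_Mapping.keys y"
      "v \<in> Poly_Mapping.keys (a + b)"
      using keys_mult[of x y] by blast
    then show "v \<in> V" using xy keys_add[of a b] unfolding vars_in_def by blast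
  qed
qed

lemma vars_in_mono: "V \<subseteq> W \<Longrightarrow> vars_in V \<subseteq> vars_in W"
  by (auto simp: vars_in_def)

lemma vars_in_mvar: "i \<in> V \<Longrightarrow> mvar i \<in> vars_in V"
  by (simp add: mvar_def vars_in_single)

lemma vars_in_Cst: "Cst c \<in> vars_in V"
  by (simp add: vars_in_single)

lemma subring_set_prod: "subring_set D \<Longrightarrow> (\<And>i. i \<in> A \<Longrightarrow> f i \<in> D) \<Longrightarrow> prod f A \<in> D"
  by (induction A rule: infinite_finite_induct) (auto simp: subring_setD)

lemma eval_hom_in_subring_set:
  assumes "subring_set D" "\<And>c. h c \<in> D" "\<And>i. i \<in> V \<Longrightarrow> \<sigma> i \<in> D" "p \<in> vars_in V"
  shows "eval_hom h \<sigma> p \<in> D"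
  unfolding eval_hom_def lin_ext_def monom_value_def
  using assms(4) by (intro subring_set_sum[OF assms(1)] subring_setD(4)[OF assms(1)]
    subring_set_prod[OF assms(1)]
      subring_set_power[OF assms(1)] assms(2,3)) (auto simp: vars_in_def)

lemma eval_hom_cong: "p \<in> vars_in V \<Longrightarrow> (\<And>i. i \<in> V \<Longrightarrow> \<sigma> i = \<tau> i) \<Longrightarrow> eval_hom h \<sigma> p = eval_hom h \<tau> p"
  unfolding eval_hom_def lin_ext_def by (intro sum.cong arg_cong2[where f =
    "(*)"] monom_value_cong) (auto simp: vars_in_def)

text \<open>A ring homomorphism that retracts onto \<open>K[x_0, ..., x_(n-1)]\<close>: it fixes the
  known data of a linear relation and moves the unknown coefficients into the smaller ring.\<close>

definition restrict_vars :: "nat \<Rightarrow> 'a::comm_ring_1 mpoly \<Rightarrow> 'a mpoly" where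
  "restrict_vars n = eval_hom Cst (\<lambda>i. if i < n then mvar i else 1)"

lemma is_ring_hom_restrict_vars: "is_ring_hom (restrict_vars n)"
  unfolding restrict_vars_def by (rule is_ring_hom_eval_hom[OF is_ring_hom_Cst])

lemma restrict_vars_in: "restrict_vars n p \<in> vars_in {..<n}"
  unfolding restrict_vars_def
proof (rule eval_hom_in_subring_set[OF subring_set_vars_in])
  show "p \<in> vars_in UNIV" by (simp add: vars_in_def)
qed (auto simp: vars_in_Cst vars_in_mvar subring_setD[OF subring_set_vars_in])

lemma restrict_vars_id: "p \<in> vars_in {..<n} \<Longrightarrow> restrict_vars n p = p"
  unfolding restrict_vars_def by (subst eval_hom_cong[where \<tau> = mvar]) (auto simp: eval_hom_mvar_id)

text \<open>Makes the theorems on adjoining a single element available for induction over the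
  variables.\<close>

lemma vars_in_insert:
  "vars_in (insert i V) = adjoin (vars_in V) (mvar i :: 'a::comm_ring_1 mpoly)"
proof
  have "i \<in> insert i V" by simp
  show "adjoin (vars_in V) (mvar i :: 'a mpoly) \<subseteq> vars_in (insert i V)"
  proof
    fix p assume "p \<in> adjoin (vars_in V) (mvar i :: 'a mpoly)"
    then obtain q where "q \<in> polys_over (vars_in V)" "p = poly q (mvar i :: 'a mpoly)" by (rule adjoinE)
    then show "p \<in> vars_in (insert i V)"
      unfolding poly_altdef polys_over_def
      using vars_in_mono[of V "insert i V"] vars_in_mvar[of i "insert i V"]
      by (auto intro!: subring_set_sum[OF subring_set_vars_in] subring_setD(4)[OF
        subring_set_vars_in] subring_set_power[OF subring_set_vars_in])
  qed
  show "vars_in (insert i V) \<subseteq> adjoin (vars_in V) (mvar i :: 'a mpoly)"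
  proof
    fix p :: "'a mpoly" assume p: "p \<in> vars_in (insert i V)"
    have "eval_hom Cst mvar p \<in> adjoin (vars_in V) (mvar i :: 'a mpoly)"
    proof (rule eval_hom_in_subring_set[OF subring_set_adjoin[OF subring_set_vars_in] _ _ p])
      show "Cst c \<in> adjoin (vars_in V) (mvar i :: 'a mpoly)" for c
        by (rule adjoin_base[OF subring_set_vars_in vars_in_Cst])
      show "mvar l \<in> adjoin (vars_in V) (mvar i :: 'a mpoly)" if "l \<in> insert i V" for l
        using that adjoin_gen[OF subring_set_vars_in] adjoin_base[OF subring_set_vars_in
          vars_in_mvar, of l] by blast
    qed
    then show "p \<in> adjoin (vars_in V) (mvar i :: 'a mpoly)" by (simp add: eval_hom_mvar_id)
  qed
qed

lemma vars_in_empty: "vars_in {} = range (Cst :: 'a::comm_ring_1 \<Rightarrow> _)"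
proof
  show "vars_in {} \<subseteq> range (Cst :: 'a \<Rightarrow> _)"
  proof
    fix p :: "'a mpoly" assume "p \<in> vars_in {}"
    then have "p = Cst (Poly_Mapping.lookup p 0)"
      by (intro poly_mapping_eqI) (auto simp: lookup_single when_def vars_in_def in_keys_iff)
    then show "p \<in> range Cst" by blast
  qed
qed (auto simp: vars_in_Cst)

lemma noetherian_in_vars_in: "finite V \<Longrightarrow> noetherian_in (vars_in V :: 'a::field mpoly set)"
proof (induction V rule: finite_induct)
  case empty
  show ?case
    unfolding noetherian_in_def
  proof (intro allI impI)
    fix J :: "'a mpoly set" assume J: "ideal_in (vars_in {}) J"
    show "\<exists>n f. (\<forall>i<n. f i \<in> J) \<and> J \<subseteq> span_in (vars_in {}) f n"
    proof (cases "J \<subseteq> {0}")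
      case True
      then show ?thesis by (intro exI[of _ 0]) (auto simp: span_in_def)
    next
      case False
      then obtain p where p: "p \<in> J" "p \<noteq> 0" by blast
      then obtain c where c: "p = Cst c" "c \<noteq> 0" using ideal_inD(1)[OF J] vars_in_empty by force
      have "q \<in> span_in (vars_in {}) (\<lambda>_. p) (Suc 0)" if "q \<in> J" for q
      proof -
        have "q \<in> range Cst" using ideal_inD(1)[OF J] that by (auto simp: vars_in_empty[symmetric])
        then obtain b where b: "q = Cst b" by blast
        then have "q = (\<Sum>i<Suc 0. Cst (b / c) * p)" using c by (simp add: mult_single)
        then show ?thesis using span_inI[of "Suc 0" "\<lambda>_. Cst (b / c)" "vars_in {}" "\<lambda>_. p"]
          vars_in_Cst by metis
      qed
      then show ?thesis using p by (intro exI[of _ "Suc 0"] exI[of _ "\<lambda>_. p"]) blast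
    qed
  qed
next
  case (insert i V)
  then show ?case by (simp add: vars_in_insert noetherian_in_adjoin subring_set_vars_in)
qed

subsection \<open>Ideals\<close>

text \<open>Ideals of the ambient ring are the submodules of the ring over itself, so that the
  calculus of spans applies to them.\<close>

global_interpretation idl: Modules.module "(*) :: 'r::comm_ring_1 \<Rightarrow> 'r \<Rightarrow> 'r"
  by unfold_locales (auto simp: algebra_simps)

abbreviation idl :: "'r::comm_ring_1 set \<Rightarrow> 'r set" where
  "idl \<equiv> idl.span"

lemma idl_lessThan:
  fixes n :: nat
  shows "idl (x ` {..<n}) = {\<Sum>l<n. c l * x l | c. True}"
proof (induction n)
  case (Suc n)
  show ?case
  proof (intro equalityI subsetI)
    fix y assume "y \<in> idl (x ` {..<Suc n})"
    then obtain k where "y - k * x n \<in> idl (x ` {..<n})"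
      by (auto simp: lessThan_Suc idl.span_insert)
    then obtain c where c: "y - k * x n = (\<Sum>l<n. c l * x l)" using Suc by auto
    have "y = (\<Sum>l<Suc n. (c(n := k)) l * x l)" using c by (simp add: algebra_simps)
    then show "y \<in> {\<Sum>l<Suc n. c l * x l | c. True}" by blast
  next
    fix y assume "y \<in> {\<Sum>l<Suc n. c l * x l | c. True}"
    then obtain c where "y = (\<Sum>l<Suc n. c l * x l)" by blast
    moreover have "(\<Sum>l<Suc n. c l * x l) \<in> idl (x ` {..<Suc n})"
      by (rule idl.span_sum, rule idl.span_scale, rule idl.span_base) auto
    ultimately show "y \<in> idl (x ` {..<Suc n})" by simp
  qed
qed simp

lemma regular_seq_idl:
  "regular_seq n x \<longleftrightarrow> (\<forall>i<n. \<forall>r. r * x i \<in> idl (x ` {..<i}) \<longrightarrow> r \<in> idl (x ` {..<i}))"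
  unfolding regular_seq_def idl_lessThan by blast

lemma ideal_mpoly_iff: "ideal I (mpoly_ring n) \<longleftrightarrow> ideal_in (vars_in {..<n}) (I :: 'a::comm_ring_1
  mpoly set)"
proof -
  interpret cring "mpoly_ring n :: 'a mpoly ring" by (rule cring_mpoly_ring)
  show ?thesis
  proof
    assume "ideal I (mpoly_ring n)"
    then interpret I: ideal I "mpoly_ring n :: 'a mpoly ring" .
    show "ideal_in (vars_in {..<n}) I"
      unfolding ideal_in_def
      using I.a_subset I.a_closed I.zero_closed I.I_l_closed
      by (auto simp: carrier_mpoly_ring mpoly_ring_ops additive_subgroup.zero_closed)
  next
    assume I: "ideal_in (vars_in {..<n}) I"
    show "ideal I (mpoly_ring n)"
    proof (rule idealI[OF ring_axioms])
      show "subgroup I (add_monoid (mpoly_ring n))"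
      proof (rule add.subgroupI)
        show "I \<subseteq> carrier (mpoly_ring n)" using I by (simp add: carrier_mpoly_ring ideal_inD)
        show "I \<noteq> {}" using ideal_inD(2)[OF I] by blast
        fix p assume p: "p \<in> I"
        have "- 1 * p \<in> I" using ideal_inD(4)[OF I _ p] subring_setD(5)[OF subring_set_vars_in
          subring_setD(1)[OF subring_set_vars_in]] by blast
        then have "- p \<in> I" by simp
        moreover have "\<ominus>\<^bsub>mpoly_ring n\<^esub> p = - p"
        proof -
          have "p \<in> carrier (mpoly_ring n)" "- p \<in> carrier (mpoly_ring n)"
            using p \<open>- p \<in> I\<close> ideal_inD(1)[OF I] by (auto simp: carrier_mpoly_ring)
          then show ?thesis using minus_equality[of "- p" p] by (simp add: mpoly_ring_ops)
        qed
        ultimately show "\<ominus>\<^bsub>mpoly_ring n\<^esub> p \<in> I" by simp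
      next
        fix p q assume "p \<in> I" "q \<in> I"
        then show "p \<oplus>\<^bsub>mpoly_ring n\<^esub> q \<in> I" using ideal_inD(3)[OF I] by (simp add: mpoly_ring_ops)
      qed
    qed (simp_all add: ideal_inD[OF I] mpoly_ring_ops carrier_mpoly_ring)
  qed
qed

text \<open>Generating in finitely many variables or in infinitely many makes no difference inside
  the smaller ring: \<open>restrict_vars\<close> fixes the generators and moves the coefficients of
  a representation into \<open>K[x_0, ..., x_(n-1)]\<close>.\<close>

lemma genideal_mpoly:
  assumes G: "G \<subseteq> vars_in {..<n}"
  shows "genideal (mpoly_ring n) G = idl G \<inter> (vars_in {..<n} :: 'a::comm_ring_1 mpoly set)"
proof
  interpret cring "mpoly_ring n :: 'a mpoly ring" by (rule cring_mpoly_ring)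
  have "ideal_in (vars_in {..<n}) (idl G \<inter> vars_in {..<n})"
    unfolding ideal_in_def using subring_setD[OF subring_set_vars_in]
    by (auto intro: idl.span_add idl.span_scale idl.span_zero)
  then have "ideal (idl G \<inter> vars_in {..<n}) (mpoly_ring n)" by (simp add: ideal_mpoly_iff)
  then show "genideal (mpoly_ring n) G \<subseteq> idl G \<inter> vars_in {..<n}"
    using G by (intro genideal_minimal) (auto intro: idl.span_base)
  have "ideal (genideal (mpoly_ring n) G) (mpoly_ring n)"
    using G by (intro genideal_ideal) (simp add: carrier_mpoly_ring)
  then have I: "ideal_in (vars_in {..<n}) (genideal (mpoly_ring n) G)" by (simp add: ideal_mpoly_iff)
  have GI: "G \<subseteq> genideal (mpoly_ring n) G" using G by (intro genideal_self) (simp add: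
    carrier_mpoly_ring)
  have "restrict_vars n p \<in> genideal (mpoly_ring n) G" if "p \<in> idl G" for p
    using that
  proof (induction rule: idl.span_induct_alt)
    case base
    then show ?case using ideal_inD(2)[OF I] by (simp add: is_ring_homD[OF is_ring_hom_restrict_vars])
  next
    case (step c x y)
    then have "restrict_vars n x = x" "x \<in> genideal (mpoly_ring n) G" using G GI restrict_vars_id by
      blast+
    then have "restrict_vars n c * x \<in> genideal (mpoly_ring n) G" using ideal_inD(4)[OF I
      restrict_vars_in] by simp
    then show ?case
      using ideal_inD(3)[OF I _ step(2)] \<open>restrict_vars n x =
        x\<close> by (simp add: is_ring_homD[OF is_ring_hom_restrict_vars])
  qed
  then show "idl G \<inter> vars_in {..<n} \<subseteq> genideal (mpoly_ring n) G" using restrict_vars_id by force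
qed

lemma lookup_mult_single:
  fixes p :: "'a::comm_ring_1 mpoly"
  shows "Poly_Mapping.lookup (p * Poly_Mapping.single m c) (k + m) = Poly_Mapping.lookup p k * c"
proof (induction p rule: mpoly_induct)
  case (single a b)
  then show ?case by (simp add: mult_single lookup_single when_def)
qed (simp add: distrib_right lookup_add)

definition monom_dvd :: "(nat \<Rightarrow>\<^sub>0 nat) \<Rightarrow> (nat \<Rightarrow>\<^sub>0 nat) \<Rightarrow> bool" where
  "monom_dvd m k \<longleftrightarrow> (\<forall>v. Poly_Mapping.lookup m v \<le> Poly_Mapping.lookup k v)"

lemma monom_dvd_add: "monom_dvd m k \<Longrightarrow> m + (k - m) = k"
  by (intro poly_mapping_eqI) (simp add: monom_dvd_def lookup_add lookup_minus)

lemma idl_mon: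
  "p \<in> idl (mon ` M) \<longleftrightarrow> (\<forall>k\<in>Poly_Mapping.keys (p :: 'a::comm_ring_1 mpoly). \<exists>m\<in>M. monom_dvd m k)"
proof
  assume "p \<in> idl (mon ` M)"
  then show "\<forall>k\<in>Poly_Mapping.keys p. \<exists>m\<in>M. monom_dvd m k"
  proof (induction rule: idl.span_induct_alt)
    case (step c x y)
    then obtain m where m: "m \<in> M" "x = mon m" by blast
    have "monom_dvd m (a + m)" for a by (simp add: monom_dvd_def lookup_add)
    then have "\<forall>k\<in>Poly_Mapping.keys (c * x). monom_dvd m k"
      using keys_mult[of c x] m(2) by (auto split: if_splits)
    then show ?case using step(2) keys_add[of "c * x" y] m(1) by blast
  qed simp
next
  assume *: "\<forall>k\<in>Poly_Mapping.keys p. \<exists>m\<in>M. monom_dvd m k"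
  have "p = (\<Sum>k\<in>Poly_Mapping.keys p. Poly_Mapping.single k (Poly_Mapping.lookup p k))"
    by (intro poly_mapping_eqI) (simp add: lookup_sum lookup_single when_def in_keys_iff)
  also have "\<dots> \<in> idl (mon ` M)"
  proof (rule idl.span_sum)
    fix k assume "k \<in> Poly_Mapping.keys p"
    then obtain m where m: "m \<in> M" "monom_dvd m k" using * by blast
    have "Poly_Mapping.single k (Poly_Mapping.lookup p k) =
        Poly_Mapping.single (k - m) (Poly_Mapping.lookup p k) * mon m"
      using monom_dvd_add[OF m(2)] by (simp add: mult_single add.commute)
    then show "Poly_Mapping.single k (Poly_Mapping.lookup p k) \<in> idl (mon ` M)"
      using m(1) by (auto intro: idl.span_scale idl.span_base)
  qed
  finally show "p \<in> idl (mon ` M)" .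
qed

text \<open>If \<open>m l\<close> divides \<open>k + m i\<close> and shares no variable with
  \<open>m i\<close>, then it divides \<open>k\<close>; by \<open>idl_mon\<close> membership in a
  monomial ideal is tested monomial by monomial.\<close>

lemma regular_seq_coprime_monomials:
  assumes "\<And>i l. i < n \<Longrightarrow> l < n \<Longrightarrow> i \<noteq> l \<Longrightarrow> Poly_Mapping.keys (m i) \<inter> Poly_Mapping.keys (m l) = {}"
  shows "regular_seq n (\<lambda>i. mon (m i) :: 'a::comm_ring_1 mpoly)"
  unfolding regular_seq_idl
proof (intro allI impI)
  fix i and r :: "'a mpoly" assume i: "i < n"
  assume *: "r * mon (m i) \<in> idl ((\<lambda>i. mon (m i)) ` {..<i})"
  have im: "(\<lambda>i. mon (m i) :: 'a mpoly) ` {..<i} = mon ` m ` {..<i}" by auto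
  show "r \<in> idl ((\<lambda>i. mon (m i)) ` {..<i})"
    unfolding im idl_mon
  proof
    fix k assume "k \<in> Poly_Mapping.keys r"
    then have "k + m i \<in> Poly_Mapping.keys (r * mon (m i))"
      using lookup_mult_single[of r "m i" 1 k] by (simp add: in_keys_iff)
    then obtain l where l: "l < i" "monom_dvd (m l) (k + m i)"
      using * unfolding im idl_mon by blast
    have "monom_dvd (m l) k"
      unfolding monom_dvd_def
    proof
      fix v
      have "Poly_Mapping.lookup (m l) v = 0 \<or> Poly_Mapping.lookup (m i) v = 0"
        using l assms[of i l] i by (auto simp: disjoint_iff in_keys_iff)
      moreover have "Poly_Mapping.lookup (m l) v \<le> Poly_Mapping.lookup k v +
        Poly_Mapping.lookup (m i) v"
        using l(2) by (simp add: monom_dvd_def lookup_add)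
      ultimately show "Poly_Mapping.lookup (m l) v \<le> Poly_Mapping.lookup k v" by auto
    qed
    then show "\<exists>a\<in>m ` {..<i}. monom_dvd a k" using l(1) by blast
  qed
qed

subsection \<open>Weights\<close>

definition weight :: "(nat \<Rightarrow> nat) \<Rightarrow> (nat \<Rightarrow>\<^sub>0 nat) \<Rightarrow> nat" where
  "weight \<omega> m = (\<Sum>i\<in>Poly_Mapping.keys m. Poly_Mapping.lookup m i * \<omega> i)"

lemma weight_superset:
  assumes "finite A" "Poly_Mapping.keys m \<subseteq> A"
  shows "weight \<omega> m = (\<Sum>i\<in>A. Poly_Mapping.lookup m i * \<omega> i)"
  unfolding weight_def using assms by (intro sum.mono_neutral_left) (auto simp: in_keys_iff)

lemma weight_add: "weight \<omega> (m + m') = weight \<omega> m + weight \<omega> m'"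
  using keys_add[of m m']
  by (simp add: weight_superset[of "Poly_Mapping.keys m \<union> Poly_Mapping.keys m'"] lookup_add
    distrib_right
      sum.distrib)

lemma weight_single: "weight \<omega> (Poly_Mapping.single i e) = e * \<omega> i"
  by (simp add: weight_superset[of "{i}"])

lemma monom_deg_weight: "monom_deg m = weight (\<lambda>_. 1) m"
  by (simp add: monom_deg_def weight_def)

definition trunc :: "(nat \<Rightarrow> nat) \<Rightarrow> int \<Rightarrow> 'a::comm_ring_1 mpoly \<Rightarrow> 'a mpoly" where
  "trunc \<omega> W = lin_ext Cst (\<lambda>m. if int (weight \<omega> m) \<le> W then mon m else 0)"

lemma trunc_single:
  "trunc \<omega> W (Poly_Mapping.single m c) = (if int (weight \<omega> m) \<le> W then Poly_Mapping.single m c else 0)"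
  by (simp add: trunc_def lin_ext_single is_ring_hom_Cst mult_single)

lemma trunc_add: "trunc \<omega> W (p + q) = trunc \<omega> W p + trunc \<omega> W q"
  by (simp add: trunc_def lin_ext_add is_ring_hom_Cst)

lemma trunc_0: "trunc \<omega> W 0 = 0"
  by (simp add: trunc_def lin_ext_0)

lemma trunc_mon_mult:
  "trunc \<omega> W (mon m * p) = mon m * trunc \<omega> (W - int (weight \<omega> m)) p"
proof (induction p rule: mpoly_induct)
  case (single k c)
  then show ?case by (simp add: mult_single trunc_single weight_add algebra_simps)
qed (simp add: distrib_left trunc_add)

lemma eagon_northcott_monomials:
  fixes upper_monom lower_monom :: "nat \<Rightarrow> (nat \<Rightarrow>\<^sub>0 nat)"
  assumes "\<And>i l. i < n \<Longrightarrow> l < n \<Longrightarrow> i \<noteq> l \<Longrightarrow> Poly_Mapping.keys (upper_monom i) \<inter> Poly_Mapping.keys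
    (upper_monom l) = {}"
    and "\<And>i l. i < n \<Longrightarrow> l < n \<Longrightarrow> i \<noteq> l \<Longrightarrow> Poly_Mapping.keys (lower_monom i) \<inter> Poly_Mapping.keys
      (lower_monom l) = {}"
    and "\<And>i. i < n \<Longrightarrow> weight \<omega> (lower_monom i) = Suc (weight \<omega> (upper_monom i))"
  shows "eagon_northcott n (\<lambda>i. mon (upper_monom i) :: 'a::field_char_0 mpoly) (\<lambda>i. mon (lower_monom i))
    (\<lambda>i. int (weight \<omega> (lower_monom i))) (trunc \<omega>)"
proof
  show "regular_seq n (\<lambda>i. mon (upper_monom i) :: 'a mpoly)" by (rule
    regular_seq_coprime_monomials[OF assms(1)])
  show "regular_seq n (\<lambda>i. mon (lower_monom i) :: 'a mpoly)" by (rule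
    regular_seq_coprime_monomials[OF assms(2)])
  fix W and x :: "'a mpoly"
  show "trunc \<omega> W (- x) = - trunc \<omega> W x" by (simp add: trunc_def lin_ext_minus is_ring_hom_Cst)
  show "trunc \<omega> W (mon (lower_monom i) * x) = mon (lower_monom i) * trunc \<omega> (W -
    int (weight \<omega> (lower_monom i))) x" for i
    by (rule trunc_mon_mult)
  show "trunc \<omega> W (mon (upper_monom i) * x) = mon (upper_monom i) * trunc \<omega> (W -
    int (weight \<omega> (lower_monom i)) + 1) x" if "i < n" for i
    using assms(3)[OF that] by (simp add: trunc_mon_mult)
  show "trunc \<omega> W x = 0" if "W < 0"
    using that by (induction x rule: mpoly_induct) (simp_all add: trunc_single trunc_add)
  show "trunc \<omega> W (trunc \<omega> W x) = trunc \<omega> W x"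
    by (induction x rule: mpoly_induct) (simp_all add: trunc_single trunc_add trunc_0)
  show "\<exists>V. \<forall>W\<ge>V. trunc \<omega> W x = x"
  proof (induction x rule: mpoly_induct)
    case (single m c)
    then show ?case by (intro exI[of _ "int (weight \<omega> m)"]) (simp add: trunc_single)
  next
    case (add p q)
    then obtain V V' where "\<forall>W\<ge>V. trunc \<omega> W p = p" "\<forall>W\<ge>V'. trunc \<omega> W q = q" by blast
    then show ?case by (intro exI[of _ "max V V'"]) (simp add: trunc_add)
  qed
qed (simp_all add: trunc_add)

subsection \<open>Graded pieces\<close>

lemma graded_piece_iff:
  "p \<in> graded_piece n e \<longleftrightarrow> p \<in> vars_in {..<n} \<and> (\<forall>m\<in>Poly_Mapping.keys p. int (weight (\<lambda>_. 1) m) = e)"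
  by (simp add: graded_piece_def carrier_mpoly_ring monom_deg_weight)

lemma graded_piece_0: "0 \<in> graded_piece n e"
  by (simp add: graded_piece_iff vars_in_def)

lemma graded_piece_diff: "p \<in> graded_piece n e \<Longrightarrow> q \<in> graded_piece n e \<Longrightarrow> p - q \<in> graded_piece n e"
  using keys_diff[of p q] subring_setD(3)[OF subring_set_vars_in] by (auto simp: graded_piece_iff)

lemma graded_piece_minus: "p \<in> graded_piece n e \<Longrightarrow> - p \<in> graded_piece n e"
  using graded_piece_diff[OF graded_piece_0, of p n e] by simp

lemma graded_piece_add: "p \<in> graded_piece n e \<Longrightarrow> q \<in> graded_piece n e \<Longrightarrow> p + q \<in> graded_piece n e"
  using graded_piece_diff[OF _ graded_piece_minus, of p n e q] by simp

lemma graded_piece_mult: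
  assumes "p \<in> graded_piece n e" "q \<in> graded_piece n e'"
  shows "p * q \<in> graded_piece n (e + e')"
  unfolding graded_piece_iff
proof (intro conjI ballI)
  show "p * q \<in> vars_in {..<n}" using assms subring_setD(4)[OF subring_set_vars_in] by (auto simp:
    graded_piece_iff)
  fix m assume "m \<in> Poly_Mapping.keys (p * q)"
  then obtain a b where "m = a + b" "a \<in> Poly_Mapping.keys p" "b \<in> Poly_Mapping.keys q"
    using keys_mult[of p q] by blast
  then show "int (weight (\<lambda>_. 1) m) = e + e'" using assms by (auto simp: graded_piece_iff weight_add)
qed

lemma graded_piece_mon:
  "Poly_Mapping.keys m \<subseteq> {..<n} \<Longrightarrow> e = int (weight (\<lambda>_. 1) m) \<Longrightarrow>
    Poly_Mapping.single m c \<in> graded_piece n e"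
  by (simp add: graded_piece_iff vars_in_single)

section \<open>Algebraic dependence and chains of prime ideals\<close>

text \<open>Fewer equations than unknowns: each equation eliminates one unknown.\<close>

lemma homogeneous_system:
  fixes M :: "'e \<Rightarrow> 'j \<Rightarrow> 'a::field"
  assumes "finite J" "finite E" "card J < card E"
  shows "\<exists>c. (\<exists>e\<in>E. c e \<noteq> 0) \<and> (\<forall>j\<in>J. (\<Sum>e\<in>E. c e * M e j) = 0)"
  using assms
proof (induction J arbitrary: E M rule: finite_induct)
  case empty
  then have "E \<noteq> {}" by auto
  then show ?case by (intro exI[of _ "\<lambda>_. 1"]) auto
next
  case (insert j J)
  show ?case
  proof (cases "\<forall>e\<in>E. M e j = 0")
    case True
    have "card J < card E" using insert.prems insert.hyps by simp
    then obtain c where "\<exists>e\<in>E. c e \<noteq> 0" "\<forall>j\<in>J. (\<Sum>e\<in>E. c e * M e j) = 0"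
      using insert.IH[OF insert.prems(1), of M] by blast
    then show ?thesis using True by (intro exI[of _ c]) auto
  next
    case False
    then obtain f where f: "f \<in> E" "M f j \<noteq> 0" by blast
    define E' where "E' = E - {f}"
    define M' where "M' e i = M e i - M e j / M f j * M f i" for e i
    have "card J < card E'" "finite E'" using insert.prems insert.hyps f by (auto simp: E'_def)
    then obtain c where c: "\<exists>e\<in>E'. c e \<noteq> 0" "\<And>i. i \<in> J \<Longrightarrow> (\<Sum>e\<in>E'. c e * M' e i) = 0"
      using insert.IH[of E' M'] by blast
    define c' where "c' = c(f := - (\<Sum>e\<in>E'. c e * (M e j / M f j)))"
    have sum: "(\<Sum>e\<in>E. c' e * M e i) = (\<Sum>e\<in>E'. c e * M' e i)" for i
    proof -
      have "(\<Sum>e\<in>E. c' e * M e i) = c' f * M f i + (\<Sum>e\<in>E'. c' e * M e i)"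
        unfolding E'_def using insert.prems f by (subst sum.remove[of E f]) auto
      also have "(\<Sum>e\<in>E'. c' e * M e i) = (\<Sum>e\<in>E'. c e * M e i)"
        by (intro sum.cong) (auto simp: c'_def E'_def)
      finally have "(\<Sum>e\<in>E. c' e * M e i) =
          (\<Sum>e\<in>E'. c e * M e i) - (\<Sum>e\<in>E'. c e * (M e j / M f j)) * M f i"
        by (simp add: c'_def)
      also have "\<dots> = (\<Sum>e\<in>E'. c e * M e i - c e * (M e j / M f j) * M f i)"
        by (simp only: sum_subtractf sum_distrib_right)
      also have "\<dots> = (\<Sum>e\<in>E'. c e * M' e i)"
        by (intro sum.cong refl) (simp only: M'_def right_diff_distrib mult.assoc)
      finally show ?thesis .
    qed
    have "M' e j = 0" for e using f by (simp add: M'_def)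
    then have "(\<Sum>e\<in>E. c' e * M e i) = 0" if "i \<in> insert j J" for i
      using that c(2)[of i] unfolding sum by auto
    moreover have "\<exists>e\<in>E. c' e \<noteq> 0" using c(1) by (auto simp: c'_def E'_def)
    ultimately show ?thesis by blast
  qed
qed

section \<open>Counting monomials with bounded exponents\<close>

definition exp_bound :: "nat \<Rightarrow> 'a::comm_ring_1 mpoly \<Rightarrow> bool" where
  "exp_bound B p \<longleftrightarrow> (\<forall>m\<in>Poly_Mapping.keys p. \<forall>v. Poly_Mapping.lookup m v \<le> B)"

lemma exp_bound_mult:
  assumes "exp_bound B p" "exp_bound B' q"
  shows "exp_bound (B + B') (p * q)"
  unfolding exp_bound_def
proof (intro ballI allI)
  fix m v assume "m \<in> Poly_Mapping.keys (p * q)"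
  then obtain a b where "m = a + b" "a \<in> Poly_Mapping.keys p" "b \<in> Poly_Mapping.keys q"
    using keys_mult[of p q] by blast
  then show "Poly_Mapping.lookup m v \<le> B + B'"
    using assms by (auto simp: exp_bound_def lookup_add intro: add_mono)
qed

lemma exp_bound_power: "exp_bound B p \<Longrightarrow> exp_bound (n * B) (p ^ n)"
proof (induction n)
  case (Suc n)
  then show ?case using exp_bound_mult[of B p "n * B" "p ^ n"] by simp
qed (simp add: exp_bound_def)

lemma exp_bound_prod:
  "finite A \<Longrightarrow> (\<And>i. i \<in> A \<Longrightarrow> exp_bound (B i) (f i)) \<Longrightarrow> exp_bound (sum B A) (prod f A)"
proof (induction A rule: finite_induct)
  case (insert a A)
  then show ?case using exp_bound_mult[of "B a" "f a" "sum B A" "prod f A"] by simp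
qed (simp add: exp_bound_def)

lemma exp_bound_mono: "exp_bound B p \<Longrightarrow> B \<le> B' \<Longrightarrow> exp_bound B' p"
  by (meson exp_bound_def le_trans)

lemma exp_bound_ex: "\<exists>B. exp_bound B p"
proof -
  let ?X = "insert 0 (\<Union>m\<in>Poly_Mapping.keys p. Poly_Mapping.lookup m ` Poly_Mapping.keys m)"
  have "Poly_Mapping.lookup m v \<le> Max ?X" if "m \<in> Poly_Mapping.keys p" for m v
  proof (cases "v \<in> Poly_Mapping.keys m")
    case True
    then show ?thesis using that by (intro Max_ge) auto
  qed (simp add: in_keys_iff)
  then show ?thesis by (auto simp: exp_bound_def)
qed

lemma card_bounded_monomials:
  "finite {m :: nat \<Rightarrow>\<^sub>0 nat. Poly_Mapping.keys m \<subseteq> {..<N} \<and> (\<forall>v. Poly_Mapping.lookup m v \<le> B)} \<and>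
   card {m :: nat \<Rightarrow>\<^sub>0 nat. Poly_Mapping.keys m \<subseteq> {..<N} \<and>
     (\<forall>v. Poly_Mapping.lookup m v \<le> B)} \<le> (B + 1) ^ N"
  (is "finite ?A \<and> _")
proof -
  let ?g = "\<lambda>m :: nat \<Rightarrow>\<^sub>0 nat. restrict (Poly_Mapping.lookup m) {..<N}"
  have inj: "inj_on ?g ?A"
  proof (rule inj_onI, rule poly_mapping_eqI)
    fix m m' v assume m: "m \<in> ?A" "m' \<in> ?A" "?g m = ?g m'"
    show "Poly_Mapping.lookup m v = Poly_Mapping.lookup m' v"
    proof (cases "v < N")
      case True
      then show ?thesis using fun_cong[OF m(3), of v] by simp
    next
      case False
      then have "v \<notin> Poly_Mapping.keys m" "v \<notin> Poly_Mapping.keys m'" using m by auto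
      then show ?thesis by (simp add: in_keys_iff)
    qed
  qed
  have sub: "?g ` ?A \<subseteq> {..<N} \<rightarrow>\<^sub>E {..B}"
    by (rule image_subsetI) (simp add: restrict_PiE_iff)
  have fin: "finite ({..<N} \<rightarrow>\<^sub>E {..B})" by (simp add: finite_PiE)
  have "card ?A \<le> card ({..<N} \<rightarrow>\<^sub>E {..B})" using card_inj_on_le[OF inj sub fin] .
  then show ?thesis using inj_on_finite[OF inj sub fin] by (simp add: card_PiE)
qed

lemma lookup_Cst_mult: "Poly_Mapping.lookup (Cst c * p) m = c * Poly_Mapping.lookup p m"
  using lookup_mult_single[of p 0 c m] by (simp add: mult.commute)

text \<open>A dimension count: there are \<open>M ^ (N + 1)\<close> products of powers of the
  \<open>f i\<close> with exponents below \<open>M\<close>, while the number of monomials that can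
  occur in them grows only like the \<open>N\<close>-th power of \<open>M\<close>.\<close>

lemma algebraic_dependence:
  fixes f :: "nat \<Rightarrow> 'a::field mpoly"
  assumes f: "\<And>i. i \<le> N \<Longrightarrow> f i \<in> vars_in {..<N}"
  shows "\<exists>E c. finite E \<and> E \<subseteq> extensional {..N} \<and> (\<exists>e\<in>E. c e \<noteq> 0) \<and>
    (\<Sum>e\<in>E. Cst (c e) * (\<Prod>i\<le>N. f i ^ e i)) = 0"
proof -
  have "\<forall>i. \<exists>B. exp_bound B (f i)" by (simp add: exp_bound_ex)
  then obtain B where B: "\<And>i. exp_bound (B i) (f i)" by metis
  define D where "D = Max (B ` {..N})"
  have D: "exp_bound D (f i)" if "i \<le> N" for i
    using exp_bound_mono[OF B] that by (simp add: D_def)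
  \<comment> \<open>Chosen to exceed \<open>((N + 1) * D + 1) ^ N\<close>, so that the
    \<open>M ^ (N + 1)\<close> unknowns outnumber the at most
    \<open>(M * ((N + 1) * D + 1)) ^ N\<close> equations.\<close>
  define M where "M = ((N + 1) * D + 1) ^ N + 1"
  define E where "E = {..N} \<rightarrow>\<^sub>E {..<M}"
  define J where "J = {m :: nat \<Rightarrow>\<^sub>0 nat. Poly_Mapping.keys m \<subseteq> {..<N} \<and>
      (\<forall>v. Poly_Mapping.lookup m v \<le> (N + 1) * M * D)}"
  have J: "finite J" "card J \<le> ((N + 1) * M * D + 1) ^ N"
    using card_bounded_monomials[of N "(N + 1) * M * D"] by (simp_all add: J_def)
  have "(N + 1) * M * D + 1 \<le> M * ((N + 1) * D + 1)" by (simp add: M_def algebra_simps)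
  then have "((N + 1) * M * D + 1) ^ N \<le> (M * ((N + 1) * D + 1)) ^ N" by (rule power_mono) simp
  also have "\<dots> = M ^ N * ((N + 1) * D + 1) ^ N" by (rule power_mult_distrib)
  also have "\<dots> < M ^ N * M" by (simp add: M_def)
  finally have "card J < card E" using J(2) by (simp add: E_def card_PiE mult.commute)
  moreover have "finite E" by (simp add: E_def finite_PiE)
  ultimately obtain c where c: "\<exists>e\<in>E. c e \<noteq> 0"
    "\<And>m. m \<in> J \<Longrightarrow> (\<Sum>e\<in>E. c e * Poly_Mapping.lookup (\<Prod>i\<le>N. f i ^ e i) m) = 0"
    using homogeneous_system[OF J(1), of E "\<lambda>e m. Poly_Mapping.lookup (\<Prod>i\<le>N. f i ^ e i) m"] by blast
  have keys: "Poly_Mapping.keys (\<Prod>i\<le>N. f i ^ e i) \<subseteq> J" if e: "e \<in> E" for e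
  proof -
    have "exp_bound (\<Sum>i\<le>N. e i * D) (\<Prod>i\<le>N. f i ^ e i)"
      by (intro exp_bound_prod exp_bound_power D) auto
    then have "exp_bound (\<Sum>i\<le>N. M * D) (\<Prod>i\<le>N. f i ^ e i)"
      by (rule exp_bound_mono) (rule sum_mono, rule mult_right_mono, use e in \<open>auto simp: E_def
        PiE_def Pi_def less_imp_le\<close>)
    moreover have "(\<Sum>i\<le>N. M * D) = (N + 1) * M * D" by (simp add: distrib_right mult.assoc)
    ultimately have "exp_bound ((N + 1) * M * D) (\<Prod>i\<le>N. f i ^ e i)"
      by simp
    moreover have "(\<Prod>i\<le>N. f i ^ e i) \<in> vars_in {..<N}"
      by (intro subring_set_prod[OF subring_set_vars_in] subring_set_power[OF subring_set_vars_in]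
        f) simp
    ultimately show ?thesis by (auto simp: J_def exp_bound_def vars_in_def)
  qed
  have "Poly_Mapping.lookup (\<Sum>e\<in>E. Cst (c e) * (\<Prod>i\<le>N. f i ^ e i)) m = 0" for m
  proof (cases "m \<in> J")
    case True
    then show ?thesis using c(2) by (simp add: lookup_sum lookup_Cst_mult)
  next
    case False
    then have "Poly_Mapping.lookup (\<Prod>i\<le>N. f i ^ e i) m = 0" if "e \<in> E" for e
      using keys[OF that] by (auto simp: in_keys_iff)
    then show ?thesis by (simp add: lookup_sum lookup_Cst_mult)
  qed
  then have "(\<Sum>e\<in>E. Cst (c e) * (\<Prod>i\<le>N. f i ^ e i)) = 0" by (intro poly_mapping_eqI) simp
  then show ?thesis using c(1) \<open>finite E\<close> by (intro exI[of _ E] exI[of _ c]) (auto simp: E_def PiE_def)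
qed

definition prime_in :: "'r::comm_ring_1 set \<Rightarrow> 'r set \<Rightarrow> bool" where
  "prime_in D P \<longleftrightarrow> ideal_in D P \<and> 1 \<notin> P \<and> (\<forall>x\<in>D. \<forall>y\<in>D. x * y \<in> P \<longrightarrow> x \<in> P \<or> y \<in> P)"

text \<open>If \<open>x\<^sub>i \<in> Q\<^sub>i\<^sub>+\<^sub>1 - Q\<^sub>i\<close>, then the lexicographically smallest monomial of a polynomial relation
  between the \<open>x\<^sub>i\<close> modulo \<open>Q\<^sub>0\<close> would lead to a unit in the last prime ideal.\<close>

lemma prime_chain_relation:
  fixes Q :: "nat \<Rightarrow> 'a::field mpoly set"
  assumes D: "subring_set D" "\<And>c. Cst c \<in> D"
    and Q: "\<And>i. i \<le> Suc N \<Longrightarrow> prime_in D (Q i)" "\<And>i. i \<le> N \<Longrightarrow> Q i \<subset> Q (Suc i)"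
    and rel: "\<And>x. (\<And>i. i \<le> N \<Longrightarrow> x i \<in> D) \<Longrightarrow> \<exists>E c. finite E \<and> E \<subseteq> extensional {..N} \<and>
      (\<exists>e\<in>E. c e \<noteq> 0) \<and> (\<Sum>e\<in>E. Cst (c e) * (\<Prod>i\<le>N. x i ^ e i)) \<in> Q 0"
  shows False
proof -
  have "\<forall>i\<in>{..N}. \<exists>x. x \<in> Q (Suc i) - Q i" using Q(2) by blast
  then obtain x where x: "\<And>i. i \<le> N \<Longrightarrow> x i \<in> Q (Suc i)" "\<And>i. i \<le> N \<Longrightarrow>
    x i \<notin> Q i" by (metis DiffE atMost_iff)
  have idl: "ideal_in D (Q i)" "1 \<notin> Q i" if "i \<le> Suc N" for i using Q(1)[OF that] by (auto simp:
    prime_in_def)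
  have prime: "y \<in> Q i \<or> z \<in> Q i" if "i \<le> Suc N" "y \<in> D" "z \<in> D" "y * z \<in> Q i" for i y z
    using Q(1)[OF that(1)] that by (auto simp: prime_in_def)
  have xD: "x i \<in> D" if "i \<le> N" for i using x(1)[OF that] ideal_inD(1)[OF idl(1), of "Suc i"] that
    by auto
  have pD: "(\<Prod>j\<in>A. x j ^ f j) \<in> D" if "A \<subseteq> {..N}" for A and f :: "nat \<Rightarrow> nat"
    using that xD by (intro subring_set_prod[OF D(1)] subring_set_power[OF D(1)]) auto
  have tD: "(\<Sum>e\<in>E. Cst (c e) * (\<Prod>j\<in>A. x j ^ f e j)) \<in> D" if "A \<subseteq> {..N}"
    for E :: "(nat \<Rightarrow> nat) set" and c A and f :: "_ \<Rightarrow> nat \<Rightarrow> nat"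
    using that pD by (intro subring_set_sum[OF D(1)] subring_setD(4)[OF D(1)] D(2)) auto
  \<comment> \<open>Invariant: a relation modulo \<open>Q i\<close> in the elements from
    \<open>x i\<close> on, whose exponents are still pairwise different on the remaining indices, so
    that no two terms merge.\<close>
  have "\<exists>E c. finite E \<and> E \<noteq> {} \<and> (\<forall>e\<in>E. c e \<noteq> 0) \<and>
      (\<forall>e\<in>E. \<forall>e'\<in>E. (\<forall>j\<in>{i..N}. e j = e' j) \<longrightarrow> e = e') \<and>
      (\<Sum>e\<in>E. Cst (c e) * (\<Prod>j\<in>{i..N}. x j ^ e j)) \<in> Q i" if "i \<le> Suc N" for i
    using that
  proof (induction i)
    case 0
    obtain E c where E: "finite E" "E \<subseteq> extensional {..N}" "\<exists>e\<in>E. c e \<noteq> 0"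
      "(\<Sum>e\<in>E. Cst (c e) * (\<Prod>i\<le>N. x i ^ e i)) \<in> Q 0"
      using rel[of x] xD by blast
    let ?E = "{e \<in> E. c e \<noteq> 0}"
    have "(\<Sum>e\<in>?E. Cst (c e) * (\<Prod>j\<in>{0..N}. x j ^ e j)) = (\<Sum>e\<in>E. Cst (c e) * (\<Prod>i\<le>N. x i ^ e i))"
      using E(1) by (intro sum.mono_neutral_cong_left) (auto simp: atLeast0AtMost)
    moreover have "e = e'" if "e \<in> ?E" "e' \<in> ?E" "\<forall>j\<in>{0..N}. e j = e' j" for e e'
      using that E(2) by (intro extensionalityI[of _ "{..N}"]) auto
    ultimately show ?case using E by (intro exI[of _ ?E] exI[of _ c]) auto
  next
    case (Suc i)
    then have i: "i \<le> N" by simp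
    obtain E c where E: "finite E" "E \<noteq> {}" "\<forall>e\<in>E. c e \<noteq> 0"
      "\<forall>e\<in>E. \<forall>e'\<in>E. (\<forall>j\<in>{i..N}. e j = e' j) \<longrightarrow> e = e'"
      "(\<Sum>e\<in>E. Cst (c e) * (\<Prod>j\<in>{i..N}. x j ^ e j)) \<in> Q i"
      using Suc by auto
    define m where "m = Min ((\<lambda>e. e i) ` E)"
    have m: "m \<le> e i" if "e \<in> E" for e using E(1) that by (simp add: m_def)
    define E0 where "E0 = {e \<in> E. e i = m}"
    have "m \<in> (\<lambda>e. e i) ` E" unfolding m_def using E by (intro Min_in) auto
    then have E0: "E0 \<noteq> {}" "finite E0" "E0 \<subseteq> E" using E(1) by (auto simp: E0_def)
    define u where "u = (\<Sum>e\<in>E. Cst (c e) * (\<Prod>j\<in>{i..N}. x j ^ (if j = i then e i - m else e j)))"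
    define v where "v = (\<Sum>e\<in>E0. Cst (c e) * (\<Prod>j\<in>{Suc i..N}. x j ^ e j))"
    have int: "{i..N} = insert i {Suc i..N}" using i by auto
    have splitp: "(\<Prod>j\<in>{i..N}. x j ^ f j) = x i ^ f i * (\<Prod>j\<in>{Suc i..N}. x j ^ f j)" for f :: "nat \<Rightarrow> nat"
      by (simp add: int)
    have other: "(\<Prod>j\<in>{Suc i..N}. x j ^ (if j = i then e i - m else e j)) =
      (\<Prod>j\<in>{Suc i..N}. x j ^ e j)" for e
      by (intro prod.cong) auto
    \<comment> \<open>The smallest power of \<open>x i\<close> can be cancelled, as
      \<open>x i\<close> is not in the prime \<open>Q i\<close>. Modulo \<open>Q (i + 1)\<close> the
      terms that still contain \<open>x i\<close> disappear, and \<open>v\<close> remains.\<close>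
    have "(\<Sum>e\<in>E. Cst (c e) * (\<Prod>j\<in>{i..N}. x j ^ e j)) = x i ^ m * u"
      unfolding u_def sum_distrib_left
    proof (rule sum.cong[OF refl])
      fix e assume "e \<in> E"
      then have "x i ^ e i = x i ^ m * x i ^ (e i - m)" using m by (simp add: power_add[symmetric])
      moreover have "(\<Prod>j\<in>{i..N}. x j ^ (if j = i then e i - m else e j)) =
          x i ^ (e i - m) * (\<Prod>j\<in>{Suc i..N}. x j ^ e j)"
        unfolding splitp other by simp
      ultimately show "Cst (c e) * (\<Prod>j\<in>{i..N}. x j ^ e j) =
          x i ^ m * (Cst (c e) * (\<Prod>j\<in>{i..N}. x j ^ (if j = i then e i - m else e j)))"
        by (simp only: splitp[of e] mult_ac)
    qed
    then have *: "x i ^ m * u \<in> Q i" using E(5) by simp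
    have uD: "u \<in> D" unfolding u_def by (rule tD) auto
    have "u \<in> Q i"
      using *
    proof (induction m)
      case (Suc l)
      from Suc.prems have "x i * (x i ^ l * u) \<in> Q i" by (simp only: power_Suc mult.assoc)
      moreover have "x i ^ l * u \<in> D" using subring_setD(4)[OF D(1)] subring_set_power[OF D(1)]
        xD[OF i] uD by auto
      ultimately show ?case using prime[of i "x i" "x i ^ l * u"] x(2)[OF i] xD[OF i] Suc.IH i by simp
    qed simp
    then have u1: "u \<in> Q (Suc i)" using Q(2)[OF i] by blast
    have "u - v = (\<Sum>e\<in>E - E0. Cst (c e) * (\<Prod>j\<in>{i..N}. x j ^ (if j = i then e i - m else e j)))"
    proof -
      have "v = (\<Sum>e\<in>E0. Cst (c e) * (\<Prod>j\<in>{i..N}. x j ^ (if j = i then e i - m else e j)))"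
        unfolding v_def splitp other by (intro sum.cong) (auto simp: E0_def)
      then show ?thesis
        unfolding u_def sum.subset_diff[OF E0(3) E(1)] by simp
    qed
    also have "\<dots> \<in> Q (Suc i)"
    proof (rule ideal_in_sum[OF idl(1)])
      fix e assume e: "e \<in> E - E0"
      then have "e i - m = Suc (e i - m - 1)" using m[of e] by (auto simp: E0_def)
      then have pw: "x i ^ (e i - m) = x i ^ (e i - m - 1) * x i" by (metis power_Suc2)
      have eq: "Cst (c e) * (\<Prod>j\<in>{i..N}. x j ^ (if j = i then e i - m else e j)) =
          Cst (c e) * x i ^ (e i - m - 1) * (\<Prod>j\<in>{Suc i..N}. x j ^ e j) * x i"
        unfolding splitp other by (simp only: if_True refl pw mult_ac)
      have mem: "Cst (c e) * x i ^ (e i - m - 1) * (\<Prod>j\<in>{Suc i..N}. x j ^ e j) \<in> D"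
        using xD[OF i] pD by (intro subring_setD(4)[OF D(1)] subring_set_power[OF D(1)] D(2)) auto
      have "ideal_in D (Q (Suc i))" using idl(1) i by simp
      from ideal_inD(4)[OF this mem x(1)[OF i]]
      show "Cst (c e) * (\<Prod>j\<in>{i..N}. x j ^ (if j = i then e i - m else e j)) \<in> Q (Suc i)"
        unfolding eq .
    qed (use i in simp)
    finally have "u - (u - v) \<in> Q (Suc i)"
      using ideal_in_diff[OF D(1) idl(1), of "Suc i" u "u - v"] u1 i by simp
    then have "v \<in> Q (Suc i)" by simp
    moreover have "e = e'" if "e \<in> E0" "e' \<in> E0" "\<forall>j\<in>{Suc i..N}. e j = e' j" for e e'
    proof -
      have "\<forall>j\<in>{i..N}. e j = e' j" using that by (auto simp: E0_def int)
      then show ?thesis using E(4) that E0(3) by blast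
    qed
    ultimately show ?case using E0 E(3) unfolding v_def by (intro exI[of _ E0] exI[of _ c]) blast
  qed
  from this[OF le_refl] have "\<exists>(E :: (nat \<Rightarrow> nat) set) c. finite E \<and> E \<noteq> {} \<and> (\<forall>e\<in>E. c e \<noteq> 0) \<and>
      (\<forall>e\<in>E. \<forall>e'\<in>E. e = e') \<and> (\<Sum>e\<in>E. Cst (c e)) \<in> Q (Suc N)" by simp
  then obtain E and c :: "(nat \<Rightarrow> nat) \<Rightarrow> 'a" where E: "finite E" "E \<noteq> {}" "\<forall>e\<in>E. c e \<noteq> 0"
      "\<forall>e\<in>E. \<forall>e'\<in>E. e = e'" "(\<Sum>e\<in>E. Cst (c e)) \<in> Q (Suc N)" by blast
  \<comment> \<open>Exponents agree on the empty set of indices, so a single term is left: a nonzero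
    constant in a proper ideal.\<close>
  then obtain e where "E = {e}" by blast
  then have "Cst (c e) \<in> Q (Suc N)" "c e \<noteq> 0" using E by auto
  then have "Cst (inverse (c e)) * Cst (c e) \<in> Q (Suc N)" using ideal_inD(4)[OF idl(1) D(2)] by blast
  then show False using \<open>c e \<noteq> 0\<close> idl(2)[of "Suc N"] by (simp add: mult_single)
qed

section \<open>Grade and height\<close>

text \<open>The smaller prime ideal avoids the multiplicative set of all \<open>s x\<^sup>n\<close> with \<open>s \<notin> Q\<close>.\<close>

lemma (in cring) smaller_prime:
  assumes Q: "primeideal Q R" and J: "ideal J R" "J \<subseteq> Q" and x: "x \<in> carrier R"
    and nzd: "\<And>r. r \<in> carrier R \<Longrightarrow> r \<otimes> x \<in> J \<Longrightarrow> r \<in> J"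
  shows "\<exists>P. primeideal P R \<and> J \<subseteq> P \<and> P \<subseteq> Q \<and> x \<notin> P"
proof -
  interpret Q: primeideal Q R by fact
  interpret J: ideal J R by fact
  define M where "M = {s \<otimes> x [^] n | s (n::nat). s \<in> carrier R \<and> s \<notin> Q}"
  define \<A> where "\<A> = {K. ideal K R \<and> J \<subseteq> K \<and> K \<inter> M = {}}"
  have one: "\<one> \<notin> Q" using Q.I_notcarr Q.one_imp_carrier by blast
  have MI: "s \<otimes> x [^] n \<in> M" if "s \<in> carrier R" "s \<notin> Q" for s and n :: nat
    using that by (auto simp: M_def)
  have Mcarr: "M \<subseteq> carrier R" using x by (auto simp: M_def)
  have Mmult: "m \<otimes> m' \<in> M" if mm: "m \<in> M" "m' \<in> M" for m m'
  proof -
    obtain s n s' n' where *: "m = s \<otimes> x [^] (n::nat)" "m' = s' \<otimes> x [^] (n'::nat)"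
      "s \<in> carrier R" "s \<notin> Q" "s' \<in> carrier R" "s' \<notin> Q" using mm by (auto simp: M_def)
    have "m \<otimes> m' = (s \<otimes> s') \<otimes> x [^] (n + n')"
      using * x by (simp add: nat_pow_mult[symmetric] m_ac)
    moreover have "s \<otimes> s' \<notin> Q" using * Q.I_prime by blast
    ultimately show ?thesis using MI * by simp
  qed
  have nzpow: "r \<in> J" if "r \<in> carrier R" "r \<otimes> x [^] n \<in> J" for r and n :: nat
    using that
  proof (induction n)
    case (Suc n)
    then have "(r \<otimes> x [^] n) \<otimes> x \<in> J" using x by (simp add: m_assoc)
    then show ?case using nzd[of "r \<otimes> x [^] n"] Suc x by simp
  qed simp
  \<comment> \<open>As \<open>x\<close> is a nonzerodivisor modulo \<open>J\<close>, an element
    \<open>s x^n\<close> of \<open>J\<close> would put \<open>s\<close> into \<open>J\<close>, hence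
    into \<open>Q\<close>.\<close>
  have "J \<inter> M = {}" using nzpow J(2) x by (auto simp: M_def)
  then have JA: "J \<in> \<A>" using J by (simp add: \<A>_def)
  have "\<exists>K\<in>\<A>. \<forall>X\<in>\<A>. K \<subseteq> X \<longrightarrow> X = K"
  proof (rule subset_Zorn_nonempty)
    show "\<A> \<noteq> {}" using JA by blast
    fix C assume C: "C \<noteq> {}" "subset.chain \<A> C"
    have "subset.chain {I. ideal I R} C" using C(2) by (auto simp: subset.chain_def \<A>_def)
    from chain_Union_is_ideal[OF this] have "ideal (\<Union>C) R" using C(1) by simp
    moreover have "C \<subseteq> \<A>" using C(2) by (simp add: subset.chain_def)
    ultimately show "\<Union>C \<in> \<A>" using C(1) unfolding \<A>_def by blast
  qed
  then obtain K where K: "K \<in> \<A>" and max: "\<And>X. X \<in> \<A> \<Longrightarrow> K \<subseteq> X \<Longrightarrow> X = K" by blast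
  interpret K: ideal K R using K by (simp add: \<A>_def)
  have JK: "J \<subseteq> K" and KM: "K \<inter> M = {}" using K by (auto simp: \<A>_def)
  have KQ: "K \<subseteq> Q"
  proof
    fix s assume s: "s \<in> K"
    then have "s \<in> carrier R" using K.a_subset by blast
    then show "s \<in> Q" using MI[of s 0] KM s by auto
  qed
  \<comment> \<open>By maximality of \<open>K\<close>, enlarging it by an element makes it meet
    \<open>M\<close>. Two such meeting points have a product in \<open>M\<close>, which would lie in
    \<open>K\<close> if the product of the added elements did.\<close>
  have meet: "\<exists>k\<in>K. \<exists>r\<in>carrier R. k \<oplus> r \<otimes> a \<in> M" if a: "a \<in> carrier R" "a \<notin> K" for a
  proof -
    let ?X = "set_add R K (PIdl a)"
    have X: "ideal ?X R" using add_ideals K.ideal_axioms cgenideal_ideal[OF a(1)] by blast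
    have KX: "K \<subseteq> ?X"
    proof
      fix k assume k: "k \<in> K"
      have "\<zero> \<in> PIdl a" using additive_subgroup.zero_closed cgenideal_ideal[OF a(1)] ideal.axioms(1)
        by blast
      moreover have "k = k \<oplus> \<zero>" using k K.a_subset by auto
      ultimately show "k \<in> ?X" using k unfolding set_add_def' by blast
    qed
    have "a \<in> ?X"
    proof -
      have "a = \<zero> \<oplus> a" using a by simp
      then show ?thesis using K.zero_closed cgenideal_self[OF a(1)] unfolding set_add_def' by blast
    qed
    then have "?X \<notin> \<A>" using max KX a by blast
    then obtain y where "y \<in> ?X" "y \<in> M" using X KX JK by (auto simp: \<A>_def)
    then show ?thesis unfolding set_add_def' cgenideal_def by blast
  qed
  have "primeideal K R"
  proof (rule primeidealI[OF K.ideal_axioms is_cring])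
    show "carrier R \<noteq> K" using KQ one by auto
    fix a b assume ab: "a \<in> carrier R" "b \<in> carrier R" "a \<otimes> b \<in> K"
    show "a \<in> K \<or> b \<in> K"
    proof (rule ccontr)
      assume "\<not> ?thesis"
      then obtain k r k' r' where *: "k \<in> K" "r \<in> carrier R" "k \<oplus> r \<otimes> a \<in> M"
        "k' \<in> K" "r' \<in> carrier R" "k' \<oplus> r' \<otimes> b \<in> M"
        using meet ab by meson
      have kc: "k \<in> carrier R" "k' \<in> carrier R" using * K.a_subset by auto
      have "(k \<oplus> r \<otimes> a) \<otimes> (k' \<oplus> r' \<otimes> b) =
          (k \<otimes> (k' \<oplus> r' \<otimes> b) \<oplus> (r \<otimes> a) \<otimes> k') \<oplus> (r \<otimes> r') \<otimes> (a \<otimes> b)"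
        using kc * ab by (simp add: l_distr r_distr m_ac a_ac)
      moreover have "\<dots> \<in> K"
        using * ab kc
        by (intro K.a_closed K.I_r_closed[OF *(1)] K.I_l_closed[OF *(4)] K.I_l_closed[OF ab(3)]) auto
      ultimately show False using Mmult[OF *(3,6)] KM by auto
    qed
  qed
  moreover have "x \<notin> K"
    using MI[OF one_closed one, of 1] KM x by auto
  ultimately show ?thesis using JK KQ by blast
qed

text \<open>The chain is built downwards from \<open>P\<close>: the last element not yet used is a
  nonzerodivisor modulo the earlier ones, so \<open>smaller_prime\<close> gives a prime that still
  contains these but misses that element.\<close>

lemma (in cring) regular_sequence_chain:
  assumes reg: "regular_sequence R xs" and xs: "set xs \<subseteq> P" and P: "primeideal P R" and l: "l \<le>
    length xs"
  shows "\<exists>Q. (\<forall>i\<le>l. primeideal (Q i) R) \<and> (\<forall>i<l. Q i \<subset> Q (Suc i)) \<and> Q l = P \<and>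
    genideal R (set (take (length xs - l) xs)) \<subseteq> Q 0"
  using l
proof (induction l)
  case 0
  have "genideal R (set xs) \<subseteq> P" using P xs by (intro genideal_minimal) (auto simp: primeideal_def)
  then show ?case using P by (intro exI[of _ "\<lambda>_. P"]) simp
next
  case (Suc l)
  then obtain Q where Q: "\<And>i. i \<le> l \<Longrightarrow> primeideal (Q i) R" "\<And>i. i < l \<Longrightarrow> Q i \<subset> Q (Suc i)" "Q l = P"
    "genideal R (set (take (length xs - l) xs)) \<subseteq> Q 0" by auto
  define i where "i = length xs - Suc l"
  have i: "i < length xs" "length xs - l = Suc i" using Suc.prems by (auto simp: i_def)
  have carr: "set xs \<subseteq> carrier R" using reg by (simp add: regular_sequence_def)
  have sub: "set (take j xs) \<subseteq> carrier R" for j using carr set_take_subset by fast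
  have sub2: "set (take (length xs - l) xs) \<subseteq> genideal R (set (take (length xs - l) xs))"
    by (rule genideal_self[OF sub])
  have *: "set (take i xs) \<subseteq> Q 0" "xs ! i \<in> Q 0"
    using sub2 Q(4) i by (auto simp: take_Suc_conv_app_nth)
  have "\<exists>K. primeideal K R \<and> genideal R (set (take i xs)) \<subseteq> K \<and> K \<subseteq> Q 0 \<and> xs ! i \<notin> K"
  proof (rule smaller_prime)
    show "primeideal (Q 0) R" using Q(1) by simp
    then show "genideal R (set (take i xs)) \<subseteq> Q 0"
      using * by (intro genideal_minimal) (auto simp: primeideal_def)
    show "ideal (genideal R (set (take i xs))) R" by (rule genideal_ideal[OF sub])
    show "xs ! i \<in> carrier R" using carr i by auto
    show "r \<in> genideal R (set (take i xs))"
      if "r \<in> carrier R" "r \<otimes> xs ! i \<in> genideal R (set (take i xs))" for r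
      using reg i that by (simp add: regular_sequence_def)
  qed
  then obtain K where K: "primeideal K R" "genideal R (set (take i xs)) \<subseteq> K" "K \<subseteq> Q 0" "xs ! i \<notin> K"
    by blast
  define Q' where "Q' j = (case j of 0 \<Rightarrow> K | Suc j \<Rightarrow> Q j)" for j
  have "K \<subset> Q 0" using K * by blast
  then have "Q' j \<subset> Q' (Suc j)" if "j < Suc l" for j
    using that Q(2) by (auto simp: Q'_def split: nat.split)
  moreover have "primeideal (Q' j) R" if "j \<le> Suc l" for j
    using that Q(1) K(1) by (auto simp: Q'_def split: nat.split)
  ultimately show ?case
    using K(2) Q(3) by (intro exI[of _ Q']) (auto simp: Q'_def i_def)
qed

lemma (in cring) grade_le_prime_height:
  assumes "primeideal P R"
  shows "grade R P \<le> prime_height R P"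
  unfolding grade_def
proof (rule Sup_least, clarify)
  fix xs assume "set xs \<subseteq> P" "regular_sequence R xs"
  then obtain Q where "\<forall>i\<le>length xs. primeideal (Q i) R" "\<forall>i<length xs. Q i \<subset> Q (Suc i)" "Q (length
    xs) = P"
    using regular_sequence_chain[OF _ _ assms le_refl] by blast
  then show "enat (length xs) \<le> prime_height R P"
    unfolding prime_height_def by (intro Sup_upper) blast
qed

section \<open>Regular sequences\<close>

text \<open>The remainder of a polynomial under the rewrite rule that replaces \<open>x\<^sub>v\<^sup>d\<close> by \<open>g\<close>.\<close>

definition reduce_power :: "nat \<Rightarrow> nat \<Rightarrow> 'a::comm_ring_1 mpoly \<Rightarrow> 'a mpoly \<Rightarrow> 'a mpoly" where
  "reduce_power v d g = lin_ext Cst (\<lambda>m. mon (m - Poly_Mapping.single v (d *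
    (Poly_Mapping.lookup m v div d))) *
     g ^ (Poly_Mapping.lookup m v div d))"

lemma reduce_power_add: "reduce_power v d g (p + q) = reduce_power v d g p + reduce_power v d g q"
  by (simp add: reduce_power_def lin_ext_add is_ring_hom_Cst)

lemma reduce_power_diff: "reduce_power v d g (p - q) = reduce_power v d g p - reduce_power v d g q"
  by (simp add: reduce_power_def lin_ext_diff is_ring_hom_Cst)

lemma reduce_power_0: "reduce_power v d g 0 = 0"
  by (simp add: reduce_power_def lin_ext_0)

lemma reduce_power_single: "reduce_power v d g (Poly_Mapping.single m c) = Cst c *
    (mon (m - Poly_Mapping.single v (d * (Poly_Mapping.lookup m v div d))) *
      g ^ (Poly_Mapping.lookup m v div d))"
  by (simp add: reduce_power_def lin_ext_single is_ring_hom_Cst)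

lemma reduce_power_mult_free:
  assumes "q \<in> vars_in V" "v \<notin> V"
  shows "reduce_power v d g (q * p) = q * reduce_power v d g p"
proof -
  have *: "reduce_power v d g (Poly_Mapping.single k b * Poly_Mapping.single m c) =
      Poly_Mapping.single k b * reduce_power v d g (Poly_Mapping.single m c)"
    if "Poly_Mapping.lookup k v = 0" for k m b c
  proof -
    have "(k + m) - Poly_Mapping.single v (d * (Poly_Mapping.lookup m v div d)) =
        k + (m - Poly_Mapping.single v (d * (Poly_Mapping.lookup m v div d)))"
      using that by (intro poly_mapping_eqI) (auto simp: lookup_add lookup_minus lookup_single when_def)
    then show ?thesis
      using that by (simp add: mult_single reduce_power_single lookup_add mult.assoc[symmetric])
  qed
  have single: "reduce_power v d g (Poly_Mapping.single k b * p) =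
    Poly_Mapping.single k b * reduce_power v d g p"
    if "Poly_Mapping.lookup k v = 0" for k b
    by (induction p rule: mpoly_induct) (use that in \<open>simp_all add: * distrib_left reduce_power_add\<close>)
  have "q = (\<Sum>k\<in>Poly_Mapping.keys q. Poly_Mapping.single k (Poly_Mapping.lookup q k))"
    by (intro poly_mapping_eqI) (simp add: lookup_sum lookup_single when_def in_keys_iff)
  then obtain c where q: "q = (\<Sum>k\<in>Poly_Mapping.keys q. Poly_Mapping.single k (c k))" by blast
  have "reduce_power v d g ((\<Sum>k\<in>A. Poly_Mapping.single k (c k)) * p) =
    (\<Sum>k\<in>A. Poly_Mapping.single k (c k)) * reduce_power v d g p"
    if "A \<subseteq> Poly_Mapping.keys q" for A
    using finite_subset[OF that finite_keys] that
  proof (induction A rule: finite_induct)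
    case (insert k A)
    have "v \<notin> Poly_Mapping.keys k" using insert.prems assms by (auto simp: vars_in_def)
    then have "Poly_Mapping.lookup k v = 0" by (simp add: in_keys_iff)
    then show ?case using insert by (simp add: distrib_right reduce_power_add single)
  qed (simp add: reduce_power_0)
  from this[OF subset_refl] show ?thesis using q by simp
qed

lemma mvar_power: "mvar v ^ d = mon (Poly_Mapping.single v d)"
  by (rule monom_value_single[of mvar v d, unfolded monom_value_mvar, symmetric])

lemma reduce_power_mult_power:
  assumes "d \<ge> 1"
  shows "reduce_power v d g (mvar v ^ d * p) = g * reduce_power v d g p"
proof (induction p rule: mpoly_induct)
  case (single m c)
  let ?q = "Poly_Mapping.lookup m v div d"
  have q: "Poly_Mapping.lookup (Poly_Mapping.single v d + m) v div d = Suc ?q"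
    using assms by (simp add: lookup_add)
  have *: "(Poly_Mapping.single v d + m) - Poly_Mapping.single v (d * Suc ?q) =
      m - Poly_Mapping.single v (d * ?q)"
    by (intro poly_mapping_eqI) (auto simp: lookup_add lookup_minus lookup_single when_def)
  have "mvar v ^ d * Poly_Mapping.single m c = Poly_Mapping.single (Poly_Mapping.single v d + m) c"
    by (simp add: mvar_power mult_single)
  then have "reduce_power v d g (mvar v ^ d * Poly_Mapping.single m c) =
      Cst c * (mon (m - Poly_Mapping.single v (d * ?q)) * g ^ Suc ?q)"
    by (simp only: reduce_power_single q *)
  then show ?case by (simp only: reduce_power_single power_Suc mult_ac)
qed (simp add: distrib_left reduce_power_add)

lemma reduce_power_mult_zero:
  assumes "d \<ge> 1" "g \<in> vars_in V" "v \<notin> V"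
  shows "reduce_power v d g ((mvar v ^ d - g) * p) = 0"
  using assms by (simp add: left_diff_distrib reduce_power_diff reduce_power_mult_power
    reduce_power_mult_free)

lemma power_diff_idl: "x ^ n - y ^ n \<in> idl {x - y}"
proof (induction n)
  case (Suc n)
  have "x * (x ^ n - y ^ n) + y ^ n * (x - y) \<in> idl {x - y}"
    by (intro idl.span_add idl.span_scale Suc idl.span_base) simp
  then show ?case by (simp add: algebra_simps)
qed (simp add: idl.span_zero)

lemma reduce_power_cong: "p - reduce_power v d g p \<in> idl {mvar v ^ d - g}"
proof (induction p rule: mpoly_induct)
  case (single m c)
  let ?q = "Poly_Mapping.lookup m v div d"
  let ?m = "m - Poly_Mapping.single v (d * ?q)"
  have "?m + Poly_Mapping.single v (d * ?q) = m"
    by (intro poly_mapping_eqI)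
      (auto simp: lookup_add lookup_minus lookup_single when_def intro: le_add_diff_inverse2)
  moreover have "(mvar v ^ d) ^ ?q = (mon (Poly_Mapping.single v (d * ?q)) :: 'a mpoly)"
    by (simp only: mvar_power[symmetric] power_mult)
  ultimately have "Poly_Mapping.single m c = Poly_Mapping.single ?m c * (mvar v ^ d) ^ ?q"
    by (simp add: mult_single)
  moreover have "reduce_power v d g (Poly_Mapping.single m c) = Poly_Mapping.single ?m c * g ^ ?q"
    by (simp add: reduce_power_single mult.assoc[symmetric] mult_single)
  ultimately have "Poly_Mapping.single m c - reduce_power v d g (Poly_Mapping.single m c) =
      Poly_Mapping.single ?m c * ((mvar v ^ d) ^ ?q - g ^ ?q)"
    by (simp add: right_diff_distrib)
  then show ?case by (simp add: idl.span_scale power_diff_idl)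
next
  case (add p q)
  then show ?case using idl.span_add[OF add] by (simp add: reduce_power_add algebra_simps)
qed

primrec reduce_powers :: "(nat \<Rightarrow> nat) \<Rightarrow> (nat \<Rightarrow> nat) \<Rightarrow> (nat \<Rightarrow> 'a::comm_ring_1 mpoly) \<Rightarrow> nat \<Rightarrow> 'a mpoly
  \<Rightarrow> 'a mpoly" where
  "reduce_powers v d g 0 p = p"
| "reduce_powers v d g (Suc j) p = reduce_power (v j) (d j) (g j) (reduce_powers v d g j p)"

text \<open>Successive remainders modulo the first \<open>i\<close> elements give a map that kills
  their ideal, changes its argument only by elements of that ideal and commutes with multiplication
  by the element of index \<open>i\<close>. If the product of \<open>p\<close> with that element is
  in the ideal, then the product with the remainder of \<open>p\<close> is 0, and in a domain the
  remainder vanishes.\<close>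

lemma regular_seq_powers:
  fixes g :: "nat \<Rightarrow> 'a::field mpoly"
  assumes v: "inj_on v {..<r}" "\<And>i. i < r \<Longrightarrow> v i \<notin> V" and d: "\<And>i. i < r \<Longrightarrow> d i \<ge> 1"
    and g: "\<And>i. i < r \<Longrightarrow> g i \<in> vars_in V"
  shows "regular_seq r (\<lambda>i. mvar (v i) ^ d i - g i)"
  unfolding regular_seq_idl
proof (intro allI impI)
  fix i and p :: "'a mpoly"
  let ?f = "\<lambda>i. mvar (v i) ^ d i - g i"
  assume i: "i < r" and p: "p * ?f i \<in> idl (?f ` {..<i})"
  have fv: "?f l \<in> vars_in (insert (v l) V)" if "l < r" for l
    using g[OF that] vars_in_mono[of V "insert (v l) V"] vars_in_mvar[of "v l" "insert (v l) V"]
    by (intro subring_setD(3)[OF subring_set_vars_in] subring_set_power[OF subring_set_vars_in]) auto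
  have add: "reduce_powers v d g j (x + y) = reduce_powers v d g j x +
    reduce_powers v d g j y" for j x y
    by (induction j) (simp_all add: reduce_power_add)
  have N0: "reduce_powers v d g j 0 = 0" for j by (induction j) (simp_all add: reduce_power_0)
  \<comment> \<open>The rewritten variables are distinct and lie outside \<open>V\<close>, so
    \<open>?f l\<close> contains none of those rewritten before step \<open>l\<close>.\<close>
  have mult: "reduce_powers v d g j (?f l * x) = ?f l * reduce_powers v d g j x" if "j \<le>
    l" "l < r" for j l x
    using that
  proof (induction j)
    case (Suc j)
    have "v j \<notin> insert (v l) V" using v(2) inj_onD[OF v(1), of j l] Suc.prems by auto
    then show ?case using Suc reduce_power_mult_free[OF fv[OF Suc.prems(2)]] by simp
  qed simp
  have zero: "reduce_powers v d g j (?f l * x) = 0" if "l < j" "j \<le> r" for j l x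
    using that
  proof (induction j)
    case (Suc j)
    show ?case
    proof (cases "l = j")
      case True
      then show ?thesis using mult[of j j x] reduce_power_mult_zero[OF d g v(2)] Suc.prems by simp
    next
      case False
      then show ?thesis using Suc by (simp add: reduce_power_0)
    qed
  qed simp
  have cong: "x - reduce_powers v d g j x \<in> idl (?f ` {..<j})" for j x
  proof (induction j)
    case (Suc j)
    let ?y = "reduce_powers v d g j x"
    have "idl {?f j} \<subseteq> idl (?f ` {..<Suc j})" "idl (?f ` {..<j}) \<subseteq> idl (?f ` {..<Suc j})"
      by (intro idl.span_mono; auto)+
    then have "(x - ?y) + (?y - reduce_powers v d g (Suc j) x) \<in> idl (?f ` {..<Suc j})"
      using Suc reduce_power_cong[of ?y "v j" "d j" "g j"] by (intro idl.span_add) auto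
    then show ?case by simp
  qed (simp add: idl.span_zero)
  have kill: "reduce_powers v d g i y = 0" if "y \<in> idl (?f ` {..<i})" for y
    using that
  proof (induction rule: idl.span_induct_alt)
    case (step c x y)
    then obtain l where "l < i" "x = ?f l" by blast
    then show ?case using step zero[of l i c] i by (simp add: add mult.commute)
  qed (simp add: N0)
  have "?f i * reduce_powers v d g i p = 0"
    using kill[OF p] mult[OF le_refl i, of p] by (simp add: mult.commute)
  moreover have "?f i \<noteq> 0"
  proof
    assume "?f i = 0"
    then have "Poly_Mapping.lookup (mon (Poly_Mapping.single (v i) (d i)) :: 'a mpoly)
      (Poly_Mapping.single (v i) (d i)) =
        Poly_Mapping.lookup (g i) (Poly_Mapping.single (v i) (d i))"
      by (simp add: mvar_power)
    then have "Poly_Mapping.single (v i) (d i) \<in> Poly_Mapping.keys (g i)" by (simp add: in_keys_iff)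
    then have "Poly_Mapping.keys (Poly_Mapping.single (v i) (d i)) \<subseteq> V"
      using g[OF i] unfolding vars_in_def by blast
    then show False using v(2)[OF i] d[OF i] by simp
  qed
  ultimately have "reduce_powers v d g i p = 0" by simp
  then show "p \<in> idl (?f ` {..<i})" using cong[of p i] by simp
qed

lemma idl_genideal_Un:
  fixes f :: "nat \<Rightarrow> 'a::comm_ring_1 mpoly" and i :: nat
  assumes I: "ideal_in (vars_in {..<n}) I" and f: "\<And>l. l < i \<Longrightarrow> f l \<in> vars_in {..<n}"
    and p: "p \<in> genideal (mpoly_ring n) (I \<union> f ` {..<i})"
  shows "\<exists>t\<in>I. \<exists>c. (\<forall>l<i. c l \<in> vars_in {..<n}) \<and> p = t + (\<Sum>l<i. c l * f l)"
proof -
  interpret cring "mpoly_ring n :: 'a mpoly ring" by (rule cring_mpoly_ring)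
  let ?C = "vars_in {..<n} :: 'a mpoly set"
  note C = subring_setD[OF subring_set_vars_in]
  define S where "S = {t + s | t s. t \<in> I \<and> s \<in> span_in ?C f i}"
  have span_in: "ideal_in ?C (span_in ?C f i)" using ideal_in_span_in[OF subring_set_vars_in] f by blast
  have "ideal_in ?C S"
    unfolding ideal_in_def
  proof (intro conjI ballI)
    show "S \<subseteq> ?C" using ideal_inD(1)[OF I] ideal_inD(1)[OF span_in] by (auto simp: S_def intro!: C(6))
    show "0 \<in> S" using ideal_inD(2)[OF I] ideal_inD(2)[OF span_in] by (force simp: S_def)
    fix x y assume y: "y \<in> S"
    then obtain t s where ts: "y = t + s" "t \<in> I" "s \<in> span_in ?C f i" by (auto simp: S_def)
    show "x + y \<in> S" if x: "x \<in> S"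
    proof -
      obtain t' s' where ts': "x = t' + s'" "t' \<in> I" "s' \<in> span_in ?C f i" using x by (auto simp: S_def)
      have "x + y = (t' + t) + (s' + s)" using ts ts' by simp
      then show ?thesis using ideal_inD(3)[OF I ts'(2) ts(2)] ideal_inD(3)[OF span_in ts'(3) ts(3)]
        unfolding S_def by blast
    qed
    show "x * y \<in> S" if x: "x \<in> ?C"
    proof -
      have "x * y = x * t + x * s" using ts by (simp add: distrib_left)
      then show ?thesis using ideal_inD(4)[OF I x ts(2)] ideal_inD(4)[OF span_in x ts(3)] unfolding
        S_def by blast
    qed
  qed
  then have "ideal S (mpoly_ring n)" by (simp add: ideal_mpoly_iff)
  moreover have "I \<subseteq> S"
  proof
    fix t assume "t \<in> I"
    then show "t \<in> S" using ideal_inD(2)[OF span_in] unfolding S_def by force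
  qed
  moreover have "f ` {..<i} \<subseteq> S"
  proof
    fix y assume "y \<in> f ` {..<i}"
    then have "y \<in> span_in ?C f i" using span_in_gen[OF subring_set_vars_in] by blast
    then show "y \<in> S" using ideal_inD(2)[OF I] unfolding S_def by force
  qed
  ultimately have "p \<in> S" using genideal_minimal[of S "I \<union> f ` {..<i}"] p by blast
  then obtain t s where "p = t + s" "t \<in> I" "s \<in> span_in ?C f i" by (auto simp: S_def)
  moreover from this(3) obtain c where "s = (\<Sum>l<i. c l * f l)" "\<forall>l<i. c l \<in> ?C" by (rule span_inE)
  ultimately show ?thesis by blast
qed

text \<open>If \<open>R = I \<oplus> N\<close> with \<open>f\<^sub>l N \<subseteq> N\<close>, then relations modulo \<open>I\<close> lift to relations in \<open>R\<close>.\<close>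

lemma regular_mod_ideal:
  fixes N :: "'a::field mpoly set"
  assumes I: "ideal_in (vars_in {..<n}) I" and f: "\<And>l. l < r \<Longrightarrow> f l \<in> vars_in {..<n}" "regular_seq r f"
    and N: "N \<subseteq> vars_in {..<n}" "0 \<in> N" "\<And>x y. x \<in> N \<Longrightarrow> y \<in> N \<Longrightarrow> x - y \<in> N"
      "\<And>l x. l < r \<Longrightarrow> x \<in> N \<Longrightarrow> x * f l \<in> N" "N \<inter> I \<subseteq> {0}"
    and rep: "\<And>p. p \<in> vars_in {..<n} \<Longrightarrow> \<exists>q\<in>N. p - q \<in> I"
    and i: "i < r" and p: "p \<in> vars_in {..<n}"
      "p * f i \<in> genideal (mpoly_ring n) (I \<union> f ` {..<i})"
  shows "p \<in> genideal (mpoly_ring n) (I \<union> f ` {..<i})"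
proof -
  let ?C = "vars_in {..<n} :: 'a mpoly set"
  have IC: "I \<subseteq> ?C" by (rule ideal_inD(1)[OF I])
  have f': "f l \<in> ?C" if "l < i" for l using f(1) that i by simp
  obtain t c where tc: "t \<in> I" "\<And>l. l < i \<Longrightarrow> c l \<in> ?C" "p * f i = t + (\<Sum>l<i. c l * f l)"
    using idl_genideal_Un[OF I f' p(2)] by blast
  obtain q where q: "q \<in> N" "p - q \<in> I" using rep[OF p(1)] by blast
  have "\<forall>l. \<exists>e. l < i \<longrightarrow> e \<in> N \<and> c l - e \<in> I" using rep tc(2) by blast
  then obtain e where e: "\<And>l. l < i \<Longrightarrow> e l \<in> N" "\<And>l. l < i \<Longrightarrow> c l - e l \<in> I" by metis
  have sum: "sum h A \<in> N" if "\<And>l. l \<in> A \<Longrightarrow> h l \<in> N" for h :: "nat \<Rightarrow> 'a mpoly" and A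
    using that
  proof (induction A rule: infinite_finite_induct)
    case (insert a A)
    have "0 - h a \<in> N" using N(2,3) insert by blast
    then have "sum h A - (0 - h a) \<in> N" using N(3) insert by blast
    then show ?case using insert by (simp add: add.commute)
  qed (use N(2) in auto)
  \<comment> \<open>Replacing all coefficients by representatives in \<open>N\<close> turns the
    relation modulo \<open>I\<close> into an element of both \<open>N\<close> and \<open>I\<close>,
    which is 0.\<close>
  have "q * f i - (\<Sum>l<i. e l * f l) \<in> N" using q e i by (intro N(3,4) sum) auto
  moreover have "q * f i - (\<Sum>l<i. e l * f l) = (t + (\<Sum>l<i. (c l - e l) * f l)) - (p - q) * f i"
    using tc(3) by (simp add: left_diff_distrib sum_subtractf)
  moreover have "(\<Sum>l<i. (c l - e l) * f l) \<in> I"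
    by (rule ideal_in_sum[OF I]) (use ideal_inD(5)[OF I f'] e(2) in auto)
  from ideal_in_diff[OF subring_set_vars_in I ideal_inD(3)[OF I tc(1) this] ideal_inD(5)[OF I
    f(1)[OF i] q(2)]]
  have "(t + (\<Sum>l<i. (c l - e l) * f l)) - (p - q) * f i \<in> I" .
  ultimately have "q * f i = (\<Sum>l<i. e l * f l)" using N(5) by auto
  then have "q * f i \<in> idl (f ` {..<i})" unfolding idl_lessThan by blast
  then have "q \<in> idl (f ` {..<i})" using f(2) i unfolding regular_seq_idl by blast
  then have "q \<in> idl (I \<union> f ` {..<i})" using idl.span_mono[of "f ` {..<i}" "I \<union> f ` {..<i}"] by auto
  moreover have "p - q \<in> idl (I \<union> f ` {..<i})" using q(2) by (intro idl.span_base) simp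
  ultimately have "p \<in> idl (I \<union> f ` {..<i})" using idl.span_add by force
  moreover have "I \<union> f ` {..<i} \<subseteq> ?C" using IC f' by auto
  ultimately show ?thesis using p(1) by (simp add: genideal_mpoly)
qed

section \<open>Quotient rings\<close>

lemma FactRing_zero: "\<zero>\<^bsub>R Quot I\<^esub> = I"
  by (simp add: FactRing_def)

lemma FactRing_one: "\<one>\<^bsub>R Quot I\<^esub> = I +>\<^bsub>R\<^esub> \<one>\<^bsub>R\<^esub>"
  by (simp add: FactRing_def)

lemma carrier_FactRingE:
  assumes "r \<in> carrier (R Quot I)"
  obtains s where "s \<in> carrier R" "r = I +>\<^bsub>R\<^esub> s"
  using assms by (auto simp: FactRing_def A_RCOSETS_def')

lemma (in cring) mem_genideal_quot:
  assumes I: "ideal I R" and X: "X \<subseteq> carrier R" and r: "r \<in> carrier R"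
  shows "I +> r \<in> genideal (R Quot I) ((+>) I ` X) \<longleftrightarrow> r \<in> genideal R (I \<union> X)"
proof -
  interpret I: ideal I R by fact
  interpret Q: cring "R Quot I" using ideal.quotient_is_cring[OF I is_cring] .
  interpret h: ring_hom_ring R "R Quot I" "(+>) I" using I.rcos_ring_hom_ring .
  let ?G = "genideal R (I \<union> X)" and ?H = "genideal (R Quot I) ((+>) I ` X)"
  have IX: "I \<union> X \<subseteq> carrier R" using X I.a_subset by auto
  have hX: "(+>) I ` X \<subseteq> carrier (R Quot I)" using X h.hom_closed by auto
  have G: "ideal ?G R" "I \<union> X \<subseteq> ?G" using genideal_ideal[OF IX] genideal_self[OF IX] by auto
  have H: "ideal ?H (R Quot I)" "(+>) I ` X \<subseteq> ?H"
    using Q.genideal_ideal[OF hX] Q.genideal_self[OF hX] by auto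
  show ?thesis
  proof
    have "ideal ((+>) I ` ?G) (R Quot I)"
      using ring_ideal_imp_quot_ideal[OF I G(1)] G(2) by auto
    then have "?H \<subseteq> (+>) I ` ?G" using G(2) by (intro Q.genideal_minimal) auto
    moreover assume "I +> r \<in> ?H"
    ultimately obtain s where s: "s \<in> ?G" "I +> r = I +> s" by auto
    interpret G: ideal ?G R by fact
    have "r \<in> I +> r" using r I.a_rcos_self by simp
    then have "r \<in> I +> s" using s by simp
    then obtain t where "t \<in> I" "r = t \<oplus> s" unfolding a_r_coset_def' by blast
    then show "r \<in> ?G" using s(1) G(2) G.a_closed by blast
  next
    assume "r \<in> ?G"
    have K: "ideal {r \<in> carrier R. I +> r \<in> ?H} R" using h.ideal_vimage[OF H(1)] .
    have "I +> t \<in> ?H" if "t \<in> I" for t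
    proof -
      have "I +> t = \<zero>\<^bsub>R Quot I\<^esub>" unfolding FactRing_zero by (rule I.a_rcos_const[OF that])
      then show ?thesis using H(1) by (simp add: additive_subgroup.zero_closed ideal.axioms(1))
    qed
    then have "?G \<subseteq> {r \<in> carrier R. I +> r \<in> ?H}"
      using H(2) IX by (intro genideal_minimal K) auto
    then show "I +> r \<in> ?H" using \<open>r \<in> ?G\<close> by auto
  qed
qed

lemma (in cring) regular_sequence_quot:
  assumes I: "ideal I R" and xs: "set xs \<subseteq> carrier R"
    and reg: "\<And>i r. i < length xs \<Longrightarrow> r \<in> carrier R \<Longrightarrow> r \<otimes> xs ! i \<in> genideal R (I \<union> set (take i xs)) \<Longrightarrow>
      r \<in> genideal R (I \<union> set (take i xs))"
    and proper: "\<one> \<notin> genideal R (I \<union> set xs)"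
  shows "regular_sequence (R Quot I) (map ((+>) I) xs)"
  unfolding regular_sequence_def
proof (intro conjI allI impI ballI)
  interpret I: ideal I R by fact
  interpret h: ring_hom_ring R "R Quot I" "(+>) I" using I.rcos_ring_hom_ring .
  show "set (map ((+>) I) xs) \<subseteq> carrier (R Quot I)" using xs h.hom_closed by auto
  show "genideal (R Quot I) (set (map ((+>) I) xs)) \<noteq> carrier (R Quot I)"
    using proper mem_genideal_quot[OF I xs one_closed] h.hom_closed[OF one_closed]
    by (metis list.set_map)
  fix i r assume i: "i < length (map ((+>) I) xs)" and r: "r \<in> carrier (R Quot I)"
  assume *: "r \<otimes>\<^bsub>R Quot I\<^esub> map ((+>) I) xs ! i \<in> genideal (R Quot I) (set (take i (map ((+>) I) xs)))"
  obtain s where s: "s \<in> carrier R" "r = I +> s" using r by (rule carrier_FactRingE)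
  have xi: "xs ! i \<in> carrier R" using xs i by auto
  have ti: "set (take i xs) \<subseteq> carrier R" using xs set_take_subset by fast
  have "I +> (s \<otimes> xs ! i) \<in> genideal (R Quot I) ((+>) I ` set (take i xs))"
    using * i s xi h.hom_mult[OF s(1) xi] by (simp add: take_map)
  then have "s \<in> genideal R (I \<union> set (take i xs))"
    using mem_genideal_quot[OF I ti, of "s \<otimes> xs ! i"] s xi i reg by simp
  then show "r \<in> genideal (R Quot I) (set (take i (map ((+>) I) xs)))"
    using mem_genideal_quot[OF I ti s(1)] s by (simp add: take_map)
qed

lemma (in cring) maximalideal_inverse:
  assumes P: "maximalideal P R" and a: "a \<in> carrier R" "a \<notin> P"
  shows "\<exists>p\<in>P. \<exists>b\<in>carrier R. \<one> = p \<oplus> b \<otimes> a"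
proof -
  interpret P: maximalideal P R by fact
  let ?X = "set_add R P (PIdl a)"
  have X: "ideal ?X R" using add_ideals P.ideal_axioms cgenideal_ideal[OF a(1)] by blast
  have "P \<subseteq> ?X"
  proof
    fix k assume k: "k \<in> P"
    have "\<zero> \<in> PIdl a" using additive_subgroup.zero_closed cgenideal_ideal[OF a(1)] ideal.axioms(1)
      by blast
    moreover have "k = k \<oplus> \<zero>" using k P.a_subset by auto
    ultimately show "k \<in> ?X" using k unfolding set_add_def' by blast
  qed
  moreover have "a \<in> ?X"
  proof -
    have "a = \<zero> \<oplus> a" using a by simp
    then show ?thesis using P.zero_closed cgenideal_self[OF a(1)] unfolding set_add_def' by blast
  qed
  moreover have "?X \<subseteq> carrier R" using X additive_subgroup.a_subset ideal.axioms(1) by blast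
  ultimately have "?X = carrier R" using P.I_maximal[OF X] a(2) by blast
  then have "\<one> \<in> ?X" by simp
  then show ?thesis unfolding set_add_def' cgenideal_def by blast
qed

lemma prime_in_iff: "prime_in (vars_in {..<n}) P \<longleftrightarrow> primeideal P (mpoly_ring n)"
  for P :: "'a::comm_ring_1 mpoly set"
proof -
  interpret cring "mpoly_ring n :: 'a mpoly ring" by (rule cring_mpoly_ring)
  have "vars_in {..<n} \<noteq> P \<longleftrightarrow> 1 \<notin> P" if "ideal_in (vars_in {..<n}) P"
    using ideal_inD(1)[OF that] ideal_inD(5)[OF that, of _ 1] subring_setD(1)[OF
      subring_set_vars_in, of "{..<n}"] by auto
  then show ?thesis
    unfolding prime_in_def primeideal_def primeideal_axioms_def ideal_mpoly_iff
    using is_cring by (auto simp: carrier_mpoly_ring mpoly_ring_ops)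
qed

section \<open>Maximal ideals over an algebraically closed field\<close>

lemma G_ideal_vars_in_contract:
  assumes "finite W" "G_ideal (vars_in (W \<union> V)) P"
  shows "G_ideal (vars_in V) (P \<inter> vars_in V :: 'a::comm_ring_1 mpoly set)"
  using assms
proof (induction W arbitrary: P rule: finite_induct)
  case empty
  then have "P \<subseteq> vars_in V" by (auto simp: G_ideal_def ideal_in_def)
  then have "P \<inter> vars_in V = P" by blast
  then show ?case using empty by simp
next
  case (insert w W)
  have "G_ideal (adjoin (vars_in (W \<union> V)) (mvar w)) P"
    using insert.prems by (simp add: vars_in_insert[symmetric])
  then have "G_ideal (vars_in (W \<union> V)) (P \<inter> vars_in (W \<union> V))" by (rule G_ideal_contract[OF
    subring_set_vars_in])
  from insert.IH[OF this] have "G_ideal (vars_in V) (P \<inter> vars_in (W \<union> V) \<inter> vars_in V)" .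
  moreover have "P \<inter> vars_in (W \<union> V) \<inter> vars_in V = P \<inter> vars_in V"
    using vars_in_mono[of V "W \<union> V"] by blast
  ultimately show ?case by simp
qed

text \<open>A nonzero prime of \<open>K[X]\<close> contains a linear polynomial because
  \<open>K\<close> is algebraically closed. It remains to exclude the zero ideal, that is, to see
  that inverting one element does not make \<open>K[X]\<close> a field.\<close>

lemma G_ideal_univariate:
  fixes P :: "'a::alg_closed_field mpoly set"
  assumes G: "G_ideal (vars_in {j}) P"
  shows "\<exists>\<alpha>. mvar j - Cst \<alpha> \<in> P"
proof -
  define \<psi> :: "'a mpoly \<Rightarrow> 'a poly" where "\<psi> = eval_hom (\<lambda>c. [:c:]) (\<lambda>_. [:0, 1:])"
  define \<phi> :: "'a poly \<Rightarrow> 'a mpoly" where "\<phi> q = poly (map_poly Cst q) (mvar j)" for q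
  have hc: "is_ring_hom (\<lambda>c::'a. [:c:])" by (auto simp: is_ring_hom_def one_pCons)
  have \<psi>: "is_ring_hom \<psi>" unfolding \<psi>_def by (rule is_ring_hom_eval_hom[OF hc])
  have C: "Cst 0 = (0 :: 'a mpoly)" by simp
  have \<phi>: "is_ring_hom \<phi>"
    unfolding is_ring_hom_def
  proof (intro conjI allI)
    show "\<phi> 1 = 1" by (simp add: \<phi>_def map_poly_1')
    fix p q :: "'a poly"
    have "map_poly Cst (p + q) = map_poly Cst p + map_poly Cst q"
      by (rule poly_eqI) (simp add: coeff_map_poly single_add)
    then show "\<phi> (p + q) = \<phi> p + \<phi> q" by (simp add: \<phi>_def)
    have "map_poly Cst (p * q) = map_poly Cst p * map_poly Cst q"
      by (rule poly_eqI) (simp add: coeff_map_poly coeff_mult is_ring_homD[OF is_ring_hom_Cst])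
    then show "\<phi> (p * q) = \<phi> p * \<phi> q" by (simp add: \<phi>_def)
  qed
  have \<phi>X: "\<phi> [:0, 1:] = mvar j" by (simp add: \<phi>_def map_poly_pCons)
  have \<phi>C: "\<phi> [:c:] = Cst c" for c by (simp add: \<phi>_def map_poly_pCons)
  have \<phi>\<psi>: "\<phi> (\<psi> p) = p" if "p \<in> vars_in {j}" for p
  proof -
    have "\<phi> (\<psi> p) = eval_hom Cst (\<lambda>_. mvar j) p"
      unfolding \<psi>_def by (subst eval_hom_comp[OF \<phi> hc]) (simp add: \<phi>X \<phi>C)
    also have "\<dots> = eval_hom Cst mvar p" using that by (rule eval_hom_cong) simp
    finally show ?thesis by (simp add: eval_hom_mvar_id)
  qed
  have \<psi>\<phi>: "\<psi> (\<phi> q) = q" for q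
  proof (induction q)
    case (pCons a q)
    have "pCons a q = [:a:] + [:0, 1:] * q" by simp
    then have "\<psi> (\<phi> (pCons a q)) = \<psi> (\<phi> [:a:]) + \<psi> (\<phi> [:0, 1:]) * \<psi> (\<phi> q)"
      by (simp only: is_ring_homD[OF \<phi>] is_ring_homD[OF \<psi>])
    then show ?case using pCons
      by (simp add: \<phi>X \<phi>C) (simp add: \<psi>_def eval_hom_mvar[OF hc] eval_hom_Cst[OF hc])
  qed (simp add: is_ring_homD[OF \<phi>] is_ring_homD[OF \<psi>])
  have \<phi>in: "\<phi> q \<in> vars_in {j}" for q
  proof (induction q)
    case (pCons a q)
    have "pCons a q = [:a:] + [:0, 1:] * q" by simp
    then have "\<phi> (pCons a q) = Cst a + mvar j * \<phi> q" by (simp only: is_ring_homD[OF \<phi>] \<phi>X \<phi>C)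
    then show ?case using pCons vars_in_mvar[of j "{j}"] by (auto intro!: subring_setD(4,6)[OF
      subring_set_vars_in] vars_in_Cst)
  qed (simp add: is_ring_homD[OF \<phi>] subring_setD[OF subring_set_vars_in])
  have P: "ideal_in (vars_in {j}) P" "1 \<notin> P"
    and prime: "\<And>x y. x \<in> vars_in {j} \<Longrightarrow> y \<in> vars_in {j} \<Longrightarrow> x * y \<in> P \<Longrightarrow> x \<in> P \<or> y \<in> P"
    using G by (auto simp: G_ideal_def)
  obtain g where g: "g \<in> vars_in {j}" "g \<notin> P"
    "\<And>u. u \<in> vars_in {j} \<Longrightarrow> u \<notin> P \<Longrightarrow> \<exists>v\<in>vars_in {j}. \<exists>N. u * v - g ^ N \<in> P"
    using G unfolding G_ideal_def by blast
  have "\<exists>q. q \<noteq> 0 \<and> \<phi> q \<in> P"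
  proof (rule ccontr)
    assume no: "\<not> ?thesis"
    have P0: "p = 0" if "p \<in> P" for p
    proof -
      have "\<phi> (\<psi> p) = p" using that ideal_inD(1)[OF P(1)] by (intro \<phi>\<psi>) auto
      then have "\<psi> p = 0" using no that by metis
      then show ?thesis using \<open>\<phi> (\<psi> p) = p\<close> by (simp add: is_ring_homD[OF \<phi>])
    qed
    \<comment> \<open>A variant of Euclid's argument: a root of \<open>1 + X g\<close> is no root of
      \<open>g\<close>, so this polynomial divides no power of \<open>g\<close>.\<close>
    define u where "u = 1 + [:0, 1:] * \<psi> g"
    have g0: "\<psi> g \<noteq> 0"
      using \<phi>\<psi>[OF g(1)] g(2) ideal_inD(2)[OF P(1)] by (auto simp: is_ring_homD[OF \<phi>])
    have u0: "poly u 0 = 1" by (simp add: u_def)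
    have "u \<noteq> 0" using u0 by auto
    then have "\<phi> u \<notin> P" using no by blast
    then obtain v N where v: "\<phi> u * v - g ^ N \<in> P" using g(3)[OF \<phi>in] by blast
    have "\<psi> (\<phi> u * v - g ^ N) = 0" using P0[OF v] by (simp add: is_ring_homD[OF \<psi>])
    then have uv: "u * \<psi> v = \<psi> g ^ N" by (simp add: is_ring_homD[OF \<psi>] \<psi>\<phi>)
    have "degree ([:0, 1:] * \<psi> g) = Suc (degree (\<psi> g))" using g0 by (simp add: degree_mult_eq)
    then have "degree u = Suc (degree (\<psi> g))" unfolding u_def by (subst degree_add_eq_right) auto
    then obtain \<alpha> where \<alpha>: "poly u \<alpha> = 0" using alg_closed_imp_poly_has_root[of u] by auto
    then have "poly (\<psi> g) \<alpha> \<noteq> 0" by (auto simp: u_def)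
    moreover have "poly (\<psi> g ^ N) \<alpha> = 0" using \<alpha> unfolding uv[symmetric] by simp
    ultimately show False by simp
  qed
  then obtain q0 where q0: "q0 \<noteq> 0 \<and> \<phi> q0 \<in> P" by blast
  define q where "q = arg_min degree (\<lambda>q. q \<noteq> 0 \<and> \<phi> q \<in> P)"
  have q: "q \<noteq> 0" "\<phi> q \<in> P" "\<And>p. p \<noteq> 0 \<Longrightarrow> \<phi> p \<in> P \<Longrightarrow> degree q \<le> degree p"
    using arg_min_natI[of "\<lambda>q. q \<noteq> 0 \<and> \<phi> q \<in> P", OF q0] arg_min_nat_le[of "\<lambda>q. q \<noteq> 0 \<and> \<phi> q \<in> P"]
    unfolding q_def by blast+
  have "degree q > 0"
  proof (rule ccontr)
    assume "\<not> ?thesis"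
    then obtain c where c: "q = [:c:]" by (metis degree_eq_zeroE gr0I)
    then have "Cst (inverse c) * Cst c \<in> P" using q(2) ideal_inD(4)[OF P(1) vars_in_Cst] \<phi>C by metis
    then show False using P(2) q(1) c by (simp add: mult_single)
  qed
  then obtain \<alpha> where "poly q \<alpha> = 0" using alg_closed_imp_poly_has_root[of q] by auto
  then obtain p where p: "q = [:- \<alpha>, 1:] * p" by (auto simp: poly_eq_0_iff_dvd elim: dvdE)
  have p0: "p \<noteq> 0" using p q(1) by auto
  have "degree q = degree p + 1" unfolding p using p0 by (subst degree_mult_eq) auto
  then have "\<phi> p \<notin> P" using q(3)[OF p0] by auto
  moreover have "\<phi> [:- \<alpha>, 1:] * \<phi> p \<in> P" using q(2) unfolding p by (simp only: is_ring_homD[OF \<phi>])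
  ultimately have "\<phi> [:- \<alpha>, 1:] \<in> P" using prime[OF \<phi>in \<phi>in] by blast
  moreover have "\<phi> [:- \<alpha>, 1:] = mvar j - Cst \<alpha>"
  proof -
    have "[:- \<alpha>, 1:] = [:0, 1:] - [:\<alpha>:]" by simp
    then show ?thesis by (simp only: is_ring_homD[OF \<phi>] \<phi>X \<phi>C)
  qed
  ultimately show ?thesis by auto
qed

section \<open>Cohen-Macaulay quotients\<close>

lemma noetherian_mpoly_quot:
  fixes I :: "'a::field mpoly set"
  assumes I: "ideal I (mpoly_ring n)"
  shows "noetherian_ring (mpoly_ring n Quot I)"
proof -
  interpret R: cring "mpoly_ring n :: 'a mpoly ring" by (rule cring_mpoly_ring)
  interpret I: ideal I "mpoly_ring n :: 'a mpoly ring" by fact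
  interpret h: ring_hom_ring "mpoly_ring n" "mpoly_ring n Quot I" "(+>\<^bsub>mpoly_ring n\<^esub>) I"
    using I.rcos_ring_hom_ring .
  interpret Q: cring "mpoly_ring n Quot I" using ideal.quotient_is_cring[OF I R.is_cring] .
  show ?thesis
  proof (rule ring.noetherian_ringI[OF cring.axioms(1)[OF Q.is_cring]])
    fix K assume K: "ideal K (mpoly_ring n Quot I)"
    interpret K: ideal K "mpoly_ring n Quot I" by fact
    let ?K = "{r \<in> carrier (mpoly_ring n). I +>\<^bsub>mpoly_ring n\<^esub> r \<in> K}"
    have "ideal_in (vars_in {..<n}) ?K" using h.ideal_vimage[OF K] by (simp add: ideal_mpoly_iff)
    moreover have "noetherian_in (vars_in {..<n} :: 'a mpoly set)" by (rule noetherian_in_vars_in) simp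
    ultimately obtain m f where f: "\<And>i. i < m \<Longrightarrow> f i \<in> ?K" "?K \<subseteq> span_in (vars_in {..<n}) f m"
      unfolding noetherian_in_def by blast
    let ?X = "f ` {..<m}"
    let ?A = "(+>\<^bsub>mpoly_ring n\<^esub>) I ` ?X"
    have X: "?X \<subseteq> carrier (mpoly_ring n)" using f(1) by auto
    have A: "?A \<subseteq> K" using f(1) by auto
    have AC: "?A \<subseteq> carrier (mpoly_ring n Quot I)" using A K.a_subset by blast
    have IX: "I \<union> ?X \<subseteq> carrier (mpoly_ring n)" using X I.a_subset by blast
    have G: "ideal_in (vars_in {..<n}) (genideal (mpoly_ring n) (I \<union> ?X))"
      using R.genideal_ideal[OF IX] by (simp add: ideal_mpoly_iff)
    have "f i \<in> genideal (mpoly_ring n) (I \<union> ?X)" if "i < m" for i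
      using R.genideal_self[OF IX] that by auto
    then have sub: "?K \<subseteq> genideal (mpoly_ring n) (I \<union> ?X)"
      by (rule subset_trans[OF f(2) span_in_least[OF G]])
    have "K = genideal (mpoly_ring n Quot I) ?A"
    proof
      show "genideal (mpoly_ring n Quot I) ?A \<subseteq> K" by (rule ring.genideal_minimal[OF
        cring.axioms(1)[OF Q.is_cring] K A])
      show "K \<subseteq> genideal (mpoly_ring n Quot I) ?A"
      proof
        fix x assume x: "x \<in> K"
        then have "x \<in> carrier (mpoly_ring n Quot I)" using K.a_subset by blast
        then obtain r where r: "r \<in> carrier (mpoly_ring n)" "x = I +>\<^bsub>mpoly_ring n\<^esub> r"
          by (rule carrier_FactRingE)
        then have "r \<in> genideal (mpoly_ring n) (I \<union> ?X)" using x sub by blast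
        then show "x \<in> genideal (mpoly_ring n Quot I) ?A"
          using R.mem_genideal_quot[OF I X r(1)] r(2) by blast
      qed
    qed
    then show "\<exists>A\<subseteq>carrier (mpoly_ring n Quot I). finite A \<and> K = genideal (mpoly_ring n Quot I) A"
      using AC by (intro exI[of _ ?A]) auto
  qed
qed

text \<open>The quotient is already a field, so 1 serves as the element to invert.\<close>

lemma maximal_G_ideal:
  fixes I :: "'a::comm_ring_1 mpoly set"
  assumes I: "ideal I (mpoly_ring n)" and P: "maximalideal P (mpoly_ring n Quot I)"
  shows "G_ideal (vars_in {..<n}) {r \<in> carrier (mpoly_ring n). I +>\<^bsub>mpoly_ring n\<^esub> r \<in> P}"
proof -
  interpret R: cring "mpoly_ring n :: 'a mpoly ring" by (rule cring_mpoly_ring)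
  interpret I: ideal I "mpoly_ring n :: 'a mpoly ring" by fact
  interpret h: ring_hom_ring "mpoly_ring n" "mpoly_ring n Quot I" "(+>\<^bsub>mpoly_ring n\<^esub>) I"
    using I.rcos_ring_hom_ring .
  interpret Q: cring "mpoly_ring n Quot I" using ideal.quotient_is_cring[OF I R.is_cring] .
  let ?P = "{r \<in> carrier (mpoly_ring n). I +>\<^bsub>mpoly_ring n\<^esub> r \<in> P}"
  let ?C = "vars_in {..<n} :: 'a mpoly set"
  have "primeideal ?P (mpoly_ring n)"
    using h.primeideal_vimage[OF R.is_cring Q.maximalideal_prime[OF P]] .
  then have pr: "prime_in ?C ?P" by (simp add: prime_in_iff)
  have one: "1 \<in> ?C" using subring_setD(1)[OF subring_set_vars_in] .
  have "\<exists>v\<in>?C. \<exists>N. u * v - 1 ^ N \<in> ?P" if u: "u \<in> ?C - ?P" for u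
  proof -
    have uc: "u \<in> carrier (mpoly_ring n)" using u by (simp add: carrier_mpoly_ring)
    then have "I +>\<^bsub>mpoly_ring n\<^esub> u \<in> carrier (mpoly_ring n Quot I)" "I +>\<^bsub>mpoly_ring n\<^esub> u \<notin> P"
      using u h.hom_closed by auto
    from Q.maximalideal_inverse[OF P this] obtain p b where pb: "p \<in> P" "b \<in>
      carrier (mpoly_ring n Quot I)"
      "\<one>\<^bsub>mpoly_ring n Quot I\<^esub> = p \<oplus>\<^bsub>mpoly_ring n Quot I\<^esub> b \<otimes>\<^bsub>mpoly_ring n Quot I\<^esub> (I +>\<^bsub>mpoly_ring
        n\<^esub> u)"
      by blast
    have pc: "p \<in> carrier (mpoly_ring n Quot I)"
      using pb(1) maximalideal.axioms(1)[OF P] additive_subgroup.a_subset ideal.axioms(1) by blast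
    obtain v where v: "v \<in> carrier (mpoly_ring n)" "b =
      I +>\<^bsub>mpoly_ring n\<^esub> v" using pb(2) by (rule carrier_FactRingE)
    obtain q where q: "q \<in> carrier (mpoly_ring n)" "p =
      I +>\<^bsub>mpoly_ring n\<^esub> q" using pc by (rule carrier_FactRingE)
    have vu: "v \<otimes>\<^bsub>mpoly_ring n\<^esub> u \<in> carrier (mpoly_ring n)" using v uc by simp
    have "I +>\<^bsub>mpoly_ring n\<^esub> \<one>\<^bsub>mpoly_ring n\<^esub> =
        I +>\<^bsub>mpoly_ring n\<^esub> (q \<oplus>\<^bsub>mpoly_ring n\<^esub> v \<otimes>\<^bsub>mpoly_ring n\<^esub> u)"
      unfolding h.hom_add[OF q(1) vu] h.hom_mult[OF v(1) uc] v(2)[symmetric] q(2)[symmetric]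
      by (rule trans[OF FactRing_one[symmetric] pb(3)])
    moreover have "1 \<in> I +>\<^bsub>mpoly_ring n\<^esub> \<one>\<^bsub>mpoly_ring n\<^esub>"
      using I.a_rcos_self[of "1"] one by (simp add: mpoly_ring_ops carrier_mpoly_ring)
    ultimately obtain t where t: "t \<in> I" "1 = t + (q + v * u)"
      unfolding a_r_coset_def' by (auto simp: mpoly_ring_ops)
    have "I +>\<^bsub>mpoly_ring n\<^esub> t = \<zero>\<^bsub>mpoly_ring n Quot I\<^esub>"
      unfolding FactRing_zero by (rule I.a_rcos_const[OF t(1)])
    then have tP: "t \<in> ?P"
      using t(1) I.a_subset maximalideal.axioms(1)[OF P]
      by (auto simp: additive_subgroup.zero_closed ideal.axioms(1))
    have qP: "q \<in> ?P" using q pb(1) by simp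
    have idP: "ideal_in ?C ?P" using pr by (simp add: prime_in_def)
    have "t + q \<in> ?P" by (rule ideal_inD(3)[OF idP tP qP])
    then have "0 - (t + q) \<in> ?P" using ideal_in_diff[OF subring_set_vars_in idP ideal_inD(2)[OF
      idP]] by blast
    moreover have "0 - (t + q) = u * v - 1 ^ 0" using t(2) by (simp add: algebra_simps)
    ultimately have "u * v - 1 ^ 0 \<in> ?P" by simp
    then show ?thesis using v(1) unfolding carrier_mpoly_ring by blast
  qed
  then show ?thesis
    unfolding G_ideal_def using pr one unfolding prime_in_def by blast
qed

text \<open>Stability of \<open>N\<close> under constants and variables passes to the translated
  variables, which form a regular sequence in the polynomial ring itself.\<close>

lemma regular_coordinates:
  fixes I N :: "'a::field mpoly set"
  assumes I: "ideal_in (vars_in {..<n}) I" and r: "r \<le> n"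
    and N: "N \<subseteq> vars_in {..<n}" "0 \<in> N" "\<And>x y. x \<in> N \<Longrightarrow> y \<in> N \<Longrightarrow> x - y \<in> N"
      "\<And>c x. x \<in> N \<Longrightarrow> x * Cst c \<in> N" "\<And>l x. l < r \<Longrightarrow> x \<in> N \<Longrightarrow> x * mvar l \<in> N" "N \<inter> I \<subseteq> {0}"
    and rep: "\<And>p. p \<in> vars_in {..<n} \<Longrightarrow> \<exists>q\<in>N. p - q \<in> I"
    and i: "i < r" and p: "p \<in> vars_in {..<n}"
      "p * (mvar i - Cst (\<alpha> i)) \<in> genideal (mpoly_ring n) (I \<union> (\<lambda>l. mvar l - Cst (\<alpha> l)) ` {..<i})"
  shows "p \<in> genideal (mpoly_ring n) (I \<union> (\<lambda>l. mvar l - Cst (\<alpha> l)) ` {..<i})"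
proof (rule regular_mod_ideal[OF I _ _ N(1-3) _ N(6) rep i p])
  show "mvar l - Cst (\<alpha> l) \<in> vars_in {..<n}" if "l < r" for l
    using that r by (intro subring_setD(3)[OF subring_set_vars_in] vars_in_Cst vars_in_mvar) auto
  have "regular_seq r (\<lambda>i. mvar i ^ 1 - Cst (\<alpha> i))"
    using regular_seq_powers[of "\<lambda>i. i" r "{r..}" "\<lambda>_. 1" "\<lambda>i. Cst (\<alpha> i)"] vars_in_Cst by auto
  then show "regular_seq r (\<lambda>l. mvar l - Cst (\<alpha> l))" by simp
  show "x * (mvar l - Cst (\<alpha> l)) \<in> N" if "l < r" "x \<in> N" for l x
    using N(3)[OF N(5)[OF that] N(4)[OF that(2)]] by (simp add: right_diff_distrib)
qed

text \<open>\<open>N\<close> is a complement of \<open>I\<close> that is stable under the first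
  \<open>r\<close> variables, as the span of a basis over \<open>K[x_0, ..., x_(r-1)]\<close> is; it
  makes the \<open>r\<close> translated variables through any point a regular sequence on the
  quotient, so grades are at least \<open>r\<close>. The kernel of \<open>\<psi>\<close> lies in
  \<open>I\<close>, and any \<open>r + 1\<close> elements of its target are algebraically dependent;
  this bounds heights by \<open>r\<close>.\<close>

theorem cohen_macaulay_criterion:
  fixes I N :: "'a::alg_closed_field mpoly set"
  assumes I: "ideal I (mpoly_ring n)" "1 \<notin> I" and r: "r \<le> n" "r \<ge> 1"
    and \<psi>: "is_ring_hom \<psi>" "\<And>c. \<psi> (Cst c) = (Cst c :: 'a mpoly)" "\<And>p. p \<in> vars_in {..<n} \<Longrightarrow>
      \<psi> p \<in> vars_in {..<r}"
    and ker: "\<And>p. p \<in> vars_in {..<n} \<Longrightarrow> \<psi> p = 0 \<Longrightarrow> p \<in> I"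
    and N: "N \<subseteq> vars_in {..<n}" "0 \<in> N" "\<And>x y. x \<in> N \<Longrightarrow> y \<in> N \<Longrightarrow> x - y \<in> N"
      "\<And>c x. x \<in> N \<Longrightarrow> x * Cst c \<in> N" "\<And>l x. l < r \<Longrightarrow> x \<in> N \<Longrightarrow> x * mvar l \<in> N" "N \<inter> I \<subseteq> {0}"
    and rep: "\<And>p. p \<in> vars_in {..<n} \<Longrightarrow> \<exists>q\<in>N. p - q \<in> I"
  shows "cohen_macaulay_ideal (mpoly_ring n) I"
  unfolding cohen_macaulay_ideal_def cohen_macaulay_ring_def
proof (intro conjI allI impI)
  interpret R: cring "mpoly_ring n :: 'a mpoly ring" by (rule cring_mpoly_ring)
  interpret I: ideal I "mpoly_ring n :: 'a mpoly ring" by (rule I(1))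
  interpret h: ring_hom_ring "mpoly_ring n" "mpoly_ring n Quot I" "(+>\<^bsub>mpoly_ring n\<^esub>) I"
    using I.rcos_ring_hom_ring .
  let ?C = "vars_in {..<n} :: 'a mpoly set"
  show "ideal I (mpoly_ring n)" by (rule I(1))
  show cQ: "cring (mpoly_ring n Quot I)" using ideal.quotient_is_cring[OF I(1) R.is_cring] .
  interpret Q: cring "mpoly_ring n Quot I" by (rule cQ)
  show "noetherian_ring (mpoly_ring n Quot I)" by (rule noetherian_mpoly_quot[OF I(1)])
  have idI: "ideal_in ?C I" using I(1) by (simp add: ideal_mpoly_iff)
  fix P assume P: "maximalideal P (mpoly_ring n Quot I)"
  let ?P = "{r \<in> carrier (mpoly_ring n). I +>\<^bsub>mpoly_ring n\<^esub> r \<in> P}"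
  have gP: "G_ideal ?C ?P" by (rule maximal_G_ideal[OF I(1) P])
  \<comment> \<open>The Nullstellensatz in the form that is needed: the contraction of
    \<open>?P\<close> to each \<open>K[x_j]\<close> contains a linear polynomial.\<close>
  have pt: "\<exists>\<alpha>. mvar j - Cst \<alpha> \<in> ?P" if "j < n" for j
  proof -
    have "{..<n} = {..<n} \<union> {j}" using that by auto
    then have "G_ideal (vars_in ({..<n} \<union> {j})) ?P" using gP by simp
    then have "G_ideal (vars_in {j}) (?P \<inter> vars_in {j})" by (rule G_ideal_vars_in_contract[rotated])
      simp
    then show ?thesis using G_ideal_univariate by blast
  qed
  define \<alpha> where "\<alpha> j = (SOME a. mvar j - Cst a \<in> ?P)" for j
  have \<alpha>: "mvar j - Cst (\<alpha> j) \<in> ?P" if "j < n" for j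
    unfolding \<alpha>_def by (rule someI_ex[OF pt[OF that]])
  define f where "f l = mvar l - Cst (\<alpha> l)" for l
  define xs where "xs = map f [0..<r]"
  have f\<alpha>: "f l \<in> ?P" if "l < r" for l using \<alpha>[of l] that r by (simp add: f_def)
  have xsP: "set xs \<subseteq> ?P" using f\<alpha> by (auto simp: xs_def)
  have take: "set (take i xs) = f ` {..<i}" if "i \<le> r" for i
    using that by (auto simp: xs_def take_map)
  have "regular_sequence (mpoly_ring n Quot I) (map ((+>\<^bsub>mpoly_ring n\<^esub>) I) xs)"
  proof (rule R.regular_sequence_quot[OF I(1)])
    show "set xs \<subseteq> carrier (mpoly_ring n)" using xsP by auto
    have "ideal ?P (mpoly_ring n)" using gP by (simp add: G_ideal_def ideal_mpoly_iff)
    moreover have "I \<union> set xs \<subseteq> ?P"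
    proof -
      have "t \<in> ?P" if "t \<in> I" for t
      proof -
        have "I +>\<^bsub>mpoly_ring n\<^esub> t = \<zero>\<^bsub>mpoly_ring n Quot I\<^esub>"
          unfolding FactRing_zero by (rule I.a_rcos_const[OF that])
        then show ?thesis
          using that I.a_subset maximalideal.axioms(1)[OF P]
          by (auto simp: additive_subgroup.zero_closed ideal.axioms(1))
      qed
      then show ?thesis using xsP by blast
    qed
    ultimately have "genideal (mpoly_ring n) (I \<union> set xs) \<subseteq> ?P" by (intro R.genideal_minimal)
    moreover have "1 \<notin> ?P" using gP by (simp add: G_ideal_def)
    ultimately show "\<one>\<^bsub>mpoly_ring n\<^esub> \<notin> genideal (mpoly_ring n) (I \<union> set xs)"
      by (auto simp: mpoly_ring_ops)
    fix i p assume i: "i < length xs" and p: "p \<in> carrier (mpoly_ring n)"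
      "p \<otimes>\<^bsub>mpoly_ring n\<^esub> xs ! i \<in> genideal (mpoly_ring n) (I \<union> set (take i xs))"
    have ir: "i < r" using i by (simp add: xs_def)
    then show "p \<in> genideal (mpoly_ring n) (I \<union> set (take i xs))"
      using p regular_coordinates[OF idI r(1) N rep ir, of p \<alpha>] take[of i]
      by (simp add: carrier_mpoly_ring mpoly_ring_ops xs_def f_def)
  qed
  moreover have "set (map ((+>\<^bsub>mpoly_ring n\<^esub>) I) xs) \<subseteq> P" using xsP by auto
  ultimately have "enat (length (map ((+>\<^bsub>mpoly_ring n\<^esub>) I) xs)) \<le> grade (mpoly_ring n Quot I) P"
    unfolding grade_def by (intro Sup_upper) blast
  then have lower: "enat r \<le> grade (mpoly_ring n Quot I) P" by (simp add: xs_def)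
  have upper: "prime_height (mpoly_ring n Quot I) P \<le> enat r"
    unfolding prime_height_def
  proof (rule Sup_least, clarify)
    fix l :: nat and Q assume Q: "\<forall>i\<le>l. primeideal (Q i) (mpoly_ring n Quot I)" "\<forall>i<l. Q i \<subset> Q (Suc i)"
    show "enat l \<le> enat r"
    proof (rule ccontr)
      assume "\<not> ?thesis"
      then have l: "Suc r \<le> l" by simp
      define Q' where "Q' i = {s \<in> carrier (mpoly_ring n). I +>\<^bsub>mpoly_ring n\<^esub> s \<in> Q i}" for i
      have Q': "prime_in ?C (Q' i)" if "i \<le> Suc r" for i
        using h.primeideal_vimage[OF R.is_cring, of "Q i"] Q(1) that l by (simp add: Q'_def
          prime_in_iff)
      have strict: "Q' i \<subset> Q' (Suc i)" if "i \<le> r" for i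
      proof -
        have sub: "Q i \<subset> Q (Suc i)" using Q(2) that l by simp
        then obtain x where x: "x \<in> Q (Suc i)" "x \<notin> Q i" by blast
        have "primeideal (Q (Suc i)) (mpoly_ring n Quot I)" using Q(1) that l by simp
        then have "x \<in> carrier (mpoly_ring n Quot I)"
          using x(1) additive_subgroup.a_subset ideal.axioms(1) primeideal.axioms(1) by blast
        then obtain s where "s \<in> carrier (mpoly_ring n)" "x =
          I +>\<^bsub>mpoly_ring n\<^esub> s" by (rule carrier_FactRingE)
        then have "s \<in> Q' (Suc i)" "s \<notin> Q' i" using x by (auto simp: Q'_def)
        then show ?thesis using sub by (auto simp: Q'_def)
      qed
      have IQ: "t \<in> Q' 0" if "t \<in> I" for t
      proof -
        have "I +>\<^bsub>mpoly_ring n\<^esub> t = \<zero>\<^bsub>mpoly_ring n Quot I\<^esub>"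
          unfolding FactRing_zero by (rule I.a_rcos_const[OF that])
        moreover have "primeideal (Q 0) (mpoly_ring n Quot I)" using Q(1) by simp
        ultimately show ?thesis
          using that I.a_subset unfolding Q'_def
          by (auto simp: additive_subgroup.zero_closed ideal.axioms(1) primeideal.axioms(1))
      qed
      show False
      proof (rule prime_chain_relation[where D = ?C and Q = Q' and N =
        r, OF subring_set_vars_in vars_in_Cst Q' strict])
        fix x :: "nat \<Rightarrow> 'a mpoly" assume x: "\<And>i. i \<le> r \<Longrightarrow> x i \<in> ?C"
        \<comment> \<open>A relation between the images under \<open>\<psi>\<close> lifts to an
          element of the kernel, hence of \<open>I\<close> and of the lowest prime of the
          chain.\<close>
        obtain E c where E: "finite E" "E \<subseteq> extensional {..r}" "\<exists>e\<in>E. c e \<noteq> 0"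
          "(\<Sum>e\<in>E. Cst (c e) * (\<Prod>i\<le>r. \<psi> (x i) ^ e i)) = 0"
          using algebraic_dependence[of r "\<lambda>i. \<psi> (x i)"] \<psi>(3)[OF x] by blast
        let ?s = "\<Sum>e\<in>E. Cst (c e) * (\<Prod>i\<le>r. x i ^ e i)"
        have "\<psi> ?s = 0" using E(4) by (simp add: is_ring_homD[OF \<psi>(1)] \<psi>(2))
        moreover have "?s \<in> ?C"
          using x by (intro subring_set_sum[OF subring_set_vars_in] subring_setD(4)[OF
            subring_set_vars_in] vars_in_Cst
              subring_set_prod[OF subring_set_vars_in] subring_set_power[OF subring_set_vars_in]) auto
        ultimately have "?s \<in> Q' 0" using ker IQ by blast
        then show "\<exists>E c. finite E \<and> E \<subseteq> extensional {..r} \<and> (\<exists>e\<in>E. c e \<noteq> 0) \<and>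
            (\<Sum>e\<in>E. Cst (c e) * (\<Prod>i\<le>r. x i ^ e i)) \<in> Q' 0"
          using E(1-3) by (intro exI[of _ E] exI[of _ c] conjI)
      qed
    qed
  qed
  have "grade (mpoly_ring n Quot I) P \<le> prime_height (mpoly_ring n Quot I) P"
    by (rule Q.grade_le_prime_height[OF Q.maximalideal_prime[OF P]])
  then show "grade (mpoly_ring n Quot I) P = prime_height (mpoly_ring n Quot I) P"
    using lower upper by (meson order_antisym order_trans)
qed

text \<open>A regular sequence in \<open>P 0\<close> gives a chain of primes of its own length that
  ends there. The primes above prolong it by \<open>r\<close>, and in \<open>n\<close> variables no
  chain is longer than \<open>n\<close>.\<close>

lemma grade_le_of_chain:
  fixes P :: "nat \<Rightarrow> 'a::field mpoly set"
  assumes P: "\<And>i. i \<le> r \<Longrightarrow> primeideal (P i) (mpoly_ring n)" "\<And>i. i < r \<Longrightarrow>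
    P i \<subset> P (Suc i)" and n: "n = m + r"
  shows "grade (mpoly_ring n) (P 0) \<le> enat m"
  unfolding grade_def
proof (rule Sup_least, clarify)
  interpret R: cring "mpoly_ring n :: 'a mpoly ring" by (rule cring_mpoly_ring)
  fix xs assume xs: "set xs \<subseteq> P 0" "regular_sequence (mpoly_ring n) xs"
  let ?g = "length xs"
  obtain Q where Q: "\<And>i. i \<le> ?g \<Longrightarrow> primeideal (Q i) (mpoly_ring n)" "\<And>i. i < ?g \<Longrightarrow>
    Q i \<subset> Q (Suc i)" "Q ?g = P 0"
    using R.regular_sequence_chain[OF xs(2,1) P(1) le_refl] by auto
  show "enat ?g \<le> enat m"
  proof (rule ccontr)
    assume "\<not> ?thesis"
    then have g: "Suc m \<le> ?g" by simp
    define T where "T i = (if i \<le> ?g then Q i else P (i - ?g))" for i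
    have T: "prime_in (vars_in {..<n}) (T i)" if "i \<le> Suc n" for i
      unfolding prime_in_iff T_def using Q(1) P(1)[of "i - ?g"] that g n by auto
    have strict: "T i \<subset> T (Suc i)" if "i \<le> n" for i
    proof -
      consider "i < ?g" | "i = ?g" | "i > ?g" by linarith
      then show ?thesis
      proof cases
        case 2
        moreover have "r > 0 \<or> i < ?g" using 2 that n g by linarith
        ultimately show ?thesis using Q(3) P(2)[of 0] by (simp add: T_def)
      next
        case 3
        then have "i - ?g < r" "Suc i - ?g = Suc (i - ?g)" using that n g by linarith+
        then show ?thesis using P(2)[of "i - ?g"] 3 by (simp add: T_def)
      qed (use Q(2) in \<open>simp add: T_def\<close>)
    qed
    show False
    proof (rule prime_chain_relation[where D = "vars_in {..<n}" and Q = T and N = n,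
          OF subring_set_vars_in vars_in_Cst T strict])
      fix x :: "nat \<Rightarrow> 'a mpoly" assume x: "\<And>i. i \<le> n \<Longrightarrow> x i \<in> vars_in {..<n}"
      have "0 \<in> T 0" using T[of 0] by (auto simp: prime_in_def ideal_in_def)
      moreover obtain E c where E: "finite E" "E \<subseteq> extensional {..n}" "\<exists>e\<in>E. c e \<noteq> 0"
          "(\<Sum>e\<in>E. Cst (c e) * (\<Prod>i\<le>n. x i ^ e i)) = 0"
        using algebraic_dependence[of n x, OF x] by blast
      ultimately have "(\<Sum>e\<in>E. Cst (c e) * (\<Prod>i\<le>n. x i ^ e i)) \<in> T 0" by simp
      then show "\<exists>E c. finite E \<and> E \<subseteq> extensional {..n} \<and> (\<exists>e\<in>E. c e \<noteq> 0) \<and>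
            (\<Sum>e\<in>E. Cst (c e) * (\<Prod>i\<le>n. x i ^ e i)) \<in> T 0"
        using E(1-3) by (intro exI[of _ E] exI[of _ c] conjI)
    qed
  qed
qed

section \<open>The toric ideal of the surface\<close>

text \<open>Over an arbitrary ring, so that it parametrizes vectors when the arguments are scalars
  and defines the homomorphism into \<open>K[x, y, z]\<close> when they are variables.\<close>

definition toric :: "nat \<Rightarrow> 'b::comm_ring_1 \<Rightarrow> 'b \<Rightarrow> 'b \<Rightarrow> nat \<Rightarrow> 'b" where
  "toric d x y z i = (if i = 0 then x ^ d else if i = 1 then y ^ d else if i = 2 then z ^ d
     else x ^ (d div 2 - (i - 3)) * y ^ (d div 2 - (i - 3)) * z ^ (d mod 2 + 2 * (i - 3)))"

text \<open>The variable \<open>w\<^sub>i\<close> that stands for \<open>(x y)\<^sup>k\<^sup>-\<^sup>i z\<^sup>\<epsilon>\<^sup>+\<^sup>2\<^sup>i\<close>, where \<open>w\<^sub>k\<close> stands for \<open>z\<^sup>d\<close>.\<close>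

definition w_index :: "nat \<Rightarrow> nat \<Rightarrow> nat" where
  "w_index k i = (if i < k then 3 + i else 2)"

abbreviation w_var :: "nat \<Rightarrow> nat \<Rightarrow> 'a::comm_ring_1 mpoly" where
  "w_var k i \<equiv> mvar (w_index k i)"

text \<open>Index \<open>k\<close> is the extra column with entries \<open>x_0 x_1\<close> and
  \<open>w_0^2\<close> of the odd case; the even case uses only the columns below
  \<open>k\<close>.\<close>

definition upper_monom :: "nat \<Rightarrow> nat \<Rightarrow> nat \<Rightarrow>\<^sub>0 nat" where
  "upper_monom k i = (if i < k then Poly_Mapping.single (w_index k i) 1 else Poly_Mapping.single 0 1
    + Poly_Mapping.single 1 1)"

definition lower_monom :: "nat \<Rightarrow> nat \<Rightarrow> nat \<Rightarrow>\<^sub>0 nat" where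
  "lower_monom k i = (if i < k then Poly_Mapping.single (w_index k (i +
    1)) 1 else Poly_Mapping.single 3 2)"

definition minors :: "nat \<Rightarrow> (nat \<Rightarrow> 'r::comm_ring_1) \<Rightarrow> (nat \<Rightarrow> 'r) \<Rightarrow> 'r set" where
  "minors n a b = {a i * b l - a l * b i | i l. i < l \<and> l < n}"

lemma minorsI: "i < l \<Longrightarrow> l < n \<Longrightarrow> a i * b l - a l * b i \<in> minors n a b"
  unfolding minors_def by blast

definition quadric :: "'a::comm_ring_1 mpoly" where
  "quadric = mvar 0 * mvar 1 - mvar 3 ^ 2"

definition surface_gens :: "nat \<Rightarrow> 'a::comm_ring_1 mpoly set" where
  "surface_gens d = (let k = d div 2 in
     if odd d then minors (k + 1) (\<lambda>i. mon (upper_monom k i)) (\<lambda>i. mon (lower_monom k i))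
     else insert quadric (minors k (\<lambda>i. mon (upper_monom k i)) (\<lambda>i. mon (lower_monom k i))))"

lemma mon_upper_monom: "i < k \<Longrightarrow> mon (upper_monom k i) = w_var k i" "mon (upper_monom k k) =
  mvar 0 * mvar 1"
  by (simp_all add: upper_monom_def mvar_def mult_single)

lemma mon_lower_monom: "i < k \<Longrightarrow> mon (lower_monom k i) = w_var k (i + 1)" "mon (lower_monom k k) =
  mvar 3 ^ 2"
  by (simp_all add: lower_monom_def mvar_power) (simp add: mvar_def)

locale surface =
  fixes d k \<epsilon> :: nat and ty :: "'a::{alg_closed_field, field_char_0} itself"
  assumes d: "d = 2 * k + \<epsilon>" "\<epsilon> < 2" "d \<ge> 3"
begin

abbreviation xv :: "nat \<Rightarrow> 'a mpoly" where "xv \<equiv> mvar"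

abbreviation w :: "nat \<Rightarrow> 'a mpoly" where "w i \<equiv> w_var k i"

abbreviation mn :: "(nat \<Rightarrow>\<^sub>0 nat) \<Rightarrow> 'a mpoly" where "mn \<equiv> mon"

abbreviation gens :: "'a mpoly set" where "gens \<equiv> surface_gens d"

abbreviation polys :: "'a mpoly set" where "polys \<equiv> vars_in {..<k + 3}"

lemma k: "d div 2 = k" "d mod 2 = \<epsilon>" "k \<ge> 1" "odd d \<longleftrightarrow> \<epsilon> = 1"
  using d by (auto simp: less_2_cases_iff)

lemma w_index_0: "w_index k 0 = 3" using k by (simp add: w_index_def)

lemma w_index_k: "w_index k k = 2" by (simp add: w_index_def)

lemma toric_w: "i \<le> k \<Longrightarrow> toric d x y z (w_index k i) = (x * y) ^ (k - i) * z ^ (\<epsilon> + 2 * i)"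
proof (cases "i < k")
  case True
  then show ?thesis using k by (simp add: toric_def w_index_def power_mult_distrib)
next
  case False
  moreover assume "i \<le> k"
  ultimately show ?thesis using d(1) by (simp add: toric_def w_index_def add.commute)
qed

lemma gens_vars: "gens \<subseteq> polys"
proof -
  have W: "w_index k i < k + 3" for i using k by (auto simp: w_index_def)
  have "mn (upper_monom k i) \<in> polys" "mn (lower_monom k i) \<in> polys" for i
    using W[of i] W[of "i + 1"] k(3)
      keys_add[of "Poly_Mapping.single 0 (Suc 0)" "Poly_Mapping.single (Suc 0) (Suc 0)"]
    by (auto simp: upper_monom_def lower_monom_def intro!: vars_in_single)
  moreover have "quadric \<in> polys"
    unfolding quadric_def using k
    by (intro subring_setD(3,4)[OF subring_set_vars_in] subring_set_power[OF subring_set_vars_in]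
      vars_in_mvar) auto
  ultimately show ?thesis
    by (auto simp: surface_gens_def k(1) minors_def intro!: subring_setD(3,4)[OF subring_set_vars_in])
qed

text \<open>Each generator is a difference of two monomials with the same image, as a comparison of
  the exponents of \<open>x * y\<close> and \<open>z\<close> shows.\<close>

lemma gens_toric:
  assumes h: "is_ring_hom h" and f: "f \<in> gens"
  shows "eval_hom h (toric d x y z) f = 0"
proof -
  note e = is_ring_homD[OF is_ring_hom_eval_hom[OF h]]
  let ?e = "eval_hom h (toric d x y z)"
  have W: "i \<le> k \<Longrightarrow> ?e (w i) = (x * y) ^ (k - i) * z ^ (\<epsilon> + 2 * i)" for i
    by (simp add: eval_hom_mvar[OF h] toric_w)
  have ab: "?e (xv 0 * xv 1) = (x * y) ^ d"
    by (simp add: e eval_hom_mvar[OF h] toric_def power_mult_distrib)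
  have w0: "?e (xv 3) = (x * y) ^ k * z ^ \<epsilon>" using W[of 0] by (simp add: w_index_0)
  have 1: "?e (mn (upper_monom k i) * mn (lower_monom k l) -
    mn (upper_monom k l) * mn (lower_monom k i)) = 0" if "i < l" "l < k" for i l
  proof -
    have "k - i + (k - (l + 1)) = k - l + (k - (i + 1))" using that by simp
    then have "(x * y) ^ (k - i) * (x * y) ^ (k - (l + 1)) =
      (x * y) ^ (k - l) * (x * y) ^ (k - (i + 1))"
      by (simp only: power_add[symmetric])
    moreover have "z ^ (\<epsilon> + 2 * i) * z ^ (\<epsilon> + 2 * (l + 1)) = z ^ (\<epsilon> + 2 * l) * z ^ (\<epsilon> + 2 * (i + 1))"
    proof -
      have "\<epsilon> + 2 * i + (\<epsilon> + 2 * (l + 1)) = \<epsilon> + 2 * l + (\<epsilon> + 2 * (i + 1))" by simp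
      then show ?thesis by (simp only: power_add[symmetric])
    qed
    ultimately have "((x * y) ^ (k - i) * (x * y) ^ (k - (l + 1))) * (z ^ (\<epsilon> + 2 * i) * z ^ (\<epsilon> +
      2 * (l + 1))) =
        ((x * y) ^ (k - l) * (x * y) ^ (k - (i + 1))) * (z ^ (\<epsilon> + 2 * l) * z ^ (\<epsilon> + 2 * (i +
          1)))" by simp
    moreover have "?e (w i) = (x * y) ^ (k - i) * z ^ (\<epsilon> + 2 * i)"
      "?e (w l) = (x * y) ^ (k - l) * z ^ (\<epsilon> + 2 * l)"
      "?e (w (i + 1)) = (x * y) ^ (k - (i + 1)) * z ^ (\<epsilon> + 2 * (i + 1))"
      "?e (w (l + 1)) = (x * y) ^ (k - (l + 1)) * z ^ (\<epsilon> + 2 * (l + 1))"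
      using that by (intro W; simp)+
    ultimately show ?thesis
      using that by (simp only: mon_upper_monom mon_lower_monom e less_trans[OF that]) (simp only:
        mult_ac diff_self)
  qed
  have 2: "?e (mn (upper_monom k i) * mn (lower_monom k k) -
    mn (upper_monom k k) * mn (lower_monom k i)) = 0" if "i < k" "odd d" for i
  proof -
    have \<epsilon>: "\<epsilon> = 1" using that k by simp
    have "k - i + (k + k) = d + (k - (i + 1))" using that d \<epsilon> by simp
    then have "(x * y) ^ (k - i) * ((x * y) ^ k * (x * y) ^ k) = (x * y) ^ d * (x * y) ^ (k - (i + 1))"
      by (simp only: power_add[symmetric])
    moreover have "z ^ (\<epsilon> + 2 * i) * (z ^ \<epsilon> * z ^ \<epsilon>) = z ^ (\<epsilon> + 2 * (i + 1))"
      by (simp add: power_add[symmetric] \<epsilon>)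
    ultimately have "((x * y) ^ (k - i) * ((x * y) ^ k * (x * y) ^ k)) * (z ^ (\<epsilon> +
      2 * i) * (z ^ \<epsilon> * z ^ \<epsilon>)) =
        ((x * y) ^ d * (x * y) ^ (k - (i + 1))) * z ^ (\<epsilon> + 2 * (i + 1))" by simp
    moreover have "?e (w i) = (x * y) ^ (k - i) * z ^ (\<epsilon> + 2 * i)"
      "?e (w (i + 1)) = (x * y) ^ (k - (i + 1)) * z ^ (\<epsilon> + 2 * (i + 1))"
      using that by (intro W; simp)+
    ultimately show ?thesis
      using that by (simp only: mon_upper_monom mon_lower_monom e(3,6,7) ab[unfolded e(3)] w0
        power2_eq_square)
        (simp only: mult_ac diff_self)
  qed
  have 3: "?e quadric = 0" if "even d"
  proof -
    have "\<epsilon> = 0" using that k d(2) by auto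
    then have "d = k * 2" "\<epsilon> = 0" using d by auto
    then have "(x * y) ^ d = ((x * y) ^ k * z ^ \<epsilon>)\<^sup>2" by (simp add: power_mult)
    then show ?thesis unfolding quadric_def by (simp only: e(6,7) ab w0 diff_self)
  qed
  show ?thesis
  proof (cases "odd d")
    case True
    then obtain i l where "f = mn (upper_monom k i) * mn (lower_monom k l) -
      mn (upper_monom k l) * mn (lower_monom k i)" "i < l" "l < k + 1"
      using f by (auto simp: surface_gens_def k(1) minors_def)
    then show ?thesis using 1[of i l] 2[of i] True by (cases "l = k") auto
  next
    case False
    then consider "f = quadric" | i l where "f = mn (upper_monom k i) * mn (lower_monom k l) -
      mn (upper_monom k l) * mn (lower_monom k i)" "i < l" "l < k"
      using f by (auto simp: surface_gens_def k(1) minors_def)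
    then show ?thesis using 1 3 False by cases auto
  qed
qed

lemma idl_toric:
  assumes h: "is_ring_hom h" and f: "f \<in> idl gens"
  shows "eval_hom h (toric d x y z) f = 0"
  using f
proof (induction rule: idl.span_induct_alt)
  case (step c p q)
  then show ?case using gens_toric[OF h step(1)] by (simp add: is_ring_homD[OF
    is_ring_hom_eval_hom[OF h]])
qed (simp add: is_ring_homD[OF is_ring_hom_eval_hom[OF h]])

subsection \<open>Standard monomials\<close>

text \<open>The monomial \<open>e\<^sub>u\<close>, chosen such that its image has degree \<open>u\<close> in \<open>x\<close> and in \<open>y\<close>.\<close>

definition std_factor :: "nat \<Rightarrow> nat \<Rightarrow>\<^sub>0 nat" where
  "std_factor u = (if u = 0 then 0 else if u \<le> k then Poly_Mapping.single (w_index k (k - u)) 1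
     else Poly_Mapping.single (w_index k 0) 1 + Poly_Mapping.single (w_index k (2 * k - u)) 1)"

definition std_monom :: "nat \<Rightarrow> nat \<Rightarrow> nat \<Rightarrow> nat \<Rightarrow> nat \<Rightarrow>\<^sub>0 nat" where
  "std_monom i j l u = Poly_Mapping.single 0 i + Poly_Mapping.single 1 j + Poly_Mapping.single 2 l +
    std_factor u"

definition std_monoms :: "(nat \<Rightarrow>\<^sub>0 nat) set" where
  "std_monoms = {std_monom i j l u | i j l u. u < d}"

section \<open>Rewriting monomials modulo the generators\<close>

definition eqv :: "'a mpoly \<Rightarrow> 'a mpoly \<Rightarrow> bool" where
  "eqv p q \<longleftrightarrow> p - q \<in> idl gens"

lemma eqv_refl: "eqv p p"
  by (simp add: eqv_def idl.span_zero)

lemma eqv_sym: "eqv p q \<Longrightarrow> eqv q p"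
  using idl.span_neg[of "p - q" "gens"] by (simp add: eqv_def)

lemma eqv_trans: "eqv p q \<Longrightarrow> eqv q r \<Longrightarrow> eqv p r"
  using idl.span_add[of "p - q" "gens" "q - r"] by (simp add: eqv_def)

lemma eqv_mult: "eqv p q \<Longrightarrow> eqv (r * p) (r * q)"
  using idl.span_scale[of "p - q" "gens" r] by (simp add: eqv_def right_diff_distrib)

lemma eqv_mult2: "eqv p q \<Longrightarrow> eqv (p * r) (q * r)"
  using eqv_mult[of p q r] by (simp add: mult.commute)

lemma eqv_minor:
  assumes "i < k" "l < k"
  shows "eqv (w i * w (l + 1)) (w l * w (i + 1))"
proof -
  have main: "eqv (w i * w (l + 1)) (w l * w (i + 1))" if "i < l" "l < k" for i l
  proof -
    have "mn (upper_monom k i) * mn (lower_monom k l) -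
      mn (upper_monom k l) * mn (lower_monom k i) \<in> gens"
      using that minorsI[of i l k "\<lambda>i. mn (upper_monom k i)" "\<lambda>i. mn (lower_monom k i)"]
        minorsI[of i l "k + 1" "\<lambda>i. mn (upper_monom k i)" "\<lambda>i. mn (lower_monom k i)"]
      by (simp add: surface_gens_def k(1))
    then show ?thesis using that unfolding eqv_def by (intro idl.span_base) (simp add:
      mon_upper_monom mon_lower_monom)
  qed
  consider "i < l" | "i = l" | "l < i" by linarith
  then show ?thesis using main[of i l] main[of l i] assms by cases (auto intro: eqv_refl eqv_sym)
qed

text \<open>The minors move one unit of index from one factor to the other, so modulo the generators
  \<open>w i * w l\<close> depends only on \<open>i + l\<close>. The normal form contains
  \<open>w 0\<close> if the sum is at most \<open>k\<close>, and \<open>w k\<close>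
  otherwise.\<close>

lemma eqv_low: "i + l \<le> k \<Longrightarrow> eqv (w i * w l) (w 0 * w (i + l))"
proof (induction i arbitrary: l)
  case (Suc i)
  have "eqv (w l * w (i + 1)) (w i * w (l + 1))" using Suc.prems eqv_minor[of l i] by simp
  then have "eqv (w (Suc i) * w l) (w i * w (Suc l))" by (simp add: mult.commute)
  moreover have "eqv (w i * w (Suc l)) (w 0 * w (i + Suc l))"
    using Suc.IH[of "Suc l"] Suc.prems by simp
  ultimately have "eqv (w (Suc i) * w l) (w 0 * w (i + Suc l))" by (rule eqv_trans)
  then show ?case by simp
qed (simp add: eqv_refl)

lemma eqv_high:
  assumes "i \<le> k" "l \<le> k" "i + l \<ge> k"
  shows "eqv (w i * w l) (w k * w (i + l - k))"
  using assms
proof (induction "k - i" arbitrary: i l)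
  case 0
  then show ?case by (simp add: eqv_refl)
next
  case (Suc m)
  then have i: "i < k" and l: "l \<ge> 1" by simp_all
  define l' where "l' = l - 1"
  have l': "l = l' + 1" "l' < k" using l Suc.prems by (auto simp: l'_def)
  have "eqv (w i * w (l' + 1)) (w l' * w (i + 1))" using eqv_minor[OF i l'(2)] .
  moreover have "eqv (w (i + 1) * w l') (w k * w (i + 1 + l' - k))"
    by (rule Suc.hyps(1)) (use Suc.prems Suc.hyps(2) i l' in auto)
  then have "eqv (w l' * w (i + 1)) (w k * w (i + l - k))"
    using l' by (simp add: mult.commute)
  ultimately show ?case using eqv_trans l'(1) by blast
qed

lemma eqv_even: "even d \<Longrightarrow> eqv (w 0 * w 0) (xv 0 * xv 1)"
proof -
  assume "even d"
  then have "quadric \<in> gens" by (simp add: surface_gens_def k(1))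
  then have "eqv (xv 0 * xv 1) (xv 3 ^ 2)"
    unfolding eqv_def quadric_def[symmetric] by (rule idl.span_base)
  then show ?thesis using eqv_sym by (simp add: w_index_0 power2_eq_square)
qed

lemma eqv_odd:
  assumes "odd d" "i < k"
  shows "eqv (w 0 * w 0 * w i) (xv 0 * xv 1 * w (i + 1))"
proof -
  have "mn (upper_monom k i) * mn (lower_monom k k) - mn (upper_monom k k) * mn (lower_monom k i) \<in>
    gens"
    using assms minorsI[of i k "k + 1" "\<lambda>i. mn (upper_monom k i)" "\<lambda>i. mn (lower_monom k i)"]
    by (simp add: surface_gens_def k(1))
  then have "eqv (w i * xv 3 ^ 2) (xv 0 * xv 1 * w (i + 1))"
    using assms unfolding eqv_def by (intro idl.span_base) (simp add: mon_upper_monom mon_lower_monom)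
  then show ?thesis by (simp only: w_index_0 power2_eq_square mult_ac)
qed

lemma mon_std_factor: "mn (std_factor u) = (if u = 0 then 1 else if u \<le>
  k then w (k - u) else w 0 * w (2 * k - u))"
  by (auto simp: std_factor_def mvar_def mult_single)

lemma mon_std_monom: "mn (std_monom i j l u) = xv 0 ^ i * xv 1 ^ j * w k ^ l * mn (std_factor u)"
  by (simp add: std_monom_def mvar_power mult_single w_index_k)

text \<open>The image of the product has degree \<open>u + (k - s)\<close> in \<open>x\<close>. The
  normal form is the standard factor of that degree, up to a power of \<open>w k\<close>; once the
  degree reaches \<open>d\<close>, a factor \<open>x_0 x_1\<close> splits off and the degree drops
  by \<open>d\<close>.\<close>

lemma std_factor_mult:
  assumes u: "u < d" and s: "s < k"
  shows "\<exists>\<alpha> \<gamma> u'. u' < d \<and> eqv (mn (std_factor u) * w s) ((xv 0 * xv 1) ^ \<alpha> * w k ^ \<gamma> *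
    mn (std_factor u'))"
proof -
  have ok: ?thesis if "u' < d" "eqv (mn (std_factor u) * w s) ((xv 0 * xv 1) ^ \<alpha> * w k ^ \<gamma> *
    mn (std_factor u'))"
    for \<alpha> \<gamma> u' using that by blast
  have kd: "k < d" using d by simp
  consider "u = 0" | "1 \<le> u" "u \<le> s" | "s < u" "u \<le> k" | "k < u" "u \<le> k + s" | "k + s < u"
    using s by linarith
  then show ?thesis
  proof cases
    case 1
    then show ?thesis using ok[of "k - s" 0 0] s kd by (simp add: mon_std_factor eqv_refl)
  next
    case 2
    have "eqv (w (k - u) * w s) (w k * w (k - u + s - k))"
      using 2 s by (intro eqv_high) auto
    moreover have "mn (std_factor (k + u - s)) = w (s - u)" using 2 s by (simp add: mon_std_factor)
    ultimately show ?thesis using ok[of "k + u - s" 0 1] 2 s kd by (simp add: mon_std_factor)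
  next
    case 3
    have e: "eqv (w (k - u) * w s) (w 0 * w (k - u + s))" using 3 by (intro eqv_low) auto
    show ?thesis
    proof (cases "u + (k - s) < d")
      case True
      have "mn (std_factor (u + (k - s))) = w 0 * w (k - u + s)"
        using 3 s by (auto simp: mon_std_factor intro!: arg_cong[where f = "\<lambda>i. w i"])
      then show ?thesis using ok[of "u + (k - s)" 0 0] e True 3 by (simp add: mon_std_factor)
    next
      case False
      \<comment> \<open>Degree \<open>2 * k\<close> reaches \<open>d\<close> only for even
        \<open>d\<close>; the product is then \<open>w 0 * w 0\<close>, and the quadric
        applies.\<close>
      then have "u = k \<and> s = 0 \<and> \<epsilon> = 0" using 3 s d by linarith
      then have "u = k" "s = 0" "even d" using d by auto
      then show ?thesis using ok[of 0 1 0] eqv_even kd 3 by (simp add: mon_std_factor)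
    qed
  next
    case 4
    have su_u: "mn (std_factor u) = w 0 * w (2 * k - u)" using 4 by (simp add: mon_std_factor)
    have "eqv (w (2 * k - u) * w s) (w k * w (2 * k - u + s - k))"
      using 4 s u by (intro eqv_high) auto
    moreover have "2 * k - u + s - k = k + s - u" using 4 u d by linarith
    ultimately have "eqv (w (2 * k - u) * w s) (w k * w (k + s - u))" by simp
    from eqv_mult[OF this, of "w 0"]
    have e: "eqv (w 0 * w (2 * k - u) * w s) (w 0 * (w k * w (k + s - u)))"
      by (simp only: mult.assoc)
    show ?thesis
    proof (cases "u + (k - s) < d")
      case True
      have "mn (std_factor (u + (k - s))) = w 0 * w (k + s - u)"
        using 4 s by (auto simp: mon_std_factor intro!: arg_cong[where f = "\<lambda>i. w i"])
      then have "eqv (mn (std_factor u) * w s) ((xv 0 * xv 1) ^ 0 * w k ^ 1 * mn (std_factor (u +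
        (k - s))))"
        using e by (simp only: su_u power_0 power_one_right mult_1 mult_ac)
      then show ?thesis by (rule ok[OF True])
    next
      case False
      then have "u = k + s \<and> \<epsilon> = 0" using 4 s d by linarith
      then have "u = k + s" "even d" using d by auto
      from eqv_mult[OF eqv_even[OF this(2)], of "w k"]
      have "eqv (w 0 * (w k * w 0)) (w k * (xv 0 * xv 1))" by (simp only: mult_ac)
      moreover have "k + s - u = 0" using \<open>u = k + s\<close> by simp
      ultimately have "eqv (w 0 * w (2 * k - u) * w s) (w k * (xv 0 * xv 1))"
        using eqv_trans[OF e] by (simp only:)
      moreover have "mn (std_factor 0) = 1" by (simp add: mon_std_factor)
      ultimately have "eqv (mn (std_factor u) * w s) ((xv 0 * xv 1) ^ 1 * w k ^ 1 * mn (std_factor 0))"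
        by (simp only: su_u power_one_right mult_1 mult_1_right mult_ac)
      then show ?thesis by (rule ok[rotated]) (use kd in simp)
    qed
  next
    case 5
    \<comment> \<open>The three factors become \<open>w 0 * w 0 * w i\<close>, on which the extra
      column acts for odd \<open>d\<close> and the quadric for even \<open>d\<close>.\<close>
    define i where "i = 2 * k - u + s"
    have i: "i < k" using 5 s u d by (auto simp: i_def)
    have "eqv (w (2 * k - u) * w s) (w 0 * w i)"
      unfolding i_def using 5 s u i by (intro eqv_low) (auto simp: i_def)
    from eqv_mult[OF this, of "w 0"]
    have e: "eqv (w 0 * w (2 * k - u) * w s) (w 0 * w 0 * w i)" by (simp only: mult.assoc)
    have u: "\<not> u = 0" "\<not> u \<le> k" using 5 by auto
    show ?thesis
    proof (cases "odd d")
      case True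
      have e2: "eqv (mn (std_factor u) * w s) (xv 0 * xv 1 * w (i + 1))"
        using eqv_trans[OF e eqv_odd[OF True i]] u by (simp add: mon_std_factor)
      show ?thesis
      proof (cases "i + 1 = k")
        case True
        then show ?thesis using ok[of 0 1 1] e2 kd by (simp add: mon_std_factor)
      next
        case False
        then have "mn (std_factor (k - (i + 1))) = w (i + 1)" using i by (simp add: mon_std_factor)
        then show ?thesis using ok[of "k - (i + 1)" 1 0] e2 kd by simp
      qed
    next
      case False
      have "eqv (w 0 * w 0 * w i) (xv 0 * xv 1 * w i)"
        using eqv_mult2[OF eqv_even] False by blast
      then have e2: "eqv (mn (std_factor u) * w s) (xv 0 * xv 1 * w i)"
        using eqv_trans[OF e] u by (simp add: mon_std_factor)
      have "mn (std_factor (k - i)) = w i" using i by (simp add: mon_std_factor)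
      then show ?thesis using ok[of "k - i" 1 0] e2 kd by simp
    qed
  qed
qed

lemma monomial_std:
  "Poly_Mapping.keys m \<subseteq> {..<k + 3} \<Longrightarrow> \<exists>m'\<in>std_monoms. eqv (mn m) (mn m')"
proof (induction m rule: monomial_induct)
  case zero
  have "std_monom 0 0 0 0 = 0" by (simp add: std_monom_def std_factor_def)
  moreover have "std_monom 0 0 0 0 \<in> std_monoms" using d unfolding std_monoms_def by force
  ultimately show ?case by (intro bexI[of _ 0]) (auto simp: eqv_refl)
next
  case (add m v)
  have "Poly_Mapping.keys m \<subseteq> Poly_Mapping.keys (m + Poly_Mapping.single v 1)"
    "v \<in> Poly_Mapping.keys (m + Poly_Mapping.single v 1)"
    by (auto simp: in_keys_iff lookup_add lookup_single when_def)
  then have v: "v < k + 3" and m: "Poly_Mapping.keys m \<subseteq> {..<k + 3}" using add.prems by auto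
  obtain m' where m': "m' \<in> std_monoms" "eqv (mn m) (mn m')" using add.IH[OF m] by blast
  then obtain i j l u where iju: "u < d" "eqv (mn m) (mn (std_monom i j l u))"
    by (auto simp: std_monoms_def)
  have e: "eqv (mn (m + Poly_Mapping.single v 1)) (mn (std_monom i j l u) * xv v)"
    using eqv_mult2[OF iju(2), of "xv v"] by (simp add: mvar_def mult_single)
  have std: "std_monom i j l u \<in> std_monoms" if "u < d" for i j l u using that unfolding
    std_monoms_def by blast
  consider "v = 0" | "v = 1" | "v = 2" | s where "v = w_index k s" "s < k"
  proof (cases "v < 3")
    case False
    then have "v = w_index k (v - 3)" "v - 3 < k" using v by (auto simp: w_index_def)
    then show ?thesis using that(4) by blast
  qed (use that in linarith)
  then show ?case
  proof cases
    case 1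
    have "mn (std_monom i j l u) * xv v = mn (std_monom (Suc i) j l u)" by (simp only: 1
      mon_std_monom power_Suc mult_ac)
    then show ?thesis using e std[OF iju(1), of "Suc i" j l] by metis
  next
    case 2
    have "mn (std_monom i j l u) * xv v = mn (std_monom i (Suc j) l u)" by (simp only: 2
      mon_std_monom power_Suc mult_ac)
    then show ?thesis using e std[OF iju(1), of i "Suc j" l] by metis
  next
    case 3
    have "mn (std_monom i j l u) * xv v = mn (std_monom i j (Suc l) u)" by (simp only: 3 w_index_k
      mon_std_monom power_Suc mult_ac)
    then show ?thesis using e std[OF iju(1), of i j "Suc l"] by metis
  next
    case 4
    obtain \<alpha> \<gamma> u' where *: "u' < d"
      "eqv (mn (std_factor u) * w s) ((xv 0 * xv 1) ^ \<alpha> * w k ^ \<gamma> * (mn (std_factor u') :: 'a mpoly))"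
      using std_factor_mult[OF iju(1) 4(2)] by blast
    have "eqv (xv 0 ^ i * xv 1 ^ j * w k ^ l * (mn (std_factor u) * w s))
        (xv 0 ^ i * xv 1 ^ j * w k ^ l * ((xv 0 * xv 1) ^ \<alpha> * w k ^ \<gamma> *
          (mn (std_factor u') :: 'a mpoly)))"
      by (rule eqv_mult[OF *(2)])
    moreover have "xv 0 ^ i * xv 1 ^ j * w k ^ l * (mn (std_factor u) * w s) =
      (mn (std_monom i j l u) * xv v :: 'a mpoly)"
      by (simp only: 4 mon_std_monom mult_ac)
    moreover have "xv 0 ^ i * xv 1 ^ j * w k ^ l * ((xv 0 * xv 1) ^ \<alpha> * w k ^ \<gamma> * mn (std_factor u')) =
        (mn (std_monom (i + \<alpha>) (j + \<alpha>) (l + \<gamma>) u') :: 'a mpoly)"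
      by (simp only: mon_std_monom power_mult_distrib power_add mult_ac)
    ultimately have "eqv (mn (m + Poly_Mapping.single v 1)) (mn (std_monom (i + \<alpha>) (j + \<alpha>) (l +
      \<gamma>) u') :: 'a mpoly)"
      using eqv_trans[OF e] by simp
    then show ?thesis using std[OF *(1)] by blast
  qed
qed

definition std_span :: "'a mpoly set" where
  "std_span = {p \<in> polys. Poly_Mapping.keys p \<subseteq> std_monoms}"

lemma std_monom_keys: "u < d \<Longrightarrow> Poly_Mapping.keys (std_monom i j l u) \<subseteq> {..<k + 3}"
  using k(3) by (auto simp: std_monom_def std_factor_def w_index_def dest!: subsetD[OF keys_add]
    split: if_splits)

lemma std_span_rep:
  assumes "p \<in> polys"
  shows "\<exists>q\<in>std_span. p - (q :: 'a mpoly) \<in> idl gens"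
proof -
  have sub: "subring_set polys" by (rule subring_set_vars_in)
  have "\<forall>m\<in>Poly_Mapping.keys p. \<exists>m'. m' \<in> std_monoms \<and> eqv (mn m) (mn m' :: 'a mpoly)"
  proof
    fix m assume "m \<in> Poly_Mapping.keys p"
    then have "Poly_Mapping.keys m \<subseteq> {..<k + 3}" using assms by (auto simp: vars_in_def)
    from monomial_std[OF this] show "\<exists>m'. m' \<in> std_monoms \<and> eqv (mn m) (mn m')" by blast
  qed
  then obtain t where t: "\<And>m. m \<in> Poly_Mapping.keys p \<Longrightarrow>
    t m \<in> std_monoms \<and> eqv (mn m) (mn (t m) :: 'a mpoly)"
    by metis
  define q where "q = (\<Sum>m\<in>Poly_Mapping.keys p. Poly_Mapping.single (t m) (Poly_Mapping.lookup p m))"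
  have "p = (\<Sum>m\<in>Poly_Mapping.keys p. Poly_Mapping.single m (Poly_Mapping.lookup p m))"
    by (intro poly_mapping_eqI) (simp add: lookup_sum lookup_single when_def in_keys_iff)
  then have "p - q = (\<Sum>m\<in>Poly_Mapping.keys p. Poly_Mapping.single m (Poly_Mapping.lookup p m)) -
    q" by simp
  also have "\<dots> = (\<Sum>m\<in>Poly_Mapping.keys p. Cst (Poly_Mapping.lookup p m) * (mn m - mn (t m)))"
    by (simp add: q_def sum_subtractf right_diff_distrib mult_single)
  also have "\<dots> \<in> idl gens"
    using t by (intro idl.span_sum idl.span_scale) (auto simp: eqv_def)
  finally have "p - q \<in> idl gens" .
  moreover have "Poly_Mapping.keys q \<subseteq> std_monoms"
    unfolding q_def using keys_sum[of "\<lambda>m. Poly_Mapping.single (t m) (Poly_Mapping.lookup p m)"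
      "Poly_Mapping.keys p"] t
    by (fastforce split: if_splits)
  moreover from this have "q \<in> polys"
  proof -
    have "Poly_Mapping.keys m \<subseteq> {..<k + 3}" if "m \<in> std_monoms" for m
      using that std_monom_keys unfolding std_monoms_def by blast
    then show "q \<in> polys" if "Poly_Mapping.keys q \<subseteq> std_monoms" using that unfolding vars_in_def by
      blast
  qed
  ultimately show ?thesis by (auto simp: std_span_def)
qed

lemma std_span_0: "0 \<in> std_span"
  by (simp add: std_span_def subring_setD[OF subring_set_vars_in])

lemma std_span_diff: "x \<in> std_span \<Longrightarrow> y \<in> std_span \<Longrightarrow> x - y \<in> std_span"
  using keys_diff[of x y] by (auto simp: std_span_def subring_setD[OF subring_set_vars_in])

lemma std_span_Cst:
  assumes x: "x \<in> std_span"
  shows "x * Cst c \<in> std_span"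
proof -
  have "Poly_Mapping.keys (x * Cst c) \<subseteq> Poly_Mapping.keys x"
    using keys_mult[of x "Cst c"] by (auto split: if_splits)
  then show ?thesis using x subring_setD(4)[OF subring_set_vars_in _ vars_in_Cst] by (auto simp:
    std_span_def)
qed

lemma std_span_xv:
  assumes l: "l < 3" and x: "x \<in> std_span"
  shows "x * xv l \<in> std_span"
proof -
  have "m + Poly_Mapping.single l 1 \<in> std_monoms" if m: "m \<in> std_monoms" for m
  proof -
    obtain i j t u where *: "m = std_monom i j t u" "u < d" using m by (auto simp: std_monoms_def)
    have "std_monom i j t u + Poly_Mapping.single 0 1 = std_monom (Suc i) j t u"
      "std_monom i j t u + Poly_Mapping.single 1 1 = std_monom i (Suc j) t u"
      "std_monom i j t u + Poly_Mapping.single 2 1 = std_monom i j (Suc t) u"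
      by (rule poly_mapping_eqI, simp add: std_monom_def lookup_add lookup_single when_def)+
    moreover have "l = 0 \<or> l = 1 \<or> l = 2" using l by linarith
    ultimately show ?thesis using * unfolding std_monoms_def by auto
  qed
  then have "Poly_Mapping.keys (x * xv l) \<subseteq> std_monoms"
    using keys_mult[of x "xv l"] x by (auto simp: mvar_def std_span_def split: if_splits)
  moreover have "x * xv l \<in> polys"
    using x l by (intro subring_setD(4)[OF subring_set_vars_in] vars_in_mvar) (auto simp: std_span_def)
  ultimately show ?thesis by (simp add: std_span_def)
qed

section \<open>Injectivity of the parametrization on normal forms\<close>

abbreviation param_hom :: "'a mpoly \<Rightarrow> 'a mpoly" where
  "param_hom \<equiv> eval_hom Cst (toric d (xv 0) (xv 1) (xv 2))"

text \<open>The exponent of \<open>z\<close> in the image of the standard factor of index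
  \<open>u\<close>.\<close>

definition z_exp :: "nat \<Rightarrow> nat" where
  "z_exp u = (if u = 0 then 0 else if u \<le> k then \<epsilon> + 2 * (k - u) else \<epsilon> + \<epsilon> + 2 * (2 * k - u))"

lemma param_hom_std_factor:
  assumes "u < d"
  shows "param_hom (mn (std_factor u)) = (xv 0 * xv 1) ^ u * xv 2 ^ z_exp u"
proof -
  have W: "i \<le> k \<Longrightarrow> param_hom (w i) = (xv 0 * xv 1) ^ (k - i) * xv 2 ^ (\<epsilon> + 2 * i)" for i
    by (simp add: eval_hom_mvar[OF is_ring_hom_Cst] toric_w)
  consider "u = 0" | "1 \<le> u" "u \<le> k" | "k < u" by linarith
  then show ?thesis
  proof cases
    case 1
    then show ?thesis by (simp add: mon_std_factor z_exp_def is_ring_homD[OF is_ring_hom_eval_hom[OF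
      is_ring_hom_Cst]])
  next
    case 2
    then show ?thesis using W[of "k - u"] by (simp add: mon_std_factor z_exp_def)
  next
    case 3
    have u: "2 * k - u \<le> k" "k + (k - (2 * k - u)) = u" using 3 assms d by auto
    have "param_hom (mn (std_factor u)) = param_hom (w 0) * param_hom (w (2 * k - u))"
      using 3 by (simp add: mon_std_factor is_ring_homD[OF is_ring_hom_eval_hom[OF is_ring_hom_Cst]])
    also have "\<dots> = ((xv 0 * xv 1) ^ k * xv 2 ^ \<epsilon>) *
        ((xv 0 * xv 1) ^ (k - (2 * k - u)) * xv 2 ^ (\<epsilon> + 2 * (2 * k - u)))"
      using W[of 0] unfolding W[OF u(1)] by simp
    also have "\<dots> = (xv 0 * xv 1) ^ (k + (k - (2 * k - u))) * xv 2 ^ (\<epsilon> + (\<epsilon> + 2 * (2 * k - u)))"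
      by (simp only: power_add mult_ac)
    finally show ?thesis using 3 unfolding u(2) by (simp add: z_exp_def add.assoc)
  qed
qed

definition xyz_monom :: "nat \<Rightarrow> nat \<Rightarrow> nat \<Rightarrow> nat \<Rightarrow>\<^sub>0 nat" where
  "xyz_monom e f g = Poly_Mapping.single 0 e + Poly_Mapping.single 1 f + Poly_Mapping.single 2 g"

lemma param_hom_std_monom:
  assumes "u < d"
  shows "param_hom (mn (std_monom i j l u)) = mn (xyz_monom (u + d * i) (u + d * j) (z_exp u + d * l))"
proof -
  have "param_hom (xv 0) = xv 0 ^ d" "param_hom (xv 1) = xv 1 ^ d" "param_hom (w k) = xv 2 ^ d"
    by (simp_all add: eval_hom_mvar[OF is_ring_hom_Cst] w_index_k) (simp_all add: toric_def)
  then have "param_hom (mn (std_monom i j l u)) =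
      (xv 0 ^ d) ^ i * (xv 1 ^ d) ^ j * (xv 2 ^ d) ^ l * ((xv 0 * xv 1) ^ u * xv 2 ^ z_exp u)"
    by (simp only: mon_std_monom is_ring_homD[OF is_ring_hom_eval_hom[OF is_ring_hom_Cst]]
      param_hom_std_factor[OF assms])
  also have "\<dots> = xv 0 ^ (u + d * i) * xv 1 ^ (u + d * j) * xv 2 ^ (z_exp u + d * l)"
    by (simp only: power_add power_mult power_mult_distrib mult_ac)
  finally show ?thesis by (simp add: xyz_monom_def mvar_power mult_single)
qed

lemma xyz_monom_inj:
  assumes "xyz_monom e f g = xyz_monom e' f' g'"
  shows "e = e' \<and> f = f' \<and> g = g'"
proof -
  have "Poly_Mapping.lookup (xyz_monom e f g) v = Poly_Mapping.lookup (xyz_monom e' f' g') v" for v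
    using assms by simp
  from this[of 0] this[of 1] this[of 2] show ?thesis
    by (simp add: xyz_monom_def lookup_add lookup_single when_def)
qed

text \<open>Standard monomials are mapped to pairwise different monomials, so nothing cancels: the
  exponent of \<open>x\<close> is \<open>u + d * i\<close> with \<open>u < d\<close>, which
  determines \<open>u\<close> and \<open>i\<close>, and the other two exponents then determine
  \<open>j\<close> and \<open>l\<close>.\<close>

lemma std_span_param_hom:
  assumes q: "q \<in> std_span" and z: "param_hom q = 0"
  shows "q = (0 :: 'a mpoly)"
proof -
  have "\<forall>m\<in>std_monoms. \<exists>t. param_hom (mn m) = (mn t :: 'a mpoly) \<and>
    (\<forall>m'\<in>std_monoms. param_hom (mn m') = (mn t :: 'a mpoly) \<longrightarrow> m' = m)"
  proof
    fix m assume "m \<in> std_monoms"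
    then obtain i j l u where m: "m = std_monom i j l u" "u < d" by (auto simp: std_monoms_def)
    let ?t = "xyz_monom (u + d * i) (u + d * j) (z_exp u + d * l)"
    have "m' = m" if m': "m' \<in> std_monoms" "param_hom (mn m') = (mn ?t :: 'a mpoly)" for m'
    proof -
      obtain i' j' l' u' where m'': "m' = std_monom i' j' l' u'" "u' < d" using m'(1) by (auto simp:
        std_monoms_def)
      have "(mn (xyz_monom (u' + d * i') (u' + d * j') (z_exp u' + d * l')) :: 'a mpoly) = mn ?t"
        using m'(2) param_hom_std_monom[OF m''(2), of i' j' l'] m''(1) by simp
      then have "xyz_monom (u' + d * i') (u' + d * j') (z_exp u' + d * l') = ?t"
        by (metis keys_single singleton_inject zero_neq_one)
      then have *: "u' + d * i' = u + d * i" "u' + d * j' = u + d * j" "z_exp u' + d * l' =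
        z_exp u + d * l"
        using xyz_monom_inj by blast+
      have "u' = u"
        using arg_cong[OF *(1), of "\<lambda>n. n mod d"] m(2) m''(2) by simp
      then show ?thesis using * d m m'' by simp
    qed
    then show "\<exists>t. param_hom (mn m) = (mn t :: 'a mpoly) \<and>
      (\<forall>m'\<in>std_monoms. param_hom (mn m') = (mn t :: 'a mpoly) \<longrightarrow> m' = m)"
      using param_hom_std_monom[OF m(2)] m(1) by blast
  qed
  then obtain t where t: "\<And>m. m \<in> std_monoms \<Longrightarrow> param_hom (mn m) = (mn (t m) :: 'a mpoly)"
    "\<And>m m'. m \<in> std_monoms \<Longrightarrow> m' \<in> std_monoms \<Longrightarrow> param_hom (mn m') = (mn (t m) :: 'a mpoly) \<Longrightarrow> m' = m"
    by metis
  have keys: "Poly_Mapping.keys q \<subseteq> std_monoms" using q by (simp add: std_span_def)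
  have "param_hom q = (\<Sum>m\<in>Poly_Mapping.keys q. Cst (Poly_Mapping.lookup q m) * param_hom (mn m))"
    by (simp add: eval_hom_def lin_ext_def lin_ext_single is_ring_hom_Cst)
  also have "\<dots> = (\<Sum>m\<in>Poly_Mapping.keys q. Poly_Mapping.single (t m) (Poly_Mapping.lookup q m))"
    using keys t(1) by (intro sum.cong refl) (auto simp: mult_single)
  finally have sum: "(\<Sum>m\<in>Poly_Mapping.keys q. Poly_Mapping.single (t m) (Poly_Mapping.lookup q m)) = 0"
    using z by simp
  have "Poly_Mapping.lookup q m = 0" if m: "m \<in> Poly_Mapping.keys q" for m
  proof -
    have "0 = (\<Sum>m'\<in>Poly_Mapping.keys q. Poly_Mapping.lookup (Poly_Mapping.single (t m')
      (Poly_Mapping.lookup q m')) (t m))"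
      using arg_cong[OF sum, of "\<lambda>p. Poly_Mapping.lookup p (t m)"] by (simp add: lookup_sum)
    also have "\<dots> = (\<Sum>m'\<in>Poly_Mapping.keys q. if m' = m then Poly_Mapping.lookup q m' else 0)"
    proof (rule sum.cong[OF refl])
      fix m' assume m': "m' \<in> Poly_Mapping.keys q"
      show "Poly_Mapping.lookup (Poly_Mapping.single (t m') (Poly_Mapping.lookup q m')) (t m) =
          (if m' = m then Poly_Mapping.lookup q m' else 0)"
      proof (cases "m' = m")
        case False
        have "t m' \<noteq> t m"
        proof
          assume "t m' = t m"
          then have "param_hom (mn m') = mn (t m)" using t(1)[of m'] m' keys by auto
          then show False using t(2)[of m m'] m m' keys False by blast
        qed
        then show ?thesis using False by (simp add: lookup_single when_def)
      qed simp
    qed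
    finally show ?thesis using m by simp
  qed
  then show ?thesis by (intro poly_mapping_eqI) (metis in_keys_iff lookup_zero)
qed

text \<open>Passing to a normal form costs only elements of the generated ideal, and on normal forms
  the homomorphism is injective.\<close>

lemma kernel:
  assumes p: "p \<in> polys" and z: "param_hom p = 0"
  shows "p \<in> idl gens"
proof -
  obtain q where q: "q \<in> std_span" "p - q \<in> idl gens" using std_span_rep[OF p] by blast
  have "param_hom (p - q) = 0" by (rule idl_toric[OF is_ring_hom_Cst q(2)])
  then have "param_hom q = 0" using z by (simp add: is_ring_homD[OF is_ring_hom_eval_hom[OF
    is_ring_hom_Cst]])
  then have "q = 0" using std_span_param_hom[OF q(1)] by blast
  then show ?thesis using q(2) by simp
qed

definition surface_ideal :: "'a mpoly set" where
  "surface_ideal = idl gens \<inter> polys"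

lemma surface_ideal_genideal: "surface_ideal = genideal (mpoly_ring (k + 3)) (gens)"
  by (simp add: surface_ideal_def genideal_mpoly[OF gens_vars])

lemma surface_ideal_iff: "p \<in> surface_ideal \<longleftrightarrow> p \<in> polys \<and> param_hom p = 0"
  unfolding surface_ideal_def using idl_toric[OF is_ring_hom_Cst] kernel by blast

lemma ideal_surface_ideal: "ideal (surface_ideal :: 'a mpoly set) (mpoly_ring (k + 3))"
proof -
  interpret cring "mpoly_ring (k + 3) :: 'a mpoly ring" by (rule cring_mpoly_ring)
  show ?thesis unfolding surface_ideal_genideal
    by (rule genideal_ideal) (simp add: carrier_mpoly_ring gens_vars)
qed

lemma param_hom_vars: "p \<in> polys \<Longrightarrow> param_hom p \<in> vars_in {..<3}"
  by (rule eval_hom_in_subring_set[OF subring_set_vars_in vars_in_Cst])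
    (auto simp: toric_def intro!: subring_setD(4)[OF subring_set_vars_in] subring_set_power[OF
      subring_set_vars_in] vars_in_mvar)

text \<open>The criterion with \<open>r = 3\<close>: standard monomials stay standard under
  multiplication by the first three variables, and the parametrization takes its values in three
  variables.\<close>

theorem cohen_macaulay_surface_ideal:
  "cohen_macaulay_ideal (mpoly_ring (k + 3)) (surface_ideal :: 'a mpoly set)"
proof (rule cohen_macaulay_criterion[OF ideal_surface_ideal, where r = 3 and \<psi> = param_hom and N =
  std_span])
  note e = is_ring_homD[OF is_ring_hom_eval_hom[OF is_ring_hom_Cst]]
  show "1 \<notin> (surface_ideal :: 'a mpoly set)" by (simp add: surface_ideal_iff e)
  show "is_ring_hom (param_hom :: 'a mpoly \<Rightarrow> _)" by (rule is_ring_hom_eval_hom[OF is_ring_hom_Cst])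
  show "param_hom (Cst c) = (Cst c :: 'a mpoly)" for c by (simp add: eval_hom_Cst[OF is_ring_hom_Cst])
  show "param_hom p \<in> vars_in {..<3}" if "p \<in> polys" for p :: "'a mpoly" using param_hom_vars[OF that] .
  show "p \<in> surface_ideal" if "p \<in> polys" "param_hom p = 0" for p :: "'a mpoly"
    using that by (simp add: surface_ideal_iff)
  show "std_span \<inter> (surface_ideal :: 'a mpoly set) \<subseteq> {0}" using std_span_param_hom by (auto simp:
    surface_ideal_iff)
  show "\<exists>q\<in>std_span. p - q \<in> (surface_ideal :: 'a mpoly set)" if p: "p \<in> polys" for p
  proof -
    obtain q where q: "q \<in> std_span" "p - q \<in> idl gens" using std_span_rep[OF p] by blast
    then have "p - q \<in> polys" using p subring_setD(3)[OF subring_set_vars_in] by (auto simp: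
      std_span_def)
    then show ?thesis using q by (auto simp: surface_ideal_def)
  qed
qed (simp_all add: std_span_0 std_span_diff std_span_Cst std_span_xv, auto simp: std_span_def)

end

section \<open>The resolutions as complexes of functions\<close>

lemma sum_offdiagonal:
  fixes g :: "nat \<Rightarrow> nat \<Rightarrow> 'r::ab_group_add"
  shows "(\<Sum>i<n. \<Sum>l\<in>{..<n} - {i}. g i l) = (\<Sum>i<n. \<Sum>l<i. g i l + g l i)"
proof (induction n)
  case (Suc n)
  have "(\<Sum>l\<in>{..<Suc n} - {i}. g i l) = (\<Sum>l\<in>{..<n} - {i}. g i l) + g i n" if "i < n" for i
  proof -
    have "{..<Suc n} - {i} = insert n ({..<n} - {i})" using that by auto
    then show ?thesis by (simp add: add.commute)
  qed
  moreover have "{..<Suc n} - {n} = {..<n}" by auto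
  ultimately have "(\<Sum>i<Suc n. \<Sum>l\<in>{..<Suc n} - {i}. g i l) =
      (\<Sum>i<n. (\<Sum>l\<in>{..<n} - {i}. g i l) + g i n) + (\<Sum>l<n. g n l)"
    by simp
  also have "\<dots> = (\<Sum>i<n. \<Sum>l<i. g i l + g l i) + (\<Sum>l<n. g n l + g l n)"
    by (simp add: sum.distrib Suc add_ac)
  finally show ?case by simp
qed simp

lemma koszul_koszul_empty:
  "koszul n a (koszul n b w) {} = (\<Sum>i<n. \<Sum>l<i. w {i, l} * (a i * b l - a l * b i))"
proof -
  have "koszul n a (koszul n b w) {} = (\<Sum>i<n. \<Sum>l\<in>{..<n} -
    {i}. a i * (koszul_sign l {i} * b l * w {l, i}))"
    by (simp add: koszul_empty koszul_def[of n b] sum_distrib_left)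
  also have "\<dots> = (\<Sum>i<n. \<Sum>l<i. a i * (koszul_sign l {i} * b l * w {l, i}) +
    a l * (koszul_sign i {l} * b i * w {i, l}))"
    by (rule sum_offdiagonal)
  also have "\<dots> = (\<Sum>i<n. \<Sum>l<i. w {i, l} * (a i * b l - a l * b i))"
  proof (intro sum.cong refl)
    fix i l :: nat assume "l \<in> {..<i}"
    then have "{s \<in> {i}. s < l} = {}" "{s \<in> {l}. s < i} = {l}" by auto
    then have ks: "koszul_sign l {i} = (1::'a)" "koszul_sign i {l} =
      (- 1::'a)" by (simp_all only: koszul_sign_def) simp_all
    have W: "w {l, i} = w {i, l}" by (rule arg_cong[where f = w], rule insert_commute)
    show "a i * (koszul_sign l {i} * b l * w {l, i}) + a l * (koszul_sign i {l} * b i * w {i, l}) =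
        w {i, l} * (a i * b l - a l * b i)"
      unfolding ks W
      by (simp only: mult_1_left mult_minus_left mult_minus_right right_diff_distrib
        add_uminus_conv_diff mult_ac)
  qed
  finally show ?thesis .
qed

definition unit_fun :: "'b \<Rightarrow> 'b \<Rightarrow> 'r::zero_neq_one" where
  "unit_fun e = (\<lambda>x. if x = e then 1 else 0)"

lemma end_map_1: "end_map n a b 1 u ({}, 0) = (\<Sum>i<n. \<Sum>l<i. u ({i, l}, 0) * (a i * b l - a l * b i))"
  by (simp add: end_map_def koszul_koszul_empty)

lemma end_map_zero: "end_map n a b j (\<lambda>e. 0) = (\<lambda>e. 0)"
  using end_map_smult[of n a b j 0 "\<lambda>e. 0"] by simp

lemma end_map_image:
  "p \<in> idl (minors n a b) \<longleftrightarrow> (\<exists>u\<in>supported_on (en_basis n 1). end_map n a b 1 u ({}, 0) =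
    (p :: 'r::comm_ring_1))"
proof
  assume "\<exists>u\<in>supported_on (en_basis n 1). end_map n a b 1 u ({}, 0) = p"
  then obtain u where "end_map n a b 1 u ({}, 0) = p" by blast
  then have u: "p = (\<Sum>i<n. \<Sum>l<i. u ({i, l}, 0) * (a i * b l - a l * b i))"
    by (simp only: end_map_1)
  have "a i * b l - a l * b i \<in> idl (minors n a b)" if "l < i" "i < n" for i l
    using idl.span_neg[OF idl.span_base[OF minorsI[OF that, of a b]]] by simp
  then show "p \<in> idl (minors n a b)"
    unfolding u by (intro idl.span_sum idl.span_scale) auto
next
  assume "p \<in> idl (minors n a b)"
  then show "\<exists>u\<in>supported_on (en_basis n 1). end_map n a b 1 u ({}, 0) = p"
  proof (induction rule: idl.span_induct_alt)
    case base
    show ?case by (intro bexI[of _ "\<lambda>_. 0"]) (simp_all add: end_map_zero supported_on_def)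
  next
    case (step c x y)
    obtain l i where li: "x = a l * b i - a i * b l" "l < i" "i < n" using step(1) by (auto simp:
      minors_def)
    obtain v where v: "v \<in> supported_on (en_basis n 1)" "end_map n a b 1 v ({}, 0) =
      y" using step(2) by blast
    \<comment> \<open>For \<open>l < i\<close> the double contraction yields
      \<open>a i * b l - a l * b i\<close>, the negative of the minor; hence the sign.\<close>
    define u :: "nat set \<times> nat \<Rightarrow> 'r" where "u = (\<lambda>e. - c * unit_fun ({i, l}, 0) e)"
    have "({i, l}, 0) \<in> en_basis n 1" using li by (simp add: en_basis_def)
    then have "u \<in> supported_on (en_basis n 1)" by (auto simp: supported_on_def u_def unit_fun_def)
    moreover have "end_map n a b 1 u ({}, 0) = c * x"
    proof -
      have "end_map n a b 1 u ({}, 0) =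
          (\<Sum>i'<n. \<Sum>l'<i'. if i' = i then if l' = l then c * x else 0 else 0)"
        unfolding end_map_1
      proof (intro sum.cong refl)
        fix i' l' :: nat assume "l' \<in> {..<i'}"
        then have "{i', l'} = {i, l} \<longleftrightarrow> i' = i \<and> l' = l" using li(2) by (auto simp: doubleton_eq_iff)
        then show "u ({i', l'}, 0) * (a i' * b l' - a l' * b i') = (if i' = i then if l' =
          l then c * x else 0 else 0)"
          by (cases "i' = i \<and> l' = l") (auto simp: u_def unit_fun_def li(1) right_diff_distrib)
      qed
      also have "\<dots> = (\<Sum>i'<n. if i' = i then \<Sum>l'<i'. if l' = l then c * x else 0 else 0)"
        by (intro sum.cong refl) auto
      also have "\<dots> = c * x" using li by simp
      finally show ?thesis .
    qed
    ultimately show ?case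
      using v by (intro bexI[of _ "\<lambda>e. u e + v e"]) (auto simp: end_map_add supported_on_def)
  qed
qed

text \<open>Combines the degree and the minimality of a matrix entry: in degree 0 only the zero
  polynomial qualifies.\<close>

definition pos_piece :: "nat \<Rightarrow> int \<Rightarrow> 'a::comm_ring_1 mpoly set" where
  "pos_piece N e = {p \<in> graded_piece N e. 0 \<notin> Poly_Mapping.keys p}"

lemma pos_piece_0: "0 \<in> pos_piece N e"
  by (simp add: pos_piece_def graded_piece_0)

lemma pos_piece_minus: "p \<in> pos_piece N e \<Longrightarrow> - p \<in> pos_piece N e"
  by (simp add: pos_piece_def graded_piece_minus in_keys_iff)

lemma pos_piece_add: "p \<in> pos_piece N e \<Longrightarrow> q \<in> pos_piece N e \<Longrightarrow> p + q \<in> pos_piece N e"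
  by (simp add: pos_piece_def graded_piece_add in_keys_iff lookup_add)

lemma pos_piece_sum: "(\<And>i. i \<in> A \<Longrightarrow> f i \<in> pos_piece N e) \<Longrightarrow> sum f A \<in> pos_piece N e"
  by (induction A rule: infinite_finite_induct) (simp_all add: pos_piece_0 pos_piece_add)

lemma pos_pieceI: "p \<in> graded_piece N e \<Longrightarrow> e > 0 \<Longrightarrow> p \<in> pos_piece N e"
  by (auto simp: pos_piece_def graded_piece_iff weight_def dest: bspec[of _ _ 0])

lemma pos_piece_koszul_sign:
  assumes "p \<in> pos_piece N e"
  shows "koszul_sign i S * p \<in> pos_piece N e"
proof -
  have "koszul_sign i S = (1::'a mpoly) \<or> koszul_sign i S = (-1::'a mpoly)"
    unfolding koszul_sign_def by (metis neg_one_even_power neg_one_odd_power)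
  then show ?thesis using assms by (auto simp: pos_piece_minus)
qed

lemma koszul_unit_pos_piece:
  fixes x :: "nat \<Rightarrow> 'a::comm_ring_1 mpoly"
  assumes x: "\<And>i. i < n \<Longrightarrow> x i \<in> graded_piece N (int (\<delta> i))" "\<And>i. i < n \<Longrightarrow> \<delta> i > 0"
    and S: "S \<subseteq> {..<n}"
  shows "koszul n x (\<lambda>T. if T = S' \<and> Q then 1 else 0) S \<in> pos_piece N (int (sum \<delta> S') - int (sum \<delta> S))"
  unfolding koszul_def
proof (rule pos_piece_sum)
  fix i assume i: "i \<in> {..<n} - S"
  have fin: "finite S" using S finite_subset by blast
  show "koszul_sign i S * x i * (if insert i S = S' \<and> Q then 1 else 0) \<in>
    pos_piece N (int (sum \<delta> S') - int (sum \<delta> S))"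
  proof (cases "insert i S = S' \<and> Q")
    case True
    then have "int (sum \<delta> S') - int (sum \<delta> S) = int (\<delta> i)" using i fin by auto
    moreover have "x i \<in> pos_piece N (int (\<delta> i))" using x[of i] i by (intro pos_pieceI) auto
    ultimately show ?thesis using True pos_piece_koszul_sign by simp
  qed (simp only: if_False mult_zero_right pos_piece_0)
qed

text \<open>Both entries of column \<open>i\<close> have the degree \<open>\<delta> i\<close>, so
  the basis elements belonging to \<open>S\<close> sit in degree \<open>sum \<delta> S\<close>,
  whatever the exponent of the divided power.\<close>

lemma end_map_unit_pos_piece:
  fixes a b :: "nat \<Rightarrow> 'a::comm_ring_1 mpoly"
  assumes a: "\<And>i. i < n \<Longrightarrow> a i \<in> graded_piece N (int (\<delta> i))"
    and b: "\<And>i. i < n \<Longrightarrow> b i \<in> graded_piece N (int (\<delta> i))" and \<delta>: "\<And>i. i < n \<Longrightarrow> \<delta> i > 0"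
    and e: "(S, p) \<in> en_basis n j" and e': "(S', p') \<in> en_basis n (Suc j)"
  shows "end_map n a b (Suc j) (unit_fun (S', p')) (S, p) \<in>
    pos_piece N (int (sum \<delta> S') - int (sum \<delta> S))"
proof (cases "j = 0")
  case True
  then have Sp: "S = {}" "p = 0" using e by (auto simp: en_basis_def)
  have "end_map n a b 1 (unit_fun (S', p')) ({}, 0) \<in> pos_piece N (int (sum \<delta> S'))"
    unfolding end_map_1
  proof (intro pos_piece_sum)
    fix i l assume i: "i \<in> {..<n}" "l \<in> {..<i}"
    show "unit_fun (S', p') ({i, l}, 0) * (a i * b l - a l * b i) \<in> pos_piece N (int (sum \<delta> S'))"
    proof (cases "S' = {i, l} \<and> p' = 0")
      case True
      then have "sum \<delta> S' = \<delta> i + \<delta> l" using i by simp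
      then have "a i * b l - a l * b i \<in> graded_piece N (int (sum \<delta> S'))"
        using i graded_piece_diff[OF graded_piece_mult[OF a[of i] b[of l]], of "a l * b i"]
          graded_piece_mult[OF a[of l] b[of i]] by (simp add: add.commute)
      then have "a i * b l - a l * b i \<in> pos_piece N (int (sum \<delta> S'))"
        using \<delta>[of i] i True by (intro pos_pieceI) auto
      then show ?thesis using True by (simp add: unit_fun_def)
    qed (auto simp: unit_fun_def pos_piece_0)
  qed
  then show ?thesis using True Sp by simp
next
  case False
  then have S: "S \<subseteq> {..<n}" "p < j" using e by (auto simp: en_basis_def)
  have *: "(\<lambda>T. unit_fun (S', p') (T, q)) = (\<lambda>T. if T = S' \<and> q = p' then 1 else 0)" for q
    by (auto simp: unit_fun_def)
  show ?thesis
    using False S(2) koszul_unit_pos_piece[OF a \<delta> S(1)] koszul_unit_pos_piece[OF b \<delta> S(1)]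
    by (simp add: end_map_def * pos_piece_add)
qed

subsection \<open>Cones\<close>

text \<open>The mapping cone of multiplication by \<open>f\<close>: \<open>Inl\<close> marks the
  target complex, \<open>Inr\<close> the source shifted by one step, with the sign that makes the
  square vanish. In degree 1 the shifted part has reached its end and maps into the target
  only.\<close>

definition cone_map :: "nat \<Rightarrow> (nat \<Rightarrow> 'r::comm_ring_1) \<Rightarrow> (nat \<Rightarrow> 'r) \<Rightarrow> 'r \<Rightarrow> nat \<Rightarrow>
    ((nat set \<times> nat) + (nat set \<times> nat) \<Rightarrow> 'r) \<Rightarrow> (nat set \<times> nat) + (nat set \<times> nat) \<Rightarrow> 'r" where
  "cone_map n a b f j u = (\<lambda>x. case x of
     Inl e \<Rightarrow> end_map n a b j (\<lambda>e. u (Inl e)) e + f * u (Inr e)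
   | Inr e \<Rightarrow> if j = 1 then 0 else - end_map n a b (j - 1) (\<lambda>e. u (Inr e)) e)"

definition cone_basis :: "nat \<Rightarrow> nat \<Rightarrow> ((nat set \<times> nat) + (nat set \<times> nat)) set" where
  "cone_basis n j = Inl ` en_basis n j \<union> (if j = 0 then {} else Inr ` en_basis n (j - 1))"

lemma cone_basis_Inl: "Inl e \<in> cone_basis n j \<longleftrightarrow> e \<in> en_basis n j"
  by (auto simp: cone_basis_def)

lemma cone_basis_Inr: "Inr e \<in> cone_basis n j \<longleftrightarrow> j \<ge> 1 \<and> e \<in> en_basis n (j - 1)"
  by (auto simp: cone_basis_def)

lemma cone_map_add: "cone_map n a b f j (\<lambda>e. u e + v e) =
  (\<lambda>e. cone_map n a b f j u e + cone_map n a b f j v e)"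
  by (rule ext) (simp add: cone_map_def end_map_add algebra_simps split: sum.split)

lemma cone_map_smult: "cone_map n a b f j (\<lambda>e. c * u e) = (\<lambda>e. c * cone_map n a b f j u e)"
  by (rule ext) (simp add: cone_map_def end_map_smult distrib_left mult.left_commute split: sum.split)

lemma supp_onD: "u \<in> supported_on X \<Longrightarrow> e \<notin> X \<Longrightarrow> u e = 0"
  by (simp add: supported_on_def)

lemma cone_supp:
  assumes "u \<in> supported_on (cone_basis n j)"
  shows "(\<lambda>e. u (Inl e)) \<in> supported_on (en_basis n j)" "j \<ge> 1 \<Longrightarrow>
    (\<lambda>e. u (Inr e)) \<in> supported_on (en_basis n (j - 1))"
    "j = 0 \<Longrightarrow> u (Inr e) = 0"
  using assms by (auto simp: supported_on_def cone_basis_Inl cone_basis_Inr)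

lemma cone_map_supp:
  assumes u: "u \<in> supported_on (cone_basis n (Suc j))"
  shows "cone_map n a b f (Suc j) u \<in> supported_on (cone_basis n j)"
  unfolding supported_on_def
proof (clarify)
  fix x assume x: "x \<notin> cone_basis n j"
  have L: "end_map n a b (Suc j) (\<lambda>e. u (Inl e)) \<in> supported_on (en_basis n j)"
    by (rule end_map_supp[OF cone_supp(1)[OF u]])
  have R: "(\<lambda>e. u (Inr e)) \<in> supported_on (en_basis n j)" using cone_supp(2)[OF u] by simp
  show "cone_map n a b f (Suc j) u x = 0"
  proof (cases x)
    case (Inl e)
    then have "e \<notin> en_basis n j" using x by (simp add: cone_basis_Inl)
    then show ?thesis using supp_onD[OF L] supp_onD[OF R] by (simp add: cone_map_def Inl)
  next
    case (Inr e)
    show ?thesis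
    proof (cases j)
      case (Suc i)
      then have "e \<notin> en_basis n i" using x Inr by (simp add: cone_basis_Inr)
      moreover have "end_map n a b (Suc i) (\<lambda>e. u (Inr e)) \<in> supported_on (en_basis n i)"
        using end_map_supp[of "\<lambda>e. u (Inr e)" n i] R Suc by simp
      ultimately show ?thesis using supp_onD by (simp add: cone_map_def Inr Suc)
    qed (simp add: cone_map_def Inr)
  qed
qed

lemma end_map_minus: "end_map n a b j (\<lambda>e. - u e) = (\<lambda>e. - end_map n a b j u e)"
  using end_map_smult[of n a b j "-1" u] by simp

lemma cone_map_cone_map:
  fixes a :: "nat \<Rightarrow> 'r::{idom,ring_char_0}"
  assumes "u \<in> supported_on (cone_basis n (Suc (Suc j)))"
  shows "cone_map n a b f (Suc j) (cone_map n a b f (Suc (Suc j)) u) x = 0"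
proof -
  let ?L = "\<lambda>e. u (Inl e)" and ?R = "\<lambda>e. u (Inr e)"
  have "end_map n a b (Suc j) (\<lambda>e. end_map n a b (Suc (Suc j)) ?L e + f * ?R e) =
      (\<lambda>e. f * end_map n a b (Suc j) ?R e)"
    by (rule ext) (simp add: end_map_add end_map_smult end_map_end_map)
  moreover have "end_map n a b j (\<lambda>e. - end_map n a b (Suc j) ?R e) e = 0" if "j \<ge> 1" for e
    using end_map_end_map[of n a b "j - 1" ?R e] that by (simp add: end_map_minus)
  ultimately show ?thesis by (auto simp: cone_map_def split: sum.split)
qed

text \<open>The long exact sequence of the cone made explicit: the \<open>Inr\<close> part of a
  cycle is a boundary, by exactness or, at the bottom, because \<open>f\<close> is a nonzerodivisor
  modulo the minors. Correcting the \<open>Inl\<close> part by \<open>f\<close> times its preimage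
  leaves a cycle of the Eagon-Northcott complex.\<close>

lemma (in eagon_northcott) cone_map_exact:
  assumes nzd: "\<And>r. f * r \<in> idl (minors n a b) \<Longrightarrow> r \<in> idl (minors n a b)"
    and u: "u \<in> supported_on (cone_basis n (Suc j))" and z: "cone_map n a b f (Suc j) u = (\<lambda>e. 0)"
  shows "\<exists>v\<in>supported_on (cone_basis n (Suc (Suc j))). cone_map n a b f (Suc (Suc j)) v = u"
proof -
  let ?d = "end_map n a b"
  let ?L = "\<lambda>e. u (Inl e)" and ?R = "\<lambda>e. u (Inr e)"
  have L: "?L \<in> supported_on (en_basis n (Suc j))" and R: "?R \<in> supported_on (en_basis n j)"
    using cone_supp(1,2)[OF u] by auto
  have zL: "?d (Suc j) ?L e + f * ?R e = 0" for e
    using fun_cong[OF z, of "Inl e"] by (simp add: cone_map_def)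
  have "\<exists>v\<in>supported_on (en_basis n (Suc j)). ?d (Suc j) v = ?R"
  proof (cases j)
    case 0
    have "f * ?R ({}, 0) = ?d 1 (\<lambda>e. - ?L e) ({}, 0)"
      using zL[of "({}, 0)"] 0 by (simp add: end_map_minus eq_neg_iff_add_eq_0 add.commute)
    moreover have "(\<lambda>e. - ?L e) \<in> supported_on (en_basis n 1)" using L 0 by (simp add: supported_on_def)
    ultimately have "f * ?R ({}, 0) \<in> idl (minors n a b)" unfolding end_map_image by metis
    then have "?R ({}, 0) \<in> idl (minors n a b)" by (rule nzd)
    then obtain v where v: "v \<in> supported_on (en_basis n 1)" "?d 1 v ({}, 0) = ?R ({}, 0)"
      unfolding end_map_image by blast
    have "?d 1 v e = ?R e" for e
    proof (cases "e = ({}, 0)")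
      case False
      then have "e \<notin> en_basis n 0" by (simp add: en_basis_def)
      then show ?thesis
        using supp_onD[OF end_map_supp[of v n 0 a b]] supp_onD[OF R] v(1) 0 by simp
    qed (use v(2) in simp)
    then have "?d 1 v = ?R" by (rule ext)
    then show ?thesis using v(1) 0 by auto
  next
    case (Suc i)
    have "?d (Suc i) ?R = (\<lambda>e. 0)"
    proof
      fix e show "?d (Suc i) ?R e = 0" using fun_cong[OF z, of "Inr e"] by (simp add: cone_map_def Suc)
    qed
    then show ?thesis using end_map_exact[of ?R i] R Suc by simp
  qed
  then obtain v where v: "v \<in> supported_on (en_basis n (Suc j))" "?d (Suc j) v = ?R" by blast
  let ?w = "\<lambda>e. ?L e + f * v e"
  have "?w \<in> supported_on (en_basis n (Suc j))" using L v(1) by (simp add: supported_on_def)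
  moreover have "?d (Suc j) ?w = (\<lambda>e. 0)" using zL v(2) by (simp add: end_map_add end_map_smult)
  ultimately obtain t where t: "t \<in> supported_on (en_basis n (Suc (Suc j)))" "?d (Suc (Suc j)) t = ?w"
    using end_map_exact by blast
  define y where "y = case_sum t (\<lambda>e. - v e)"
  have "y \<in> supported_on (cone_basis n (Suc (Suc j)))"
    using t(1) v(1) by (auto simp: y_def supported_on_def cone_basis_Inl cone_basis_Inr split:
      sum.split)
  moreover have "cone_map n a b f (Suc (Suc j)) y = u"
  proof
    fix x show "cone_map n a b f (Suc (Suc j)) y x = u x"
    proof (cases x)
      case (Inl e)
      then show ?thesis using fun_cong[OF t(2), of e] by (simp add: cone_map_def y_def)
    next
      case (Inr e)
      then show ?thesis using fun_cong[OF v(2), of e] by (simp add: cone_map_def y_def end_map_minus)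
    qed
  qed
  ultimately show ?thesis by blast
qed

lemma cone_map_image:
  "p \<in> idl (insert f (minors n a b)) \<longleftrightarrow>
    (\<exists>u\<in>supported_on (cone_basis n 1). cone_map n a b f 1 u (Inl ({}, 0)) = (p :: 'r::comm_ring_1))"
proof
  assume "p \<in> idl (insert f (minors n a b))"
  then obtain c where "p - c * f \<in> idl (minors n a b)" by (auto simp: idl.span_insert)
  then obtain u where u: "u \<in> supported_on (en_basis n 1)" "end_map n a b 1 u ({}, 0) = p - c * f"
    unfolding end_map_image by blast
  let ?v = "case_sum u (\<lambda>e. c * unit_fun ({}, 0) e)"
  have "?v \<in> supported_on (cone_basis n 1)"
    using u(1) by (auto simp: supported_on_def cone_basis_Inl cone_basis_Inr unit_fun_def
      en_basis_def split: sum.split)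
  moreover have "cone_map n a b f 1 ?v (Inl ({}, 0)) = p"
    using u(2) by (simp add: cone_map_def unit_fun_def algebra_simps)
  ultimately show "\<exists>u\<in>supported_on (cone_basis n 1). cone_map n a b f 1 u (Inl ({}, 0)) = p" by blast
next
  assume "\<exists>u\<in>supported_on (cone_basis n 1). cone_map n a b f 1 u (Inl ({}, 0)) = p"
  then obtain u where u: "u \<in> supported_on (cone_basis n 1)"
    "p = end_map n a b 1 (\<lambda>e. u (Inl e)) ({}, 0) + f * u (Inr ({}, 0))"
    by (auto simp: cone_map_def)
  have "end_map n a b 1 (\<lambda>e. u (Inl e)) ({}, 0) \<in> idl (minors n a b)"
    unfolding end_map_image using cone_supp(1)[OF u(1)] by blast
  then have "p - u (Inr ({}, 0)) * f \<in> idl (minors n a b)" using u(2) by (simp add: mult.commute)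
  then show "p \<in> idl (insert f (minors n a b))" by (auto simp: idl.span_insert)
qed

lemma cone_map_unit_pos_piece:
  fixes a b :: "nat \<Rightarrow> 'a::comm_ring_1 mpoly"
  assumes a: "\<And>i. i < n \<Longrightarrow> a i \<in> graded_piece N (int (\<delta> i))"
    and b: "\<And>i. i < n \<Longrightarrow> b i \<in> graded_piece N (int (\<delta> i))" and \<delta>: "\<And>i. i < n \<Longrightarrow> \<delta> i > 0"
    and f: "f \<in> graded_piece N 2"
    and e: "x \<in> cone_basis n j" and e': "x' \<in> cone_basis n (Suc j)"
  defines "dg \<equiv> case_sum (\<lambda>e :: nat set \<times> nat. int (sum \<delta> (fst e))) (\<lambda>e :: nat set \<times> nat. int (sum \<delta>
    (fst e)) + 2)"
  shows "cone_map n a b f (Suc j) (unit_fun x') x \<in> pos_piece N (dg x' - dg x)"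
proof -
  have E: "end_map n a b (Suc i) (unit_fun (S', p')) (S, p) \<in>
    pos_piece N (int (sum \<delta> S') - int (sum \<delta> S))"
    if "(S, p) \<in> en_basis n i" "(S', p') \<in> en_basis n (Suc i)" for S S' p p' i
    using that by (intro end_map_unit_pos_piece a b \<delta>)
  have z: "end_map n a b i (\<lambda>e. 0) = (\<lambda>e. 0)" for i by (rule end_map_zero)
  have LL: "(\<lambda>e. unit_fun (Inl t) (Inl e)) = unit_fun t" "(\<lambda>e. unit_fun (Inl t) (Inr e)) = (\<lambda>e. 0)"
    "(\<lambda>e. unit_fun (Inr t) (Inr e)) = unit_fun t" "(\<lambda>e. unit_fun (Inr t) (Inl e)) = (\<lambda>e. 0)"
    for t :: "nat set \<times> nat"
    by (auto simp: unit_fun_def)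
  obtain S p where t: "x = Inl (S, p) \<or> x = Inr (S, p)" by (metis old.sum.exhaust surj_pair)
  obtain S' p' where t': "x' = Inl (S', p') \<or> x' = Inr (S', p')" by (metis old.sum.exhaust surj_pair)
  show ?thesis
  proof (cases "x = Inl (S, p)")
    case x: True
    then have S: "(S, p) \<in> en_basis n j" using e by (simp add: cone_basis_Inl)
    show ?thesis
    proof (cases "x' = Inl (S', p')")
      case x': True
      then have "(S', p') \<in> en_basis n (Suc j)" using e' by (simp add: cone_basis_Inl)
      then show ?thesis using E[OF S, of S' p'] x x' by (simp add: cone_map_def LL dg_def) (simp
        add: unit_fun_def)
    next
      case False
      then have x': "x' = Inr (S', p')" using t' by blast
      have "f \<in> pos_piece N 2" by (rule pos_pieceI[OF f]) simp
      then show ?thesis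
        using x x' by (simp add: cone_map_def LL z dg_def) (auto simp: unit_fun_def pos_piece_0)
    qed
  next
    case False
    then have x: "x = Inr (S, p)" using t by blast
    then have j: "j \<ge> 1" "(S, p) \<in> en_basis n (j - 1)" using e by (simp_all add: cone_basis_Inr)
    show ?thesis
    proof (cases "x' = Inl (S', p')")
      case x': True
      then show ?thesis using x by (simp add: cone_map_def LL z pos_piece_0)
    next
      case False
      then have x': "x' = Inr (S', p')" using t' by blast
      then have "(S', p') \<in> en_basis n (Suc (j - 1))" using e' j by (simp add: cone_basis_Inr)
      then show ?thesis
        using E[OF j(2), of S' p'] j x x' by (simp add: cone_map_def LL dg_def pos_piece_minus)
    qed
  qed
qed

section \<open>The quadric is regular modulo the minors\<close>

text \<open>The coefficient of \<open>x_0^i x_1^j\<close>, for polynomials in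
  \<open>x_0, x_1\<close> over the ring of the remaining variables.\<close>

definition coeff_x0_x1 :: "nat \<Rightarrow> nat \<Rightarrow> 'a::comm_ring_1 mpoly \<Rightarrow> 'a mpoly" where
  "coeff_x0_x1 i j = lin_ext Cst (\<lambda>m. if Poly_Mapping.lookup m 0 = i \<and> Poly_Mapping.lookup m 1 = j
     then mon (m - (Poly_Mapping.single 0 i + Poly_Mapping.single 1 j)) else 0)"

lemma coeff_x0_x1_add: "coeff_x0_x1 i j (p + q) = coeff_x0_x1 i j p + coeff_x0_x1 i j q"
  by (simp add: coeff_x0_x1_def lin_ext_add is_ring_hom_Cst)

lemma coeff_x0_x1_0: "coeff_x0_x1 i j 0 = 0"
  by (simp add: coeff_x0_x1_def lin_ext_0)

lemma coeff_x0_x1_diff: "coeff_x0_x1 i j (p - q) = coeff_x0_x1 i j p - coeff_x0_x1 i j q"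
  by (simp add: coeff_x0_x1_def lin_ext_diff is_ring_hom_Cst)

lemma coeff_x0_x1_single: "coeff_x0_x1 i j (Poly_Mapping.single m c) =
    (if Poly_Mapping.lookup m 0 = i \<and> Poly_Mapping.lookup m 1 = j
     then Poly_Mapping.single (m - (Poly_Mapping.single 0 i + Poly_Mapping.single 1 j)) c else 0)"
  by (simp add: coeff_x0_x1_def lin_ext_single is_ring_hom_Cst mult_single)

lemma coeff_x0_x1_mon_free:
  assumes "Poly_Mapping.lookup m 0 = 0" "Poly_Mapping.lookup m 1 = 0"
  shows "coeff_x0_x1 i j (mon m * p) = mon m * coeff_x0_x1 i j p"
proof (induction p rule: mpoly_induct)
  case (single n c)
  have "m + n - (Poly_Mapping.single 0 i + Poly_Mapping.single 1 j) =
      m + (n - (Poly_Mapping.single 0 i + Poly_Mapping.single 1 j))"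
    if "Poly_Mapping.lookup n 0 = i" "Poly_Mapping.lookup n 1 = j"
    using that assms by (intro poly_mapping_eqI) (auto simp: lookup_add lookup_minus lookup_single
      when_def)
  then show ?case using assms by (simp add: mult_single coeff_x0_x1_single lookup_add)
qed (simp add: distrib_left coeff_x0_x1_add)

lemma coeff_x0_x1_shift: "coeff_x0_x1 (Suc i) (Suc j) (mvar 0 * mvar 1 * p) = coeff_x0_x1 i j p"
proof (induction p rule: mpoly_induct)
  case (single n c)
  have "(Poly_Mapping.single 0 1 + Poly_Mapping.single 1 1 + n) -
      (Poly_Mapping.single 0 (Suc i) + Poly_Mapping.single 1 (Suc j)) =
      n - (Poly_Mapping.single 0 i + Poly_Mapping.single 1 j)"
    by (intro poly_mapping_eqI) (auto simp: lookup_add lookup_minus lookup_single when_def)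
  then show ?case by (simp add: mvar_def mult_single coeff_x0_x1_single lookup_add lookup_single)
qed (simp add: distrib_left coeff_x0_x1_add)

lemma coeff_x0_x1_expand:
  "\<exists>B. (\<forall>i j. i > B \<longrightarrow> coeff_x0_x1 i j p = 0) \<and>
    (\<forall>B'\<ge>B. p = (\<Sum>i\<le>B'. \<Sum>j\<le>B'. mvar 0 ^ i * mvar 1 ^ j * coeff_x0_x1 i j p))"
proof (induction p rule: mpoly_induct)
  case (single m c)
  let ?i = "Poly_Mapping.lookup m 0" and ?j = "Poly_Mapping.lookup m 1"
  have m: "Poly_Mapping.single 0 ?i + Poly_Mapping.single 1 ?j + (m - (Poly_Mapping.single 0 ?i +
    Poly_Mapping.single 1 ?j)) = m"
    by (intro poly_mapping_eqI) (auto simp: lookup_add lookup_minus lookup_single when_def)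
  have "Poly_Mapping.single m c = (\<Sum>i\<le>B. \<Sum>j\<le>B. mvar 0 ^ i * mvar 1 ^ j *
    coeff_x0_x1 i j (Poly_Mapping.single m c))"
    if B: "B \<ge> max ?i ?j" for B
  proof -
    have "(\<Sum>i\<le>B. \<Sum>j\<le>B. mvar 0 ^ i * mvar 1 ^ j * coeff_x0_x1 i j (Poly_Mapping.single m c)) =
        (\<Sum>i\<le>B. \<Sum>j\<le>B. if i = ?i then if j = ?j then Poly_Mapping.single m c else 0 else 0)"
      using m by (intro sum.cong refl) (auto simp: coeff_x0_x1_single mvar_power mult_single)
    also have "\<dots> = (\<Sum>i\<le>B. if i = ?i then \<Sum>j\<le>B. if j = ?j then Poly_Mapping.single m c else 0 else 0)"
      by (intro sum.cong refl) auto
    also have "\<dots> = Poly_Mapping.single m c" using B by simp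
    finally show ?thesis by simp
  qed
  moreover have "coeff_x0_x1 i j (Poly_Mapping.single m c) = 0" if "i > max ?i ?j" for i j
    using that by (simp add: coeff_x0_x1_single)
  ultimately show ?case by blast
next
  case (add p q)
  then obtain B B' where B: "\<And>i j. i > B \<Longrightarrow> coeff_x0_x1 i j p = 0"
    "\<And>N. N \<ge> B \<Longrightarrow> p = (\<Sum>i\<le>N. \<Sum>j\<le>N. mvar 0 ^ i * mvar 1 ^ j * coeff_x0_x1 i j p)"
    "\<And>i j. i > B' \<Longrightarrow> coeff_x0_x1 i j q = 0"
    "\<And>N. N \<ge> B' \<Longrightarrow> q = (\<Sum>i\<le>N. \<Sum>j\<le>N. mvar 0 ^ i * mvar 1 ^ j * coeff_x0_x1 i j q)" by blast
  have "p + q = (\<Sum>i\<le>N. \<Sum>j\<le>N. mvar 0 ^ i * mvar 1 ^ j * coeff_x0_x1 i j (p + q))" if "N \<ge> max B B'" for N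
  proof -
    have "(\<Sum>i\<le>N. \<Sum>j\<le>N. mvar 0 ^ i * mvar 1 ^ j * coeff_x0_x1 i j (p + q)) =
        (\<Sum>i\<le>N. \<Sum>j\<le>N. mvar 0 ^ i * mvar 1 ^ j * coeff_x0_x1 i j p) +
        (\<Sum>i\<le>N. \<Sum>j\<le>N. mvar 0 ^ i * mvar 1 ^ j * coeff_x0_x1 i j q)"
      by (simp add: coeff_x0_x1_add distrib_left sum.distrib)
    then show ?thesis using B(2)[of N] B(4)[of N] that by simp
  qed
  moreover have "coeff_x0_x1 i j (p + q) = 0" if "i > max B B'" for i j
    using that B(1,3) by (simp add: coeff_x0_x1_add)
  ultimately show ?case by blast
qed

text \<open>Elements of \<open>M\<close> act as constants with respect to \<open>x_0, x_1\<close>,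
  and the quadric is \<open>x_0 x_1\<close> minus such a constant. Modulo \<open>M\<close> each
  coefficient of \<open>r\<close> is therefore a multiple of the one with both indices raised by
  one, and these vanish eventually.\<close>

lemma quadric_nzd:
  fixes M :: "'a::comm_ring_1 mpoly set"
  assumes M: "\<And>g i j p. g \<in> M \<Longrightarrow> coeff_x0_x1 i j (g * p) = g * coeff_x0_x1 i j p"
    and r: "quadric * r \<in> idl M"
  shows "r \<in> idl M"
proof -
  have c: "coeff_x0_x1 i j p \<in> idl M" if "p \<in> idl M" for i j p
    using that
  proof (induction rule: idl.span_induct_alt)
    case (step c x y)
    have "coeff_x0_x1 i j (c * x + y) = coeff_x0_x1 i j c * x + coeff_x0_x1 i j y"
      using M[OF step(1), of i j c] by (simp add: coeff_x0_x1_add mult.commute)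
    then show ?case using step by (simp add: idl.span_add idl.span_scale idl.span_base)
  qed (simp add: coeff_x0_x1_0 idl.span_zero)
  obtain B where B: "\<And>i j. i > B \<Longrightarrow> coeff_x0_x1 i j r = 0"
    "r = (\<Sum>i\<le>B. \<Sum>j\<le>B. mvar 0 ^ i * mvar 1 ^ j * coeff_x0_x1 i j r)"
    using coeff_x0_x1_expand[of r] by blast
  have step: "coeff_x0_x1 i j r \<in> idl M" if "coeff_x0_x1 (Suc i) (Suc j) r \<in> idl M" for i j
  proof -
    have "mvar 3 ^ 2 * p = mon (Poly_Mapping.single 3 2) *
      p" for p :: "'a mpoly" by (simp add: mvar_power)
    then have "coeff_x0_x1 (Suc i) (Suc j) (quadric * r) =
      coeff_x0_x1 i j r - mvar 3 ^ 2 * coeff_x0_x1 (Suc i) (Suc j) r"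
      by (simp add: quadric_def left_diff_distrib coeff_x0_x1_diff coeff_x0_x1_shift[unfolded
        One_nat_def]
          coeff_x0_x1_mon_free lookup_single)
    then have "coeff_x0_x1 i j r = coeff_x0_x1 (Suc i) (Suc j) (quadric * r) +
      mvar 3 ^ 2 * coeff_x0_x1 (Suc i) (Suc j) r" by simp
    then show ?thesis using c[OF r] that by (simp add: idl.span_add idl.span_scale)
  qed
  have "\<forall>i j. i + m > B \<longrightarrow> coeff_x0_x1 i j r \<in> idl M" for m
  proof (induction m)
    case 0
    then show ?case using B(1) by (simp add: idl.span_zero)
  next
    case (Suc m)
    then show ?case using step by simp
  qed
  from this[of "Suc B"] have "coeff_x0_x1 i j r \<in> idl M" for i j by simp
  then have "(\<Sum>i\<le>B. \<Sum>j\<le>B. mvar 0 ^ i * mvar 1 ^ j * coeff_x0_x1 i j r) \<in> idl M"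
    by (intro idl.span_sum idl.span_scale)
  then show ?thesis using B(2) by simp
qed

section \<open>Matrices of a complex of functions\<close>

definition lin_map :: "(('b \<Rightarrow> 'r::comm_ring_1) \<Rightarrow> 'c \<Rightarrow> 'r) \<Rightarrow> bool" where
  "lin_map \<phi> \<longleftrightarrow> (\<forall>u v. \<phi> (\<lambda>e. u e + v e) = (\<lambda>e. \<phi> u e + \<phi> v e)) \<and>
    (\<forall>c u. \<phi> (\<lambda>e. c * u e) = (\<lambda>e. c * \<phi> u e))"

lemma lin_map_expand:
  fixes \<phi> :: "('b \<Rightarrow> 'r::comm_ring_1) \<Rightarrow> 'c \<Rightarrow> 'r"
  assumes lin: "lin_map \<phi>" and u: "u \<in> supported_on (set xs)" and xs: "distinct xs"
  shows "\<phi> u e = (\<Sum>i<length xs. \<phi> (unit_fun (xs ! i)) e * u (xs ! i))"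
proof -
  have zero: "\<phi> (\<lambda>x. 0) = (\<lambda>e. 0)"
    using lin[unfolded lin_map_def, THEN conjunct2, rule_format, of 0 "\<lambda>_. 0"] by simp
  have *: "\<phi> (\<lambda>x. \<Sum>i<n. u (xs ! i) * unit_fun (xs ! i) x) =
    (\<lambda>e. \<Sum>i<n. \<phi> (unit_fun (xs ! i)) e * u (xs ! i))" for n
  proof (induction n)
    case (Suc n)
    have "\<phi> (\<lambda>x. \<Sum>i<Suc n. u (xs ! i) * unit_fun (xs ! i) x) =
        \<phi> (\<lambda>x. (\<Sum>i<n. u (xs ! i) * unit_fun (xs ! i) x) + u (xs ! n) * unit_fun (xs ! n) x)" by simp
    also have "\<dots> = (\<lambda>e. \<phi> (\<lambda>x. \<Sum>i<n. u (xs ! i) * unit_fun (xs ! i) x) e +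
      u (xs ! n) * \<phi> (unit_fun (xs ! n)) e)"
      using lin unfolding lin_map_def by simp
    finally show ?case unfolding Suc by (simp add: mult.commute)
  qed (simp add: zero)
  have "u = (\<lambda>x. \<Sum>i<length xs. u (xs ! i) * unit_fun (xs ! i) x)"
  proof
    fix x
    show "u x = (\<Sum>i<length xs. u (xs ! i) * unit_fun (xs ! i) x)"
    proof (cases "x \<in> set xs")
      case True
      then obtain l where l: "l < length xs" "x = xs ! l" by (auto simp: in_set_conv_nth)
      have "(\<Sum>i<length xs. u (xs ! i) * unit_fun (xs ! i) x) = (\<Sum>i<length xs. if i = l then u x else 0)"
        using l xs by (intro sum.cong refl) (auto simp: unit_fun_def nth_eq_iff_index_eq)
      then show ?thesis using l by simp
    next
      case False
      then have "(\<Sum>i<length xs. u (xs ! i) * unit_fun (xs ! i) x) =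
        0" by (intro sum.neutral) (auto simp: unit_fun_def)
      then show ?thesis using u False by (simp add: supported_on_def)
    qed
  qed
  then have "\<phi> u = \<phi> (\<lambda>x. \<Sum>i<length xs. u (xs ! i) * unit_fun (xs ! i) x)" by (rule arg_cong)
  then show ?thesis unfolding * by (rule fun_cong)
qed

lemma pos_piece_irrelevant:
  fixes p :: "'a::comm_ring_1 mpoly"
  assumes "p \<in> vars_in {..<n}" "0 \<notin> Poly_Mapping.keys p"
  shows "p \<in> irrelevant_ideal n"
proof -
  have "(mvar ` {..<n} :: 'a mpoly set) \<subseteq> vars_in {..<n}" by (auto intro!: vars_in_mvar)
  then have eq: "irrelevant_ideal n = idl (mvar ` {..<n} :: 'a mpoly set) \<inter> vars_in {..<n}"
    by (simp add: irrelevant_ideal_def genideal_mpoly)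
  have im: "(mvar ` {..<n} :: 'a mpoly set) = mon ` (\<lambda>i. Poly_Mapping.single i 1) ` {..<n}"
    by (auto simp: mvar_def image_image)
  have "\<exists>m\<in>(\<lambda>i. Poly_Mapping.single i 1) ` {..<n}. monom_dvd m k" if k: "k \<in> Poly_Mapping.keys p" for k
  proof -
    have "k \<noteq> 0" using k assms(2) by blast
    then obtain v where v: "v \<in> Poly_Mapping.keys k" by (metis keys_eq_empty ex_in_conv
      poly_mapping_eqI in_keys_iff lookup_zero)
    then have "v < n" using k assms(1) by (auto simp: vars_in_def)
    moreover have "monom_dvd (Poly_Mapping.single v 1) k"
      using v by (auto simp: monom_dvd_def lookup_single when_def in_keys_iff)
    ultimately show ?thesis by blast
  qed
  then show ?thesis using assms(1) by (simp add: eq im idl_mon)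
qed

text \<open>Applying the retraction \<open>restrict_vars n\<close> to a preimage moves it into \<open>K[x\<^sub>0, \<dots>, x\<^sub>n\<^sub>-\<^sub>1]\<close>.\<close>

theorem resolution_of_functions:
  fixes \<phi> :: "nat \<Rightarrow> ('b \<Rightarrow> 'a::comm_ring_1 mpoly) \<Rightarrow> 'b \<Rightarrow> 'a mpoly" and xs :: "nat \<Rightarrow> 'b list"
    and dg :: "'b \<Rightarrow> int"
  assumes xs: "\<And>j. distinct (xs j)" "xs 0 = [base]" "xs (Suc L) = []" and L: "L \<ge> 1"
    and F: "\<And>j. j \<le> L \<Longrightarrow> F j = map dg (xs j)" and F0: "F 0 = [0]"
    and lin: "\<And>j. lin_map (\<phi> j)"
    and supp: "\<And>j u. u \<in> supported_on (set (xs (Suc j))) \<Longrightarrow> \<phi> (Suc j) u \<in> supported_on (set (xs j))"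
    and entries: "\<And>j e e'. e \<in> set (xs j) \<Longrightarrow> e' \<in> set (xs (Suc j)) \<Longrightarrow>
      \<phi> (Suc j) (unit_fun e') e \<in> pos_piece n (dg e' - dg e)"
    and cplx: "\<And>j u e. u \<in> supported_on (set (xs (Suc (Suc j)))) \<Longrightarrow> \<phi> (Suc j) (\<phi> (Suc (Suc j)) u) e = 0"
    and exact: "\<And>j u. u \<in> supported_on (set (xs (Suc j))) \<Longrightarrow> \<phi> (Suc j) u = (\<lambda>e. 0) \<Longrightarrow>
      \<exists>v\<in>supported_on (set (xs (Suc (Suc j)))). \<phi> (Suc (Suc j)) v = u"
    and I: "\<And>p. p \<in> I \<longleftrightarrow> p \<in> vars_in {..<n} \<and> (\<exists>u\<in>supported_on (set (xs 1)). \<phi> 1 u base = p)"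
  shows "has_minimal_free_resolution n I L F"
proof -
  define D where "D j = mat (length (xs (j - 1))) (length (xs j)) (\<lambda>(r, c). \<phi> j (unit_fun (xs j !
    c)) (xs (j - 1) ! r))" for j
  \<comment> \<open>\<open>fn\<close> and \<open>vc\<close> translate between vectors and functions
    supported on the basis list; under this translation \<open>D j\<close> is the matrix of
    \<open>\<phi> j\<close>.\<close>
  define fn where "fn j v = (\<lambda>e. \<Sum>i<length (xs j). if e =
    xs j ! i then v $ i else 0)" for j and v :: "'a mpoly vec"
  define vc where "vc j u = vec (length (xs j)) (\<lambda>i. u (xs j ! i))" for j and u :: "'b \<Rightarrow> 'a mpoly"
  let ?C = "vars_in {..<n} :: 'a mpoly set"
  have fn_nth: "fn j v (xs j ! i) = v $ i" if "i < length (xs j)" for i j v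
  proof -
    have "fn j v (xs j ! i) = (\<Sum>l<length (xs j). if l = i then v $ l else 0)"
      unfolding fn_def using that xs(1) by (intro sum.cong refl) (auto simp: nth_eq_iff_index_eq)
    then show ?thesis using that by simp
  qed
  have fn_supp: "fn j v \<in> supported_on (set (xs j))" for j v
    unfolding supported_on_def fn_def by (auto intro!: sum.neutral)
  have vc_fn: "vc j (fn j v) = v" if "v \<in> carrier_vec (length (xs j))" for j v
    using that by (intro eq_vecI) (auto simp: vc_def fn_nth)
  have fn_eqI: "u = u'" if "u \<in> supported_on (set (xs j))" "u' \<in> supported_on (set (xs j))"
      "\<And>i. i < length (xs j) \<Longrightarrow> u (xs j ! i) = u' (xs j ! i)" for u u' :: "'b \<Rightarrow> 'a mpoly" and j
  proof
    fix e show "u e = u' e"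
      using that by (cases "e \<in> set (xs j)") (auto simp: in_set_conv_nth supported_on_def)
  qed
  have fn_vc: "fn j (vc j u) = u" if "u \<in> supported_on (set (xs j))" for j u
    using that by (intro fn_eqI[OF fn_supp]) (auto simp: fn_nth vc_def)
  have Dv: "D j *\<^sub>v v = vc (j - 1) (\<phi> j (fn j v))" if v: "v \<in> carrier_vec (length (xs j))" for j v
  proof (rule eq_vecI)
    fix r assume "r < dim_vec (vc (j - 1) (\<phi> j (fn j v)))"
    then have r: "r < length (xs (j - 1))" by (simp add: vc_def)
    have "(D j *\<^sub>v v) $ r = (\<Sum>i<length (xs j). \<phi> j (unit_fun (xs j ! i)) (xs (j - 1) ! r) * v $ i)"
      using r v by (simp add: D_def scalar_prod_def lessThan_atLeast0)
    also have "\<dots> = (\<Sum>i<length (xs j). \<phi> j (unit_fun (xs j ! i)) (xs (j - 1) ! r) * fn j v (xs j ! i))"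
      by (intro sum.cong refl) (simp add: fn_nth)
    also have "\<dots> = \<phi> j (fn j v) (xs (j - 1) ! r)"
      by (rule lin_map_expand[OF lin fn_supp xs(1), symmetric])
    finally show "(D j *\<^sub>v v) $ r = vc (j - 1) (\<phi> j (fn j v)) $ r" using r by (simp add: vc_def)
  qed (simp add: D_def vc_def)
  have entC: "\<phi> (Suc j) (unit_fun e') e \<in> ?C" if "e \<in> set (xs j)" "e' \<in> set (xs (Suc j))" for j e e'
    using entries[OF that] by (simp add: pos_piece_def graded_piece_iff)
  have \<rho>: "\<phi> (Suc j) (\<lambda>e. restrict_vars n (u e)) e = restrict_vars n (\<phi> (Suc j) u e)"
    if "u \<in> supported_on (set (xs (Suc j)))" "e \<in> set (xs j)" for j u e
  proof -
    have "(\<lambda>e. restrict_vars n (u e)) \<in> supported_on (set (xs (Suc j)))"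
      using that(1) by (simp add: supported_on_def is_ring_homD[OF is_ring_hom_restrict_vars])
    then have "\<phi> (Suc j) (\<lambda>e. restrict_vars n (u e)) e =
        (\<Sum>i<length (xs (Suc j)). \<phi> (Suc j) (unit_fun (xs (Suc j) ! i)) e *
          restrict_vars n (u (xs (Suc j) ! i)))"
      by (rule lin_map_expand[OF lin _ xs(1)])
    also have "\<dots> = (\<Sum>i<length (xs (Suc j)). restrict_vars n (\<phi> (Suc j) (unit_fun (xs (Suc j) ! i)) e
      * u (xs (Suc j) ! i)))"
      using that(2) entC by (intro sum.cong refl) (simp add: is_ring_homD[OF
        is_ring_hom_restrict_vars] restrict_vars_id)
    also have "\<dots> = restrict_vars n (\<phi> (Suc j) u e)"
      by (simp add: lin_map_expand[OF lin that(1) xs(1)] is_ring_homD[OF is_ring_hom_restrict_vars])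
    finally show ?thesis .
  qed
  have len: "length (F j) = length (xs j)" if "j \<le> L" for j using F[OF that] by simp
  have free: "v \<in> free_module n (F j) \<longleftrightarrow> v \<in> carrier_vec (length (xs j)) \<and>
    (\<forall>i<length (xs j). v $ i \<in> ?C)"
    if "j \<le> L" for j and v :: "'a mpoly vec"
    by (simp add: free_module_def len[OF that] carrier_mpoly_ring)
  have image: "\<exists>v'\<in>free_module n (F (Suc j)). D (Suc j) *\<^sub>v v' = v"
    if j: "Suc j \<le> L" and v: "v \<in> free_module n (F j)" and u: "u \<in>
      supported_on (set (xs (Suc j)))" "\<phi> (Suc j) u = fn j v"
    for j u and v :: "'a mpoly vec"
  proof -
    let ?u = "\<lambda>e. restrict_vars n (u e)"
    have us: "?u \<in> supported_on (set (xs (Suc j)))" using u(1) by (simp add: supported_on_def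
      is_ring_homD[OF is_ring_hom_restrict_vars])
    have vC: "v \<in> carrier_vec (length (xs j))" "\<And>i. i < length (xs j) \<Longrightarrow> v $ i \<in> ?C"
      using v free j by auto
    have v': "vc (Suc j) ?u \<in> free_module n (F (Suc j))" using free[OF j] restrict_vars_in by (auto
      simp: vc_def)
    have "D (Suc j) *\<^sub>v vc (Suc j) ?u = vc j (\<phi> (Suc j) ?u)"
      using Dv[of "vc (Suc j) ?u" "Suc j"] fn_vc[OF us] by (simp add: vc_def)
    also have "\<dots> = v"
    proof (rule eq_vecI)
      fix i assume i: "i < dim_vec v"
      then have i': "i < length (xs j)" using vC by simp
      have "\<phi> (Suc j) ?u (xs j ! i) = restrict_vars n (v $ i)" using \<rho>[OF u(1)] u(2) i' fn_nth[OF
        i'] by simp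
      also have "\<dots> = v $ i" by (rule restrict_vars_id[OF vC(2)[OF i']])
      finally show "vc j (\<phi> (Suc j) ?u) $ i = v $ i" using i' by (simp add: vc_def)
    qed (use vC in \<open>simp add: vc_def\<close>)
    finally show ?thesis using v' by blast
  qed
  have vc0: "vc j (\<lambda>e. 0) = 0\<^sub>v (length (xs j))" for j by (intro eq_vecI) (auto simp: vc_def)
  have fwd: "D (Suc j) *\<^sub>v v' \<in> free_module n (F j)" if "Suc j \<le> L" "v' \<in>
    free_module n (F (Suc j))" for j and v' :: "'a mpoly vec"
  proof -
    have v': "v' \<in> carrier_vec (length (xs (Suc j)))" "\<And>i. i < length (xs (Suc j)) \<Longrightarrow> v' $ i \<in> ?C"
      using that free by auto
    have "\<phi> (Suc j) (fn (Suc j) v') (xs j ! i) \<in> ?C" if "i < length (xs j)" for i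
      unfolding lin_map_expand[OF lin fn_supp xs(1)] using that v' entC
      by (intro subring_set_sum[OF subring_set_vars_in] subring_setD(4)[OF subring_set_vars_in])
        (auto simp: fn_nth)
    then show ?thesis using free[of j] that Dv[OF v'(1)] by (simp add: vc_def)
  qed
  have "minimal_free_resolution n I L F D"
    unfolding minimal_free_resolution_def
  proof (intro conjI ballI allI impI)
    show "F 0 = [0]" by (rule F0)
  next
    fix j assume j: "j \<in> {1..L}"
    then obtain i where i: "j = Suc i" "i \<le> L" "Suc i \<le> L" by (cases j) auto
    show "homogeneous_mat n (F (j - 1)) (F j) (D j)"
      unfolding homogeneous_mat_def
    proof (intro conjI allI impI)
      show "D j \<in> carrier_mat (length (F (j - 1))) (length (F j))" using i len by (simp add: D_def)
      fix r c assume "r < length (F (j - 1))" "c < length (F j)"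
      then have "r < length (xs i)" "c < length (xs (Suc i))" using i len by auto
      then show "D j $$ (r, c) \<in> graded_piece n (F j ! c - F (j - 1) ! r)"
        using entries[of "xs i ! r" i "xs (Suc i) ! c"] i F by (simp add: D_def pos_piece_def)
    qed
    fix v :: "'a mpoly vec" and r assume v: "v \<in> free_module n (F j)" and "r < length (F (j - 1))"
    then have r: "r < length (xs i)" using i len by simp
    have vC: "v \<in> carrier_vec (length (xs j))" "\<And>i. i < length (xs j) \<Longrightarrow> v $ i \<in> ?C"
      using v free i by auto
    have "(D j *\<^sub>v v) $ r = (\<Sum>c<length (xs j). v $ c * \<phi> j (unit_fun (xs j ! c)) (xs i ! r))"
      using r vC i by (simp add: D_def scalar_prod_def lessThan_atLeast0 mult.commute)
    moreover have "\<dots> \<in> irrelevant_ideal n"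
    proof -
      interpret R: cring "mpoly_ring n :: 'a mpoly ring" by (rule cring_mpoly_ring)
      have "ideal (irrelevant_ideal n :: 'a mpoly set) (mpoly_ring n)"
        unfolding irrelevant_ideal_def
        by (intro R.genideal_ideal) (auto simp: carrier_mpoly_ring intro!: vars_in_mvar)
      then have idm: "ideal_in ?C (irrelevant_ideal n)" by (simp add: ideal_mpoly_iff)
      have "\<phi> j (unit_fun (xs j ! c)) (xs i ! r) \<in> irrelevant_ideal n" if "c < length (xs j)" for c
        using entries[of "xs i ! r" i "xs j ! c"] r that i(1) entC[of "xs i ! r" i "xs j ! c"]
        by (intro pos_piece_irrelevant) (auto simp: pos_piece_def)
      then show ?thesis using vC(2) by (intro ideal_in_sum[OF idm] ideal_inD(4)[OF idm]) auto
    qed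
    ultimately show "(D j *\<^sub>v v) $ r \<in> irrelevant_ideal n" by simp
  next
    fix j assume j: "j \<le> L"
    show "res_cycles n I F D j = res_boundaries n L F D j"
    proof (cases "j = 0")
      case True
      have 0: "v \<in> free_module n (F 0) \<longleftrightarrow> v \<in> carrier_vec 1 \<and> v $ 0 \<in> ?C" for v :: "'a mpoly vec"
        using free[of 0 v] xs(2) by simp
      have fn0: "fn 0 v = (\<lambda>e. if e = base then v $ 0 else 0)" for v unfolding fn_def xs(2) by auto
      show ?thesis
      proof (intro equalityI subsetI)
        fix v assume "v \<in> res_cycles n I F D j"
        then have v: "v \<in> free_module n (F 0)" "v $ 0 \<in> I" using True by (auto simp: res_cycles_def)
        then obtain u where u: "u \<in> supported_on (set (xs 1))" "\<phi> 1 u base = v $ 0" using I by blast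
        have "\<phi> (Suc 0) u = fn 0 v"
          using supp[of u 0] u by (intro fn_eqI[OF _ fn_supp]) (auto simp: xs(2) fn0)
        then have "\<exists>v'\<in>free_module n (F (Suc 0)). D (Suc 0) *\<^sub>v v' = v"
          using image[of 0 v u] L v(1) u(1) by simp
        then show "v \<in> res_boundaries n L F D j" using True L by (auto simp: res_boundaries_def)
      next
        fix v assume "v \<in> res_boundaries n L F D j"
        then obtain v' where v': "v' \<in> free_module n (F (Suc 0))" "v = D (Suc 0) *\<^sub>v v'"
          using True L by (auto simp: res_boundaries_def)
        have v: "v \<in> free_module n (F 0)" using fwd[of 0 v'] v' L by simp
        have "v' \<in> carrier_vec (length (xs 1))" using v'(1) free[of 1] L by simp
        then have "v $ 0 = \<phi> 1 (fn 1 v') base" using Dv[of v' 1] v'(2) xs(2) by (simp add: vc_def)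
        then have "v $ 0 \<in> I" using I v 0 fn_supp by metis
        then show "v \<in> res_cycles n I F D j" using True v by (simp add: res_cycles_def)
      qed
    next
      case False
      then obtain i where i: "j = Suc i" "i \<le> L" using j by (cases j) auto
      have cyc: "v \<in> res_cycles n I F D j \<longleftrightarrow> v \<in> free_module n (F j) \<and>
        \<phi> j (fn j v) = (\<lambda>e. 0)" for v :: "'a mpoly vec"
      proof -
        have "D j *\<^sub>v v = 0\<^sub>v (length (F (j - 1))) \<longleftrightarrow> \<phi> j (fn j v) =
          (\<lambda>e. 0)" if "v \<in> free_module n (F j)"
        proof -
          have v: "v \<in> carrier_vec (length (xs j))" using that free[OF j] by blast
          have s: "\<phi> j (fn j v) \<in> supported_on (set (xs i))" using supp[of "fn j v" i] fn_supp i by simp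
          show ?thesis
          proof
            assume "D j *\<^sub>v v = 0\<^sub>v (length (F (j - 1)))"
            then have z: "vc i (\<phi> j (fn j v)) = vc i (\<lambda>e. 0)" using Dv[OF v] i len vc0 by simp
            have "\<phi> j (fn j v) = fn i (vc i (\<lambda>e. 0))" using fn_vc[OF s] z by simp
            then show "\<phi> j (fn j v) = (\<lambda>e. 0)" using fn_vc[of "\<lambda>e. 0" i] by (simp add: supported_on_def)
          next
            assume "\<phi> j (fn j v) = (\<lambda>e. 0)"
            then show "D j *\<^sub>v v = 0\<^sub>v (length (F (j - 1)))" using Dv[OF v] i len vc0 by simp
          qed
        qed
        then show ?thesis using False by (auto simp: res_cycles_def)
      qed
      show ?thesis
      proof (intro equalityI subsetI)
        fix v assume "v \<in> res_cycles n I F D j"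
        then have v: "v \<in> free_module n (F j)" "\<phi> j (fn j v) = (\<lambda>e. 0)" using cyc by auto
        obtain u where u: "u \<in> supported_on (set (xs (Suc j)))" "\<phi> (Suc j) u = fn j v"
          using exact[of "fn j v" i] v(2) fn_supp i by auto
        show "v \<in> res_boundaries n L F D j"
        proof (cases "j < L")
          case True
          then show ?thesis using image[of j v u] v(1) u by (auto simp: res_boundaries_def)
        next
          case False
          \<comment> \<open>At the left end the next basis is empty, so \<open>exact\<close>
            expresses injectivity of the last map.\<close>
          then have jL: "j = L" using j by simp
          then have "u = (\<lambda>e. 0)" using u(1) xs(3) by (auto simp: supported_on_def)
          moreover have "\<phi> (Suc j) (\<lambda>e. 0) = (\<lambda>e. 0)"
            using lin[of "Suc j", unfolded lin_map_def, THEN conjunct2, rule_format, of 0 "\<lambda>_.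
              0"] by simp
          ultimately have "fn j v = (\<lambda>e. 0)" using u(2) by simp
          moreover have "v \<in> carrier_vec (length (xs j))" using v(1) free[OF j] by blast
          ultimately have "v = 0\<^sub>v (length (F j))" using vc_fn vc0 len[OF j] by metis
          then show ?thesis using False by (simp add: res_boundaries_def)
        qed
      next
        fix v assume vb: "v \<in> res_boundaries n L F D j"
        show "v \<in> res_cycles n I F D j"
        proof (cases "j < L")
          case True
          then obtain v' where v': "v' \<in> free_module n (F (Suc j))" "v = D (Suc j) *\<^sub>v v'"
            using vb by (auto simp: res_boundaries_def)
          have c: "v' \<in> carrier_vec (length (xs (Suc j)))" using v'(1) free[of "Suc j"] True by simp
          have "fn j v = \<phi> (Suc j) (fn (Suc j) v')"
            using Dv[OF c] v'(2) fn_vc[OF supp[OF fn_supp]] by simp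
          then have "\<phi> j (fn j v) = (\<lambda>e. 0)" using cplx[of "fn (Suc j) v'" i] fn_supp i by auto
          then show ?thesis using cyc fwd[of j v'] v' True by simp
        next
          case False
          then have v: "v = 0\<^sub>v (length (xs j))" using vb len[OF j] by (simp add: res_boundaries_def)
          then have "v = vc j (\<lambda>e. 0)" using vc0 by simp
          then have "fn j v = (\<lambda>e. 0)" using fn_vc[of "\<lambda>e. 0" j] by (simp add: supported_on_def)
          moreover have "\<phi> j (\<lambda>e. 0) = (\<lambda>e. 0)"
            using lin[of j, unfolded lin_map_def, THEN conjunct2, rule_format, of 0 "\<lambda>_. 0"] by simp
          moreover have "(0 :: 'a mpoly) \<in> ?C" by (rule subring_setD(2)[OF subring_set_vars_in])
          ultimately show ?thesis using cyc free[OF j] v by simp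
        qed
      qed
    qed
  qed
  then show ?thesis unfolding has_minimal_free_resolution_def by blast
qed

section \<open>Enumeration of finite bases\<close>

definition list_of_set :: "'b set \<Rightarrow> 'b list" where
  "list_of_set A = (SOME xs. set xs = A \<and> distinct xs)"

lemma list_of_set:
  assumes "finite A"
  shows "set (list_of_set A) = A" "distinct (list_of_set A)" "length (list_of_set A) = card A"
proof -
  show *: "set (list_of_set A) = A" "distinct (list_of_set A)"
    using someI_ex[OF finite_distinct_list[OF assms]] unfolding list_of_set_def by blast+
  then show "length (list_of_set A) = card A" by (metis distinct_card)
qed

lemma map_const: "(\<And>x. x \<in> set xs \<Longrightarrow> f x = c) \<Longrightarrow> map f xs = replicate (length xs) c"
  by (induction xs) auto

definition card_subsets :: "nat \<Rightarrow> nat \<Rightarrow> nat set set" where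
  "card_subsets k j = {S. S \<subseteq> {..<k} \<and> card S = j}"

lemma card_subsets: "finite (card_subsets k j)" "card (card_subsets k j) = k choose j"
  using n_subsets[of "{..<k}" j] by (auto simp: card_subsets_def)

section \<open>The vanishing ideal\<close>

lemma eval_mpoly_eval_hom: "eval_mpoly p v = eval_hom (\<lambda>x. x) (\<lambda>i. v $ i) p"
  by (simp add: eval_mpoly_def eval_hom_def lin_ext_def monom_value_def)

lemma phi_vec_nth:
  assumes "i < d div 2 + 3"
  shows "phi_vec d v $ i = toric d (v $ 0) (v $ 1) (v $ 2) i"
proof (cases "i < 3")
  case True
  then consider "i = 0" | "i = 1" | "i = 2" by linarith
  then show ?thesis
    by cases (simp_all add: toric_def phi_vec_def Let_def vec_of_list_index del: vec_of_list_map
      vec_of_list_Cons)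
next
  case False
  define j where "j = i - 3"
  have "i = Suc (Suc (Suc j))" "j < d div 2" using False assms by (auto simp: j_def)
  then show ?thesis
    by (simp add: toric_def phi_vec_def Let_def vec_of_list_index del: vec_of_list_map vec_of_list_Cons)
qed

lemma is_ring_hom_toric: "is_ring_hom f \<Longrightarrow> f (toric d x y z i) = toric d (f x) (f y) (f z) i"
  by (simp add: toric_def is_ring_homD)

lemma digits_unique:
  fixes a b :: "nat \<Rightarrow> nat"
  assumes "(\<Sum>i<n. a i * N ^ i) = (\<Sum>i<n. b i * N ^ i)" "\<And>i. i < n \<Longrightarrow> a i < N" "\<And>i. i < n \<Longrightarrow>
    b i < N" "i < n"
  shows "a i = b i"
  using assms
proof (induction n arbitrary: a b i)
  case (Suc n)
  have shift: "(\<Sum>i<Suc n. c i * N ^ i) = c 0 + N * (\<Sum>i<n. c (Suc i) * N ^ i)" for c :: "nat \<Rightarrow> nat"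
    unfolding sum.lessThan_Suc_shift sum_distrib_left by (simp add: mult_ac)
  have lt: "a 0 < N" "b 0 < N" using Suc.prems by auto
  have eq: "a 0 + N * (\<Sum>i<n. a (Suc i) * N ^ i) = b 0 + N * (\<Sum>i<n. b (Suc i) * N ^ i)"
    using Suc.prems(1) by (simp only: shift)
  have 0: "a 0 = b 0" using arg_cong[OF eq, of "\<lambda>x. x mod N"] lt by simp
  then have "(\<Sum>i<n. a (Suc i) * N ^ i) = (\<Sum>i<n. b (Suc i) * N ^ i)" using eq lt by simp
  from Suc.IH[OF this] have "l < n \<Longrightarrow> a (Suc l) = b (Suc l)" for l using Suc.prems by auto
  then show ?case using 0 Suc.prems(4) by (cases i) auto
qed simp

text \<open>Kronecker substitution \<open>x\<^sub>i \<mapsto> t ^ (N ^ i)\<close>.\<close>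

lemma kronecker_substitution:
  fixes p :: "'a::field mpoly"
  assumes p: "p \<in> vars_in {..<n}" "p \<noteq> 0"
  shows "\<exists>\<omega>. finite {t. eval_hom (\<lambda>c. c) (\<lambda>i. t ^ \<omega> i) p = 0}"
proof -
  obtain B where B: "exp_bound B p" using exp_bound_ex by blast
  \<comment> \<open>The base exceeds every exponent in \<open>p\<close>, so the weight of a monomial
    has the exponents as its digits and distinct monomials do not merge.\<close>
  define \<omega> where "\<omega> i = Suc B ^ i" for i
  define q where "q = (\<Sum>m\<in>Poly_Mapping.keys p. Polynomial.monom (Poly_Mapping.lookup p m) (weight \<omega> m))"
  have weight: "weight \<omega> m = (\<Sum>i<n. Poly_Mapping.lookup m i * Suc B ^ i)" if "m \<in>
    Poly_Mapping.keys p" for m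
    unfolding \<omega>_def using that p(1) by (intro weight_superset) (auto simp: vars_in_def)
  have inj: "m = m'" if m: "m \<in> Poly_Mapping.keys p" "m' \<in>
    Poly_Mapping.keys p" and eq: "weight \<omega> m = weight \<omega> m'" for m m'
  proof (rule poly_mapping_eqI)
    fix i
    show "Poly_Mapping.lookup m i = Poly_Mapping.lookup m' i"
    proof (cases "i < n")
      case True
      have *: "(\<Sum>i<n. Poly_Mapping.lookup m i * Suc B ^ i) =
        (\<Sum>i<n. Poly_Mapping.lookup m' i * Suc B ^ i)"
        using eq m weight by simp
      show ?thesis
        by (rule digits_unique[OF * _ _ True]) (use B m in \<open>auto simp: exp_bound_def less_Suc_eq_le\<close>)
    next
      case False
      then have "i \<notin> Poly_Mapping.keys m" "i \<notin> Poly_Mapping.keys m'" using m p(1) by (auto simp: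
        vars_in_def)
      then show ?thesis by (simp add: in_keys_iff)
    qed
  qed
  obtain m0 where m0: "m0 \<in> Poly_Mapping.keys p" using p(2) by (metis ex_in_conv keys_eq_empty)
  have "poly.coeff q (weight \<omega> m0) = (\<Sum>m\<in>Poly_Mapping.keys p. if m =
    m0 then Poly_Mapping.lookup p m else 0)"
    unfolding q_def Polynomial.coeff_sum using inj m0 by (intro sum.cong refl) auto
  then have "poly.coeff q (weight \<omega> m0) \<noteq> 0" using m0 by (simp add: in_keys_iff)
  then have "q \<noteq> 0" by auto
  then have "finite {t. poly q t = 0}" by (rule poly_roots_finite)
  moreover have "eval_hom (\<lambda>c. c) (\<lambda>i. t ^ \<omega> i) p = poly q t" for t
  proof -
    have "monom_value (\<lambda>i. t ^ \<omega> i) m = t ^ weight \<omega> m" for m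
      by (simp add: monom_value_def weight_def power_sum power_mult[symmetric] mult.commute)
    then show ?thesis by (simp add: eval_hom_def lin_ext_def q_def poly_sum poly_monom)
  qed
  ultimately have "finite {t. eval_hom (\<lambda>c. c) (\<lambda>i. t ^ \<omega> i) p = 0}" by simp
  then show ?thesis by blast
qed

definition col_degree :: "nat \<Rightarrow> nat \<Rightarrow> nat" where
  "col_degree k i = (if i < k then 1 else 2)"

context surface
begin

lemma w_index_less: "w_index k i < k + 3" using k by (auto simp: w_index_def)

lemma upper_monom_graded: "i \<le> k \<Longrightarrow> mn (upper_monom k i) \<in> graded_piece (k + 3) (int (col_degree k i))"
  using w_index_less[of i] keys_add[of "Poly_Mapping.single 0 (Suc 0)" "Poly_Mapping.single (Suc 0)
    (Suc 0)"]
  by (intro graded_piece_mon) (auto simp: upper_monom_def col_degree_def weight_add weight_single)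

lemma lower_monom_graded: "i \<le> k \<Longrightarrow> mn (lower_monom k i) \<in> graded_piece (k + 3) (int (col_degree k i))"
  using w_index_less[of "i + 1"] k
  by (intro graded_piece_mon) (auto simp: lower_monom_def col_degree_def weight_single)

lemma quadric_graded: "(quadric :: 'a mpoly) \<in> graded_piece (k + 3) 2"
proof -
  have m: "Poly_Mapping.single 0 (Suc 0) + Poly_Mapping.single (Suc 0) (Suc 0) = upper_monom k k"
    "Poly_Mapping.single 3 2 = lower_monom k k" by (simp_all add: upper_monom_def lower_monom_def)
  have "(quadric :: 'a mpoly) = mn (upper_monom k k) - mn (lower_monom k k)"
    by (simp add: quadric_def mon_upper_monom mon_lower_monom)
  then show ?thesis using graded_piece_diff[OF upper_monom_graded[of k] lower_monom_graded[of k]] by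
    (simp add: col_degree_def)
qed

lemma gens_graded:
  assumes "f \<in> gens"
  shows "\<exists>e. f \<in> graded_piece (k + 3) e"
proof -
  have "mn (upper_monom k i) * mn (lower_monom k l) - mn (upper_monom k l) * mn (lower_monom k i) \<in>
    graded_piece (k + 3) (int (col_degree k i) + int (col_degree k l))"
    if "i \<le> k" "l \<le> k" for i l
    using graded_piece_diff[OF graded_piece_mult[OF upper_monom_graded lower_monom_graded]
      graded_piece_mult[OF lower_monom_graded upper_monom_graded]] that
    by (simp add: mult.commute)
  note minor = this
  consider "f = quadric" | i l where "f = mn (upper_monom k i) * mn (lower_monom k l) -
    mn (upper_monom k l) * mn (lower_monom k i)" "i \<le> k" "l \<le> k"
    using assms by (cases "odd d") (auto simp: surface_gens_def k(1) minors_def)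
  then show ?thesis using quadric_graded minor by cases blast+
qed

text \<open>A representative of a point is an arbitrary nonzero multiple of a parametrized vector; a
  \<open>d\<close>-th root of the factor moves it into the parameters.\<close>

lemma surface_point:
  assumes "P \<in> S_surface d" "v \<in> P"
  shows "\<exists>x y z :: 'a. \<forall>i<k + 3. v $ i = toric d x y z i"
proof -
  obtain u :: "'a vec" where u: "u \<in> carrier_vec 3" "P = phi d (proj_point u)"
    using assms(1) by (auto simp: S_surface_def proj_space_def)
  then have "v \<in> proj_point (phi_vec d u)" using assms(2) phi_proj_point[OF u(1)] by simp
  then obtain c where c: "c \<noteq> 0" "v = c \<cdot>\<^sub>v phi_vec d u" by (auto simp: proj_point_def)
  obtain r where r: "r ^ d = c" using nth_root_exists[of d c] d(3) by auto
  have "v = phi_vec d (r \<cdot>\<^sub>v u)" using c(2) r phi_vec_smult[OF u(1)] by simp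
  then show ?thesis using phi_vec_nth k(1) by blast
qed

lemma point_surface:
  assumes "x \<noteq> (0::'a)"
  shows "\<exists>P\<in>S_surface d. \<exists>v\<in>P. \<forall>i<k + 3. v $ i = toric d x y z i"
proof -
  define u where "u = vec 3 (\<lambda>i. if i = 0 then x else if i = 1 then y else z)"
  have u: "u \<in> carrier_vec 3" "u $ 0 = x" "u $ 1 = y" "u $ 2 = z" by (simp_all add: u_def)
  have "u \<noteq> 0\<^sub>v 3"
  proof
    assume "u = 0\<^sub>v 3"
    then have "u $ 0 = 0" by simp
    then show False using u assms by simp
  qed
  then have "phi d (proj_point u) \<in> S_surface d" using u by (auto simp: S_surface_def proj_space_def)
  moreover have "phi_vec d u \<in> phi d (proj_point u)"
    unfolding phi_proj_point[OF u(1)] unfolding proj_point_def by (rule CollectI, rule exI[of _ 1]) simp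
  moreover have "\<forall>i<k + 3. phi_vec d u $ i = toric d x y z i" using phi_vec_nth[of _ d u] u k(1) by simp
  ultimately show ?thesis by blast
qed

text \<open>Parameters with \<open>x \<noteq> 0\<close> suffice to recover the kernel: if the image
  of \<open>p\<close> in \<open>K[x, y, z]\<close> were nonzero, substituting powers of one element
  would leave only finitely many zeros, and an infinite field contains a further element different
  from 0.\<close>

lemma vanishing_iff:
  assumes p: "p \<in> polys"
  shows "(\<forall>P\<in>S_surface d. \<forall>v\<in>P. eval_mpoly p v = 0) \<longleftrightarrow> p \<in> surface_ideal"
proof
  assume "p \<in> surface_ideal"
  then have p': "p \<in> idl gens" by (simp add: surface_ideal_def)
  show "\<forall>P\<in>S_surface d. \<forall>v\<in>P. eval_mpoly p v = 0"
  proof (intro ballI)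
    fix P :: "'a vec set" and v assume "P \<in> S_surface d" "v \<in> P"
    then obtain x y z where v: "\<forall>i<k + 3. v $ i = toric d x y z i" using surface_point by blast
    have "eval_mpoly p v = eval_hom (\<lambda>x. x) (toric d x y z) p"
      unfolding eval_mpoly_eval_hom using v by (intro eval_hom_cong[OF p]) auto
    then show "eval_mpoly p v = 0" using idl_toric[OF is_ring_hom_id p'] by simp
  qed
next
  assume van: "\<forall>P\<in>S_surface d. \<forall>v\<in>P. eval_mpoly p v = 0"
  have z: "eval_hom (\<lambda>c. c) (toric d x y z) p = 0" if "x \<noteq> 0" for x y z
  proof -
    obtain P v where v: "P \<in> S_surface d" "v \<in> P" "\<forall>i<k + 3. v $ i = toric d x y z i"
      using point_surface[OF \<open>x \<noteq> 0\<close>] by blast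
    have "eval_mpoly p v = eval_hom (\<lambda>x. x) (toric d x y z) p"
      unfolding eval_mpoly_eval_hom using v(3) by (intro eval_hom_cong[OF p]) auto
    then show ?thesis using van v(1,2) by simp
  qed
  have "param_hom p = 0"
  proof (rule ccontr)
    assume "param_hom p \<noteq> 0"
    then obtain \<omega> where fin: "finite {t. eval_hom (\<lambda>c. c) (\<lambda>i. t ^ \<omega> i) (param_hom p) = 0}"
      using kronecker_substitution[OF param_hom_vars[OF p]] by blast
    have "infinite (UNIV :: 'a set)" by (rule infinite_UNIV_char_0)
    then obtain t where t: "t \<notin> insert 0 {t. eval_hom (\<lambda>c. c) (\<lambda>i. t ^ \<omega> i) (param_hom p) = 0}"
      using fin by (meson finite_insert finite_subset subsetI)
    let ?f = "eval_hom (\<lambda>c. c) (\<lambda>i. t ^ \<omega> i)"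
    have f: "is_ring_hom ?f" by (rule is_ring_hom_eval_hom[OF is_ring_hom_id])
    have "?f (param_hom p) = eval_hom (\<lambda>c. ?f (Cst c)) (\<lambda>i. ?f (toric d (xv 0) (xv 1) (xv 2) i)) p"
      by (rule eval_hom_comp[OF f is_ring_hom_Cst])
    also have "\<dots> = eval_hom (\<lambda>c. c) (toric d (t ^ \<omega> 0) (t ^ \<omega> 1) (t ^ \<omega> 2)) p"
      by (simp add: eval_hom_Cst[OF is_ring_hom_id] is_ring_hom_toric[OF f] eval_hom_mvar[OF
        is_ring_hom_id])
    finally show False using z[of "t ^ \<omega> 0"] t by simp
  qed
  then show "p \<in> surface_ideal" using p by (simp add: surface_ideal_iff)
qed

text \<open>The vanishing ideal is generated by homogeneous polynomials only. It still contains the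
  whole kernel because the generators of the kernel are themselves homogeneous.\<close>

theorem homogeneous_ideal_of_surface: "homogeneous_ideal_of (k + 2) (S_surface d) = surface_ideal"
proof -
  let ?H = "{f :: 'a mpoly. (\<exists>e. f \<in> graded_piece (k + 3) e) \<and>
    (\<forall>P\<in>S_surface d. \<forall>v\<in>P. eval_mpoly f v = 0)}"
  have HC: "?H \<subseteq> polys" by (auto simp: graded_piece_iff)
  have gs: "gens \<subseteq> surface_ideal" using gens_vars by (auto simp: surface_ideal_def idl.span_base)
  have "?H \<subseteq> idl gens"
    using vanishing_iff HC by (auto simp: surface_ideal_def)
  moreover have "gens \<subseteq> ?H"
  proof
    fix f assume f: "f \<in> gens"
    then have "f \<in> polys" "f \<in> surface_ideal" using gens_vars gs by auto
    then show "f \<in> ?H" using vanishing_iff[of f] gens_graded[OF f] by simp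
  qed
  ultimately have "idl ?H = idl gens" by (metis (no_types, lifting) idl.span_mono idl.span_span
    subset_antisym)
  moreover have "genideal (mpoly_ring (k + 3)) ?H = idl ?H \<inter> polys" by (rule genideal_mpoly[OF HC])
  ultimately show ?thesis by (simp add: homogeneous_ideal_of_def surface_ideal_def eval_nat_numeral)
qed

end

section \<open>The resolutions\<close>

lemma w_index_inj: "i \<le> k \<Longrightarrow> l \<le> k \<Longrightarrow> w_index k i = w_index k l \<Longrightarrow> i = l"
  by (auto simp: w_index_def split: if_splits)

lemma keys_upper_monom: "Poly_Mapping.keys (upper_monom k i) =
  (if i < k then {w_index k i} else {0, 1})"
  by (auto simp: upper_monom_def in_keys_iff lookup_add lookup_single when_def split: if_splits)

lemma keys_lower_monom: "Poly_Mapping.keys (lower_monom k i) =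
  (if i < k then {w_index k (i + 1)} else {3})"
  by (simp add: lower_monom_def)

context surface
begin

lemma eagon_northcott:
  assumes n: "n \<le> k + 1"
  shows "\<exists>\<beta> t. eagon_northcott n (\<lambda>i. mn (upper_monom k i)) (\<lambda>i. mn (lower_monom k i)) \<beta> t"
proof -
  \<comment> \<open>Gives \<open>w i\<close> the weight \<open>i + 1\<close>, and
    \<open>x_0 x_1\<close> the weight 1 against 2 for the square of \<open>w 0\<close>: in every
    column the lower entry is heavier by exactly one.\<close>
  define \<omega> :: "nat \<Rightarrow> nat" where "\<omega> v = (if v = 0 then 1 else if v = 1 then 0 else if v =
    2 then k + 1 else v - 2)" for v
  have \<omega>: "\<omega> (w_index k i) = i + 1" if "i \<le> k" for i using that by (auto simp: \<omega>_def w_index_def)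
  have W: "w_index k i \<ge> 2" "w_index k i = 3 \<Longrightarrow> i = 0" for i by (auto simp: w_index_def split: if_splits)
  have "Poly_Mapping.keys (upper_monom k i) \<inter> Poly_Mapping.keys (upper_monom k l) =
    {}" if "i \<le> k" "l \<le> k" "i \<noteq> l" for i l
    using that W(1)[of i] W(1)[of l] w_index_inj[of i k l] by (auto simp: keys_upper_monom)
  moreover have "Poly_Mapping.keys (lower_monom k i) \<inter> Poly_Mapping.keys (lower_monom k l) =
    {}" if "i \<le> k" "l \<le> k" "i \<noteq> l" for i l
    using that W(2)[of "i + 1"] W(2)[of "l + 1"] w_index_inj[of "i + 1" k "l +
      1"] by (auto simp: keys_lower_monom)
  moreover have "weight \<omega> (lower_monom k i) = Suc (weight \<omega> (upper_monom k i))" if "i \<le> k" for i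
    using that \<omega>[of i] \<omega>[of "i + 1"] by (auto simp: upper_monom_def lower_monom_def weight_add
      weight_single) (simp_all add: \<omega>_def)
  ultimately have "eagon_northcott n (\<lambda>i. mn (upper_monom k i)) (\<lambda>i. mn (lower_monom k i)) (\<lambda>i. int
    (weight \<omega> (lower_monom k i))) (trunc \<omega>)"
    using n by (intro eagon_northcott_monomials) auto
  then show ?thesis by blast
qed

lemma finite_en_basis: "finite (en_basis n j)"
  by (simp add: en_basis_def)

lemma en_basis_card_subsets: "j \<ge> 1 \<Longrightarrow> en_basis n j = card_subsets n (j + 1) \<times> {..<j}"
  by (simp add: en_basis_def card_subsets_def)

text \<open>Separates the basis elements that use the last column, the only quadratic one in the odd
  case.\<close>

lemma card_subsets_Suc: "card_subsets (Suc n) (Suc j) =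
  card_subsets n (Suc j) \<union> insert n ` card_subsets n j"
proof (intro equalityI subsetI)
  fix S assume S: "S \<in> card_subsets (Suc n) (Suc j)"
  show "S \<in> card_subsets n (Suc j) \<union> insert n ` card_subsets n j"
  proof (cases "n \<in> S")
    case True
    have "finite S" using S finite_subset by (auto simp: card_subsets_def)
    then have "S - {n} \<in> card_subsets n j" using S True by (auto simp: card_subsets_def less_Suc_eq)
    then show ?thesis using True by (auto intro!: image_eqI[of _ _ "S - {n}"])
  next
    case False
    then have "S \<subseteq> {..<n}" using S by (auto simp: card_subsets_def less_Suc_eq)
    then show ?thesis using S by (simp add: card_subsets_def)
  qed
next
  fix S assume "S \<in> card_subsets n (Suc j) \<union> insert n ` card_subsets n j"
  then consider "S \<in> card_subsets n (Suc j)" | T where "S = insert n T" "T \<in> card_subsets n j" by blast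
  then show "S \<in> card_subsets (Suc n) (Suc j)"
  proof cases
    case 1
    then show ?thesis by (auto simp: card_subsets_def)
  next
    case 2
    then have "n \<notin> T" "finite T" using finite_subset by (auto simp: card_subsets_def)
    then show ?thesis using 2 by (auto simp: card_subsets_def)
  qed
qed

text \<open>In step \<open>j\<close> the sets without the index \<open>k\<close> have degree
  \<open>j + 1\<close>, and the others \<open>j + 2\<close> because the extra column is quadratic;
  listing the former first gives the two blocks of shifts. The complex ends at \<open>k\<close>,
  since \<open>k + 1\<close> columns have no subset of size \<open>k + 2\<close>.\<close>

theorem odd_resolution:
  assumes "odd d"
  shows "has_minimal_free_resolution (k + 3) surface_ideal k
    (\<lambda>j. if j = 0 then [0]
      else replicate (j * (k choose (j + 1))) (int j + 1) @ replicate (j * (k choose j)) (int j + 2))"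
proof -
  let ?a = "\<lambda>i. mn (upper_monom k i)" and ?b = "\<lambda>i. mn (lower_monom k i)"
  obtain \<beta> t where "eagon_northcott (k + 1) ?a ?b \<beta> t" using eagon_northcott by blast
  then interpret eagon_northcott "k + 1" ?a ?b \<beta> t .
  define X where "X j = list_of_set (card_subsets k (j + 1) \<times> {..<j})" for j
  define Y where "Y j = list_of_set (card_subsets k j \<times> {..<j})" for j
  define xs where "xs j = (if j = 0 then [({}, 0)] else X j @
    map (\<lambda>(S, p). (insert k S, p)) (Y j))" for j
  define dg where "dg e = int (sum (col_degree k) (fst e))" for e :: "nat set \<times> nat"
  have X: "set (X j) = card_subsets k (j + 1) \<times> {..<j}" "distinct (X j)" "length (X j) =
    j * (k choose (j + 1))" for j
    using list_of_set[of "card_subsets k (j + 1) \<times> {..<j}"] by (auto simp: X_def card_subsets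
      card_cartesian_product)
  have Y: "set (Y j) = card_subsets k j \<times> {..<j}" "distinct (Y j)" "length (Y j) =
    j * (k choose j)" for j
    using list_of_set[of "card_subsets k j \<times> {..<j}"] by (auto simp: Y_def card_subsets
      card_cartesian_product)
  have notin: "k \<notin> S" if "S \<in> card_subsets k j" for S j using that by (auto simp: card_subsets_def)
  have set_xs: "set (xs j) = en_basis (k + 1) j" for j
    using X(1)[of j] Y(1)[of j]
    by (auto simp: xs_def en_basis_card_subsets card_subsets_Suc image_iff en_basis_def[of _ 0])
  show ?thesis
  proof (rule resolution_of_functions[where \<phi> = "\<lambda>j. end_map (k + 1) ?a ?b j" and xs = xs and dg =
    dg and base = "({}, 0)"])
    show "distinct (xs j)" for j
    proof -
      have "inj_on (\<lambda>(S, p). (insert k S, p)) (set (Y j))"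
        unfolding Y inj_on_def using notin by (auto simp: insert_ident)
      then show ?thesis using X[of j] Y[of j] notin by (auto simp: xs_def distinct_map)
    qed
    show "xs 0 = [({}, 0)]" by (simp add: xs_def)
    have "length (xs (Suc k)) = 0" by (simp add: xs_def X Y)
    then show "xs (Suc k) = []" by blast
    show "k \<ge> 1" by (rule k(3))
    show "(if j = 0 then [0] else replicate (j * (k choose (j + 1))) (int j + 1) @
        replicate (j * (k choose j)) (int j + 2)) = map dg (xs j)" for j
    proof (cases "j = 0")
      case False
      have sub: "sum (col_degree k) S = card S" if "S \<in> card_subsets k i" for S i
      proof -
        have "sum (col_degree k) S = (\<Sum>i\<in>S. 1)" using that by (intro sum.cong refl) (auto simp:
          card_subsets_def col_degree_def)
        then show ?thesis by simp
      qed
      have "map dg (X j) = replicate (length (X j)) (int j + 1)"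
        by (rule map_const) (auto simp: X dg_def sub simp del: of_nat_sum, simp add: card_subsets_def)
      moreover have "map (\<lambda>x. dg (case x of (S, p) \<Rightarrow> (insert k S, p))) (Y j) =
        replicate (length (Y j)) (int j + 2)"
      proof (rule map_const)
        fix x assume "x \<in> set (Y j)"
        then obtain S p where x: "x = (S, p)" "S \<in> card_subsets k j" by (auto simp: Y)
        have "finite S" using x(2) finite_subset by (auto simp: card_subsets_def)
        then show "dg (case x of (S, p) \<Rightarrow> (insert k S, p)) = int j + 2"
          using x notin[OF x(2)] sub[OF x(2)] by (simp add: dg_def) (simp add: col_degree_def
            card_subsets_def)
      qed
      ultimately show ?thesis using False by (simp add: xs_def X Y comp_def)
    qed (simp add: xs_def dg_def)
    show "lin_map (end_map (k + 1) ?a ?b j)" for j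
      unfolding lin_map_def by (simp add: end_map_add end_map_smult)
    show "end_map (k + 1) ?a ?b (Suc j) u \<in> supported_on (set (xs j))" if "u \<in>
      supported_on (set (xs (Suc j)))" for j u
      using that unfolding set_xs by (rule end_map_supp)
    show "end_map (k + 1) ?a ?b (Suc j) (unit_fun e') e \<in> pos_piece (k + 3) (dg e' - dg e)"
      if "e \<in> set (xs j)" "e' \<in> set (xs (Suc j))" for j e e'
    proof -
      obtain S p S' p' where e: "e = (S, p)" "e' = (S', p')" by (metis surj_pair)
      show ?thesis
        using that unfolding set_xs e dg_def fst_conv
        by (intro end_map_unit_pos_piece upper_monom_graded lower_monom_graded) (auto simp:
          col_degree_def)
    qed
    show "end_map (k + 1) ?a ?b (Suc j) (end_map (k + 1) ?a ?b (Suc (Suc j)) u) e = 0" for j u e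
      by (rule end_map_end_map)
    show "\<exists>v\<in>supported_on (set (xs (Suc (Suc j)))). end_map (k + 1) ?a ?b (Suc (Suc j)) v = u"
      if "u \<in> supported_on (set (xs (Suc j)))" "end_map (k + 1) ?a ?b (Suc j) u = (\<lambda>e. 0)" for j u
      using that unfolding set_xs by (rule end_map_exact)
    show "p \<in> surface_ideal \<longleftrightarrow> p \<in> polys \<and> (\<exists>u\<in>supported_on (set (xs 1)). end_map (k +
      1) ?a ?b 1 u ({}, 0) = p)" for p
      using assms unfolding set_xs end_map_image[symmetric] by (auto simp: surface_ideal_def
        surface_gens_def k(1))
  qed simp
qed

text \<open>The first \<open>k\<close> columns contain neither \<open>x_0\<close> nor
  \<open>x_1\<close>, so their minors are constants for the extraction of coefficients.\<close>

lemma even_nzd: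
  assumes "(quadric :: 'a mpoly) * r \<in> idl (minors k (\<lambda>i. mn (upper_monom k i)) (\<lambda>i. mn (lower_monom
    k i)))"
  shows "r \<in> idl (minors k (\<lambda>i. mn (upper_monom k i)) (\<lambda>i. mn (lower_monom k i)))"
proof (rule quadric_nzd[OF _ assms])
  fix g p :: "'a mpoly" and i j assume "g \<in> minors k (\<lambda>i. mn (upper_monom k i)) (\<lambda>i. mn (lower_monom
    k i))"
  then obtain r s where g: "g = mn (upper_monom k r) * mn (lower_monom k s) -
    mn (upper_monom k s) * mn (lower_monom k r)" "r < s" "s < k"
    by (auto simp: minors_def)
  have f: "coeff_x0_x1 i j (mn (upper_monom k r) * mn (lower_monom k s) * p) =
    mn (upper_monom k r) * mn (lower_monom k s) * coeff_x0_x1 i j p"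
    if "r < k" "s < k" for r s
  proof -
    have W: "w_index k l \<ge> 2" for l by (simp add: w_index_def)
    have "coeff_x0_x1 i j (mn (upper_monom k r) * q) = mn (upper_monom k r) * coeff_x0_x1 i j q"
      "coeff_x0_x1 i j (mn (lower_monom k s) * q) = mn (lower_monom k s) * coeff_x0_x1 i j q" for q
      using that W[of r] W[of "s + 1"]
      by (intro coeff_x0_x1_mon_free; auto simp: upper_monom_def lower_monom_def lookup_single
        when_def)+
    then show ?thesis by (simp only: mult.assoc)
  qed
  show "coeff_x0_x1 i j (g * p) = g * coeff_x0_x1 i j p"
    using f[of r s] f[of s r] g(2,3) unfolding g(1) by (simp only: left_diff_distrib coeff_x0_x1_diff)
qed

text \<open>In step \<open>j\<close> of the cone the Eagon-Northcott basis of \<open>k\<close>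
  linear columns contributes the degree \<open>j + 1\<close>. The basis of step
  \<open>j - 1\<close>, shifted by the degree of the quadric, contributes \<open>j + 2\<close>,
  except that for \<open>j = 1\<close> it is the quadric alone, of degree 2.\<close>

theorem even_resolution:
  assumes "even d"
  shows "has_minimal_free_resolution (k + 3) surface_ideal k
    (\<lambda>j. if j = 0 then [0] else if j = 1 then replicate (1 + (k choose 2)) 2
      else replicate (j * (k choose (j + 1))) (int j + 1) @
        replicate ((j - 1) * (k choose j)) (int j + 2))"
proof -
  let ?a = "\<lambda>i. mn (upper_monom k i)" and ?b = "\<lambda>i. mn (lower_monom k i)"
  let ?f = "cone_map k ?a ?b quadric"
  obtain \<beta> t where "eagon_northcott k ?a ?b \<beta> t" using eagon_northcott[of k] by auto
  then interpret eagon_northcott k ?a ?b \<beta> t .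
  define xs where "xs j = (if j = 0 then [Inl ({}, 0)] else map Inl (list_of_set (en_basis k j)) @
    map Inr (list_of_set (en_basis k (j - 1))))" for j
  define \<delta> :: "nat \<Rightarrow> nat" where "\<delta> i = 1" for i
  define dg where "dg = case_sum (\<lambda>e :: nat set \<times> nat. int (sum \<delta> (fst e))) (\<lambda>e :: nat set \<times> nat.
    int (sum \<delta> (fst e)) + 2)"
  note X = list_of_set[OF finite_en_basis]
  have set_xs: "set (xs j) = cone_basis k j" for j
    using X(1) by (auto simp: xs_def cone_basis_def en_basis_def[of _ 0])
  have card: "card (en_basis k j) = (if j = 0 then 1 else j * (k choose (j + 1)))" for j
    by (cases "j = 0") (auto simp: en_basis_def[of _ 0] en_basis_card_subsets card_cartesian_product
      card_subsets)
  have deg: "sum \<delta> (fst e) = (if j = 0 then 0 else j + 1)" if "e \<in> en_basis k j" for e j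
    using that by (auto simp: en_basis_def \<delta>_def split: if_splits)
  show ?thesis
  proof (rule resolution_of_functions[where \<phi> = ?f and xs = xs and dg = dg and base = "Inl ({}, 0)"])
    show "distinct (xs j)" for j using X(2) by (auto simp: xs_def distinct_map)
    show "xs 0 = [Inl ({}, 0)]" by (simp add: xs_def)
    have "length (xs (Suc k)) = 0" using k(3) by (simp add: xs_def X card)
    then show "xs (Suc k) = []" by blast
    show "k \<ge> 1" by (rule k(3))
    show "(if j = 0 then [0] else if j = 1 then replicate (1 + (k choose 2)) 2
      else replicate (j * (k choose (j + 1))) (int j + 1) @
        replicate ((j - 1) * (k choose j)) (int j + 2)) = map dg (xs j)" for j
    proof (cases "j = 0")
      case False
      have L: "map (\<lambda>e. dg (Inl e)) (list_of_set (en_basis k j)) =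
        replicate (length (list_of_set (en_basis k j))) (int j + 1)"
        using False by (intro map_const) (simp add: X dg_def deg del: of_nat_sum)
      have R: "map (\<lambda>e. dg (Inr e)) (list_of_set (en_basis k (j - 1))) =
        replicate (length (list_of_set (en_basis k (j - 1)))) (int j + (if j = 1 then 1 else 2))"
        using False by (intro map_const) (auto simp: X dg_def deg simp del: of_nat_sum)
      have xs: "map dg (xs j) = map (\<lambda>e. dg (Inl e)) (list_of_set (en_basis k j)) @
        map (\<lambda>e. dg (Inr e)) (list_of_set (en_basis k (j - 1)))"
        using False by (simp add: xs_def comp_def)
      show ?thesis
      proof (cases "j = 1")
        case True
        then show ?thesis unfolding xs L R X(3) card
          by (simp add: replicate_append_same numeral_2_eq_2)
      next
        case j: False
        then have "Suc (j - Suc 0) = j" "j - Suc 0 \<noteq> 0" using False by auto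
        then show ?thesis using j False unfolding xs L R X(3) card by simp
      qed
    qed (simp add: xs_def dg_def)
    show "lin_map (?f j)" for j
      unfolding lin_map_def by (simp add: cone_map_add cone_map_smult)
    show "?f (Suc j) u \<in> supported_on (set (xs j))" if "u \<in> supported_on (set (xs (Suc j)))" for j u
      using that unfolding set_xs by (rule cone_map_supp)
    show "?f (Suc j) (unit_fun e') e \<in> pos_piece (k + 3) (dg e' - dg e)"
      if "e \<in> set (xs j)" "e' \<in> set (xs (Suc j))" for j e e'
    proof -
      have 1: "?a i \<in> graded_piece (k + 3) (int (\<delta> i))" "?b i \<in>
        graded_piece (k + 3) (int (\<delta> i))" if "i < k" for i
        using upper_monom_graded[of i] lower_monom_graded[of i] that by (simp_all add: \<delta>_def
          col_degree_def)
      show ?thesis unfolding dg_def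
        by (rule cone_map_unit_pos_piece[OF 1 _ quadric_graded that[unfolded set_xs]]) (simp_all
          add: \<delta>_def)
    qed
    show "?f (Suc j) (?f (Suc (Suc j)) u) e = 0" if "u \<in>
      supported_on (set (xs (Suc (Suc j))))" for j u e
      using that unfolding set_xs by (rule cone_map_cone_map)
    show "\<exists>v\<in>supported_on (set (xs (Suc (Suc j)))). ?f (Suc (Suc j)) v = u"
      if "u \<in> supported_on (set (xs (Suc j)))" "?f (Suc j) u = (\<lambda>e. 0)" for j u
      unfolding set_xs
      by (rule cone_map_exact[where f = quadric]) (use that in \<open>auto simp: set_xs intro: even_nzd\<close>)
    show "p \<in> surface_ideal \<longleftrightarrow> p \<in> polys \<and> (\<exists>u\<in>supported_on (set (xs 1)). ?f 1 u (Inl ({}, 0)) =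
      p)" for p
      using assms unfolding set_xs cone_map_image[symmetric] by (auto simp: surface_ideal_def
        surface_gens_def k(1))
  qed simp
qed

end

section \<open>The determinantal ideal\<close>

lemma det_2:
  fixes A :: "'r::comm_ring_1 mat"
  assumes A: "A \<in> carrier_mat 2 2"
  shows "det A = A $$ (0, 0) * A $$ (1, 1) - A $$ (1, 0) * A $$ (0, 1)"
proof -
  have d: "det (mat_delete A i 0) = A $$ (1 - i, 1)" if "i < 2" for i
  proof -
    have "mat_delete A i 0 \<in> carrier_mat 1 1" using A by (auto simp: mat_delete_def)
    then show ?thesis using A that by (auto simp: det_single mat_delete_def)
  qed
  have "det A = (\<Sum>i<2. A $$ (i, 0) * cofactor A i 0)" by (rule laplace_expansion_column[OF A]) simp
  then show ?thesis by (simp add: numeral_2_eq_2 cofactor_def d)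
qed

text \<open>Selecting rows by a set keeps their order, so each two-element set gives the minor with
  increasing indices.\<close>

lemma minors_det:
  "{det (submatrix (mat n 2 (\<lambda>(i, j). if j = 0 then a i else b i)) T UNIV) | T. T \<subseteq> {..<n} \<and>
    card T = 2} = minors n a b"
    (is "?D = _")
proof -
  let ?M = "mat n 2 (\<lambda>(i, j). if j = 0 then a i else b i)"
  have det: "det (submatrix ?M {i, l} UNIV) = a i * b l - a l * b i" if il: "i < l" "l < n" for i l
  proof -
    have r: "{x. x < dim_row ?M \<and> x \<in> {i, l}} = {i, l}" "card {i, l} = 2" using il by auto
    have c: "{x. x < dim_col ?M \<and> x \<in> (UNIV :: nat set)} = {..<2}" by auto
    have lt: "{x \<in> {i, l}. x < i} = {}" "{x \<in> {i, l}. x < l} = {i}" using il by auto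
    have p: "pick {i, l} 0 = i" "pick {i, l} 1 = l"
      using pick_card_in_set[of i "{i, l}", unfolded lt] pick_card_in_set[of l "{i, l}", unfolded lt]
      by (simp_all del: pick.simps)
    have ix: "submatrix ?M {i, l} UNIV $$ (s, t) = ?M $$ (pick {i, l} s, t)" if "s < 2" "t < 2" for s t
      using submatrix_index[of s ?M "{i, l}" t UNIV] that unfolding r c pick_UNIV by simp
    have "submatrix ?M {i, l} UNIV \<in> carrier_mat 2 2"
      unfolding carrier_mat_def using dim_submatrix[of ?M "{i, l}" UNIV] unfolding r c by simp
    from det_2[OF this] show ?thesis using il by (simp add: ix p del: pick.simps One_nat_def)
  qed
  show ?thesis
  proof (intro equalityI subsetI)
    fix x assume "x \<in> ?D"
    then obtain T where T: "T \<subseteq> {..<n}" "card T = 2" and x: "x = det (submatrix ?M T UNIV)" by blast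
    obtain s t where "T = {s, t}" "s \<noteq> t" using T(2) by (auto simp: card_2_iff)
    then have "T = {min s t, max s t}" "min s t < max s t" "max s t < n" using T(1) by (auto simp:
      min_def max_def)
    then show "x \<in> minors n a b" using det[of "min s t" "max s t"] minorsI[of "min s t" "max s t" n
      a b] x by simp
  next
    fix x assume "x \<in> minors n a b"
    then obtain i l where il: "x = a i * b l - a l * b i" "i < l" "l < n" unfolding minors_def by blast
    have "x = det (submatrix ?M {i, l} UNIV)" "{i, l} \<subseteq> {..<n}" "card {i, l} = 2"
      using il det[OF il(2,3)] by auto
    then show "x \<in> ?D" by blast
  qed
qed

context surface
begin

section \<open>Grade of the ideal of the surface\<close>

definition coord :: "nat \<Rightarrow> nat \<Rightarrow> 'a mpoly" where
  "coord s i = (if i < s then 0 else xv i)"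

text \<open>The parametrization with the first \<open>s\<close> of the parameters
  \<open>x, y, z\<close> set to 0. The kernels for increasing \<open>s\<close> form a chain of
  primes that starts at the ideal of the surface.\<close>

definition face_hom :: "nat \<Rightarrow> 'a mpoly \<Rightarrow> 'a mpoly" where
  "face_hom s = eval_hom Cst (toric d (coord s 0) (coord s 1) (coord s 2))"

lemma is_ring_hom_face_hom: "is_ring_hom (face_hom s)"
  unfolding face_hom_def by (rule is_ring_hom_eval_hom[OF is_ring_hom_Cst])

lemma face_hom_mono:
  assumes "face_hom s p = 0"
  shows "face_hom (Suc s) p = 0"
proof -
  let ?f = "eval_hom Cst (coord (Suc s)) :: 'a mpoly \<Rightarrow> 'a mpoly"
  have f: "is_ring_hom ?f" by (rule is_ring_hom_eval_hom[OF is_ring_hom_Cst])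
  have "?f (coord s i) = coord (Suc s) i" for i
    by (simp add: coord_def is_ring_homD[OF f] eval_hom_mvar[OF is_ring_hom_Cst])
  then have "?f (face_hom s p) = face_hom (Suc s) p"
    unfolding face_hom_def by (simp add: eval_hom_comp[OF f is_ring_hom_Cst] is_ring_hom_toric[OF f]
      eval_hom_Cst[OF is_ring_hom_Cst])
  then show ?thesis using assms by (simp add: is_ring_homD[OF f])
qed

lemma face_hom_xv: "s < 3 \<Longrightarrow> face_hom t (xv s) = coord t s ^ d"
  by (auto simp: face_hom_def eval_hom_mvar[OF is_ring_hom_Cst] toric_def numeral_2_eq_2
    numeral_3_eq_3 less_Suc_eq)

text \<open>In \<open>k + 3\<close> variables, a chain of three further primes above the ideal of
  the surface leaves at most \<open>k\<close> for the grade; an explicit regular sequence in the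
  ideal attains it.\<close>

lemma grade_surface_ideal: "grade (mpoly_ring (k + 3)) surface_ideal = enat k"
proof (rule antisym)
  define P where "P s = {p \<in> polys. face_hom s p = 0}" for s
  note h = is_ring_homD[OF is_ring_hom_face_hom]
  have P0: "P 0 = surface_ideal" by (auto simp: P_def face_hom_def coord_def surface_ideal_iff)
  have "grade (mpoly_ring (k + 3)) (P 0) \<le> enat k"
  proof (rule grade_le_of_chain[where r = 3])
    show "primeideal (P i) (mpoly_ring (k + 3))" for i
      unfolding prime_in_iff[symmetric] prime_in_def ideal_in_def
      using subring_setD[OF subring_set_vars_in[of "{..<k + 3}"]] by (auto simp: P_def h)
    show "P i \<subset> P (Suc i)" if i: "i < 3" for i
    proof
      show "P i \<subseteq> P (Suc i)" using face_hom_mono by (auto simp: P_def)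
      \<comment> \<open>The variable of index \<open>i\<close> separates the two primes: it is sent
        to its own \<open>d\<close>-th power until the parameter of that index is set to 0.\<close>
      have "Poly_Mapping.lookup (xv i) (Poly_Mapping.single i 1) \<noteq> 0" by (simp add: mvar_def)
      then have "xv i \<noteq> 0" by auto
      then have "xv i \<in> P (Suc i)" "xv i \<notin> P i"
        using i d(3) vars_in_mvar[of i "{..<k + 3}"]
        by (auto simp: P_def face_hom_xv coord_def)
      then show "P i \<noteq> P (Suc i)" by blast
    qed
  qed simp
  then show "grade (mpoly_ring (k + 3)) surface_ideal \<le> enat k" by (simp add: P0)
next
  \<comment> \<open>The monomial attached to the variable of index \<open>3 + i\<close>. Putting the
    \<open>d\<close>-th powers in place of \<open>x_0, x_1, x_2\<close> turns it into its own
    \<open>d\<close>-th power, so \<open>f i\<close> lies in the ideal; moreover \<open>f i\<close>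
    is monic in a variable of its own.\<close>
  define g where "g i = xv 0 ^ (k - i) * xv 1 ^ (k - i) * xv 2 ^ (\<epsilon> + 2 * i)" for i
  define f where "f i = xv (3 + i) ^ d - g i" for i
  note e = is_ring_homD[OF is_ring_hom_eval_hom[OF is_ring_hom_Cst]]
  have reg: "regular_seq k f"
    unfolding f_def using d
    by (intro regular_seq_powers[where V = "{0, 1, 2}"])
      (auto simp: g_def inj_on_def intro!: subring_setD(4)[OF subring_set_vars_in]
        subring_set_power[OF subring_set_vars_in] vars_in_mvar)
  have fI: "f i \<in> surface_ideal" if i: "i < k" for i
  proof -
    have "f i \<in> polys"
      unfolding f_def g_def using i
      by (intro subring_setD(3)[OF subring_set_vars_in] subring_setD(4)[OF subring_set_vars_in]
        subring_set_power[OF subring_set_vars_in] vars_in_mvar) auto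
    moreover have "param_hom (f i) = 0"
    proof -
      have "toric d (xv 0) (xv 1) (xv 2) (3 + i) = g i" by (simp add: toric_def g_def k)
      moreover have "param_hom (g i) = (xv 0 ^ d) ^ (k - i) * (xv 1 ^ d) ^ (k -
        i) * (xv 2 ^ d) ^ (\<epsilon> + 2 * i)"
        by (simp add: g_def e eval_hom_mvar[OF is_ring_hom_Cst]) (simp add: toric_def)
      moreover have "\<dots> = g i ^ d"
        by (simp only: g_def power_mult_distrib power_mult[symmetric] mult.commute[of d])
      ultimately show ?thesis by (simp add: f_def e eval_hom_mvar[OF is_ring_hom_Cst])
    qed
    ultimately show ?thesis by (simp add: surface_ideal_iff)
  qed
  then have fC: "f i \<in> polys" if "i < k" for i using that by (simp add: surface_ideal_def)
  have take: "set (take i (map f [0..<k])) = f ` {..<i}" if "i \<le> k" for i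
    using that by (auto simp: take_map)
  have gen: "genideal (mpoly_ring (k + 3)) (f ` {..<i}) = idl (f ` {..<i}) \<inter> polys" if "i \<le> k" for i
    using that fC by (intro genideal_mpoly) auto
  have "regular_sequence (mpoly_ring (k + 3)) (map f [0..<k])"
    unfolding regular_sequence_def
  proof (intro conjI allI impI ballI)
    show "set (map f [0..<k]) \<subseteq> carrier (mpoly_ring (k +
      3))" using fC by (auto simp: carrier_mpoly_ring)
  next
    fix i r assume i: "i < length (map f [0..<k])" and r: "r \<in> carrier (mpoly_ring (k + 3))"
      and "r \<otimes>\<^bsub>mpoly_ring (k + 3)\<^esub> map f [0..<k] ! i \<in> genideal (mpoly_ring (k +
        3)) (set (take i (map f [0..<k])))"
    then have "r * f i \<in> idl (f ` {..<i})" using take[of i] gen[of i] by (simp add: mpoly_ring_ops)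
    then have "r \<in> idl (f ` {..<i})" using reg i unfolding regular_seq_idl by simp
    then show "r \<in> genideal (mpoly_ring (k + 3)) (set (take i (map f [0..<k])))"
      using r i take[of i] gen[of i] by (simp add: carrier_mpoly_ring)
  next
    have "f ` {..<k} \<subseteq> idl gens" using fI by (auto simp: surface_ideal_def)
    then have "idl (f ` {..<k}) \<subseteq> idl gens" by (metis idl.span_mono idl.span_span)
    moreover have "1 \<notin> idl gens" using surface_ideal_iff[of 1] subring_setD(1)[OF
      subring_set_vars_in, of "{..<k + 3}"] by (auto simp: surface_ideal_def e)
    ultimately have "1 \<notin> genideal (mpoly_ring (k + 3)) (f ` {..<k})" using gen[of k] by auto
    moreover have "1 \<in> carrier (mpoly_ring (k + 3) :: 'a mpoly ring)"
      using subring_setD(1)[OF subring_set_vars_in] by (simp add: carrier_mpoly_ring)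
    ultimately show "genideal (mpoly_ring (k + 3)) (set (map f [0..<k])) \<noteq> carrier (mpoly_ring (k + 3))"
      using take[of k] by auto
  qed
  then show "enat k \<le> grade (mpoly_ring (k + 3)) surface_ideal"
    unfolding grade_def using fI by (intro Sup_upper CollectI exI[of _ "map f [0..<k]"]) auto
qed

text \<open>The two-row matrix is transposed to have at least as many rows as columns; the negative
  row degrees give both entries of row \<open>i\<close> the degree \<open>col_degree k i\<close>.
  For \<open>k + 1\<close> rows and 2 columns the required grade is \<open>k\<close>.\<close>

theorem determinantal_surface_ideal:
  assumes "odd d"
  shows "determinantal_ideal (k + 3) surface_ideal"
proof -
  let ?M = "mat (k + 1) 2 (\<lambda>(i, j). if j = 0 then mn (upper_monom k i) else mn (lower_monom k i))"
  let ?as = "map (\<lambda>i. - int (col_degree k i)) [0..<k + 1]" and ?bs = "[0, 0] :: int list"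
  have "homogeneous_ideal (k + 3) surface_ideal"
    unfolding homogeneous_ideal_def surface_ideal_genideal using gens_graded by (intro exI[of _
      gens]) auto
  moreover have "homogeneous_mat (k + 3) ?as ?bs ?M"
    unfolding homogeneous_mat_def
  proof (intro conjI allI impI)
    show "?M \<in> carrier_mat (length ?as) (length ?bs)" by (simp add: numeral_2_eq_2)
    fix i j assume i: "i < length ?as" and j: "j < length ?bs"
    then have "?as ! i = - int (col_degree k i)" "?bs ! j = 0" by (auto simp: nth_append less_Suc_eq)
    then show "?M $$ (i, j) \<in> graded_piece (k + 3) (?bs ! j - ?as ! i)"
      using i j upper_monom_graded[of i] lower_monom_graded[of i] by simp
  qed
  moreover have "surface_ideal = genideal (mpoly_ring (k + 3))
      {det (submatrix ?M T UNIV) | T. T \<subseteq> {..<k + 1} \<and> card T = 2}"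
    unfolding minors_det surface_ideal_genideal using assms by (simp add: surface_gens_def k(1))
  moreover have "grade (mpoly_ring (k + 3)) surface_ideal = enat (k + 1 - 2 + 1)"
    using k(3) by (simp add: grade_surface_ideal)
  moreover have "length ?as = k + 1" "length ?bs = 2" "1 \<le> (2::nat)" "2 \<le> k + 1" using k(3) by auto
  ultimately show ?thesis unfolding determinantal_ideal_def by blast
qed

end

theorem theorem7p3:
  fixes d k \<epsilon> :: nat
    and S :: "'a::{alg_closed_field, field_char_0} vec set set"
    and I :: "'a mpoly set"
  assumes "d \<ge> 3" and "d = 2 * k + \<epsilon>" and "\<epsilon> \<in> {0, 1}"
    and "S = S_surface d"
    and "I = homogeneous_ideal_of (k + 2) S"
  shows
    "(d = 2 * k + 1 \<longrightarrow>
        determinantal_ideal (k + 3) I \<and>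
        cohen_macaulay_ideal (mpoly_ring (k + 3)) I \<and>
        has_minimal_free_resolution (k + 3) I k
          (\<lambda>j. if j = 0 then [0]
                else replicate (j * (k choose (j + 1))) (int j + 1) @
                     replicate (j * (k choose j)) (int j + 2)))
     \<and>
     (d = 2 * k \<longrightarrow>
        cohen_macaulay_ideal (mpoly_ring (k + 3)) I \<and>
        has_minimal_free_resolution (k + 3) I k
          (\<lambda>j. if j = 0 then [0]
                else if j = 1 then replicate (1 + (k choose 2)) 2
                else replicate (j * (k choose (j + 1))) (int j + 1) @
                     replicate ((j - 1) * (k choose j)) (int j + 2)))"
proof -
  interpret surface d k \<epsilon> "TYPE('a)" using assms by unfold_locales auto
  have I: "I = surface_ideal" using assms homogeneous_ideal_of_surface by simp
  show ?thesis
    unfolding I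
    using determinantal_surface_ideal cohen_macaulay_surface_ideal odd_resolution even_resolution
    by (intro conjI impI) simp_all
qed

end
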